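(* Let $X_1,\dots,X_n$ be i.i.d. with density $f$ on $\mathbb R$, and let $\widetilde f_{K_0}$ be the kernel density estimator whose kernel $K_0$ minimizes the cross-validation criterion $CV(K)$ over all $K\in\mathcal K$ with $\operatorname{supp}\widehat K\subseteq[-n,n]$. Then $\widetilde f_{K_0}$ is asymptotically sharp minimax-adaptive on the whole scale of Sobolev classes with smoothness index greater than $1/2$; that is, simultaneously for every real $\beta>1/2$ and every $0<L<\infty$, $$\lim_{n\to\infty}\ \frac{\sup_{f\in\mathcal S_\beta(L)}E_f\int\bigl(\widetilde f_{K_0}(x)-f(x)\bigr)^2dx}{\inf_{\widetilde f}\ \sup_{f\in\mathcal S_\beta(L)}E_f\int\bigl(\widetilde f(x)-f(x)\bigr)^2dx}=1,$$ where the infimum is over all estimators $\widetilde f$ based on $X_1,\dots,X_n$.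
   Context: Fourier transforms are $\widehat g(\omega)=\int g(x)e^{i\omega x}dx$. For a kernel $K$, $\widetilde f_K(x)=\frac1n\sum_{i=1}^nK(X_i-x)$ and $$CV(K)=\int\widetilde f_K^2(x)\,dx-\frac{2}{n(n-1)}\sum_{i\ne j}K(X_i-X_j).$$ $\mathcal K$ (depending on $n$) is the set of all $L_2$-integrable kernel functions $K$ with $\|K\|_2\le\sqrt n$ whose Fourier transform $\widehat K$ is real, symmetric, non-negative and unimodal (non-increasing on $[0,\infty)$), with the normalization $0\le\widehat K\le1$. The Sobolev class $\mathcal S_\beta(L)$ is the set of probability densities $f\in L_2(\mathbb R)$ with $\frac1{2\pi}\int|\omega^\beta\widehat f(\omega)|^2d\omega\le L$. The kernel $K_0$ depends only on the sample, not on $\beta$ or $L$. *)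

theory Defs
  imports "HOL-Probability.Probability"
begin

definition fourier :: "(real \<Rightarrow> real) \<Rightarrow> real \<Rightarrow> complex" where
  "fourier g \<omega> = (LINT x|lborel. complex_of_real (g x) * iexp (\<omega> * x))"

definition L2_real :: "(real \<Rightarrow> real) set" where
  "L2_real = {g \<in> borel_measurable lborel. integrable lborel (\<lambda>x. (g x)\<^sup>2)}"

definition L2_norm :: "(real \<Rightarrow> real) \<Rightarrow> real" where
  "L2_norm g = sqrt (LINT x|lborel. (g x)\<^sup>2)"

text \<open>Kernels need not be integrable (the sinc kernel is admissible), so their Fourier transform
  is the Plancherel one: the limit in \<open>L\<^sub>2\<close> of the transforms of the truncations of \<open>g\<close>
  to \<open>[-R, R]\<close>. It is unique up to null sets, hence a relation.\<close>

definition is_L2_fourier :: "(real \<Rightarrow> real) \<Rightarrow> (real \<Rightarrow> complex) \<Rightarrow> bool" where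
  "is_L2_fourier g G \<longleftrightarrow>
     g \<in> L2_real \<and> G \<in> borel_measurable lborel \<and>
     ((\<lambda>R::real. \<integral>\<^sup>+ \<omega>.
         ennreal ((cmod (fourier (\<lambda>x. indicator {-R..R} x * g x) \<omega> - G \<omega>))\<^sup>2) \<partial>lborel)
       \<longlongrightarrow> 0) at_top"

definition kernel_class :: "nat \<Rightarrow> (real \<Rightarrow> real) set" where
  "kernel_class n = {K \<in> L2_real. L2_norm K \<le> sqrt (real n) \<and>
     (\<exists>G::real \<Rightarrow> real. is_L2_fourier K (\<lambda>\<omega>. complex_of_real (G \<omega>)) \<and>
        (\<forall>\<omega>. G (- \<omega>) = G \<omega>) \<and> (\<forall>\<omega>. 0 \<le> G \<omega> \<and> G \<omega> \<le> 1) \<and> antimono_on {0..} G)}"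

text \<open>The criterion \<open>cv\<close> evaluates kernels at points. A kernel whose Fourier transform is bounded
  with compact support has exactly one continuous version, given by Fourier inversion, and this
  version is the one meant; without it \<open>cv\<close> could be made arbitrarily small by changing a kernel
  on a finite set.\<close>

definition bandlimited_kernels :: "nat \<Rightarrow> (real \<Rightarrow> real) set" where
  "bandlimited_kernels n = {K \<in> kernel_class n. continuous_on UNIV K \<and>
     (\<exists>G. is_L2_fourier K G \<and> closure {\<omega>. G \<omega> \<noteq> 0} \<subseteq> {- real n..real n})}"

definition kde :: "nat \<Rightarrow> (real \<Rightarrow> real) \<Rightarrow> (nat \<Rightarrow> real) \<Rightarrow> real \<Rightarrow> real" where
  "kde n K X x = (1 / real n) * (\<Sum>i<n. K (X i - x))"

definition cv :: "nat \<Rightarrow> (nat \<Rightarrow> real) \<Rightarrow> (real \<Rightarrow> real) \<Rightarrow> real" where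
  "cv n X K = (LINT x|lborel. (kde n K X x)\<^sup>2)
     - 2 / (real n * (real n - 1)) * (\<Sum>i<n. \<Sum>j\<in>{..<n} - {i}. K (X i - X j))"

definition sobolev_densities :: "real \<Rightarrow> real \<Rightarrow> (real \<Rightarrow> real) set" where
  "sobolev_densities \<beta> L = {f \<in> L2_real. (\<forall>x. 0 \<le> f x) \<and>
     (\<integral>\<^sup>+ x. ennreal (f x) \<partial>lborel) = 1 \<and>
     ennreal (1 / (2 * pi)) *
       (\<integral>\<^sup>+ \<omega>. ennreal ((\<bar>\<omega>\<bar> powr \<beta> * cmod (fourier f \<omega>))\<^sup>2) \<partial>lborel) \<le> ennreal L}"

definition iid_sample :: "nat \<Rightarrow> (real \<Rightarrow> real) \<Rightarrow> (nat \<Rightarrow> real) measure" where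
  "iid_sample n f = Pi\<^sub>M {..<n} (\<lambda>_. density lborel (\<lambda>x. ennreal (f x)))"

definition mise :: "nat \<Rightarrow> ((nat \<Rightarrow> real) \<Rightarrow> real \<Rightarrow> real) \<Rightarrow> (real \<Rightarrow> real) \<Rightarrow> ennreal" where
  "mise n T f = (\<integral>\<^sup>+ X. (\<integral>\<^sup>+ x. ennreal ((T X x - f x)\<^sup>2) \<partial>lborel) \<partial>iid_sample n f)"

definition estimators :: "nat \<Rightarrow> ((nat \<Rightarrow> real) \<Rightarrow> real \<Rightarrow> real) set" where
  "estimators n =
     {T. (\<lambda>(X, x). T X x) \<in> borel_measurable (Pi\<^sub>M {..<n} (\<lambda>_. lborel) \<Otimes>\<^sub>M lborel)}"

definition max_risk ::
  "nat \<Rightarrow> real \<Rightarrow> real \<Rightarrow> ((nat \<Rightarrow> real) \<Rightarrow> real \<Rightarrow> real) \<Rightarrow> ennreal" where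
  "max_risk n \<beta> L T = (SUP f\<in>sobolev_densities \<beta> L. mise n T f)"

end

(* Up to a term that does not depend on the kernel, the cross-validation criterion is the integrated
squared loss plus errors that are linear in the spectrum of the kernel and in its square. As spectra are
monotone, dyadic chaining over frequency shells bounds these errors simultaneously for all of them by the
square root of the loss times a quantity of order 1/n up to logarithms. So the minimizer does
asymptotically as well as the Pinsker filter max 0 (1 - (|w| / W)^beta), which yields the upper bound.

For the lower bound, a nearly uniform density on [-A, A] is perturbed by trigonometric functions with
independent random coefficients that have the variances of the extremal ellipsoid of Pinsker. The van Trees
inequality in each coefficient bounds the Bayes risk from below; a beta prior of large exponent is a
compactly supported substitute for the Gaussian prior. The condition beta > 1/2 makes the sum of all
coefficients tend to 0, so that the perturbed functions are densities. *)

theory Submission imports Defs "HOL-Complex_Analysis.Complex_Analysis" "HOL-Real_Asymp.Real_Asymp" begin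

text \<open>The work takes place on the Fourier side: \<open>bandlimited_kernels n\<close> is
  exactly the image of \<open>spectra n\<close>, where the criterion is a convex quadratic
  functional of the spectrum h. The obstacle is that the minimizer depends on the sample, so errors
  must be bounded for all spectra at once and relative to the loss itself. A Hoeffding decomposition
  makes this possible. Its linear part \<open>errB\<close> has variance weight |phi|^2 and is paired
  with the increasing function 1 - h; its degenerate part \<open>errV\<close> has a flat variance
  weight and is paired with the decreasing h. These are the two weighted norms in the risk
  \<open>D h\<close>, squared bias and variance. What \<open>errB\<close> adds independently of h
  has mean zero and disappears in expectation. Convexity also makes the minimizer continuous in the
  data, hence the estimator measurable, which gives a ratio of at least 1. In the lower bound the
  base density is a uniform law convolved with a Gaussian: the zeros of its transform make
  trigonometric functions exactly orthonormal, and the Gaussian decay controls Sobolev norms. Its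
  width A stays fixed as n grows.\<close>

abbreviation "gauss \<equiv> std_normal_density"

lemmas LINT_cong = Bochner_Integration.integral_cong and LINT_add = Bochner_Integration.integral_add
 and LINT_diff = Bochner_Integration.integral_diff and LINT_sum = Bochner_Integration.integral_sum
 and LINT_cnj = Bochner_Integration.integral_cnj and L1_bound = Bochner_Integration.integrable_bound
 and L1_add = Bochner_Integration.integrable_add and L1_diff = Bochner_Integration.integrable_diff
 and hbi_iff = has_bochner_integral_iff and L1_sum = Bochner_Integration.integrable_sum

section \<open>Plancherel's theorem\<close>

text \<open>Unlike \<open>fourier\<close> it accepts complex arguments, because products such as
  \<open>h * ecf\<close> have to be transformed back.\<close>

definition FT :: "(real \<Rightarrow> complex) \<Rightarrow> real \<Rightarrow> complex" where
 "FT u w = (LBINT x. u x * iexp (w * x))"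

lemma borel_measurable_cnj_comp[measurable (raw)]:
 "f \<in> borel_measurable M \<Longrightarrow> (\<lambda>x. cnj (f x)) \<in> borel_measurable M"
 by (rule borel_measurable_continuous_on) (auto intro: continuous_intros)

lemma integrable_mult_unimodular:
 fixes u v :: "'a \<Rightarrow> complex"
 assumes "integrable M u" "v \<in> borel_measurable M" "\<And>x. norm (v x) \<le> C"
 shows "integrable M (\<lambda>x. u x * v x)"
proof (rule L1_bound)
 show "integrable M (\<lambda>x. u x * of_real C)" using assms(1) by simp
 show "AE x in M. norm (u x * v x) \<le> norm (u x * of_real C)"
  using assms(3) by (intro AE_I2) (auto simp: norm_mult intro!: mult_left_mono order_trans[OF assms(3)])
qed (use assms in measurable)

lemma integrable_mult_iexp:
 assumes "integrable lborel u"
 shows "integrable lborel (\<lambda>x. u x * iexp (w * x))"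
 by (rule integrable_mult_unimodular[where C=1]) (use assms in auto)

lemma FT_measurable[measurable]:
 assumes [measurable]: "u \<in> borel_measurable borel"
 shows "FT u \<in> borel_measurable borel"
 unfolding FT_def[abs_def] by measurable

lemma norm_FT_le:
 assumes "integrable lborel u"
 shows "norm (FT u w) \<le> (LBINT x. norm (u x))"
proof -
 have "norm (FT u w) \<le> (LBINT x. norm (u x * iexp (w * x)))"
  unfolding FT_def by (rule integral_norm_bound)
 then show ?thesis by (simp add: norm_mult)
qed

text \<open>Both sides are the double integral of u x * v w * exp (i w x), by Fubini. This exchange
  does the work of Fourier inversion: with a Gaussian \<open>v\<close> it drives
  \<open>Plancherel\<close>, with a conjugated \<open>G\<close> it identifies the cross term of
  \<open>Plancherel_mixed\<close>.\<close>

lemma FT_multiplication_formula: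
 assumes u: "integrable lborel u" and v: "integrable lborel v"
 shows "(LBINT w. FT u w * v w) = (LBINT x. u x * FT v x)"
proof -
 have [measurable]: "u \<in> borel_measurable borel" "v \<in> borel_measurable borel"
  using u v by auto
 have *: "integrable (lborel \<Otimes>\<^sub>M lborel) (\<lambda>(x, w). (u x * v w) * iexp (w * x))"
 proof (rule lborel_pair.Fubini_integrable)
  have "integrable lborel (\<lambda>x. norm (u x) * (LBINT w. norm (v w)))"
   using u by simp
  then show "integrable lborel (\<lambda>x. LBINT y. norm (case (x, y) of (x, w) \<Rightarrow> u x * v w * iexp (w * x)))"
   by (simp add: norm_mult)
  show "AE x in lborel. integrable lborel (\<lambda>y. case (x, y) of (x, w) \<Rightarrow> u x * v w * iexp (w * x))"
   using v by (intro AE_I2) (auto simp: mult.assoc intro!: integrable_mult_right integrable_mult_unimodular[where C=1])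
 qed measurable
 have "(LBINT w. FT u w * v w) = (LBINT w. LBINT x. (u x * v w) * iexp (w * x))"
  unfolding FT_def
  by (intro LINT_cong refl, subst integral_mult_left_zero[symmetric])
    (simp add: ac_simps)
 also have "... = (LBINT x. LBINT w. (u x * v w) * iexp (w * x))"
  using lborel_pair.Fubini_integral[OF *] by simp
 also have "... = (LBINT x. u x * FT v x)"
  unfolding FT_def
  by (intro LINT_cong refl, subst integral_mult_right_zero[symmetric])
    (simp add: ac_simps)
 finally show ?thesis .
qed

lemma integrable_indicator_Icc[simp]: "integrable lborel (indicator {a..b} :: real \<Rightarrow> real)"
 by (intro integrable_real_indicator) (auto simp: emeasure_lborel_Icc_eq)

lemma norm_add_sq_le: "(norm (a + b))^2 \<le> 2 * (norm a)^2 + 2 * (norm (b :: complex))^2"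
proof -
 have "(norm (a + b))^2 \<le> (norm a + norm b)^2" by (intro power_mono norm_triangle_ineq) auto
 also have "... \<le> 2 * (norm a)^2 + 2 * (norm b)^2" using zero_le_power2[of "norm a - norm b"] by (simp add: power2_diff power2_sum)
 finally show ?thesis .
qed

text \<open>A measurable function is almost everywhere a limit of continuous ones, but without
  domination. The map \<open>k m x\<close> supplies it: a trapezoidal cut-off in space combined with
  a radial projection onto the disc of radius \<open>M m\<close>. Being continuous in x and z, it
  turns the approximants into continuous functions with one common bound and one compact
  support.\<close>

lemma L2_approx_continuous:
 fixes u :: "real \<Rightarrow> complex"
 assumes [measurable]: "u \<in> borel_measurable borel" and u2: "integrable lborel (\<lambda>x. (norm (u x))^2)" and e: "e > 0"
 obtains v and c :: real where "0 \<le> c" "continuous_on UNIV v" "\<And>x. norm (v x) \<le> c * indicator {-c..c} x"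
  "integrable lborel (\<lambda>x. (norm (u x - v x))^2)" "(LBINT x. (norm (u x - v x))^2) < e"
proof -
 define M where "M m = real m + 1" for m
 have M: "M m > 0" for m by (simp add: M_def)
 define k where "k m x z = (max 0 (min 1 (M m - \<bar>x\<bar>)) * (M m / max (M m) (norm z))) *\<^sub>R z" for m x and z :: complex
 \<comment> \<open>The scaling factor lies in [0, 1], so \<open>u\<close> itself dominates the
   remainder as m grows; k2 gives the majorant for the limit in n with m fixed.\<close>
 have k1: "norm (z - k m x z) \<le> norm z" for m x z
 proof -
  let ?t = "max 0 (min 1 (M m - \<bar>x\<bar>)) * (M m / max (M m) (norm z))"
  have "0 \<le> ?t" "?t \<le> 1 * 1" using M[of m] by (intro mult_nonneg_nonneg mult_mono; simp add: divide_le_eq)+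
  moreover have "z - k m x z = (1 - ?t) *\<^sub>R z" by (simp add: k_def algebra_simps)
  ultimately show ?thesis by (simp add: mult_left_le_one_le)
 qed
 have k2: "norm (k m x z) \<le> M m * indicator {-M m..M m} x" for m x z
 proof -
  have "\<bar>max 0 (min 1 (M m - \<bar>x\<bar>))\<bar> \<le> indicator {-M m..M m} x" by (auto simp: indicator_def)
  moreover have "M m / max (M m) (norm z) * norm z \<le> M m" using M[of m] by (simp add: divide_le_eq mult_left_mono)
  moreover have "norm (k m x z) = \<bar>max 0 (min 1 (M m - \<bar>x\<bar>))\<bar> * (M m / max (M m) (norm z) * norm z)"
   using M[of m] by (simp add: k_def)
  ultimately have "norm (k m x z) \<le> indicator {-M m..M m} x * M m" using M[of m] by (simp only:) (intro mult_mono; simp)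
  then show ?thesis by (simp only: mult.commute)
 qed
 have kc: "continuous_on UNIV (\<lambda>x. k m x (g x))" if "continuous_on UNIV g" for g m
  unfolding k_def using M[of m] by (intro continuous_intros that) auto
 have [measurable]: "(\<lambda>x. k m x (u x)) \<in> borel_measurable borel" for m unfolding k_def by measurable
 have "(\<lambda>m. LBINT x. (norm (u x - k m x (u x)))^2) \<longlonglongrightarrow> (LINT x::real|lborel. 0::real)"
 proof (rule integral_dominated_convergence[where w = "\<lambda>x. (norm (u x))^2"])
  show "AE x in lborel. (\<lambda>m. (norm (u x - k m x (u x)))^2) \<longlonglongrightarrow> 0"
  proof (intro AE_I2 tendsto_eventually)
   fix x
   obtain N :: nat where "max (norm (u x)) \<bar>x\<bar> \<le> real N" using real_arch_simple by blast
   then have "k m x (u x) = u x" if "N \<le> m" for m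
   proof -
    have "min 1 (M m - \<bar>x\<bar>) = 1" "max (M m) (norm (u x)) = M m" "M m \<noteq> 0"
     using \<open>max _ _ \<le> _\<close> that by (auto simp: M_def min_def max_def split: if_splits)
    then show ?thesis by (simp add: k_def)
   qed
   then show "\<forall>\<^sub>F m in sequentially. (norm (u x - k m x (u x)))^2 = 0"
    unfolding eventually_sequentially by (intro exI[of _ N]) auto
  qed
 qed (use u2 k1 in \<open>auto intro!: power_mono\<close>)
 then have "\<forall>\<^sub>F m in sequentially. (LBINT x. (norm (u x - k m x (u x)))^2) < e / 4"
  using e by (intro order_tendstoD) auto
 then obtain m where m: "(LBINT x. (norm (u x - k m x (u x)))^2) < e / 4" by (auto simp: eventually_sequentially)
 have i1: "integrable lborel (\<lambda>x. (norm (u x - k m x (u x)))^2)"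
  by (rule L1_bound[OF u2]) (use k1 in \<open>auto intro!: power_mono\<close>)
 have "u measurable_on UNIV" by (rule lebesgue_measurable_imp_measurable_on) (auto intro: measurable_completion)
 then obtain N g where g: "negligible N" "\<And>n. continuous_on UNIV (g n)" "\<And>x. x \<notin> N \<Longrightarrow> (\<lambda>n. g n x) \<longlonglongrightarrow> u x"
  unfolding measurable_on_def by auto
 have [measurable]: "(\<lambda>x. k m x (g n x)) \<in> borel_measurable borel" for n
  using kc[OF g(2)] by (rule borel_measurable_continuous_onI)
 let ?w = "\<lambda>x. (2 * M m)^2 * indicator {-M m..M m} x"
 have wb: "(norm (k m x (u x) - k m x z))^2 \<le> ?w x" for x z
 proof -
  have "norm (k m x (u x) - k m x z) \<le> 2 * M m * indicator {-M m..M m} x"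
   using norm_triangle_ineq4[of "k m x (u x)" "k m x z"] k2[of m x "u x"] k2[of m x z] by linarith
  from power_mono[OF this, of 2] show ?thesis by (auto simp: power_mult_distrib indicator_def split: if_splits)
 qed
 have "(\<lambda>n. LBINT x. (norm (k m x (u x) - k m x (g n x)))^2) \<longlonglongrightarrow> (LINT x::real|lborel. 0::real)"
 proof (rule integral_dominated_convergence[where w = ?w])
  have "AE x in lborel. x \<notin> N" using AE_not_in[of N lebesgue] g(1) by (simp add: negligible_iff_null_sets AE_completion_iff)
  then show "AE x in lborel. (\<lambda>n. (norm (k m x (u x) - k m x (g n x)))^2) \<longlonglongrightarrow> 0"
  proof eventually_elim
   case (elim x)
   have "(\<lambda>n. (norm (k m x (u x) - k m x (g n x)))^2) \<longlonglongrightarrow> (norm (k m x (u x) - k m x (u x)))\<^sup>2"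
    unfolding k_def using M[of m] by (intro tendsto_intros g(3) elim) auto
   then show ?case by simp
  qed
 qed (use wb in auto)
 then have "\<forall>\<^sub>F n in sequentially. (LBINT x. (norm (k m x (u x) - k m x (g n x)))^2) < e / 4"
  using e by (intro order_tendstoD) auto
 then obtain n where n: "(LBINT x. (norm (k m x (u x) - k m x (g n x)))^2) < e / 4" by (auto simp: eventually_sequentially)
 have i2: "integrable lborel (\<lambda>x. (norm (k m x (u x) - k m x (g n x)))^2)"
  by (rule L1_bound[where f = ?w]) (use wb in auto)
 let ?v = "\<lambda>x. k m x (g n x)"
 have b: "(norm (u x - ?v x))^2 \<le> 2 * (norm (u x - k m x (u x)))^2 + 2 * (norm (k m x (u x) - ?v x))^2" for x
  using norm_add_sq_le[of "u x - k m x (u x)" "k m x (u x) - ?v x"] by simp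
 have i: "integrable lborel (\<lambda>x. (norm (u x - ?v x))^2)"
  by (rule L1_bound[OF L1_add[OF integrable_mult_right[OF i1, of 2] integrable_mult_right[OF i2, of 2]]]) (use b in auto)
 have "(LBINT x. (norm (u x - ?v x))^2) \<le> 2 * (LBINT x. (norm (u x - k m x (u x)))^2) + 2 * (LBINT x. (norm (k m x (u x) - ?v x))^2)"
  using integral_mono[OF i L1_add[OF integrable_mult_right[OF i1, of 2] integrable_mult_right[OF i2, of 2]] b] i1 i2 by simp
 then show thesis using M[of m] that[of "M m" ?v] kc[OF g(2)] k2[of m] i m n by auto
qed

text \<open>At 0 it equals the squared L2 norm of \<open>u\<close>, and its transform is the squared
  modulus of \<open>FT u\<close>. Plancherel's theorem is therefore Fourier inversion of this
  function at the single point 0.\<close>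

definition autocorr :: "(real \<Rightarrow> complex) \<Rightarrow> real \<Rightarrow> complex" where
 "autocorr u t = (LBINT y. u (y + t) * cnj (u y))"

lemma autocorr_FT:
 assumes u: "integrable lborel u"
 shows "integrable lborel (autocorr u)" "FT (autocorr u) w = of_real ((norm (FT u w))^2)"
proof -
 have [measurable]: "u \<in> borel_measurable borel" using u by auto
 have shift: "integrable lborel (\<lambda>x. u (y + x))" for y
  using lborel_integrable_real_affine[OF u, of 1 y] by (simp add: add.commute)
 have *: "integrable (lborel \<Otimes>\<^sub>M lborel) (\<lambda>(y, t). u (y + t) * cnj (u y) * iexp (w * t))" for w
 proof (rule lborel_pair.Fubini_integrable)
  have "(LBINT t. norm (u (y + t))) = (LBINT t. norm (u t))" for y
   using lborel_integral_real_affine[of 1 "\<lambda>t. norm (u t)" y] by simp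
  then show "integrable lborel (\<lambda>x. LBINT y. norm (case (x, y) of (y, t) \<Rightarrow> u (y + t) * cnj (u y) * iexp (w * t)))"
   using u by (simp add: norm_mult)
  show "AE x in lborel. integrable lborel (\<lambda>y. case (x, y) of (y, t) \<Rightarrow> u (y + t) * cnj (u y) * iexp (w * t))"
   using shift by (intro AE_I2) (auto intro!: integrable_mult_iexp[simplified] integrable_mult_left)
 qed measurable
 have "integrable lborel (\<lambda>t. LBINT y. u (y + t) * cnj (u y) * iexp (0 * t))"
  using lborel_pair.integrable_snd[OF *[of 0]] by simp
 then show "integrable lborel (autocorr u)" by (simp add: autocorr_def[abs_def])
 have "FT (autocorr u) w = (LBINT t. LBINT y. u (y + t) * cnj (u y) * iexp (w * t))"
  unfolding FT_def autocorr_def by (simp flip: integral_mult_left_zero)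
 also have "... = (LBINT y. LBINT t. u (y + t) * cnj (u y) * iexp (w * t))"
  using lborel_pair.Fubini_integral[OF *[of w]] by simp
 also have "... = (LBINT y. cnj (u y * iexp (w * y)) * FT u w)"
 proof (intro LINT_cong refl)
  fix y
  have "FT u w = (LBINT t. u (y + t) * iexp (w * (y + t)))"
   unfolding FT_def using lborel_integral_real_affine[of 1 "\<lambda>x. u x * iexp (w * x)" y] by simp
  also have "... = iexp (w * y) * (LBINT t. u (y + t) * iexp (w * t))"
   by (subst integral_mult_right_zero[symmetric])
     (auto intro!: LINT_cong simp: ring_distribs exp_add ac_simps)
  finally have "FT u w = iexp (w * y) * (LBINT t. u (y + t) * iexp (w * t))" .
  moreover have "cnj (iexp (w * y)) * iexp (w * y) = 1"
   by (simp add: exp_cnj flip: exp_add)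
  ultimately have "cnj (u y * iexp (w * y)) * FT u w = cnj (u y) * (LBINT t. u (y + t) * iexp (w * t))"
   by (simp add: mult.assoc mult.left_commute[of "cnj (u y)"])
  also have "... = (LBINT t. u (y + t) * cnj (u y) * iexp (w * t))"
   by (subst integral_mult_right_zero[symmetric]) (simp add: ac_simps)
  finally show "(LBINT t. u (y + t) * cnj (u y) * iexp (w * t)) = cnj (u y * iexp (w * y)) * FT u w" ..
 qed
 also have "... = cnj (FT u w) * FT u w"
  unfolding FT_def by (subst integral_mult_left_zero) (simp flip: LINT_cnj)
 finally show "FT (autocorr u) w = of_real ((norm (FT u w))^2)"
  unfolding complex_norm_square by (simp only: mult.commute)
qed

lemma norm_mult_le_half_sum_squares: "norm (a * b :: complex) \<le> ((norm a)^2 + (norm b)^2) / 2"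
 using sum_squares_bound[of "norm a" "norm b"] by (simp add: norm_mult)

lemma autocorr_bound:
 assumes [measurable]: "u \<in> borel_measurable borel" and u2: "integrable lborel (\<lambda>x. (norm (u x))^2)"
 shows "integrable lborel (\<lambda>y. u (y + t) * cnj (u y))" "norm (autocorr u t) \<le> (LBINT x. (norm (u x))^2)"
proof -
 have s: "integrable lborel (\<lambda>y. (norm (u (y + t)))^2)"
  using lborel_integrable_real_affine[OF u2, of 1 t] by (simp add: add.commute)
 have b: "norm (u (y + t) * cnj (u y)) \<le> ((norm (u (y + t)))^2 + (norm (u y))^2) / 2" for y
  using norm_mult_le_half_sum_squares[of "u (y + t)" "cnj (u y)"] by simp
 show i: "integrable lborel (\<lambda>y. u (y + t) * cnj (u y))"
  by (rule L1_bound[where f="\<lambda>y. ((norm (u (y + t)))^2 + (norm (u y))^2) / 2"])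
    (measurable, use s u2 b in auto)
 have "norm (autocorr u t) \<le> (LBINT y. norm (u (y + t) * cnj (u y)))"
  unfolding autocorr_def by (rule integral_norm_bound)
 also have "... \<le> (LBINT y. ((norm (u (y + t)))^2 + (norm (u y))^2) / 2)"
  using i s u2 b by (intro integral_mono) auto
 also have "... = ((LBINT y. (norm (u (y + t)))^2) + (LBINT y. (norm (u y))^2)) / 2"
  using s u2 by simp
 also have "(LBINT y. (norm (u (y + t)))^2) = (LBINT y. (norm (u y))^2)"
  using lborel_integral_real_affine[of 1 "\<lambda>x. (norm (u x))^2" t] by (simp add: add.commute)
 finally show "norm (autocorr u t) \<le> (LBINT x. (norm (u x))^2)" by simp
qed

text \<open>Translation is continuous in L2: it is so for continuous functions of compact support,
  and these approximate \<open>u\<close>.\<close>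

lemma autocorr_continuous_0:
 assumes [measurable]: "u \<in> borel_measurable borel" and u2: "integrable lborel (\<lambda>x. (norm (u x))^2)" and X: "X \<longlonglongrightarrow> 0"
 shows "(\<lambda>k. autocorr u (X k)) \<longlonglongrightarrow> autocorr u 0"
proof (rule LIMSEQ_I)
 fix e :: real assume e: "e > 0"
 define S where "S = (LBINT x. (norm (u x))^2)"
 \<comment> \<open>The weight in Young's inequality a b <= h/2 b^2 + a^2/(2h). With h (S + 1) = e
   both halves of the final estimate are at most e/2.\<close>
 define h where "h = e / (S + 1)"
 have S0: "S \<ge> 0" unfolding S_def by simp
 have h: "h > 0" using e S0 unfolding h_def by simp
 obtain v m where m0: "0 \<le> m" and v: "continuous_on UNIV v" "\<And>x. norm (v x) \<le> m * indicator {-m..m} x"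
  "integrable lborel (\<lambda>x. (norm (u x - v x))^2)" "(LBINT x. (norm (u x - v x))^2) < h * e / 16"
  by (rule L2_approx_continuous[OF assms(1) u2, of "h * e / 16"]) (use h e in auto)
 have [measurable]: "v \<in> borel_measurable borel" using v(1) by (rule borel_measurable_continuous_onI)
 obtain c where c: "\<And>k. \<bar>X k\<bar> \<le> c" using Bseq_def[of X] convergent_imp_Bseq[of X] X by (auto simp: convergent_def)
 \<comment> \<open>The shifts are bounded, so all translates of \<open>v\<close> live on one
   interval and have a common majorant.\<close>
 let ?w = "\<lambda>x. (2 * m)^2 * indicator {-(m + c)..m + c} x"
 have wb: "(norm (v (x + X k) - v x))^2 \<le> ?w x" for x k
 proof -
  have b: "norm (v y) \<le> m * indicator {-(m + c)..m + c} x" if "\<bar>y - x\<bar> \<le> c" for y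
   by (rule order_trans[OF v(2) mult_left_mono]) (use that m0 in \<open>auto simp: indicator_def\<close>)
  have "norm (v x) \<le> m * indicator {-(m + c)..m + c} x"
   by (rule b) (use order_trans[OF abs_ge_zero c[of k]] in simp)
  moreover have "norm (v (x + X k)) \<le> m * indicator {-(m + c)..m + c} x" by (rule b) (use c in simp)
  ultimately have "norm (v (x + X k) - v x) \<le> 2 * m * indicator {-(m + c)..m + c} x"
   using norm_triangle_ineq4[of "v (x + X k)" "v x"] by linarith
  from power_mono[OF this, of 2] show ?thesis by (auto simp: power_mult_distrib indicator_def split: if_splits)
 qed
 have "(\<lambda>k. LBINT x. (norm (v (x + X k) - v x))^2) \<longlonglongrightarrow> (LINT x::real|lborel. 0::real)"
 proof (rule integral_dominated_convergence[where w = ?w])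
  have "(\<lambda>k. (norm (v (x + X k) - v x))^2) \<longlonglongrightarrow> (norm (v (x + 0) - v x))\<^sup>2" for x
   by (intro tendsto_intros continuous_on_tendsto_compose[OF v(1)] X) auto
  then show "AE x in lborel. (\<lambda>k. (norm (v (x + X k) - v x))^2) \<longlonglongrightarrow> 0" by simp
 qed (use wb in auto)
 then have "\<forall>\<^sub>F k in sequentially. (LBINT x. (norm (v (x + X k) - v x))^2) < h * e / 8"
  using e h by (intro order_tendstoD) auto
 then obtain N where N: "\<And>k. k \<ge> N \<Longrightarrow> (LBINT x. (norm (v (x + X k) - v x))^2) < h * e / 8" by (auto simp: eventually_sequentially)
 show "\<exists>no. \<forall>n\<ge>no. norm (autocorr u (X n) - autocorr u 0) < e"
 proof (intro exI allI impI)
  fix k assume k: "k \<ge> N"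
  let ?t = "X k"
  define D where "D y = 4 * (norm (u (y + ?t) - v (y + ?t)))^2 + 4 * (norm (u y - v y))^2 + 2 * (norm (v (y + ?t) - v y))^2" for y
  have i3: "integrable lborel (\<lambda>x. (norm (v (x + ?t) - v x))^2)" by (rule L1_bound[where f = ?w]) (use wb in auto)
  have i4: "has_bochner_integral lborel (\<lambda>y. (norm (u (y + ?t) - v (y + ?t)))^2) (LBINT x. (norm (u x - v x))^2)"
   using lborel_has_bochner_integral_real_affine_iff[of 1 "\<lambda>x. (norm (u x - v x))^2" "LBINT x. (norm (u x - v x))^2" ?t] v(3) by (simp add: hbi_iff add.commute)
  have iD: "integrable lborel D" "(LBINT y. D y) = 8 * (LBINT x. (norm (u x - v x))^2) + 2 * (LBINT x. (norm (v (x + ?t) - v x))^2)"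
   unfolding D_def using v(3) i3 i4 by (simp_all add: hbi_iff)
  have D1: "(LBINT y. D y) < h * e" using iD(2) v(4) N[OF k] mult_pos_pos[OF h e] by linarith
  have pw: "norm ((u (y + ?t) - u y) * cnj (u y)) \<le> h / 2 * (norm (u y))^2 + 1 / (2 * h) * D y" for y
  proof -
   have "(norm (u (y + ?t) - u y))^2 \<le> D y"
    using norm_add_sq_le[of "(u (y + ?t) - v (y + ?t)) + (v y - u y)" "v (y + ?t) - v y"] norm_add_sq_le[of "u (y + ?t) - v (y + ?t)" "v y - u y"]
    by (simp add: D_def norm_minus_commute)
   moreover have "0 \<le> (h * norm (u y) - norm (u (y + ?t) - u y))^2 / (2 * h)" using h by simp
   then have "norm (u (y + ?t) - u y) * norm (u y) \<le> h / 2 * (norm (u y))^2 + 1 / (2 * h) * (norm (u (y + ?t) - u y))^2"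
    using h by (simp add: field_simps power2_eq_square)
   moreover have "1 / (2 * h) * (norm (u (y + ?t) - u y))^2 \<le> 1 / (2 * h) * D y" using calculation(1) h by (intro mult_left_mono) auto
   ultimately show ?thesis by (simp only: norm_mult complex_mod_cnj)
  qed
  have i5: "integrable lborel (\<lambda>y. h / 2 * (norm (u y))^2 + 1 / (2 * h) * D y)" by (intro L1_add integrable_mult_right u2 iD(1))
  have "norm (autocorr u ?t - autocorr u 0) = norm (LBINT y. (u (y + ?t) - u y) * cnj (u y))"
   unfolding autocorr_def using autocorr_bound(1)[OF _ u2, of ?t] autocorr_bound(1)[OF _ u2, of 0]
   by (simp add: ring_distribs flip: LINT_diff)
  also have "... \<le> (LBINT y. h / 2 * (norm (u y))^2 + 1 / (2 * h) * D y)"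
  proof (rule order_trans[OF integral_norm_bound integral_mono[OF _ i5 pw]])
   show "integrable lborel (\<lambda>y. norm ((u (y + ?t) - u y) * cnj (u y)))"
    by (rule L1_bound[OF i5]) (use order_trans[OF pw abs_ge_self] in auto)
  qed
  also have "... = h / 2 * S + 1 / (2 * h) * (LBINT y. D y)" using u2 iD(1) by (simp add: S_def)
  also have "... < h / 2 * (S + 1) + 1 / (2 * h) * (h * e)" using D1 h by (intro add_strict_mono mult_strict_left_mono) auto
  also have "... = h * (S + 1) / 2 + e / 2" using h by simp
  also have "... = e" using S0 by (simp add: h_def)
  finally show "norm (autocorr u (X k) - autocorr u 0) < e" .
 qed
qed

lemma FT_gaussian:
 assumes "e > 0"
 shows "integrable lborel (\<lambda>w. complex_of_real (exp (- (e * w)\<^sup>2 / 2)))"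
  "FT (\<lambda>w. complex_of_real (exp (- (e * w)\<^sup>2 / 2))) x = of_real (2 * pi / e * gauss (x / e))"
proof -
 let ?g = "\<lambda>w. complex_of_real (exp (- (e * w)\<^sup>2 / 2))"
 have g: "?g w = of_real (sqrt (2 * pi)) * of_real (gauss (e * w))" for w
  by (simp add: std_normal_density_def)
 have i: "integrable lborel (\<lambda>w. complex_of_real (gauss w))"
  using integrable_std_normal_moment[of 0] by simp
 show "integrable lborel ?g"
  unfolding g using lborel_integrable_real_affine[OF i, of e 0] assms by simp
 have c: "(LBINT w. of_real (gauss w) * iexp (t * w)) = of_real (exp (- t\<^sup>2 / 2))" for t
 proof -
  have "char std_normal_distribution t = (LBINT w. gauss w *\<^sub>R iexp (t * w))"
   unfolding char_def by (subst integral_density) (auto simp: normal_density_nonneg)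
  then show ?thesis unfolding char_std_normal_distribution by (simp add: scaleR_conv_of_real)
 qed
 have "FT ?g x = of_real (sqrt (2 * pi)) * (LBINT w. of_real (gauss (e * w)) * iexp (x / e * (e * w)))"
  unfolding FT_def g using assms by (simp add: mult.assoc)
 also have "(LBINT w. of_real (gauss (e * w)) * iexp (x / e * (e * w))) = complex_of_real (exp (- (x / e)\<^sup>2 / 2)) / complex_of_real e"
  (is "?I = _")
 proof -
  have "complex_of_real e * ?I = of_real (exp (- (x / e)\<^sup>2 / 2))"
   using lborel_integral_real_affine[of e "\<lambda>w. of_real (gauss w) * iexp (x / e * w)" 0] assms c[of "x / e"]
   by (simp add: scaleR_conv_of_real)
  moreover have "complex_of_real e \<noteq> 0" using assms by simp
  ultimately show ?thesis by (intro eq_divide_imp) (simp_all only: mult.commute not_False_eq_True)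
 qed
 also have "of_real (sqrt (2 * pi)) * (complex_of_real (exp (- (x / e)\<^sup>2 / 2)) / complex_of_real e) = complex_of_real (sqrt (2 * pi) * exp (- (x / e)\<^sup>2 / 2) / e)"
  by simp
 also have "sqrt (2 * pi) * exp (- (x / e)\<^sup>2 / 2) / e = 2 * pi / e * gauss (x / e)"
 proof -
  have "2 * pi / e * (1 / sqrt (2 * pi) * E) = (2 * pi / sqrt (2 * pi)) * E / e" for E by simp
  then show ?thesis unfolding std_normal_density_def by (simp only: real_div_sqrt pi_ge_zero mult_nonneg_nonneg zero_le_numeral)
 qed
 finally show "FT ?g x = of_real (2 * pi / e * gauss (x / e))" .
qed

text \<open>A Gaussian factor \<open>G k\<close> is inserted and the multiplication formula turns
  the weighted integral into an average of \<open>autocorr u\<close> against an ever narrower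
  Gaussian. On the left the weights increase to 1, so monotone convergence also yields
  integrability; on the right the average tends to the value at 0.\<close>

theorem Plancherel:
 assumes u: "integrable lborel u" and u2: "integrable lborel (\<lambda>x. (norm (u x))^2)"
 shows "integrable lborel (\<lambda>w. (norm (FT u w))^2)"
  "(LBINT w. (norm (FT u w))^2) = 2 * pi * (LBINT x. (norm (u x))^2)"
proof -
 have um[measurable]: "u \<in> borel_measurable borel" using u by auto
 define S where "S = (LBINT x. (norm (u x))^2)"
 define e where "e k = 1 / real (Suc k)" for k
 have e: "e k > 0" for k unfolding e_def by simp
 define G where "G k w = exp (- (e k * w)\<^sup>2 / 2)" for k w
 have G0: "G k w \<ge> 0" "G k w \<le> 1" for k w unfolding G_def by auto
 have Glim: "(\<lambda>k. G k w) \<longlonglongrightarrow> 1" for w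
 proof -
  have "e \<longlonglongrightarrow> 0" unfolding e_def[abs_def] using LIMSEQ_inverse_real_of_nat by (simp add: inverse_eq_divide)
  then have "(\<lambda>k. G k w) \<longlonglongrightarrow> exp (- (0 * w)\<^sup>2 / 2)" unfolding G_def by (intro tendsto_intros) auto
  then show ?thesis by simp
 qed
 have iFG: "integrable lborel (\<lambda>w. (norm (FT u w))^2 * G k w)" for k
 proof (rule L1_bound)
  show "integrable lborel (\<lambda>w. (LBINT x. norm (u x))^2 * norm (complex_of_real (exp (- (e k * w)\<^sup>2 / 2))))"
   using FT_gaussian(1)[OF e, of k] by (intro integrable_mult_right integrable_norm)
  show "AE w in lborel. norm ((norm (FT u w))^2 * G k w) \<le> norm ((LBINT x. norm (u x))^2 * norm (complex_of_real (exp (- (e k * w)\<^sup>2 / 2))))"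
   using norm_FT_le[OF u] by (intro AE_I2) (auto simp: G_def abs_mult intro!: mult_right_mono power_mono)
 qed (unfold G_def, measurable)
 have eq: "(LBINT w. (norm (FT u w))^2 * G k w) = 2 * pi * Re (LBINT z. gauss z *\<^sub>R autocorr u (e k * z))" for k
 proof -
  have "complex_of_real (LBINT w. (norm (FT u w))^2 * G k w) = (LBINT w. FT (autocorr u) w * of_real (exp (- (e k * w)\<^sup>2 / 2)))"
   unfolding autocorr_FT(2)[OF u] G_def by (simp flip: integral_complex_of_real)
  also have "... = (LBINT x. autocorr u x * of_real (2 * pi / e k * gauss (x / e k)))"
   using FT_multiplication_formula[OF autocorr_FT(1)[OF u] FT_gaussian(1)[OF e, of k]]
   unfolding FT_gaussian(2)[OF e] .
  also have "... = of_real (e k) * (LBINT z. autocorr u (e k * z) * of_real (2 * pi / e k * gauss z))"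
   using lborel_integral_real_affine[of "e k" "\<lambda>x. autocorr u x * of_real (2 * pi / e k * gauss (x / e k))" 0] e[of k]
   by (simp add: scaleR_conv_of_real del: of_real_mult of_real_divide)
  also have "... = 2 * pi * (LBINT z. gauss z *\<^sub>R autocorr u (e k * z))"
  proof -
   have "(LBINT z. autocorr u (e k * z) * of_real (2 * pi / e k * gauss z)) =
     (LBINT z. of_real (2 * pi / e k) * (gauss z *\<^sub>R autocorr u (e k * z)))"
    by (intro LINT_cong) (simp_all add: scaleR_conv_of_real)
   then show ?thesis using e[of k] by (simp only: integral_mult_right_zero) simp
  qed
  finally have "complex_of_real (LBINT w. (norm (FT u w))^2 * G k w) = 2 * pi * (LBINT z. gauss z *\<^sub>R autocorr u (e k * z))" .
  from arg_cong[OF this, of Re] show ?thesis by (simp add: mult.assoc)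
 qed
 have lim: "(\<lambda>k. LBINT z. gauss z *\<^sub>R autocorr u (e k * z)) \<longlonglongrightarrow> (LBINT z. gauss z *\<^sub>R autocorr u 0)"
 proof (rule integral_dominated_convergence[where w="\<lambda>z. gauss z * S"])
  have [measurable]: "autocorr u \<in> borel_measurable borel" using autocorr_FT(1)[OF u] by auto
  show "(\<lambda>z. gauss z *\<^sub>R autocorr u (e k * z)) \<in> borel_measurable lborel" for k by measurable
  show "integrable lborel (\<lambda>z. gauss z * S)" using integrable_std_normal_moment[of 0] by simp
  show "AE z in lborel. norm (gauss z *\<^sub>R autocorr u (e k * z)) \<le> gauss z * S" for k
   using autocorr_bound(2)[OF _ u2] by (intro AE_I2) (auto simp: S_def normal_density_nonneg intro!: mult_left_mono)
  show "AE z in lborel. (\<lambda>k. gauss z *\<^sub>R autocorr u (e k * z)) \<longlonglongrightarrow> gauss z *\<^sub>R autocorr u 0"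
  proof (intro AE_I2 tendsto_scaleR tendsto_const autocorr_continuous_0[OF um u2])
   fix z show "(\<lambda>k. e k * z) \<longlonglongrightarrow> 0" unfolding e_def by real_asymp
  qed
 qed simp
 have "(LBINT z. gauss z *\<^sub>R autocorr u 0) = autocorr u 0"
  using integral_std_normal_moment_even[of 0] integrable_std_normal_moment[of 0] by simp
 also have "autocorr u 0 = of_real S"
  unfolding autocorr_def S_def by (simp add: complex_norm_square[symmetric] del: of_real_power flip: integral_complex_of_real)
 finally have "(\<lambda>k. 2 * pi * Re (LBINT z. gauss z *\<^sub>R autocorr u (e k * z))) \<longlonglongrightarrow> 2 * pi * Re (of_real S)"
  using lim by (intro tendsto_intros) auto
 then have lim2: "(\<lambda>k. LBINT w. (norm (FT u w))^2 * G k w) \<longlonglongrightarrow> 2 * pi * S" by (simp add: eq)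
 have mono: "mono (\<lambda>k. (norm (FT u w))^2 * G k w)" for w
 proof (intro monoI mult_left_mono)
  fix k l :: nat assume "k \<le> l"
  then have "e l \<le> e k" unfolding e_def by (simp add: frac_le)
  then have "(e l * w)^2 \<le> (e k * w)^2" using e[of l]
   by (simp add: power_mult_distrib mult_right_mono power_mono)
  then show "G k w \<le> G l w" unfolding G_def by simp
 qed simp
 have "has_bochner_integral lborel (\<lambda>w. (norm (FT u w))^2) (2 * pi * S)"
 proof (rule has_bochner_integral_monotone_convergence[OF iFG _ _ lim2])
  show "AE x in lborel. mono (\<lambda>n. (norm (FT u x))^2 * G n x)" using mono by simp
  show "AE x in lborel. (\<lambda>i. (norm (FT u x))^2 * G i x) \<longlonglongrightarrow> (norm (FT u x))\<^sup>2"
   using tendsto_mult_left[OF Glim, of "(norm (FT u _))^2"] by (intro AE_I2) simp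
 qed measurable
 then show "integrable lborel (\<lambda>w. (norm (FT u w))^2)"
  "(LBINT w. (norm (FT u w))^2) = 2 * pi * (LBINT x. (norm (u x))^2)"
  unfolding S_def by (auto simp: hbi_iff)
qed

definition IFT :: "(real \<Rightarrow> complex) \<Rightarrow> real \<Rightarrow> complex" where
 "IFT G x = FT G (- x) / (2 * pi)"

lemma IFT_L2:
 assumes "integrable lborel G" "integrable lborel (\<lambda>x. (norm (G x))^2)"
 shows "integrable lborel (\<lambda>w. (norm (IFT G w))^2)"
  "2 * pi * (LBINT w. (norm (IFT G w))^2) = (LBINT x. (norm (G x))^2)"
proof -
 have e: "(norm (IFT G w))^2 = (norm (FT G (0 + - 1 * w)))^2 / (2 * pi)^2" for w
  by (simp add: IFT_def norm_divide norm_mult power_divide)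
 show "integrable lborel (\<lambda>w. (norm (IFT G w))^2)"
  unfolding e using lborel_integrable_real_affine[OF Plancherel(1)[OF assms], of "-1" 0] by simp
 have "(LBINT w. (norm (IFT G w))^2) = (LBINT w. (norm (FT G w))^2) / (2 * pi)^2"
  unfolding e using lborel_integral_real_affine[of "-1" "\<lambda>w. (norm (FT G w))^2" 0] by simp
 moreover have "2 * pi * (2 * pi * S / (2 * pi)^2) = S" for S
  by (simp add: power2_eq_square)
 ultimately show "2 * pi * (LBINT w. (norm (IFT G w))^2) = (LBINT x. (norm (G x))^2)"
  by (simp only: Plancherel(2)[OF assms])
qed

text \<open>\<open>IFT G\<close> may fail to be integrable, as for the sinc kernel, so Plancherel's
  theorem cannot be applied to u - IFT G. Instead both squares are expanded, and the multiplication
  formula matches the cross terms.\<close>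

theorem Plancherel_mixed:
 assumes u: "integrable lborel u" and u2: "integrable lborel (\<lambda>x. (norm (u x))^2)"
  and G: "integrable lborel G" and G2: "integrable lborel (\<lambda>x. (norm (G x))^2)"
 shows "integrable lborel (\<lambda>x. (norm (u x - IFT G x))^2)"
  "integrable lborel (\<lambda>w. (norm (FT u w - G w))^2)"
  "(LBINT w. (norm (FT u w - G w))^2) = 2 * pi * (LBINT x. (norm (u x - IFT G x))^2)"
proof -
 have [measurable]: "u \<in> borel_measurable borel" "G \<in> borel_measurable borel" using u G by auto
 have [measurable]: "IFT G \<in> borel_measurable borel" unfolding IFT_def[abs_def] by measurable
 have exp: "(norm (a - b))^2 = (norm a)^2 + (norm b)^2 - 2 * Re (a * cnj b)" for a b :: complex
  unfolding cmod_power2 by (simp add: algebra_simps power2_eq_square)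
 have cross: "integrable lborel (\<lambda>x. a x * cnj (b x))"
  if a: "integrable lborel (\<lambda>x. (norm (a x))^2)" and b: "integrable lborel (\<lambda>x. (norm (b x))^2)"
   and [measurable]: "a \<in> borel_measurable borel" "b \<in> borel_measurable borel" for a b :: "real \<Rightarrow> complex"
 proof (rule L1_bound[where f="\<lambda>y. ((norm (a y))^2 + (norm (b y))^2) / 2"])
  show "integrable lborel (\<lambda>y. ((norm (a y))^2 + (norm (b y))^2) / 2)" using a b by simp
  show "(\<lambda>x. a x * cnj (b x)) \<in> borel_measurable lborel" by measurable
  have "norm (a y * cnj (b y)) \<le> norm (((norm (a y))^2 + (norm (b y))^2) / 2)" for y
   using norm_mult_le_half_sum_squares[of "a y" "cnj (b y)"] by simp
  then show "AE x in lborel. norm (a x * cnj (b x)) \<le> norm (((norm (a x))^2 + (norm (b x))^2) / 2)" by simp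
 qed
 note P = Plancherel[OF u u2] and I = IFT_L2[OF G G2]
 have c1: "integrable lborel (\<lambda>x. u x * cnj (IFT G x))" by (rule cross) (use u2 I in measurable)
 have c2: "integrable lborel (\<lambda>x. FT u x * cnj (G x))" by (rule cross) (use G2 P in measurable)
 show 1: "integrable lborel (\<lambda>x. (norm (u x - IFT G x))^2)"
  unfolding exp
  by (intro L1_diff L1_add integrable_mult_right integrable_Re u2 I c1)
 show 2: "integrable lborel (\<lambda>w. (norm (FT u w - G w))^2)"
  unfolding exp
  by (intro L1_diff L1_add integrable_mult_right integrable_Re G2 P c2)
 have FTcnj: "FT (\<lambda>w. cnj (G w)) x = 2 * pi * cnj (IFT G x)" for x
  unfolding FT_def IFT_def by (simp add: exp_cnj flip: LINT_cnj)
 have "(LBINT w. FT u w * cnj (G w)) = (LBINT x. u x * FT (\<lambda>w. cnj (G w)) x)"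
  using G by (intro FT_multiplication_formula u) auto
 also have "... = 2 * pi * (LBINT x. u x * cnj (IFT G x))"
  unfolding FTcnj by (subst integral_mult_right_zero[symmetric]) (simp add: ac_simps)
 finally have c: "(LBINT w. FT u w * cnj (G w)) = 2 * pi * (LBINT x. u x * cnj (IFT G x))" .
 have expI: "(LBINT x. (norm (a x - b x))^2) = (LBINT x. (norm (a x))^2) + (LBINT x. (norm (b x))^2) - 2 * Re (LBINT x. a x * cnj (b x))"
  if a: "integrable lborel (\<lambda>x. (norm (a x))^2)" and b: "integrable lborel (\<lambda>x. (norm (b x))^2)"
   and c: "integrable lborel (\<lambda>x. a x * cnj (b x))" for a b :: "real \<Rightarrow> complex"
  unfolding exp
  by (subst LINT_diff, intro L1_add a b,
    intro integrable_mult_right integrable_Re c, subst LINT_add[OF a b],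
    simp only: integral_mult_right_zero integral_Re[OF c])
 have Re_2pi: "Re (complex_of_real (2 * pi) * z) = 2 * pi * Re z" for z by simp
 show "(LBINT w. (norm (FT u w - G w))^2) = 2 * pi * (LBINT x. (norm (u x - IFT G x))^2)"
  unfolding expI[OF P(1) G2 c2] expI[OF u2 I(1) c1] c P(2) I(2)[symmetric] Re_2pi
  by (simp only: right_diff_distrib distrib_left mult.assoc mult.left_commute)
qed

section \<open>Bandlimited kernels in the Fourier domain\<close>

definition ecf :: "nat \<Rightarrow> (nat \<Rightarrow> real) \<Rightarrow> real \<Rightarrow> complex" where
 "ecf n X w = (\<Sum>i<n. iexp (w * X i)) / of_nat n"

text \<open>The unbiased estimator of |phi w|^2: the squared modulus of \<open>ecf\<close> without
  its diagonal terms, rescaled.\<close>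

definition ustat :: "nat \<Rightarrow> (nat \<Rightarrow> real) \<Rightarrow> real \<Rightarrow> real" where
 "ustat n X w = (\<Sum>i<n. \<Sum>j\<in>{..<n} - {i}. cos (w * (X i - X j))) / (real n * (real n - 1))"

text \<open>Pointwise representatives of the admissible transforms. The values at |w| = n stay free,
  matching a closed support; outside, h vanishes everywhere and not just almost everywhere, which
  monotonicity permits.\<close>

definition spectra :: "nat \<Rightarrow> (real \<Rightarrow> real) set" where
 "spectra n = {h. (\<forall>w. h (- w) = h w) \<and> (\<forall>w. 0 \<le> h w \<and> h w \<le> 1) \<and> antimono_on {0..} h \<and>
   (\<forall>w. \<bar>w\<bar> > real n \<longrightarrow> h w = 0)}"

text \<open>Fourier inversion of an even spectrum, with a cosine so that it stays real; this is the
  continuous version of the kernel.\<close>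

definition kernel_of :: "(real \<Rightarrow> real) \<Rightarrow> real \<Rightarrow> real" where
 "kernel_of h x = (LBINT w. h w * cos (w * x)) / (2 * pi)"

lemma fourier_eq_FT: "fourier g = FT (\<lambda>x. complex_of_real (g x))"
 by (simp add: fun_eq_iff fourier_def FT_def)

lemma even_antimono_measurable:
 fixes h :: "real \<Rightarrow> real"
 assumes "\<And>w. h (- w) = h w" "antimono_on {0..} h"
 shows "h \<in> borel_measurable borel"
proof -
 have "mono (\<lambda>w. - h (max 0 w))"
  using assms(2) by (auto intro!: monoI simp: monotone_on_def)
 then have "(\<lambda>w. - h (max 0 w)) \<in> borel_measurable borel" by (rule borel_measurable_mono)
 then have "(\<lambda>w. - (- h (max 0 \<bar>w\<bar>))) \<in> borel_measurable borel"
  by (intro borel_measurable_uminus measurable_compose[of "\<lambda>w. \<bar>w\<bar>" borel borel "\<lambda>w. - h (max 0 w)"]) auto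
 moreover have "- (- h (max 0 \<bar>w\<bar>)) = h w" for w using assms(1)[of w] by (auto simp: abs_if max_def)
 ultimately show ?thesis by simp
qed

lemma spectra_measurable: "h \<in> spectra n \<Longrightarrow> h \<in> borel_measurable borel"
 by (rule even_antimono_measurable) (auto simp: spectra_def)

lemma integrable_compact_support:
 fixes g :: "real \<Rightarrow> 'b::{banach, second_countable_topology}"
 assumes [measurable]: "g \<in> borel_measurable borel" and b: "\<And>w. norm (g w) \<le> C" and z: "\<And>w. \<bar>w\<bar> > r \<Longrightarrow> g w = 0"
 shows "integrable lborel g"
proof (rule L1_bound)
 show "integrable lborel (\<lambda>w. C * indicator {-r..r} w :: real)"
  by (intro integrable_mult_right integrable_real_indicator) (auto simp: emeasure_lborel_Icc_eq)
 have "0 \<le> C" using b[of 0] norm_ge_zero[of "g 0"] by linarith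
 then show "AE w in lborel. norm (g w) \<le> norm (C * indicator {-r..r} w :: real)"
  using b z by (intro AE_I2) (force simp: indicator_def)
qed measurable

lemma spectra_integrable_mult:
 fixes g :: "real \<Rightarrow> complex"
 assumes h: "h \<in> spectra n" and [measurable]: "g \<in> borel_measurable borel" and g: "\<And>w. norm (g w) \<le> C"
 shows "integrable lborel (\<lambda>w. of_real (h w) * g w)" "integrable lborel (\<lambda>w. (norm (of_real (h w) * g w))^2)"
proof -
 have [measurable]: "h \<in> borel_measurable borel" by (rule spectra_measurable[OF h])
 have b: "norm (of_real (h w) * g w) \<le> C" for w
  using h g[of w] mult_mono[of "\<bar>h w\<bar>" 1 "norm (g w)" C] by (auto simp: norm_mult spectra_def)
 have z: "of_real (h w) * g w = 0" if "\<bar>w\<bar> > real n" for w using that h by (auto simp: spectra_def)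
 show "integrable lborel (\<lambda>w. of_real (h w) * g w)"
  by (rule integrable_compact_support[OF _ b z]) auto
 show "integrable lborel (\<lambda>w. (norm (of_real (h w) * g w))^2)"
  by (rule integrable_compact_support[where C="C\<^sup>2" and r="real n"]) (use b z in "auto intro!: power_mono")
qed

lemma spectra_integrable_mult_real:
 fixes g :: "real \<Rightarrow> real"
 assumes h: "h \<in> spectra n" and [measurable]: "g \<in> borel_measurable borel" and g: "\<And>w. \<bar>g w\<bar> \<le> C"
 shows "integrable lborel (\<lambda>w. h w * g w)"
 using spectra_integrable_mult(1)[OF h, of "\<lambda>w. of_real (g w)" C] g
 by (simp flip: of_real_mult add: complex_of_real_integrable_eq)

lemma ecf_measurable[measurable]: "ecf n X \<in> borel_measurable borel"
 unfolding ecf_def[abs_def] by measurable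

lemma norm_ecf_le: "norm (ecf n X w) \<le> 1"
proof (cases "n = 0")
 case False
 have "norm (\<Sum>i<n. iexp (w * X i)) \<le> (\<Sum>i<n. 1)" by (rule sum_norm_le) simp
 then show ?thesis using False by (simp add: ecf_def norm_divide)
qed (simp add: ecf_def)

lemma FT_even:
 assumes "integrable lborel h" "\<And>w. h (- w) = h w"
 shows "FT (\<lambda>w. of_real (h w)) x = of_real (LBINT w. h w * cos (w * x))"
proof -
 have [measurable]: "h \<in> borel_measurable borel" using assms(1) by auto
 have i1: "integrable lborel (\<lambda>w. h w * cos (w * x))"
  by (rule L1_bound[OF assms(1)]) (auto simp: abs_mult intro!: mult_left_le)
 have i2: "integrable lborel (\<lambda>w. h w * sin (w * x))"
  by (rule L1_bound[OF assms(1)]) (auto simp: abs_mult intro!: mult_left_le)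
 have "(LBINT w. h w * sin (w * x)) = - (LBINT w. h w * sin (w * x))"
  using lborel_integral_real_affine[of "-1" "\<lambda>w. h w * sin (w * x)" 0] assms(2) by simp
 then have z: "(LBINT w. h w * sin (w * x)) = 0" by linarith
 have "FT (\<lambda>w. of_real (h w)) x = (LBINT w. complex_of_real (h w * cos (w * x)) + \<i> * complex_of_real (h w * sin (w * x)))"
  unfolding FT_def by (intro LINT_cong refl) (simp add: exp_Euler algebra_simps cos_of_real sin_of_real flip: of_real_mult)
 also have "... = of_real (LBINT w. h w * cos (w * x)) + \<i> * of_real (LBINT w. h w * sin (w * x))"
  using i1 i2 by (subst LINT_add) (auto simp del: of_real_mult)
 finally show ?thesis by (simp add: z)
qed

lemma spectra_integrable: "h \<in> spectra n \<Longrightarrow> integrable lborel h"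
 using spectra_integrable_mult_real[of h n "\<lambda>_. 1" 1] by simp

lemma kernel_of_eq_IFT:
 assumes "h \<in> spectra n"
 shows "complex_of_real (kernel_of h x) = IFT (\<lambda>w. of_real (h w)) x"
proof -
 have "FT (\<lambda>w. of_real (h w)) (- x) = of_real (LBINT w. h w * cos (w * - x))"
  using assms by (intro FT_even spectra_integrable) (auto simp: spectra_def)
 then show ?thesis unfolding IFT_def kernel_of_def by simp
qed

lemma kernel_of_even: "kernel_of h (- x) = kernel_of h x"
 by (simp add: kernel_of_def)

text \<open>Shifting by an observation multiplies a transform by exp (i w X_i), and averaging
  produces \<open>ecf\<close>. The L2 norm of the estimator and its distance to f thus become
  integrals over frequencies.\<close>

lemma kde_eq_IFT:
 assumes h: "h \<in> spectra n"
 shows "complex_of_real (kde n (kernel_of h) X x) = IFT (\<lambda>w. of_real (h w) * ecf n X w) x"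
proof -
 let ?h = "\<lambda>w. complex_of_real (h w)"
 have i: "integrable lborel (\<lambda>w. ?h w * iexp (w * y))" for y
  by (rule integrable_mult_unimodular[where C=1]) (use spectra_integrable[OF h] in auto)
 have FTs: "FT (\<lambda>w. ?h w * ecf n X w) (- x) = (\<Sum>i<n. FT ?h (X i - x)) / of_nat n"
 proof -
  have "FT (\<lambda>w. ?h w * ecf n X w) (- x) = (LBINT w. (\<Sum>i<n. ?h w * iexp (w * (X i - x))) / of_nat n)"
   unfolding FT_def ecf_def
   by (intro LINT_cong refl)
     (simp add: sum_distrib_left sum_distrib_right sum_divide_distrib algebra_simps flip: exp_add)
  also have "... = (\<Sum>i<n. FT ?h (X i - x)) / of_nat n"
   unfolding FT_def by (simp only: integral_divide_zero LINT_sum[OF i] mult.commute[of "X _ - x"])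
  finally show ?thesis .
 qed
 have F: "FT ?h y = 2 * pi * of_real (kernel_of h y)" for y
  using kernel_of_eq_IFT[OF h, of "- y"] by (simp add: IFT_def kernel_of_even)
 have "IFT (\<lambda>w. ?h w * ecf n X w) x = (\<Sum>i<n. 2 * pi * of_real (kernel_of h (X i - x))) / of_nat n / (2 * pi)"
  unfolding IFT_def FTs F by simp
 also have "... = of_real (kde n (kernel_of h) X x)"
  by (simp add: kde_def flip: sum_distrib_left)
 finally show ?thesis ..
qed

lemma kde_L2:
 assumes h: "h \<in> spectra n"
 shows "integrable lborel (\<lambda>x. (kde n (kernel_of h) X x)^2)"
  "(LBINT x. (kde n (kernel_of h) X x)^2) = (LBINT w. (h w)^2 * (norm (ecf n X w))^2) / (2 * pi)"
proof -
 let ?G = "\<lambda>w. of_real (h w) * ecf n X w"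
 note G = spectra_integrable_mult[OF h ecf_measurable norm_ecf_le]
 have e: "(kde n (kernel_of h) X x)^2 = (norm (IFT ?G x))^2" for x
  by (simp flip: kde_eq_IFT[OF h])
 show "integrable lborel (\<lambda>x. (kde n (kernel_of h) X x)^2)"
  unfolding e by (rule IFT_L2[OF G])
 show "(LBINT x. (kde n (kernel_of h) X x)^2) = (LBINT w. (h w)^2 * (norm (ecf n X w))^2) / (2 * pi)"
  unfolding e using IFT_L2(2)[OF G, symmetric] by (simp add: norm_mult power_mult_distrib)
qed

lemma kde_loss:
 assumes h: "h \<in> spectra n" and f: "integrable lborel f" "integrable lborel (\<lambda>x. (f x)^2)"
 shows "integrable lborel (\<lambda>x. (kde n (kernel_of h) X x - f x)^2)"
  "integrable lborel (\<lambda>w. (norm (of_real (h w) * ecf n X w - fourier f w))^2)"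
  "(LBINT x. (kde n (kernel_of h) X x - f x)^2) =
    (LBINT w. (norm (of_real (h w) * ecf n X w - fourier f w))^2) / (2 * pi)"
proof -
 let ?G = "\<lambda>w. of_real (h w) * ecf n X w"
 note G = spectra_integrable_mult[OF h ecf_measurable norm_ecf_le]
 have e: "(kde n (kernel_of h) X x - f x)^2 = (norm (of_real (f x) - IFT ?G x))^2" for x
  by (simp flip: kde_eq_IFT[OF h] of_real_diff add: power2_commute)
 have e2: "(norm (of_real (h w) * ecf n X w - fourier f w))^2 = (norm (FT (\<lambda>x. of_real (f x)) w - ?G w))^2" for w
  by (simp add: fourier_eq_FT norm_minus_commute)
 have f': "integrable lborel (\<lambda>x. complex_of_real (f x))" "integrable lborel (\<lambda>x. (norm (complex_of_real (f x)))^2)"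
  using f by auto
 note P = Plancherel_mixed[OF f' G]
 show "integrable lborel (\<lambda>x. (kde n (kernel_of h) X x - f x)^2)" unfolding e by (rule P)
 show "integrable lborel (\<lambda>w. (norm (of_real (h w) * ecf n X w - fourier f w))^2)" unfolding e2 by (rule P)
 show "(LBINT x. (kde n (kernel_of h) X x - f x)^2) =
    (LBINT w. (norm (of_real (h w) * ecf n X w - fourier f w))^2) / (2 * pi)"
  unfolding e e2 P(3) by simp
qed

text \<open>Plancherel treats the squared estimator and inversion the double sum. Under the integral
  there remains a quadratic polynomial in h w with nonnegative leading coefficient, the source of
  convexity.\<close>

lemma cv_kernel_of:
 assumes h: "h \<in> spectra n"
 shows "cv n X (kernel_of h) =
  (LBINT w. (h w)^2 * (norm (ecf n X w))^2 - 2 * h w * ustat n X w) / (2 * pi)"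
proof -
 have [measurable]: "h \<in> borel_measurable borel" by (rule spectra_measurable[OF h])
 have [measurable]: "ustat n X \<in> borel_measurable borel" unfolding ustat_def[abs_def] by measurable
 have i: "integrable lborel (\<lambda>w. h w * cos (w * y))" for y
  by (rule spectra_integrable_mult_real[OF h, where C=1]) auto
 have iU: "integrable lborel (\<lambda>w. 2 * h w * ustat n X w)"
 proof -
  have "2 * h w * ustat n X w = (2 / (real n * (real n - 1))) * (\<Sum>i<n. \<Sum>j\<in>{..<n} - {i}. h w * cos (w * (X i - X j)))" for w
   by (simp add: ustat_def sum_distrib_left sum_divide_distrib mult.assoc)
  then show ?thesis using i by simp
 qed
 have U: "(LBINT w. 2 * h w * ustat n X w) =
   2 / (real n * (real n - 1)) * (\<Sum>i<n. \<Sum>j\<in>{..<n} - {i}. (2 * pi) * kernel_of h (X i - X j))"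
 proof -
  have "2 * h w * ustat n X w = (2 / (real n * (real n - 1))) * (\<Sum>i<n. \<Sum>j\<in>{..<n} - {i}. h w * cos (w * (X i - X j)))" for w
   by (simp add: ustat_def sum_distrib_left sum_divide_distrib mult.assoc)
  then show ?thesis using i by (simp add: kernel_of_def LINT_sum)
 qed
 have i2: "integrable lborel (\<lambda>w. (h w)^2 * (norm (ecf n X w))^2)"
  using spectra_integrable_mult(2)[OF h ecf_measurable norm_ecf_le, of n X] by (simp add: norm_mult power_mult_distrib)
 have eq: "A / (2 * pi) - c * S = (A - c * ((2 * pi) * S)) / (2 * pi)" for A c S
  by (simp add: diff_divide_distrib)
 show ?thesis
  unfolding cv_def kde_L2(2)[OF h] LINT_diff[OF i2 iU] U sum_distrib_left[symmetric]
  by (rule eq)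
qed

section \<open>Identification of the admissible kernels with their spectra\<close>

lemma integrable_truncation:
 assumes "K \<in> L2_real"
 shows "integrable lborel (\<lambda>x. complex_of_real (indicator {-R..R} x * K x))"
  "integrable lborel (\<lambda>x. (norm (complex_of_real (indicator {-R..R} x * K x)))^2)"
proof -
 have [measurable]: "K \<in> borel_measurable borel" and K2: "integrable lborel (\<lambda>x. (K x)^2)"
  using assms by (auto simp: L2_real_def)
 have "\<bar>a\<bar> \<le> 1 + a\<^sup>2" for a :: real
  using sum_squares_bound[of "\<bar>a\<bar>" 1] by simp
 then have "norm (indicator {-R..R} x * K x) \<le> norm (indicator {-R..R} x + (K x)^2)" for x
  by (auto simp: indicator_def)
 then have "integrable lborel (\<lambda>x. indicator {-R..R} x * K x)"
  by (intro L1_bound[OF L1_add[OF integrable_indicator_Icc K2]] AE_I2) auto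
 then show "integrable lborel (\<lambda>x. complex_of_real (indicator {-R..R} x * K x))"
  by (simp only: complex_of_real_integrable_eq)
 show "integrable lborel (\<lambda>x. (norm (complex_of_real (indicator {-R..R} x * K x)))^2)"
  by (rule L1_bound[OF K2]) (auto simp: indicator_def)
qed

text \<open>Mixed Plancherel for the truncated kernel against h. It moves the limit that defines
  \<open>is_L2_fourier\<close> to the space side, and is used both to show that
  \<open>kernel_of h\<close> has spectrum h and to recover a kernel from its spectrum.\<close>

lemma truncation_Plancherel:
 assumes K: "K \<in> L2_real" and h: "h \<in> spectra n"
 shows "(\<integral>\<^sup>+ w. ennreal ((norm (fourier (\<lambda>x. indicator {-R..R} x * K x) w - of_real (h w)))^2) \<partial>lborel) =
  ennreal (2 * pi) * (\<integral>\<^sup>+ x. ennreal ((indicator {-R..R} x * K x - kernel_of h x)^2) \<partial>lborel)"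
proof -
 let ?G = "\<lambda>w. complex_of_real (h w)"
 have G: "integrable lborel ?G" "integrable lborel (\<lambda>w. (norm (?G w))^2)"
  using spectra_integrable_mult[OF h, of "\<lambda>_. 1" 1] by simp_all
 note P = Plancherel_mixed[OF integrable_truncation[OF K, of R] G]
 have e: "(indicator {-R..R} x * K x - kernel_of h x)^2 = (norm (complex_of_real (indicator {-R..R} x * K x) - IFT ?G x))^2" for x
  unfolding kernel_of_eq_IFT[OF h, symmetric] of_real_diff[symmetric] norm_of_real power2_abs ..
 show ?thesis
  unfolding e fourier_eq_FT nn_integral_eq_integral[OF P(1) AE_I2[OF zero_le_power2]]
   nn_integral_eq_integral[OF P(2) AE_I2[OF zero_le_power2]] P(3)
  by (simp add: ennreal_mult')
qed

lemma kernel_of_L2: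
 assumes h: "h \<in> spectra n"
 shows "kernel_of h \<in> L2_real" "(LBINT x. (kernel_of h x)^2) = (LBINT w. (h w)^2) / (2 * pi)"
proof -
 let ?G = "\<lambda>w. complex_of_real (h w)"
 have [measurable]: "h \<in> borel_measurable borel" by (rule spectra_measurable[OF h])
 have G: "integrable lborel ?G" "integrable lborel (\<lambda>w. (norm (?G w))^2)"
  using spectra_integrable_mult[OF h, of "\<lambda>_. 1" 1] by simp_all
 have e: "(kernel_of h x)^2 = (norm (IFT ?G x))^2" for x
  by (simp flip: kernel_of_eq_IFT[OF h])
 have "kernel_of h \<in> borel_measurable borel" unfolding kernel_of_def[abs_def] by measurable
 then show "kernel_of h \<in> L2_real"
  using IFT_L2(1)[OF G] unfolding e[symmetric] by (simp add: L2_real_def)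
 show "(LBINT x. (kernel_of h x)^2) = (LBINT w. (h w)^2) / (2 * pi)"
  unfolding e using IFT_L2(2)[OF G, symmetric] by simp
qed

lemma kernel_of_is_L2_fourier:
 assumes h: "h \<in> spectra n"
 shows "is_L2_fourier (kernel_of h) (\<lambda>w. of_real (h w))"
 unfolding is_L2_fourier_def
proof (intro conjI)
 let ?K = "kernel_of h"
 have [measurable]: "h \<in> borel_measurable borel" by (rule spectra_measurable[OF h])
 show K: "?K \<in> L2_real" by (rule kernel_of_L2[OF h])
 then have [measurable]: "?K \<in> borel_measurable borel" and K2: "integrable lborel (\<lambda>x. (?K x)^2)"
  by (auto simp: L2_real_def)
 have "((\<lambda>R. LBINT x. (indicator {-R..R} x * ?K x - ?K x)^2) \<longlongrightarrow> (LBINT x::real. 0::real)) at_top"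
 proof (rule integral_dominated_convergence_at_top[where w="\<lambda>x. (?K x)^2"])
  show "AE x in lborel. ((\<lambda>R. (indicator {-R..R} x * ?K x - ?K x)^2) \<longlongrightarrow> 0) at_top"
  proof (intro AE_I2 tendsto_eventually)
   fix x show "\<forall>\<^sub>F R in at_top. (indicator {-R..R} x * ?K x - ?K x)^2 = 0"
    using eventually_ge_at_top[of "\<bar>x\<bar>"] by eventually_elim (auto simp: indicator_def)
  qed
  show "\<forall>\<^sub>F R in at_top. AE x in lborel. norm ((indicator {-R..R} x * ?K x - ?K x)^2) \<le> (?K x)^2"
   by (intro always_eventually allI AE_I2) (auto simp: indicator_def)
 qed (use K2 in auto)
 then have "((\<lambda>R. ennreal (2 * pi * (LBINT x. (indicator {-R..R} x * ?K x - ?K x)^2))) \<longlongrightarrow> ennreal (2 * pi * 0)) at_top"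
  by (intro tendsto_intros) auto
 moreover have "(\<integral>\<^sup>+ w. ennreal ((norm (fourier (\<lambda>x. indicator {-R..R} x * ?K x) w - of_real (h w)))^2) \<partial>lborel) =
   ennreal (2 * pi * (LBINT x. (indicator {-R..R} x * ?K x - ?K x)^2))" for R
 proof -
  have "integrable lborel (\<lambda>x. (indicator {-R..R} x * ?K x - ?K x)^2)"
   by (rule L1_bound[OF K2]) (auto simp: indicator_def)
  then show ?thesis
   unfolding truncation_Plancherel[OF K h] by (subst nn_integral_eq_integral) (auto simp: ennreal_mult')
 qed
 ultimately show "((\<lambda>R. \<integral>\<^sup>+ w. ennreal ((norm (fourier (\<lambda>x. indicator {-R..R} x * ?K x) w - of_real (h w)))^2) \<partial>lborel) \<longlongrightarrow> 0) at_top"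
  by simp
 show "(\<lambda>w. complex_of_real (h w)) \<in> borel_measurable lborel" by measurable
qed

lemma nn_integral_sq_diff_le:
 fixes a b c :: "'a \<Rightarrow> complex"
 assumes [measurable]: "a \<in> borel_measurable M" "b \<in> borel_measurable M" "c \<in> borel_measurable M"
 shows "(\<integral>\<^sup>+ w. ennreal ((norm (b w - c w))^2) \<partial>M) \<le>
   2 * (\<integral>\<^sup>+ w. ennreal ((norm (a w - b w))^2) \<partial>M) + 2 * (\<integral>\<^sup>+ w. ennreal ((norm (a w - c w))^2) \<partial>M)"
proof -
 have "(norm (b w - c w))^2 \<le> 2 * (norm (a w - b w))^2 + 2 * (norm (a w - c w))^2" for w
 proof -
  have "norm (b w - c w) \<le> norm (a w - b w) + norm (a w - c w)"
   using norm_triangle_ineq4[of "a w - c w" "a w - b w"] by simp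
  then have "(norm (b w - c w))^2 \<le> (norm (a w - b w) + norm (a w - c w))^2"
   by (intro power_mono) auto
  then show ?thesis using sum_squares_bound[of "norm (a w - b w)" "norm (a w - c w)"]
   by (simp add: power2_sum)
 qed
 then have "(\<integral>\<^sup>+ w. ennreal ((norm (b w - c w))^2) \<partial>M) \<le>
   (\<integral>\<^sup>+ w. 2 * ennreal ((norm (a w - b w))^2) + 2 * ennreal ((norm (a w - c w))^2) \<partial>M)"
  by (intro nn_integral_mono) (auto simp flip: ennreal_plus ennreal_numeral ennreal_mult)
 also have "... = 2 * (\<integral>\<^sup>+ w. ennreal ((norm (a w - b w))^2) \<partial>M) + 2 * (\<integral>\<^sup>+ w. ennreal ((norm (a w - c w))^2) \<partial>M)"
  by (subst nn_integral_add) (auto simp: nn_integral_cmult)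
 finally show ?thesis .
qed

lemma is_L2_fourier_unique:
 assumes G: "is_L2_fourier K G" and H: "is_L2_fourier K H"
 shows "AE w in lborel. G w = H w"
proof -
 have [measurable]: "K \<in> borel_measurable borel" "G \<in> borel_measurable borel" "H \<in> borel_measurable borel"
  using G H by (auto simp: is_L2_fourier_def L2_real_def)
 let ?F = "\<lambda>R. fourier (\<lambda>x. indicator {-R..R} x * K x)"
 have [measurable]: "?F R \<in> borel_measurable borel" for R unfolding fourier_eq_FT by measurable
 let ?I = "\<integral>\<^sup>+ w. ennreal ((norm (G w - H w))^2) \<partial>lborel"
 have "((\<lambda>R. 2 * (\<integral>\<^sup>+ w. ennreal ((norm (?F R w - G w))^2) \<partial>lborel) + 2 * (\<integral>\<^sup>+ w. ennreal ((norm (?F R w - H w))^2) \<partial>lborel)) \<longlongrightarrow> 2 * 0 + 2 * 0) at_top"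
  using G H unfolding is_L2_fourier_def by (intro tendsto_add ennreal_tendsto_cmult) auto
 then have "?I \<le> 2 * 0 + 2 * 0"
  by (rule tendsto_lowerbound) (auto intro!: always_eventually nn_integral_sq_diff_le)
 then have "?I = 0" by simp
 then have "AE w in lborel. ennreal ((norm (G w - H w))^2) = 0"
  by (subst (asm) nn_integral_0_iff_AE) auto
 then show ?thesis by eventually_elim simp
qed

text \<open>On a window [-m, m] truncation at R >= m changes nothing, so the squared difference
  integrated over the window lies below a quantity that tends to 0. Countably many windows cover the
  line.\<close>

lemma is_L2_fourier_kernel_AE:
 assumes K: "is_L2_fourier K (\<lambda>w. of_real (h w))" and h: "h \<in> spectra n"
 shows "AE x in lborel. K x = kernel_of h x"
proof -
 have KL: "K \<in> L2_real" using K by (simp add: is_L2_fourier_def)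
 have [measurable]: "K \<in> borel_measurable borel" "kernel_of h \<in> borel_measurable borel"
  using KL kernel_of_L2(1)[OF h] by (auto simp: L2_real_def)
 have R: "AE x in lborel. x \<in> {- real m..real m} \<longrightarrow> K x = kernel_of h x" for m :: nat
 proof -
  let ?I = "\<lambda>R. \<integral>\<^sup>+ x. ennreal ((indicator {-R..R} x * K x - kernel_of h x)^2) \<partial>lborel"
  let ?J = "\<integral>\<^sup>+ x. ennreal ((K x - kernel_of h x)^2) * indicator {- real m..real m} x \<partial>lborel"
  have "((\<lambda>R. ennreal (2 * pi) * ?I R) \<longlongrightarrow> 0) at_top"
   using K by (simp add: is_L2_fourier_def truncation_Plancherel[OF KL h])
  moreover have "ennreal (2 * pi) * ?J \<le> ennreal (2 * pi) * ?I R" if "R \<ge> real m" for R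
   using that by (intro mult_left_mono nn_integral_mono) (auto simp: indicator_def)
  ultimately have "ennreal (2 * pi) * ?J \<le> 0"
   by (intro tendsto_lowerbound[where F=at_top]) (auto intro: eventually_mono[OF eventually_ge_at_top[of "real m"]])
  then have "?J = 0" using pi_gt_zero by (auto simp: ennreal_eq_0_iff not_le[symmetric])
  then have "AE x in lborel. ennreal ((K x - kernel_of h x)^2) * indicator {- real m..real m} x = 0"
   by (subst (asm) nn_integral_0_iff_AE) auto
  then show ?thesis by eventually_elim (auto simp: indicator_def)
 qed
 have "AE x in lborel. \<forall>m::nat. x \<in> {- real m..real m} \<longrightarrow> K x = kernel_of h x"
  using R by (simp only: AE_all_countable) auto
 then show ?thesis
 proof eventually_elim
  case (elim x)
  obtain m :: nat where "\<bar>x\<bar> \<le> real m" using real_arch_simple by blast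
  then show ?case using elim by (auto simp: abs_le_iff)
 qed
qed

lemma continuous_AE_eq:
 fixes f g :: "real \<Rightarrow> real"
 assumes f: "continuous_on UNIV f" and g: "continuous_on UNIV g" and ae: "AE x in lborel. f x = g x"
 shows "f = g"
proof -
 have "open {x. f x \<noteq> g x}" using f g by (intro open_Collect_neq)
 moreover have "{x. f x \<noteq> g x} \<in> null_sets lborel"
  using ae \<open>open {x. f x \<noteq> g x}\<close> by (subst AE_iff_null_sets) auto
 ultimately have "{x. f x \<noteq> g x} = {}"
  using open_not_negligible by (metis negligible_iff_null_sets null_sets_completionI)
 then show ?thesis by auto
qed

text \<open>The cosine is 1-Lipschitz and |w| <= n on a support of length 2n; the resulting 2 n^2 /
  (2 pi) is rounded up to n^2.\<close>

lemma kernel_of_Lipschitz: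
 assumes h: "h \<in> spectra n"
 shows "\<bar>kernel_of h x - kernel_of h y\<bar> \<le> real n * real n * \<bar>x - y\<bar>"
proof -
 have [measurable]: "h \<in> borel_measurable borel" by (rule spectra_measurable[OF h])
 have i: "integrable lborel (\<lambda>w. h w * cos (w * y))" for y
  by (rule spectra_integrable_mult_real[OF h, where C=1]) auto
 have b: "\<bar>h w * cos (w * x) - h w * cos (w * y)\<bar> \<le> real n * \<bar>x - y\<bar> * indicator {- real n..real n} w" for w
 proof (cases "\<bar>w\<bar> \<le> real n")
  case True
  have "\<bar>cos (w * x) - cos (w * y)\<bar> \<le> \<bar>w * x - w * y\<bar>"
  proof -
   have "\<bar>cos a - cos b\<bar> \<le> \<bar>a - b\<bar>" for a b :: real
   proof -
    have "\<bar>cos a - cos b\<bar> = 2 * \<bar>sin ((a + b) / 2)\<bar> * \<bar>sin ((b - a) / 2)\<bar>"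
     by (simp add: cos_diff_cos abs_mult)
    also have "... \<le> 2 * 1 * \<bar>(b - a) / 2\<bar>"
     by (intro mult_mono abs_sin_le_one abs_sin_x_le_abs_x) auto
    finally show ?thesis by simp
   qed
   then show ?thesis .
  qed
  also have "... = \<bar>w\<bar> * \<bar>x - y\<bar>" by (simp add: abs_mult flip: right_diff_distrib)
  also have "... \<le> real n * \<bar>x - y\<bar>" using True by (intro mult_right_mono) auto
  finally have "\<bar>cos (w * x) - cos (w * y)\<bar> \<le> real n * \<bar>x - y\<bar>" .
  then have "\<bar>h w\<bar> * \<bar>cos (w * x) - cos (w * y)\<bar> \<le> 1 * (real n * \<bar>x - y\<bar>)"
   using h by (intro mult_mono) (auto simp: spectra_def)
  then show ?thesis using True by (auto simp: indicator_def abs_mult simp flip: right_diff_distrib)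
 qed (use h in "auto simp: spectra_def indicator_def")
 have "2 * pi * (kernel_of h x - kernel_of h y) = (LBINT w. h w * cos (w * x) - h w * cos (w * y))"
  using i by (simp add: kernel_of_def right_diff_distrib)
 also have "\<bar>...\<bar> \<le> (LBINT w. \<bar>h w * cos (w * x) - h w * cos (w * y)\<bar>)"
  using integral_norm_bound[of lborel "\<lambda>w. h w * cos (w * x) - h w * cos (w * y)"] by simp
 also have "... \<le> (LBINT w. real n * \<bar>x - y\<bar> * indicator {- real n..real n} w)"
  using i b by (intro integral_mono) (auto intro!: integrable_real_indicator simp: emeasure_lborel_Icc_eq)
 also have "... = real n * \<bar>x - y\<bar> * (2 * real n)" by simp
 also have "\<bar>2 * pi * (kernel_of h x - kernel_of h y)\<bar> = 2 * pi * \<bar>kernel_of h x - kernel_of h y\<bar>"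
  by (simp only: abs_mult) simp
 finally have "2 * pi * \<bar>kernel_of h x - kernel_of h y\<bar> \<le> 2 * (real n * real n * \<bar>x - y\<bar>)"
  by (simp only: mult_ac)
 moreover have "2 * \<bar>kernel_of h x - kernel_of h y\<bar> \<le> 2 * pi * \<bar>kernel_of h x - kernel_of h y\<bar>"
  using pi_gt3 by (intro mult_right_mono) auto
 ultimately have "2 * \<bar>kernel_of h x - kernel_of h y\<bar> \<le> 2 * (real n * real n * \<bar>x - y\<bar>)"
  by (rule order_trans[rotated])
 then show ?thesis by simp
qed

lemma continuous_kernel_of:
 assumes h: "h \<in> spectra n"
 shows "continuous_on UNIV (kernel_of h)"
 using kernel_of_Lipschitz[OF h]
 by (intro lipschitz_on_continuous_on[where L="real n * real n"] lipschitz_onI) (auto simp: dist_real_def)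

text \<open>The function witnessing monotonicity and the one witnessing the support are unrelated in
  the definitions. Uniqueness of the L2 transform makes them agree almost everywhere, and continuity
  then pins the kernel down at every point.\<close>

theorem bandlimited_kernels_eq: "bandlimited_kernels n = kernel_of ` spectra n"
proof (intro equalityI subsetI)
 fix K assume "K \<in> kernel_of ` spectra n"
 then obtain h where h: "h \<in> spectra n" and K: "K = kernel_of h" by auto
 have [measurable]: "h \<in> borel_measurable borel" by (rule spectra_measurable[OF h])
 have F: "is_L2_fourier K (\<lambda>w. of_real (h w))" unfolding K by (rule kernel_of_is_L2_fourier[OF h])
 have "(LBINT w. (h w)^2) \<le> (LBINT w. indicator {- real n..real n} w)"
 proof (rule integral_mono)
  show "integrable lborel (\<lambda>w. (h w)^2)" using spectra_integrable_mult(2)[OF h, of "\<lambda>_. 1" 1] by simp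
  show "(h w)^2 \<le> indicator {- real n..real n} w" for w
  proof (cases "\<bar>w\<bar> \<le> real n")
   case True
   then show ?thesis using h by (auto simp: spectra_def indicator_def abs_le_iff intro!: power_le_one)
  next
   case False
   then show ?thesis using h by (auto simp: spectra_def)
  qed
 qed simp
 also have "... = 2 * real n" by simp
 also have "... \<le> 2 * pi * real n" using pi_gt3 by (intro mult_right_mono) auto
 finally have "(LBINT w. (h w)^2) / (2 * pi) \<le> real n"
  by (simp add: divide_le_eq mult.commute)
 then have "L2_norm K \<le> sqrt (real n)"
  unfolding L2_norm_def K kernel_of_L2(2)[OF h] by simp
 then have "K \<in> kernel_class n"
  unfolding kernel_class_def using F h kernel_of_L2(1)[OF h] K by (auto simp: spectra_def intro!: exI[of _ h])
 moreover have "closure {w. complex_of_real (h w) \<noteq> 0} \<subseteq> {- real n..real n}"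
 proof (intro closure_minimal subsetI)
  fix w assume "w \<in> {w. complex_of_real (h w) \<noteq> 0}"
  then have "\<not> \<bar>w\<bar> > real n" using h by (auto simp: spectra_def)
  then show "w \<in> {- real n..real n}" by auto
 qed simp
 ultimately show "K \<in> bandlimited_kernels n"
  unfolding bandlimited_kernels_def using F continuous_kernel_of[OF h] K by blast
next
 fix K assume K: "K \<in> bandlimited_kernels n"
 obtain h where F: "is_L2_fourier K (\<lambda>w. of_real (h w))" and ev: "\<And>w. h (- w) = h w"
  and b: "\<And>w. 0 \<le> h w" "\<And>w. h w \<le> 1" and m: "antimono_on {0..} h"
  using K by (auto simp: bandlimited_kernels_def kernel_class_def)
 obtain G where G: "is_L2_fourier K G" and cl: "closure {w. G w \<noteq> 0} \<subseteq> {- real n..real n}"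
  using K by (auto simp: bandlimited_kernels_def)
 have [measurable]: "h \<in> borel_measurable borel" by (rule even_antimono_measurable[OF ev m])
 have ae: "AE w in lborel. w > real n \<longrightarrow> h w = 0"
  using is_L2_fourier_unique[OF F G]
 proof eventually_elim
  case (elim w)
  show ?case
  proof
   assume "w > real n"
   then have "w \<notin> {w. G w \<noteq> 0}" using cl closure_subset[of "{w. G w \<noteq> 0}"] by force
   then have "G w = 0" by simp
   then show "h w = 0" using elim by simp
  qed
 qed
 \<comment> \<open>The support condition gives zeros beyond n only almost everywhere, but some such
   zero lies between n and w, and monotonicity carries it to w.\<close>
 have z: "h w = 0" if "w > real n" for w
 proof -
  have "\<exists>v\<in>{real n<..<w}. h v = 0"
  proof (rule ccontr)
   assume "\<not> (\<exists>v\<in>{real n<..<w}. h v = 0)"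
   then have "AE v in lborel. v \<notin> {real n<..<w}" using ae by (auto elim!: eventually_mono)
   then have "{real n<..<w} \<in> null_sets lborel" by (subst AE_iff_null_sets) auto
   then show False using that by (auto simp: null_sets_def)
  qed
  then obtain v where "v > real n" "v < w" "h v = 0" by auto
  moreover have "h w \<le> h v" using m \<open>v > real n\<close> \<open>v < w\<close> of_nat_0_le_iff[of n] by (auto simp: monotone_on_def)
  ultimately show ?thesis using b(1)[of w] by simp
 qed
 have z': "h w = 0" if "\<bar>w\<bar> > real n" for w
  using that z[of w] z[of "- w"] ev[of w] by linarith
 have h: "h \<in> spectra n"
  unfolding spectra_def using ev b m z' by simp
 have "K = kernel_of h"
  by (rule continuous_AE_eq[OF _ continuous_kernel_of[OF h] is_L2_fourier_kernel_AE[OF F h]])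
    (use K in "auto simp: bandlimited_kernels_def")
 then show "K \<in> kernel_of ` spectra n" using h by auto
qed

section \<open>Measurability of the cross-validated estimator\<close>

lemma ustat_measurable[measurable]: "ustat n X \<in> borel_measurable borel"
 unfolding ustat_def[abs_def] by measurable

lemma abs_ustat_le:
 assumes "n \<ge> 2"
 shows "\<bar>ustat n X w\<bar> \<le> 1"
proof -
 have "\<bar>\<Sum>i<n. \<Sum>j\<in>{..<n} - {i}. cos (w * (X i - X j))\<bar> \<le> (\<Sum>i<n. \<Sum>j\<in>{..<n} - {i}. 1)"
  by (intro order_trans[OF sum_abs] sum_mono) auto
 also have "... = real n * (real n - 1)" using assms by (simp add: card_Diff_singleton of_nat_diff)
 finally show ?thesis using assms by (simp add: ustat_def abs_mult divide_le_eq_1 mult_pos_pos)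
qed

text \<open>By \<open>cv_kernel_of\<close> this is 2 pi times the cross-validation criterion of
  \<open>kernel_of h\<close>.\<close>

definition crit :: "nat \<Rightarrow> (nat \<Rightarrow> real) \<Rightarrow> (real \<Rightarrow> real) \<Rightarrow> real" where
 "crit n X h = (LBINT w. (h w)^2 * (norm (ecf n X w))^2 - 2 * h w * ustat n X w)"

lemma spectra_convex:
 assumes "h \<in> spectra n" "g \<in> spectra n" "0 \<le> t" "t \<le> 1"
 shows "(\<lambda>w. (1 - t) * h w + t * g w) \<in> spectra n"
proof -
 have "(1 - t) * h w + t * g w \<le> (1 - t) * 1 + t * 1" for w
  using assms by (intro add_mono mult_left_mono) (auto simp: spectra_def)
 moreover have "antimono_on {0..} (\<lambda>w. (1 - t) * h w + t * g w)"
  using assms unfolding spectra_def monotone_on_def by (auto intro!: add_mono mult_left_mono)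
 ultimately show ?thesis using assms by (auto simp: spectra_def)
qed

lemma spectra_integrable_terms:
 assumes h: "h \<in> spectra n" and g: "g \<in> spectra n" and n: "n \<ge> 2"
 shows "integrable lborel (\<lambda>w. h w * g w * (norm (ecf n X w))^2)" "integrable lborel (\<lambda>w. h w * ustat n X w)"
proof -
 have [measurable]: "g \<in> borel_measurable borel" by (rule spectra_measurable[OF g])
 have "integrable lborel (\<lambda>w. h w * (g w * (norm (ecf n X w))^2))"
 proof (rule spectra_integrable_mult_real[OF h])
  show "\<bar>g w * (norm (ecf n X w))\<^sup>2\<bar> \<le> 1" for w
   using g norm_ecf_le[of n X w] by (auto simp: abs_mult spectra_def intro!: mult_le_one power_le_one)
 qed measurable
 then show "integrable lborel (\<lambda>w. h w * g w * (norm (ecf n X w))^2)" by (simp add: mult.assoc)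
 show "integrable lborel (\<lambda>w. h w * ustat n X w)"
  by (rule spectra_integrable_mult_real[OF h]) (use abs_ustat_le[OF n] in auto)
qed

lemma crit_expand:
 assumes h: "h \<in> spectra n" and g: "g \<in> spectra n" and n: "n \<ge> 2"
 shows "crit n X (\<lambda>w. (1 - t) * h w + t * g w) = crit n X h
  + t * (LBINT w. 2 * (g w - h w) * (h w * (norm (ecf n X w))^2 - ustat n X w))
  + t\<^sup>2 * (LBINT w. (g w - h w)^2 * (norm (ecf n X w))^2)"
proof -
 note I = spectra_integrable_terms[OF h h n] spectra_integrable_terms[OF g g n] spectra_integrable_terms[OF h g n]
 let ?a = "\<lambda>w. (norm (ecf n X w))^2" and ?b = "ustat n X"
 have i1: "integrable lborel (\<lambda>w. (h w)^2 * ?a w - 2 * h w * ?b w)"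
 proof -
  have "integrable lborel (\<lambda>w. h w * h w * ?a w - 2 * (h w * ?b w))" using I by auto
  then show ?thesis by (simp add: power2_eq_square mult.assoc)
 qed
 have i2: "integrable lborel (\<lambda>w. 2 * (g w - h w) * (h w * ?a w - ?b w))"
 proof -
  have "integrable lborel (\<lambda>w. 2 * (h w * g w * ?a w) - 2 * (h w * h w * ?a w) - 2 * (g w * ?b w) + 2 * (h w * ?b w))"
   using I by auto
  then show ?thesis by (rule back_subst[of "integrable lborel"]) (simp add: fun_eq_iff algebra_simps)
 qed
 have i3: "integrable lborel (\<lambda>w. (g w - h w)^2 * ?a w)"
 proof -
  have "integrable lborel (\<lambda>w. g w * g w * ?a w + h w * h w * ?a w - 2 * (h w * g w * ?a w))"
   using I by auto
  then show ?thesis by (rule back_subst[of "integrable lborel"]) (simp add: fun_eq_iff algebra_simps power2_eq_square)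
 qed
 have e: "((1 - t) * h w + t * g w)^2 * ?a w - 2 * ((1 - t) * h w + t * g w) * ?b w =
   ((h w)^2 * ?a w - 2 * h w * ?b w) + t * (2 * (g w - h w) * (h w * ?a w - ?b w)) + t\<^sup>2 * ((g w - h w)^2 * ?a w)" for w
  by (simp add: algebra_simps power2_eq_square)
 show ?thesis
  unfolding crit_def e
  by (subst LINT_add, intro L1_add integrable_mult_right i1 i2,
    intro integrable_mult_right i3, subst LINT_add[OF i1], intro integrable_mult_right i2,
    simp only: integral_mult_right_zero)
qed

text \<open>Along the segment from h to g the criterion is a parabola with linear coefficient l and
  quadratic coefficient q. Minimality over a convex set forces l >= 0, so the gap l + q is at least
  q.\<close>

lemma crit_minimizer_gap:
 assumes h: "h \<in> spectra n" and min: "\<And>g. g \<in> spectra n \<Longrightarrow> crit n X h \<le> crit n X g"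
  and g: "g \<in> spectra n" and n: "n \<ge> 2"
 shows "(LBINT w. (g w - h w)^2 * (norm (ecf n X w))^2) \<le> crit n X g - crit n X h"
proof -
 define l where "l = (LBINT w. 2 * (g w - h w) * (h w * (norm (ecf n X w))^2 - ustat n X w))"
 define q where "q = (LBINT w. (g w - h w)^2 * (norm (ecf n X w))^2)"
 have ex: "crit n X (\<lambda>w. (1 - t) * h w + t * g w) = crit n X h + t * l + t\<^sup>2 * q" for t
  unfolding crit_expand[OF h g n] l_def q_def ..
 have q0: "q \<ge> 0" unfolding q_def by (intro integral_nonneg_AE AE_I2) auto
 have "l \<ge> 0"
 proof (rule ccontr)
  assume "\<not> l \<ge> 0"
  \<comment> \<open>If l were negative, this step length would make l + t q <= l/2 < 0, so that the
    criterion would drop below its minimum.\<close>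
  define t where "t = min 1 (- l / (2 * (q + 1)))"
  have t: "0 < t" "t \<le> 1" using \<open>\<not> l \<ge> 0\<close> q0 by (auto simp: t_def intro!: divide_pos_pos divide_neg_pos)
  have "t * q \<le> (- l / (2 * (q + 1))) * (q + 1)" using q0 t \<open>\<not> l \<ge> 0\<close> unfolding t_def by (intro mult_mono) auto
  also have "... = - l / 2" using q0 by (simp add: field_simps)
  finally have "l + t * q < 0" using \<open>\<not> l \<ge> 0\<close> by simp
  then have "t * (l + t * q) < 0" using t by (intro mult_pos_neg)
  moreover have "0 \<le> t * l + t\<^sup>2 * q"
   using min[OF spectra_convex[OF h g, of t]] t unfolding ex by simp
  ultimately show False by (simp add: algebra_simps power2_eq_square)
 qed
 moreover have "crit n X g = crit n X h + l + q" using ex[of 1] by simp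
 ultimately show ?thesis by (simp add: q_def)
qed

text \<open>Up to the factor 1/n, \<open>ecf\<close> is the restriction of an entire function with
  value n at 0, so its zeros are countable. The weight in \<open>crit_minimizer_gap\<close>
  therefore vanishes only on a null set.\<close>

lemma ecf_nonzero_AE:
 assumes "n > 0"
 shows "AE w in lborel. ecf n X w \<noteq> 0"
proof -
 define f where "f z = (\<Sum>i<n. exp (\<i> * (z * complex_of_real (X i))))" for z
 have hol: "f holomorphic_on UNIV" unfolding f_def by (intro holomorphic_intros)
 have "f 0 \<noteq> 0" using assms by (simp add: f_def)
 have "countable {z. f z = 0}"
 proof (cases "f constant_on UNIV")
  case True
  then have "{z. f z = 0} = {}" using \<open>f 0 \<noteq> 0\<close> by (auto simp: constant_on_def)
  then show ?thesis by simp
 next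
  case False
  then show ?thesis using holomorphic_countable_zeros[OF hol _ _ fsigma.intros[of "\<lambda>_. UNIV", simplified]] by auto
 qed
 then have "countable (complex_of_real -` {z. f z = 0})" 
  by (intro countable_image_inj_on[of complex_of_real] countable_subset[OF image_vimage_subset]) (auto simp: inj_on_def)
 moreover have "complex_of_real -` {z. f z = 0} = {w. ecf n X w = 0}"
  using assms by (auto simp: f_def ecf_def)
 ultimately have "{w. ecf n X w = 0} \<in> null_sets lborel" by (simp add: countable_imp_null_set_lborel)
 then show ?thesis by (rule AE_I'[of _ lborel]) auto
qed

text \<open>The weight may come close to 0 only on the sets \<open>A m\<close>, whose measure tends
  to 0 and where |d| <= 1 suffices. Elsewhere a is bounded below and |d| <= c + d^2 / c converts the
  weighted square into an L1 bound.\<close>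

lemma weighted_L2_to_L1:
 fixes a :: "real \<Rightarrow> real" and d :: "nat \<Rightarrow> real \<Rightarrow> real"
 assumes [measurable]: "a \<in> borel_measurable borel" "\<And>k. d k \<in> borel_measurable borel"
  and a: "\<And>w. 0 \<le> a w" "\<And>w. a w \<le> 1" "AE w in lborel. a w \<noteq> 0"
  and d: "\<And>k w. \<bar>d k w\<bar> \<le> 1" "\<And>k w. \<bar>w\<bar> > r \<Longrightarrow> d k w = 0" and r: "r \<ge> 0"
  and lim: "(\<lambda>k. LBINT w. (d k w)^2 * a w) \<longlonglongrightarrow> 0"
 shows "(\<lambda>k. LBINT w. \<bar>d k w\<bar>) \<longlonglongrightarrow> 0"
proof (rule LIMSEQ_I)
 fix e :: real assume e: "e > 0"
 define A where "A m = {w. \<bar>w\<bar> \<le> r \<and> a w < 1 / real (Suc m)}" for m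
 have [measurable]: "A m \<in> sets borel" for m unfolding A_def by measurable
 have Asub: "A m \<subseteq> {-r..r}" for m by (auto simp: A_def)
 have iA: "integrable lborel (indicator (A m) :: real \<Rightarrow> real)" for m
  by (intro integrable_real_indicator)
    (auto intro!: le_less_trans[OF emeasure_mono[OF Asub]] simp: emeasure_lborel_Icc_eq)
 have "(\<lambda>m. LBINT w. indicator (A m) w :: real) \<longlonglongrightarrow> (LBINT w::real. 0)"
 proof (rule integral_dominated_convergence[where w="indicator {-r..r}"])
  show "AE w in lborel. (\<lambda>m. indicator (A m) w :: real) \<longlonglongrightarrow> 0"
   using a(3)
  proof eventually_elim
   case (elim w)
   then have "a w > 0" using a(1)[of w] by linarith
   then obtain N where "1 / real (Suc N) < a w" by (rule nat_approx_posE)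
   then have "\<forall>\<^sub>F m in sequentially. indicator (A m) w = (0::real)"
    unfolding eventually_sequentially
   proof (intro exI allI impI)
    fix m assume "m \<ge> N"
    then have "1 / real (Suc m) \<le> 1 / real (Suc N)" by (intro frac_le) auto
    then have "w \<notin> A m" using \<open>1 / real (Suc N) < a w\<close> by (simp add: A_def)
    then show "indicator (A m) w = (0::real)" by simp
   qed
   then show ?case by (rule tendsto_eventually)
  qed
  show "AE w in lborel. norm (indicator (A m) w :: real) \<le> indicator {-r..r} w" for m
   using Asub[of m] by (intro AE_I2) (auto simp: indicator_def)
 qed auto
 then have "\<forall>\<^sub>F m in sequentially. (LBINT w. indicator (A m) w :: real) < e / 4"
  using e by (intro order_tendstoD) auto
 then obtain m where m: "(LBINT w. indicator (A m) w :: real) < e / 4" by (auto simp: eventually_sequentially)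
 \<comment> \<open>The three terms of the pointwise bound contribute at most e/4 each: c * 2r, the
   measure of \<open>A m\<close>, and C times the weighted integral.\<close>
 define c where "c = e / (8 * (r + 1))"
 have c: "c > 0" using e r by (simp add: c_def)
 define C where "C = real (Suc m) / c"
 have C: "C > 0" using c by (simp add: C_def)
 have "\<forall>\<^sub>F k in sequentially. (LBINT w. (d k w)^2 * a w) < e / (4 * C)"
  using lim e C by (intro order_tendstoD) auto
 then obtain N where N: "\<And>k. k \<ge> N \<Longrightarrow> (LBINT w. (d k w)^2 * a w) < e / (4 * C)"
  by (auto simp: eventually_sequentially)
 show "\<exists>no. \<forall>k\<ge>no. norm ((LBINT w. \<bar>d k w\<bar>) - 0) < e"
 proof (intro exI allI impI)
  fix k assume k: "k \<ge> N"
  have id: "integrable lborel (\<lambda>w. \<bar>d k w\<bar>)"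
   by (rule integrable_compact_support[where C=1 and r=r]) (use d in auto)
  have ida: "integrable lborel (\<lambda>w. (d k w)^2 * a w)"
  proof (rule integrable_compact_support[where C=1 and r=r])
   show "norm ((d k w)^2 * a w) \<le> 1" for w
    using a d(1)[of k w] by (auto simp: abs_mult abs_square_le_1 intro!: mult_le_one)
  qed (use d in auto)
  have pw: "\<bar>d k w\<bar> \<le> c * indicator {-r..r} w + indicator (A m) w + C * ((d k w)^2 * a w)" for w
  proof -
   consider "\<bar>w\<bar> > r" | "w \<in> A m" | "\<bar>w\<bar> \<le> r" "a w \<ge> 1 / real (Suc m)"
    unfolding A_def mem_Collect_eq by linarith
   then show ?thesis
   proof cases
    case 1
    then show ?thesis using d(2)[OF 1] c C a by simp
   next
    case 2
    have "0 \<le> c * indicator {-r..r} w + C * ((d k w)^2 * a w)" using c C a by simp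
    then show ?thesis using 2 d(1)[of k w] by simp
   next
    case 3
    have "\<bar>d k w\<bar> \<le> c + (d k w)^2 / c"
    proof -
     have "c * \<bar>d k w\<bar> \<le> c\<^sup>2 + \<bar>d k w\<bar>\<^sup>2" using sum_squares_bound[of c "\<bar>d k w\<bar>"]
       mult_nonneg_nonneg[of c "\<bar>d k w\<bar>"] c by linarith
     then show ?thesis using c by (simp add: field_simps power2_eq_square)
    qed
    also have "(d k w)^2 / c = C * ((d k w)^2 * (1 / real (Suc m)))" by (simp add: C_def)
    also have "... \<le> C * ((d k w)^2 * a w)" using 3 C by (intro mult_left_mono) auto
    finally show ?thesis using 3 by (auto simp: indicator_def)
   qed
  qed
  have "(LBINT w. \<bar>d k w\<bar>) \<le> (LBINT w. c * indicator {-r..r} w + indicator (A m) w + C * ((d k w)^2 * a w))"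
   using id ida iA pw by (intro integral_mono) auto
  also have "... = c * (LBINT w. indicator {-r..r} w) + (LBINT w. indicator (A m) w :: real) + C * (LBINT w. (d k w)^2 * a w)"
   using ida iA[of m] by (subst LINT_add; (intro L1_add integrable_mult_right integrable_indicator_Icc)?;
    (subst LINT_add)?; (intro integrable_mult_right integrable_indicator_Icc)?; simp only: integral_mult_right_zero)
  also have "... < e"
  proof -
   have "c * (LBINT w. indicator {-r..r} w) = c * (2 * r)" using r by simp
   also have "... \<le> e / 4" using e r by (simp add: c_def field_simps)
   finally have 1: "c * (LBINT w. indicator {-r..r} w) \<le> e / 4" .
   have "C * (LBINT w. (d k w)^2 * a w) < C * (e / (4 * C))" using N[OF k] C by (intro mult_strict_left_mono) auto
   also have "... = e / 4" using C by simp
   finally show ?thesis using 1 m e by linarith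
  qed
  finally show "norm ((LBINT w. \<bar>d k w\<bar>) - 0) < e" by simp
 qed
qed

lemma tendsto_sample_functions:
 fixes Y :: "nat \<Rightarrow> nat \<Rightarrow> real"
 assumes "\<And>i. i < n \<Longrightarrow> (\<lambda>k. Y k i) \<longlonglongrightarrow> X i"
 shows "(\<lambda>k. ecf n (Y k) w) \<longlonglongrightarrow> ecf n X w" "(\<lambda>k. ustat n (Y k) w) \<longlonglongrightarrow> ustat n X w"
proof -
 have "(\<lambda>k. (\<Sum>i<n. iexp (w * Y k i)) * inverse (of_nat n)) \<longlonglongrightarrow> (\<Sum>i<n. iexp (w * X i)) * inverse (of_nat n)"
  using assms by (intro tendsto_intros) auto
 then show "(\<lambda>k. ecf n (Y k) w) \<longlonglongrightarrow> ecf n X w" by (simp add: ecf_def divide_inverse)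
 have "(\<lambda>k. (\<Sum>i<n. \<Sum>j\<in>{..<n} - {i}. cos (w * (Y k i - Y k j))) * inverse (real n * (real n - 1))) \<longlonglongrightarrow>
  (\<Sum>i<n. \<Sum>j\<in>{..<n} - {i}. cos (w * (X i - X j))) * inverse (real n * (real n - 1))"
  using assms by (intro tendsto_intros) auto
 then show "(\<lambda>k. ustat n (Y k) w) \<longlonglongrightarrow> ustat n X w" by (simp add: ustat_def divide_inverse)
qed

text \<open>The criterion depends continuously on the data, uniformly over all spectra. Hence the
  minimizer for nearby data nearly minimizes the limiting criterion, and the quadratic gap together
  with the almost everywhere positive weight forces convergence in L1.\<close>

lemma minimizers_converge:
 fixes Y :: "nat \<Rightarrow> nat \<Rightarrow> real"
 assumes n: "n \<ge> 2" and Y: "\<And>i. i < n \<Longrightarrow> (\<lambda>k. Y k i) \<longlonglongrightarrow> X i"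
  and h: "h \<in> spectra n" and hmin: "\<And>g. g \<in> spectra n \<Longrightarrow> crit n X h \<le> crit n X g"
  and H: "\<And>k. H k \<in> spectra n" and Hmin: "\<And>k g. g \<in> spectra n \<Longrightarrow> crit n (Y k) (H k) \<le> crit n (Y k) g"
 shows "(\<lambda>k. LBINT w. \<bar>H k w - h w\<bar>) \<longlonglongrightarrow> 0"
proof (rule weighted_L2_to_L1[where a="\<lambda>w. (norm (ecf n X w))^2" and r="real n"])
 have mh[measurable]: "h \<in> borel_measurable borel" by (rule spectra_measurable[OF h])
 show "(\<lambda>w. H k w - h w) \<in> borel_measurable borel" for k
  using spectra_measurable[OF H, of k] mh by measurable
 show "(norm (ecf n X w))^2 \<le> 1" for w using norm_ecf_le[of n X w] by (simp add: power_le_one)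
 show "AE w in lborel. (norm (ecf n X w))^2 \<noteq> 0" using ecf_nonzero_AE[of n X] n by simp
 show "\<bar>H k w - h w\<bar> \<le> 1" for k w
 proof -
  have "0 \<le> H k w \<and> H k w \<le> 1" "0 \<le> h w \<and> h w \<le> 1" using H[of k] h by (auto simp: spectra_def)
  then show ?thesis by linarith
 qed
 show "H k w - h w = 0" if "\<bar>w\<bar> > real n" for k w using that h H[of k] by (auto simp: spectra_def)
 \<comment> \<open>An integrable bound for the change of the criterion's integrand that holds for
   every spectrum at once, because 0 <= g <= 1 and g vanishes beyond n.\<close>
 define E where "E k w = indicator {- real n..real n} w *
   (\<bar>(norm (ecf n X w))\<^sup>2 - (norm (ecf n (Y k) w))\<^sup>2\<bar> + 2 * \<bar>ustat n X w - ustat n (Y k) w\<bar>)" for k w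
 have [measurable]: "E k \<in> borel_measurable borel" for k unfolding E_def[abs_def] by measurable
 have Eb: "norm (E k w) \<le> 5" for k w
 proof -
  have "(norm (ecf n X w))^2 \<le> 1" "(norm (ecf n (Y k) w))^2 \<le> 1"
   using norm_ecf_le[of n X w] norm_ecf_le[of n "Y k" w] by (auto simp: power_le_one)
  moreover have "0 \<le> (norm (ecf n X w))^2" "0 \<le> (norm (ecf n (Y k) w))^2" by auto
  ultimately have "\<bar>(norm (ecf n X w))\<^sup>2 - (norm (ecf n (Y k) w))\<^sup>2\<bar> \<le> 1" by linarith
  moreover have "\<bar>ustat n X w - ustat n (Y k) w\<bar> \<le> 2" using abs_ustat_le[OF n, of X w] abs_ustat_le[OF n, of "Y k" w] by linarith
  ultimately show ?thesis unfolding E_def by (auto simp: indicator_def)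
 qed
 have iE: "integrable lborel (E k)" for k
  by (rule integrable_compact_support[OF _ Eb, where r="real n"]) (auto simp: E_def indicator_def)
 have "(\<lambda>k. LBINT w. E k w) \<longlonglongrightarrow> (LBINT w::real. (0::real))"
 proof (rule integral_dominated_convergence[where w="\<lambda>w. 5 * indicator {- real n..real n} w"])
  show "AE w in lborel. (\<lambda>k. E k w) \<longlonglongrightarrow> 0"
  proof (intro AE_I2)
   fix w
   have "(\<lambda>k. E k w) \<longlonglongrightarrow> indicator {- real n..real n} w *
     (\<bar>(norm (ecf n X w))\<^sup>2 - (norm (ecf n X w))\<^sup>2\<bar> + 2 * \<bar>ustat n X w - ustat n X w\<bar>)"
    unfolding E_def by (intro tendsto_intros tendsto_sample_functions Y)
   then show "(\<lambda>k. E k w) \<longlonglongrightarrow> 0" by simp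
  qed
  show "AE w in lborel. norm (E k w) \<le> 5 * indicator {- real n..real n} w" for k
  proof (intro AE_I2)
   fix w show "norm (E k w) \<le> 5 * indicator {- real n..real n} w"
    using Eb[of k w] by (cases "w \<in> {- real n..real n}") (simp_all add: E_def)
  qed
 qed auto
 then have limE: "(\<lambda>k. 2 * (LBINT w. E k w)) \<longlonglongrightarrow> 0" by (simp add: tendsto_mult_right_zero)
 have critE: "\<bar>crit n X g - crit n (Y k) g\<bar> \<le> (LBINT w. E k w)" if g: "g \<in> spectra n" for g k
 proof -
  have i: "integrable lborel (\<lambda>w. (g w)^2 * (norm (ecf n Z w))^2 - 2 * g w * ustat n Z w)" for Z
   using spectra_integrable_terms[OF g g n, of Z] by (simp add: power2_eq_square mult.assoc)
  have [measurable]: "g \<in> borel_measurable borel" by (rule spectra_measurable[OF g])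
  have "\<bar>crit n X g - crit n (Y k) g\<bar> \<le> (LBINT w. \<bar>((g w)^2 * (norm (ecf n X w))^2 - 2 * g w * ustat n X w) - ((g w)^2 * (norm (ecf n (Y k) w))^2 - 2 * g w * ustat n (Y k) w)\<bar>)"
   unfolding crit_def by (subst LINT_diff[symmetric, OF i i]) (rule integral_abs_bound)
  also have "... \<le> (LBINT w. E k w)"
  proof (rule integral_mono[OF _ iE])
   fix w
   have g01: "0 \<le> g w" "g w \<le> 1" using g by (auto simp: spectra_def)
   have "\<bar>((g w)^2 * p - 2 * g w * b) - ((g w)^2 * p' - 2 * g w * b')\<bar> \<le> \<bar>p - p'\<bar> + 2 * \<bar>b - b'\<bar>" for p b p' b'
   proof -
    have "((g w)^2 * p - 2 * g w * b) - ((g w)^2 * p' - 2 * g w * b') = (g w)^2 * (p - p') + (- (2 * g w)) * (b - b')"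
     by (simp add: algebra_simps)
    also have "\<bar>...\<bar> \<le> \<bar>(g w)\<^sup>2 * (p - p')\<bar> + \<bar>(- (2 * g w)) * (b - b')\<bar>" by (rule abs_triangle_ineq)
    also have "... = (g w)^2 * \<bar>p - p'\<bar> + (2 * g w) * \<bar>b - b'\<bar>" using g01 by (simp add: abs_mult)
    also have "... \<le> 1 * \<bar>p - p'\<bar> + 2 * \<bar>b - b'\<bar>"
     using g01 by (intro add_mono mult_right_mono) (auto simp: power_le_one)
    finally show ?thesis by simp
   qed
   then show "\<bar>((g w)^2 * (norm (ecf n X w))^2 - 2 * g w * ustat n X w) - ((g w)^2 * (norm (ecf n (Y k) w))^2 - 2 * g w * ustat n (Y k) w)\<bar> \<le> E k w"
    using g by (cases "\<bar>w\<bar> \<le> real n") (auto simp: E_def spectra_def abs_le_iff)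
  qed (use i in auto)
  finally show ?thesis .
 qed
 show "(\<lambda>k. LBINT w. (H k w - h w)^2 * (norm (ecf n X w))^2) \<longlonglongrightarrow> 0"
 proof (rule tendsto_sandwich[OF _ _ tendsto_const limE])
  show "\<forall>\<^sub>F k in sequentially. 0 \<le> (LBINT w. (H k w - h w)^2 * (norm (ecf n X w))^2)"
   by (intro always_eventually allI integral_nonneg_AE AE_I2) auto
  show "\<forall>\<^sub>F k in sequentially. (LBINT w. (H k w - h w)^2 * (norm (ecf n X w))^2) \<le> 2 * (LBINT w. E k w)"
  proof (intro always_eventually allI)
   fix k
   have "(LBINT w. (H k w - h w)^2 * (norm (ecf n X w))^2) \<le> crit n X (H k) - crit n X h"
    by (rule crit_minimizer_gap[OF h hmin H n])
   also have "... \<le> 2 * (LBINT w. E k w)"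
    using critE[OF H, of k k] critE[OF h, of k] Hmin[OF h, of k] by linarith
   finally show "(LBINT w. (H k w - h w)^2 * (norm (ecf n X w))^2) \<le> 2 * (LBINT w. E k w)" .
  qed
 qed
qed (use of_nat_0_le_iff in auto)

lemma kernel_of_diff_le:
 assumes h: "h \<in> spectra n" and g: "g \<in> spectra n"
 shows "\<bar>kernel_of h x - kernel_of g x\<bar> \<le> (LBINT w. \<bar>h w - g w\<bar>)"
proof -
 have ih: "integrable lborel (\<lambda>w. h w * cos (w * x))" by (rule spectra_integrable_mult_real[OF h, where C=1]) auto
 have ig: "integrable lborel (\<lambda>w. g w * cos (w * x))" by (rule spectra_integrable_mult_real[OF g, where C=1]) auto
 have i: "integrable lborel (\<lambda>w. \<bar>h w - g w\<bar>)" using spectra_integrable[OF h] spectra_integrable[OF g] by auto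
 have "\<bar>kernel_of h x - kernel_of g x\<bar> = \<bar>LBINT w. h w * cos (w * x) - g w * cos (w * x)\<bar> / (2 * pi)"
  using ih ig by (simp add: kernel_of_def abs_divide flip: diff_divide_distrib)
 also have "... \<le> (LBINT w. \<bar>h w * cos (w * x) - g w * cos (w * x)\<bar>) / 1"
  using pi_gt3 by (intro frac_le integral_abs_bound) auto
 also have "... \<le> (LBINT w. \<bar>h w - g w\<bar>)"
 proof -
  have "\<bar>h w * cos (w * x) - g w * cos (w * x)\<bar> \<le> \<bar>h w - g w\<bar>" for w
   using mult_left_le[of "\<bar>cos (w * x)\<bar>" "\<bar>h w - g w\<bar>"] by (simp flip: left_diff_distrib add: abs_mult)
  then show ?thesis using ih ig i by (auto intro!: integral_mono)
 qed
 finally show ?thesis .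
qed

text \<open>The hypothesis speaks of extensional samples only. Restricting X provides a spectrum for
  every function X, while the criterion reads just the first n coordinates.\<close>

lemma minimizer_spectrum:
 fixes K :: "(nat \<Rightarrow> real) \<Rightarrow> real \<Rightarrow> real"
 assumes K: "\<And>X. X \<in> {..<n} \<rightarrow>\<^sub>E UNIV \<Longrightarrow> is_arg_min (cv n X) (\<lambda>K. K \<in> bandlimited_kernels n) (K X)"
 shows "\<exists>h. h \<in> spectra n \<and> K (restrict X {..<n}) = kernel_of h \<and> (\<forall>g\<in>spectra n. crit n X h \<le> crit n X g)"
proof -
 let ?X = "restrict X {..<n}"
 have c: "crit n ?X g = crit n X g" for g
  by (simp add: crit_def ecf_def ustat_def)
 have m: "is_arg_min (cv n ?X) (\<lambda>K. K \<in> bandlimited_kernels n) (K ?X)" by (rule K) auto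
 then obtain h where h: "h \<in> spectra n" "K ?X = kernel_of h"
  unfolding is_arg_min_def bandlimited_kernels_eq by auto
 have "crit n X h \<le> crit n X g" if g: "g \<in> spectra n" for g
 proof -
  have "\<not> cv n ?X (kernel_of g) < cv n ?X (kernel_of h)"
   using m g h unfolding is_arg_min_def bandlimited_kernels_eq by auto
  then show ?thesis
   unfolding cv_kernel_of[OF h(1)] cv_kernel_of[OF g] crit_def[symmetric] c
   by (simp add: divide_strict_right_mono not_less[symmetric] divide_less_cancel)
 qed
 then show ?thesis using h by auto
qed

text \<open>Joint continuity in the sample and the point, for the product topology on
  \<open>nat \<Rightarrow> real\<close>, gives Borel measurability, which is then transferred to the
  finite product. The convergence of minimizers supplies continuity of the spectrum in L1, and hence
  of the kernel uniformly.\<close>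

theorem cross_validated_estimator_measurable:
 fixes K :: "(nat \<Rightarrow> real) \<Rightarrow> real \<Rightarrow> real"
 assumes n: "n \<ge> 2"
  and K: "\<And>X. X \<in> {..<n} \<rightarrow>\<^sub>E UNIV \<Longrightarrow> is_arg_min (cv n X) (\<lambda>K. K \<in> bandlimited_kernels n) (K X)"
 shows "(\<lambda>X. kde n (K X) X) \<in> estimators n"
proof -
 note ex = minimizer_spectrum[OF K]
 \<comment> \<open>The selection \<open>K\<close> is not assumed measurable. Any choice of
   minimizing spectra depends continuously on X, by \<open>minimizers_converge\<close>.\<close>
 define hs where "hs X = (SOME h. h \<in> spectra n \<and> K (restrict X {..<n}) = kernel_of h \<and> (\<forall>g\<in>spectra n. crit n X h \<le> crit n X g))" for X
 have hs: "hs X \<in> spectra n" "K (restrict X {..<n}) = kernel_of (hs X)" "\<And>g. g \<in> spectra n \<Longrightarrow> crit n X (hs X) \<le> crit n X g" for X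
  using someI_ex[OF ex[of X]] unfolding hs_def[symmetric] by auto
 define P where "P = (\<lambda>(X::nat \<Rightarrow> real, x::real). kde n (kernel_of (hs X)) X x)"
 have "isCont P z" for z
  unfolding isCont_def tendsto_at_iff_sequentially
 proof (intro allI impI)
  fix Z :: "nat \<Rightarrow> (nat \<Rightarrow> real) \<times> real" assume Z: "Z \<longlonglongrightarrow> z"
  define Y where "Y k = fst (Z k)" for k
  define y where "y k = snd (Z k)" for k
  have "Y \<longlonglongrightarrow> fst z" and yl: "y \<longlonglongrightarrow> snd z" unfolding Y_def y_def using Z by (auto intro: tendsto_fst tendsto_snd)
  then have Yl: "(\<lambda>k. Y k i) \<longlonglongrightarrow> fst z i" for i
  proof -
   have "isCont (\<lambda>X::nat \<Rightarrow> real. X i) (fst z)"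
    by (rule continuous_on_interior[OF continuous_on_product_coordinates]) simp
   then show ?thesis using \<open>Y \<longlonglongrightarrow> fst z\<close> by (rule isCont_tendsto_compose)
  qed
  have L: "(\<lambda>k. LBINT w. \<bar>hs (Y k) w - hs (fst z) w\<bar>) \<longlonglongrightarrow> 0"
   by (rule minimizers_converge[OF n Yl hs(1) hs(3) hs(1) hs(3)])
  have "(\<lambda>k. kernel_of (hs (Y k)) (Y k i - y k)) \<longlonglongrightarrow> kernel_of (hs (fst z)) (fst z i - snd z)" for i
  proof (rule Lim_transform2)
   show "(\<lambda>k. kernel_of (hs (fst z)) (Y k i - y k)) \<longlonglongrightarrow> kernel_of (hs (fst z)) (fst z i - snd z)"
    using continuous_kernel_of[OF hs(1)[of "fst z"]] tendsto_diff[OF Yl[of i] yl]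
    by (auto simp: continuous_on_eq_continuous_at intro: isCont_tendsto_compose)
   show "(\<lambda>k. kernel_of (hs (fst z)) (Y k i - y k) - kernel_of (hs (Y k)) (Y k i - y k)) \<longlonglongrightarrow> 0"
   proof (rule Lim_null_comparison[OF _ L], intro always_eventually allI)
    show "norm (kernel_of (hs (fst z)) (Y k i - y k) - kernel_of (hs (Y k)) (Y k i - y k)) \<le> (LBINT w. \<bar>hs (Y k) w - hs (fst z) w\<bar>)" for k
     using kernel_of_diff_le[OF hs(1)[of "Y k"] hs(1)[of "fst z"], of "Y k i - y k"] by (simp add: abs_minus_commute)
   qed
  qed
  then have "(\<lambda>k. P (Y k, y k)) \<longlonglongrightarrow> P (fst z, snd z)"
   unfolding P_def kde_def prod.case by (intro tendsto_intros)
  then show "(P \<circ> Z) \<longlonglongrightarrow> P z" by (simp add: comp_def Y_def y_def)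
 qed
 then have "continuous_on UNIV P" by (simp add: continuous_on_eq_continuous_at)
 then have "P \<in> borel_measurable borel" by (rule borel_measurable_continuous_onI)
 then have P[measurable]: "P \<in> borel_measurable (borel \<Otimes>\<^sub>M borel)" by (simp add: borel_prod)
 have "(\<lambda>X. X) \<in> measurable (Pi\<^sub>M {..<n} (\<lambda>_. lborel)) (Pi\<^sub>M UNIV (\<lambda>_::nat. borel :: real measure))"
 proof (rule measurable_PiM_single')
  fix i :: nat
  show "(\<lambda>X. X i) \<in> borel_measurable (Pi\<^sub>M {..<n} (\<lambda>_. lborel :: real measure))"
  \<comment> \<open>Outside the index set every point of the product space has the value
    \<open>undefined\<close>, so that coordinate is a constant function.\<close>
  proof (cases "i < n")
   case False
   then have "X i = undefined" if "X \<in> space (Pi\<^sub>M {..<n} (\<lambda>_. lborel :: real measure))" for X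
    using that by (auto simp: space_PiM PiE_def extensional_def)
   then show ?thesis by (subst measurable_cong[where g="\<lambda>X. undefined"]) auto
  qed measurable
 qed auto
 then have I[measurable]: "(\<lambda>X. X) \<in> measurable (Pi\<^sub>M {..<n} (\<lambda>_. lborel :: real measure)) (borel :: (nat \<Rightarrow> real) measure)"
  using sets_PiM_equal_borel measurable_cong_sets by blast
 have "(\<lambda>z. P (fst z, snd z)) \<in> borel_measurable (Pi\<^sub>M {..<n} (\<lambda>_. lborel) \<Otimes>\<^sub>M lborel)"
  by (rule measurable_compose[OF measurable_Pair P]) (auto intro: measurable_compose[OF measurable_fst I])
 moreover have "P (fst z, snd z) = (case z of (X, x) \<Rightarrow> kde n (K X) X x)"
  if "z \<in> space (Pi\<^sub>M {..<n} (\<lambda>_. lborel) \<Otimes>\<^sub>M lborel)" for z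
 proof -
  have "restrict (fst z) {..<n} = fst z"
   using that by (auto simp: space_pair_measure space_PiM PiE_def extensional_restrict)
  then show ?thesis using hs(2)[of "fst z"] by (simp add: P_def case_prod_unfold)
 qed
 ultimately show ?thesis
  unfolding estimators_def by (subst (asm) measurable_cong) auto
qed

section \<open>Moments of sums and of degenerate U-statistics\<close>

lemma (in prob_space) integrable_bounded:
 fixes g :: "'a \<Rightarrow> real"
 assumes "g \<in> borel_measurable M" "\<And>x. \<bar>g x\<bar> \<le> B"
 shows "integrable M g"
 by (rule integrable_const_bound[of _ B]) (use assms in auto)

text \<open>Integrating out the newest coordinate kills the cross term, and boundedness yields all
  integrability. The summands may depend on the index, as \<open>beta_chebyshev\<close>
  requires.\<close>

lemma iid_sum_moments:
 fixes a :: "'i \<Rightarrow> 'a \<Rightarrow> real"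
 assumes I: "finite I" and M: "\<And>i. prob_space (M i)"
  and a: "\<And>i. i \<in> I \<Longrightarrow> a i \<in> borel_measurable (M i)" "\<And>i x. \<bar>a i x\<bar> \<le> B"
  and mean: "\<And>i. i \<in> I \<Longrightarrow> (LINT x|M i. a i x) = 0"
 shows "(LINT x|Pi\<^sub>M I M. (\<Sum>i\<in>I. a i (x i))) = 0"
  "(LINT x|Pi\<^sub>M I M. (\<Sum>i\<in>I. a i (x i))^2) = (\<Sum>i\<in>I. LINT x|M i. (a i x)^2)"
proof -
 interpret product_prob_space M by (rule product_prob_spaceI) (rule M)
 have "(LINT x|Pi\<^sub>M I M. (\<Sum>i\<in>I. a i (x i))) = 0 \<and>
  (LINT x|Pi\<^sub>M I M. (\<Sum>i\<in>I. a i (x i))^2) = (\<Sum>i\<in>I. LINT x|M i. (a i x)^2)"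
  using I a(1) mean
 proof (induction I rule: finite_induct)
  case empty
  then show ?case by simp
 next
  case (insert i I)
  interpret Q: prob_space "Pi\<^sub>M (insert i I) M" by (rule prob_space_PiM[OF M])
  interpret QI: prob_space "Pi\<^sub>M I M" by (rule prob_space_PiM[OF M])
  have [measurable]: "a j \<in> borel_measurable (M j)" if "j \<in> insert i I" for j by (rule insert.prems(1)[OF that])
  let ?S = "\<lambda>x. \<Sum>j\<in>I. a j (x j)"
  have ms[measurable]: "?S \<in> borel_measurable (Pi\<^sub>M I M)" by measurable
  have ms': "(\<lambda>x. \<Sum>j\<in>insert i I. a j (x j)) \<in> borel_measurable (Pi\<^sub>M (insert i I) M)" by measurable
  have bS: "\<bar>\<Sum>j\<in>J. a j (x j)\<bar> \<le> real (card J) * B" if "finite J" for J and x :: "'i \<Rightarrow> 'a"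
  proof -
   have "\<bar>\<Sum>j\<in>J. a j (x j)\<bar> \<le> (\<Sum>j\<in>J. B)" by (rule order_trans[OF sum_abs]) (intro sum_mono a(2))
   then show ?thesis by simp
  qed
  have upd: "(\<Sum>j\<in>insert i I. a j ((x(i := y)) j)) = a i y + ?S x" for x y
  proof -
   have "(\<Sum>j\<in>I. a j ((x(i := y)) j)) = ?S x" using insert.hyps by (intro sum.cong) auto
   then show ?thesis using insert.hyps by simp
  qed
  have i1: "integrable (Pi\<^sub>M (insert i I) M) (\<lambda>x. \<Sum>j\<in>insert i I. a j (x j))"
   by (rule Q.integrable_bounded[OF ms' bS]) (use insert.hyps in auto)
  have sqb: "\<bar>(\<Sum>j\<in>J. a j (x j))\<^sup>2\<bar> \<le> (real (card J) * B)^2" if "finite J" for J and x :: "'i \<Rightarrow> 'a"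
   using power_mono[OF bS[OF that, of x], of 2] by simp
  have i2: "integrable (Pi\<^sub>M (insert i I) M) (\<lambda>x. (\<Sum>j\<in>insert i I. a j (x j))^2)"
   by (rule Q.integrable_bounded[OF _ sqb]) (use ms' insert.hyps in "auto intro: borel_measurable_power")
  have iS: "integrable (Pi\<^sub>M I M) ?S" by (rule QI.integrable_bounded[OF ms bS[OF insert.hyps(1)]])
  have iS2: "integrable (Pi\<^sub>M I M) (\<lambda>x. (?S x)^2)"
   by (rule QI.integrable_bounded[OF _ sqb[OF insert.hyps(1)]]) measurable
  have ia: "integrable (M i) (a i)" by (rule prob_space.integrable_bounded[OF M _ a(2)]) simp
  have ia2: "integrable (M i) (\<lambda>y. (a i y)^2)"
   by (rule prob_space.integrable_bounded[OF M, where B="B\<^sup>2"]) (use a(2)[of i] power_mono[OF a(2)[of i], of _ 2] in auto)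
  have IH: "(LINT x|Pi\<^sub>M I M. ?S x) = 0" "(LINT x|Pi\<^sub>M I M. (?S x)^2) = (\<Sum>j\<in>I. LINT x|M j. (a j x)^2)"
   using insert by auto
  have "(LINT x|Pi\<^sub>M (insert i I) M. (\<Sum>j\<in>insert i I. a j (x j))) = (LINT x|Pi\<^sub>M I M. LINT y|M i. a i y + ?S x)"
   unfolding product_integral_insert[OF insert.hyps i1] upd ..
  also have "... = 0" using ia insert.prems(2) IH(1) by (simp add: prob_space.prob_space[OF M])
  finally have 1: "(LINT x|Pi\<^sub>M (insert i I) M. (\<Sum>j\<in>insert i I. a j (x j))) = 0" .
  have inner: "(LINT y|M i. (a i y + s)^2) = (LINT y|M i. (a i y)^2) + s\<^sup>2" for s
   using ia ia2 insert.prems(2)[of i] by (simp add: power2_sum prob_space.prob_space[OF M])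
  have "(LINT x|Pi\<^sub>M (insert i I) M. (\<Sum>j\<in>insert i I. a j (x j))^2) = (LINT x|Pi\<^sub>M I M. LINT y|M i. (a i y + ?S x)^2)"
   unfolding product_integral_insert[OF insert.hyps i2] upd ..
  also have "... = (LINT y|M i. (a i y)^2) + (LINT x|Pi\<^sub>M I M. (?S x)^2)"
   unfolding inner using iS2 by (simp add: QI.prob_space)
  finally show ?case using 1 IH(2) insert.hyps by simp
 qed
 then show "(LINT x|Pi\<^sub>M I M. (\<Sum>i\<in>I. a i (x i))) = 0"
  "(LINT x|Pi\<^sub>M I M. (\<Sum>i\<in>I. a i (x i))^2) = (\<Sum>i\<in>I. LINT x|M i. (a i x)^2)" by auto
qed

text \<open>A new observation y adds 2 T X y, which has mean zero in y for each fixed sample X. The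
  cross term vanishes and the second moment grows by 4 n s, in accordance with 2 n (n - 1) + 4 n = 2
  (n + 1) n.\<close>

lemma degenerate_ustat_moments:
 fixes v :: "'a \<Rightarrow> 'a \<Rightarrow> real"
 assumes M: "prob_space M" and v[measurable]: "(\<lambda>(x, y). v x y) \<in> borel_measurable (M \<Otimes>\<^sub>M M)"
  and b: "\<And>x y. \<bar>v x y\<bar> \<le> B" and sym: "\<And>x y. v x y = v y x"
  and mean: "\<And>x. x \<in> space M \<Longrightarrow> (LINT y|M. v x y) = 0"
 defines "U \<equiv> \<lambda>n X. \<Sum>i<n. \<Sum>j\<in>{..<n} - {i}. v (X i) (X j)"
 shows "(LINT X|Pi\<^sub>M {..<n} (\<lambda>_. M). U n X) = 0"
  "(LINT X|Pi\<^sub>M {..<n} (\<lambda>_. M). (U n X)^2) = 2 * real n * (real n - 1) * (LINT y|M. LINT x|M. (v x y)^2)"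
proof -
 interpret M: prob_space M by fact
 interpret product_prob_space "\<lambda>_. M" by (rule product_prob_spaceI) (rule M)
 have "B \<ge> 0" using b[of undefined undefined] by simp
 define s where "s = (LINT y|M. LINT x|M. (v x y)^2)"
 have "(LINT X|Pi\<^sub>M {..<n} (\<lambda>_. M). U n X) = 0 \<and>
  (LINT X|Pi\<^sub>M {..<n} (\<lambda>_. M). (U n X)^2) = 2 * real n * (real n - 1) * s"
 proof (induction n)
  case 0
  then show ?case by (simp add: U_def)
 next
  case (Suc n)
  let ?P = "Pi\<^sub>M {..<n} (\<lambda>_. M)" and ?P' = "Pi\<^sub>M {..<Suc n} (\<lambda>_. M)"
  interpret Q: prob_space ?P by (rule prob_space_PiM[OF M])
  interpret Q': prob_space ?P' by (rule prob_space_PiM[OF M])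
  interpret MP: pair_prob_space ?P M ..
  have mU[measurable]: "U k \<in> borel_measurable (Pi\<^sub>M {..<k} (\<lambda>_. M))" for k
   unfolding U_def by measurable
  define T where "T X y = (\<Sum>i<n. v (X i) y)" for X y
  have mT[measurable]: "(\<lambda>(X, y). T X y) \<in> borel_measurable (?P \<Otimes>\<^sub>M M)" unfolding T_def by measurable
  have bU: "\<bar>U k X\<bar> \<le> real k * (real k * B)" for k X
  proof -
   have "\<bar>\<Sum>j\<in>{..<k} - {i}. v (X i) (X j)\<bar> \<le> real k * B" for i
   proof -
    have "\<bar>\<Sum>j\<in>{..<k} - {i}. v (X i) (X j)\<bar> \<le> (\<Sum>j\<in>{..<k} - {i}. B)"
     by (rule order_trans[OF sum_abs]) (intro sum_mono b)
    also have "... \<le> real k * B"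
     using \<open>B \<ge> 0\<close> card_mono[of "{..<k}" "{..<k} - {i}"] by (auto intro!: mult_right_mono)
    finally show ?thesis .
   qed
   then have "\<bar>U k X\<bar> \<le> (\<Sum>i<k. real k * B)"
    unfolding U_def by (rule order_trans[OF sum_abs sum_mono])
   then show ?thesis by simp
  qed
  have bT: "\<bar>T X y\<bar> \<le> real n * B" for X y
  proof -
   have "\<bar>T X y\<bar> \<le> (\<Sum>i<n. B)" unfolding T_def by (intro order_trans[OF sum_abs] sum_mono b)
   then show ?thesis by simp
  qed
  have upd: "U (Suc n) (X(n := y)) = U n X + 2 * T X y" for X y
  proof -
   have "U (Suc n) (X(n := y)) = (\<Sum>i<n. (\<Sum>j\<in>{..<n} - {i}. v (X i) (X j)) + v (X i) y) + (\<Sum>j<n. v y (X j))"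
   proof -
    have "{..<Suc n} - {i} = insert n ({..<n} - {i})" if "i < n" for i using that by auto
    then have "(\<Sum>j\<in>{..<Suc n} - {i}. v ((X(n := y)) i) ((X(n := y)) j)) = (\<Sum>j\<in>{..<n} - {i}. v (X i) (X j)) + v (X i) y" if "i < n" for i
     using that by (simp add: add.commute)
    moreover have "{..<Suc n} - {n} = {..<n}" by auto
    then have "(\<Sum>j\<in>{..<Suc n} - {n}. v ((X(n := y)) n) ((X(n := y)) j)) = (\<Sum>j<n. v y (X j))" by simp
    ultimately show ?thesis unfolding U_def by simp
   qed
   also have "(\<Sum>j<n. v y (X j)) = T X y" unfolding T_def by (intro sum.cong sym refl)
   finally show ?thesis by (simp add: sum.distrib U_def T_def)
  qed
  have set: "{..<Suc n} = insert n {..<n}" by auto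
  have i1: "integrable ?P' (U (Suc n))" by (rule Q'.integrable_bounded[OF mU bU])
  have i2: "integrable ?P' (\<lambda>X. (U (Suc n) X)^2)"
   by (rule Q'.integrable_bounded[where B="(real (Suc n) * (real (Suc n) * B))^2"])
     (use power_mono[OF bU, of "Suc n" _ 2] in auto)
  have iU: "integrable ?P (U n)" by (rule Q.integrable_bounded[OF mU bU])
  have iU2: "integrable ?P (\<lambda>X. (U n X)^2)"
   by (rule Q.integrable_bounded[where B="(real n * (real n * B))^2"])
     (use power_mono[OF bU, of n _ 2] in auto)
  have iT: "integrable M (\<lambda>y. T X y)" "integrable M (\<lambda>y. (T X y)^2)" if "X \<in> space ?P" for X
  proof -
   have [measurable]: "(\<lambda>y. T X y) \<in> borel_measurable M"
    using measurable_compose[OF measurable_Pair1'[OF that] mT] by simp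
   show "integrable M (\<lambda>y. T X y)" by (rule M.integrable_bounded[OF _ bT]) measurable
   show "integrable M (\<lambda>y. (T X y)^2)"
    by (rule M.integrable_bounded[where B="(real n * B)^2"]) (use power_mono[OF bT, of X _ 2] in auto)
  qed
  have zT: "(LINT y|M. T X y) = 0" if "X \<in> space ?P" for X
  proof -
   have sp: "X i \<in> space M" if "i < n" for i using \<open>X \<in> space ?P\<close> that by (auto simp: space_PiM PiE_def Pi_def)
   have "integrable M (\<lambda>y. v (X i) y)" if "i < n" for i
    by (rule M.integrable_bounded[OF _ b]) (use measurable_compose[OF measurable_Pair1'[OF sp[OF that]] v] in simp)
   then have "(LINT y|M. T X y) = (\<Sum>i<n. LINT y|M. v (X i) y)" unfolding T_def
    by (intro LINT_sum) auto
   then show ?thesis using mean sp by simp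
  qed
  have "(LINT X|?P'. U (Suc n) X) = (LINT X|?P. LINT y|M. U n X + 2 * T X y)"
   using product_integral_insert[of "{..<n}" n "U (Suc n)"] i1 unfolding set upd by simp
  also have "... = (LINT X|?P. U n X)"
   by (intro LINT_cong refl) (simp add: iT zT M.prob_space)
  finally have 1: "(LINT X|?P'. U (Suc n) X) = 0" using Suc.IH by simp
  have iTT: "integrable (?P \<Otimes>\<^sub>M M) (\<lambda>(X, y). (T X y)^2)"
   by (rule MP.integrable_bounded[where B="(real n * B)^2"]) (use power_mono[OF bT, of _ _ 2] in auto)
  have "(LINT X|?P'. (U (Suc n) X)^2) = (LINT X|?P. LINT y|M. (U n X + 2 * T X y)^2)"
   using product_integral_insert[of "{..<n}" n "\<lambda>X. (U (Suc n) X)^2"] i2 unfolding set upd by simp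
  also have "... = (LINT X|?P. (U n X)^2 + 4 * (LINT y|M. (T X y)^2))"
   by (intro LINT_cong refl)
     (simp add: power2_sum power_mult_distrib iT zT M.prob_space)
  also have "... = (LINT X|?P. (U n X)^2) + 4 * (LINT X|?P. LINT y|M. (T X y)^2)"
   using iU2 MP.integrable_fst[OF iTT] by (subst LINT_add) auto
  also have "(LINT X|?P. LINT y|M. (T X y)^2) = (LINT y|M. LINT X|?P. (T X y)^2)"
   using MP.Fubini_integral[OF iTT] by simp
  also have "... = (LINT y|M. real n * (LINT x|M. (v x y)^2))"
  proof (intro LINT_cong refl)
   fix y assume y: "y \<in> space M"
   have [measurable]: "(\<lambda>x. v x y) \<in> borel_measurable M"
    using measurable_compose[OF measurable_Pair2'[OF y] v] by simp
   show "(LINT X|?P. (T X y)^2) = real n * (LINT x|M. (v x y)^2)"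
    unfolding T_def using iid_sum_moments(2)[of "{..<n}" "\<lambda>_. M" "\<lambda>i x. v x y" B] M b mean[OF y]
     \<open>(\<lambda>x. v x y) \<in> borel_measurable M\<close>
    by (simp add: sym[of _ y])
  qed
  also have "(LINT y|M. real n * (LINT x|M. (v x y)^2)) = real n * s" by (simp add: s_def)
  also have "(LINT X|?P. (U n X)^2) = 2 * real n * (real n - 1) * s" using Suc.IH by simp
  finally show ?case using 1 by (simp add: algebra_simps)
 qed
 then show "(LINT X|Pi\<^sub>M {..<n} (\<lambda>_. M). U n X) = 0"
  "(LINT X|Pi\<^sub>M {..<n} (\<lambda>_. M). (U n X)^2) = 2 * real n * (real n - 1) * (LINT y|M. LINT x|M. (v x y)^2)"
  by (auto simp: s_def)
qed

section \<open>Uniform control of integrals against monotone functions\<close>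

text \<open>A discrete integral of dG / G: 1 - x <= - ln x makes the terms telescope to a logarithm.
  The first term is bounded by 1 separately, since G 0 may be 0.\<close>

lemma sum_relative_increments_le:
 fixes G :: "nat \<Rightarrow> real"
 assumes "0 \<le> G 0" "\<And>l. G l < G (Suc l)" "L > 0"
 shows "(\<Sum>l<L. (G (Suc l) - G l) / G (Suc l)) \<le> 1 + ln (G L / G 1)"
 using \<open>L > 0\<close>
proof (induction L rule: nat_induct_non_zero)
 case 1
 have "G 1 > 0" using assms(1) assms(2)[of 0] by simp
 then show ?case using assms(1) by (simp add: divide_le_eq)
next
 case (Suc L)
 have pos: "G (Suc l) > 0" for l
  by (induction l) (use assms(1,2) in "auto intro: le_less_trans less_trans")
 have GL: "G L > 0" using pos[of "L - 1"] Suc by simp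
 have "(G (Suc L) - G L) / G (Suc L) = 1 - G L / G (Suc L)" using pos[of L] by (simp add: diff_divide_distrib)
 also have "... \<le> - ln (G L / G (Suc L))" using ln_le_minus_one[of "G L / G (Suc L)"] GL pos[of L] by simp
 also have "... = ln (G (Suc L) / G 1) - ln (G L / G 1)" using GL pos[of L] pos[of 0] by (simp add: ln_div)
 finally show ?case using Suc.IH by simp
qed

lemma sum_by_parts:
 fixes a s :: "nat \<Rightarrow> real"
 shows "(\<Sum>k<N. a k * (s (Suc k) - s k)) = (\<Sum>k<N. (a k - a (Suc k)) * s (Suc k)) + a N * s N - a 0 * s 0"
 by (induction N) (auto simp: algebra_simps)

text \<open>Every prefix \<open>{..<T}\<close> is a disjoint union of dyadic blocks, at most one of each length.\<close>

lemma prefix_sum_dyadic: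
 fixes y \<mu> :: "nat \<Rightarrow> real"
 assumes \<mu>: "\<And>k. \<mu> k > 0" and T: "T \<le> 2 ^ m"
 shows "(\<Sum>k<T. y k)^2 \<le> (\<Sum>k<T. \<mu> k) * (real (Suc m) * (\<Sum>j\<le>m. \<Sum>l<2 ^ (m - j).
   (\<Sum>k\<in>{l * 2 ^ j..<Suc l * 2 ^ j}. y k)\<^sup>2 / (\<Sum>k<Suc l * 2 ^ j. \<mu> k)))"
proof -
 define Y where "Y t = (\<Sum>k<t. y k)" for t
 define M where "M t = (\<Sum>k<t. \<mu> k)" for t
 define v where "v j l = (\<Sum>k\<in>{l * 2 ^ j..<Suc l * 2 ^ j}. y k)" for j l
 \<comment> \<open>Rounding T down to multiples of 2^j gives a chain from t 0 = T to t (m + 1) = 0.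
   Its j-th link is empty or one dyadic block of length 2^j, according to the parity of T div
   2^j.\<close>
 define t where "t j = T div 2 ^ j * 2 ^ j" for j
 define d where "d j = Y (t j) - Y (t (Suc j))" for j
 have M0: "M t \<ge> 0" for t unfolding M_def using \<mu> by (intro sum_nonneg less_imp_le)
 have Mmono: "M s \<le> M t" if "s \<le> t" for s t
  unfolding M_def using that \<mu> by (intro sum_mono2) (auto intro: less_imp_le)
 have Mpos: "M t > 0" if "t > 0" for t unfolding M_def using that \<mu> by (intro sum_pos) auto
 have "t 0 = T" "t (Suc m) = 0"
  using le_less_trans[OF T, of "2 ^ Suc m"] by (auto simp: t_def)
 then have "Y T = (\<Sum>j\<le>m. d j)"
  unfolding d_def using sum_telescope[of "\<lambda>j. Y (t j)" m] by (simp add: Y_def)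
 also have "...\<^sup>2 \<le> real (Suc m) * (\<Sum>j\<le>m. (d j)^2)"
  using Cauchy_Schwarz_ineq_sum[of "\<lambda>_. 1" d "{..m}"] by simp
 also have "(\<Sum>j\<le>m. (d j)^2) \<le> (\<Sum>j\<le>m. M T * (\<Sum>l<2 ^ (m - j). (v j l)^2 / M (Suc l * 2 ^ j)))"
 proof (intro sum_mono)
  fix j assume j: "j \<in> {..m}"
  define q where "q = T div 2 ^ j"
  have tS: "t (Suc j) = q div 2 * 2 * 2 ^ j" unfolding t_def q_def by (simp add: div_mult2_eq mult.commute[of 2])
  have nn: "0 \<le> (v j l)^2 / M (Suc l * 2 ^ j)" for l using M0 by simp
  show "(d j)^2 \<le> M T * (\<Sum>l<2 ^ (m - j). (v j l)^2 / M (Suc l * 2 ^ j))"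
  proof (cases "even q")
   case True
   then have "t (Suc j) = t j" unfolding tS by (simp add: t_def q_def)
   then show ?thesis using nn M0 by (simp add: d_def sum_nonneg)
  next
   case False
   then obtain p where p: "q = Suc (2 * p)" by (metis oddE Suc_eq_plus1)
   have tj: "t j = Suc (2 * p) * 2 ^ j" and tSj: "t (Suc j) = 2 * p * 2 ^ j"
    unfolding tS by (simp_all add: t_def flip: q_def add: p)
   have "{..<Suc (2 * p) * 2 ^ j} = {..<2 * p * 2 ^ j} \<union> {2 * p * 2 ^ j..<Suc (2 * p) * 2 ^ j}" by auto
   then have "Y (t j) = Y (t (Suc j)) + v j (2 * p)"
    unfolding tj tSj Y_def v_def by (simp only:) (subst sum.union_disjoint; force)
   then have dv: "d j = v j (2 * p)" by (simp add: d_def)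
   have tT: "t j \<le> T" unfolding t_def by simp
   have "q * 2 ^ j \<le> 2 ^ (m - j) * 2 ^ j"
    using tT T j unfolding t_def q_def[symmetric] by (simp flip: power_add)
   then have "q \<le> 2 ^ (m - j)" by simp
   then have l: "2 * p < 2 ^ (m - j)" using p by simp
   have Mq: "M (Suc (2 * p) * 2 ^ j) > 0" by (rule Mpos) simp
   have "(d j)^2 = M (Suc (2 * p) * 2 ^ j) * ((v j (2 * p))^2 / M (Suc (2 * p) * 2 ^ j))"
    using Mq unfolding dv by simp
   also have "... \<le> M T * ((v j (2 * p))^2 / M (Suc (2 * p) * 2 ^ j))"
    using Mmono[OF tT] nn unfolding tj by (intro mult_right_mono)
   also have "... \<le> M T * (\<Sum>l<2 ^ (m - j). (v j l)^2 / M (Suc l * 2 ^ j))"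
    using l nn M0 by (intro mult_left_mono member_le_sum[of "2 * p" _ "\<lambda>l. (v j l)^2 / M (Suc l * 2 ^ j)"]) auto
   finally show ?thesis .
  qed
 qed
 finally have "(Y T)^2 \<le> real (Suc m) * (\<Sum>j\<le>m. M T * (\<Sum>l<2 ^ (m - j). (v j l)^2 / M (Suc l * 2 ^ j)))"
  by simp
 then show ?thesis unfolding Y_def M_def v_def by (simp add: sum_distrib_left mult.left_commute)
qed

text \<open>Abel summation replaces y by its prefix sums, which the dyadic energy bounds by a
  multiple of sqrt (M t). Summing back by parts leaves increments of sqrt M, and Cauchy-Schwarz
  separates the weighted norm of a from a logarithm. The random factor does not involve a, so the
  bound is uniform over all decreasing sequences.\<close>

lemma monotone_sum_dyadic:
 fixes a y \<mu> :: "nat \<Rightarrow> real"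
 assumes \<mu>: "\<And>k. \<mu> k > 0" and a: "\<And>k. a (Suc k) \<le> a k" "\<And>k. 0 \<le> a k"
 shows "(\<Sum>k<2 ^ m. a k * y k)^2 \<le> (\<Sum>k<2 ^ m. (a k)^2 * \<mu> k) *
  ((1 + ln ((\<Sum>k<2 ^ m. \<mu> k) / \<mu> 0)) * (real (Suc m) * (\<Sum>j\<le>m. \<Sum>l<2 ^ (m - j).
   (\<Sum>k\<in>{l * 2 ^ j..<Suc l * 2 ^ j}. y k)\<^sup>2 / (\<Sum>k<Suc l * 2 ^ j. \<mu> k))))"
proof -
 define N :: nat where "N = 2 ^ m"
 define Q where "Q = real (Suc m) * (\<Sum>j\<le>m. \<Sum>l<2 ^ (m - j).
   (\<Sum>k\<in>{l * 2 ^ j..<Suc l * 2 ^ j}. y k)\<^sup>2 / (\<Sum>k<Suc l * 2 ^ j. \<mu> k))"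
 define M where "M t = (\<Sum>k<t. \<mu> k)" for t
 define Y where "Y t = (\<Sum>k<t. y k)" for t
 have N: "N > 0" by (simp add: N_def)
 have MS: "M k < M (Suc k)" "M (Suc k) - M k = \<mu> k" for k using \<mu>[of k] by (auto simp: M_def)
 have M0: "M t \<ge> 0" for t unfolding M_def using \<mu> by (intro sum_nonneg less_imp_le)
 have Mpos: "M (Suc t) > 0" for t using MS(1)[of t] M0[of t] by simp
 have Q0: "Q \<ge> 0" unfolding Q_def using \<mu> by (intro mult_nonneg_nonneg sum_nonneg divide_nonneg_nonneg) (auto intro: less_imp_le)
 have YM: "\<bar>Y t\<bar> \<le> sqrt Q * sqrt (M t)" if "t \<le> N" for t
 proof -
  have "(Y t)^2 \<le> M t * Q"
   unfolding Y_def M_def Q_def using prefix_sum_dyadic[of \<mu> t m y] \<mu> that N_def by simp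
  then have "sqrt ((Y t)^2) \<le> sqrt (M t * Q)" by (rule real_sqrt_le_mono)
  then show ?thesis by (simp add: real_sqrt_mult mult.commute)
 qed
 have "(\<Sum>k<N. a k * y k) = (\<Sum>k<N. a k * (Y (Suc k) - Y k))" by (simp add: Y_def)
 also have "... = (\<Sum>k<N. (a k - a (Suc k)) * Y (Suc k)) + a N * Y N"
  by (subst sum_by_parts) (simp add: Y_def)
 also have "\<bar>...\<bar> \<le> (\<Sum>k<N. (a k - a (Suc k)) * (sqrt Q * sqrt (M (Suc k)))) + a N * (sqrt Q * sqrt (M N))"
 proof (rule order_trans[OF abs_triangle_ineq], intro add_mono)
  show "\<bar>\<Sum>k<N. (a k - a (Suc k)) * Y (Suc k)\<bar> \<le> (\<Sum>k<N. (a k - a (Suc k)) * (sqrt Q * sqrt (M (Suc k))))"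
   using a YM by (intro order_trans[OF sum_abs] sum_mono) (auto simp: abs_mult intro!: mult_left_mono)
  show "\<bar>a N * Y N\<bar> \<le> a N * (sqrt Q * sqrt (M N))"
   using a YM[of N] by (auto simp: abs_mult intro!: mult_left_mono)
 qed
 also have "... = sqrt Q * (\<Sum>k<N. a k * (sqrt (M (Suc k)) - sqrt (M k)))"
  by (subst sum_by_parts) (simp add: M_def sum_distrib_left algebra_simps)
 also have "... \<le> sqrt Q * (\<Sum>k<N. (a k * sqrt (\<mu> k)) * (sqrt (\<mu> k) / sqrt (M (Suc k))))"
 proof (intro mult_left_mono sum_mono)
  fix k
  have "(sqrt (M (Suc k)) - sqrt (M k)) * sqrt (M (Suc k)) \<le> M (Suc k) - M k"
  proof -
   have "sqrt (M k) * sqrt (M k) \<le> sqrt (M k) * sqrt (M (Suc k))"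
    using M0 MS(1)[of k] by (intro mult_left_mono) auto
   then show ?thesis using M0[of k] M0[of "Suc k"] by (simp add: algebra_simps)
  qed
  then have "sqrt (M (Suc k)) - sqrt (M k) \<le> sqrt (\<mu> k) * (sqrt (\<mu> k) / sqrt (M (Suc k)))"
   using Mpos[of k] \<mu>[of k] by (simp add: MS(2) pos_le_divide_eq)
  then show "a k * (sqrt (M (Suc k)) - sqrt (M k)) \<le> a k * sqrt (\<mu> k) * (sqrt (\<mu> k) / sqrt (M (Suc k)))"
   using a(2)[of k] by (simp only: mult.assoc mult_left_mono)
 qed (use Q0 in auto)
 finally have "\<bar>\<Sum>k<N. a k * y k\<bar> \<le> sqrt Q * (\<Sum>k<N. (a k * sqrt (\<mu> k)) * (sqrt (\<mu> k) / sqrt (M (Suc k))))" .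
 then have "\<bar>\<Sum>k<N. a k * y k\<bar>\<^sup>2 \<le> (sqrt Q * (\<Sum>k<N. (a k * sqrt (\<mu> k)) * (sqrt (\<mu> k) / sqrt (M (Suc k)))))^2"
  by (rule power_mono) simp
 also have "... = Q * (\<Sum>k<N. (a k * sqrt (\<mu> k)) * (sqrt (\<mu> k) / sqrt (M (Suc k))))^2"
  using Q0 by (simp add: power_mult_distrib)
 also have "... \<le> Q * ((\<Sum>k<N. (a k * sqrt (\<mu> k))^2) * (\<Sum>k<N. (sqrt (\<mu> k) / sqrt (M (Suc k)))^2))"
  using Q0 by (intro mult_left_mono Cauchy_Schwarz_ineq_sum)
 also have "(\<Sum>k<N. (a k * sqrt (\<mu> k))^2) = (\<Sum>k<N. (a k)^2 * \<mu> k)"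
  using \<mu> by (intro sum.cong) (auto simp: power_mult_distrib less_imp_le)
 also have "(\<Sum>k<N. (sqrt (\<mu> k) / sqrt (M (Suc k)))^2) = (\<Sum>k<N. (M (Suc k) - M k) / M (Suc k))"
  using \<mu> Mpos by (intro sum.cong) (auto simp: power_divide less_imp_le MS(2))
 also have "Q * ((\<Sum>k<N. (a k)^2 * \<mu> k) * (\<Sum>k<N. (M (Suc k) - M k) / M (Suc k))) \<le>
  Q * ((\<Sum>k<N. (a k)^2 * \<mu> k) * (1 + ln (M N / M 1)))"
  using Q0 \<mu> sum_relative_increments_le[of M N, OF M0 MS(1) N]
  by (intro mult_left_mono sum_nonneg mult_nonneg_nonneg) (auto intro: less_imp_le)
 finally show ?thesis unfolding N_def Q_def M_def by (simp add: ac_simps)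
qed

text \<open>The second moment of a block is at most c times its mass; divided by the mass of the
  prefix that it ends, it is a relative increment. Each of the m + 1 levels thus contributes one
  logarithm.\<close>

lemma dyadic_energy_expectation:
 fixes y :: "nat \<Rightarrow> 'a \<Rightarrow> real" and \<mu> :: "nat \<Rightarrow> real"
 assumes \<mu>: "\<And>k. \<mu> k > 0" and c: "c \<ge> 0"
  and int: "\<And>s t. integrable P (\<lambda>x. (\<Sum>k\<in>{s..<t}. y k x)^2)"
  and le: "\<And>s t. s \<le> t \<Longrightarrow> t \<le> 2 ^ m \<Longrightarrow> (LINT x|P. (\<Sum>k\<in>{s..<t}. y k x)^2) \<le> c * (\<Sum>k\<in>{s..<t}. \<mu> k)"
 shows "(LINT x|P. (\<Sum>j\<le>m. \<Sum>l<2 ^ (m - j).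
   (\<Sum>k\<in>{l * 2 ^ j..<Suc l * 2 ^ j}. y k x)\<^sup>2 / (\<Sum>k<Suc l * 2 ^ j. \<mu> k))) \<le>
  c * real (Suc m) * (1 + ln ((\<Sum>k<2 ^ m. \<mu> k) / \<mu> 0))"
proof -
 define M where "M t = (\<Sum>k<t. \<mu> k)" for t
 have Mpos: "M t > 0" if "t > 0" for t unfolding M_def using that \<mu> by (intro sum_pos) auto
 have "(LINT x|P. (\<Sum>j\<le>m. \<Sum>l<2 ^ (m - j). (\<Sum>k\<in>{l * 2 ^ j..<Suc l * 2 ^ j}. y k x)^2 / M (Suc l * 2 ^ j))) =
  (\<Sum>j\<le>m. \<Sum>l<2 ^ (m - j). (LINT x|P. (\<Sum>k\<in>{l * 2 ^ j..<Suc l * 2 ^ j}. y k x)^2) / M (Suc l * 2 ^ j))"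
  using int by (simp add: LINT_sum)
 also have "... \<le> (\<Sum>j\<le>m. c * (1 + ln (M (2 ^ m) / M 1)))"
 proof (intro sum_mono)
  fix j assume j: "j \<in> {..m}"
  define G where "G l = M (l * 2 ^ j)" for l
  have inc: "(\<Sum>k\<in>{l * 2 ^ j..<Suc l * 2 ^ j}. \<mu> k) = G (Suc l) - G l" for l
  proof -
   have "{..<Suc l * 2 ^ j} = {..<l * 2 ^ j} \<union> {l * 2 ^ j..<Suc l * 2 ^ j}" by auto
   then have "G (Suc l) = G l + (\<Sum>k\<in>{l * 2 ^ j..<Suc l * 2 ^ j}. \<mu> k)"
    unfolding G_def M_def by (simp only:) (subst sum.union_disjoint; force)
   then show ?thesis by simp
  qed
  have Ginc: "G l < G (Suc l)" for l
  proof -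
   have "0 < (\<Sum>k\<in>{l * 2 ^ j..<Suc l * 2 ^ j}. \<mu> k)" using \<mu> by (intro sum_pos) auto
   then show ?thesis unfolding inc by simp
  qed
  have Gm: "G (2 ^ (m - j)) = M (2 ^ m)" using j by (simp add: G_def flip: power_add)
  have "(\<Sum>l<2 ^ (m - j). (LINT x|P. (\<Sum>k\<in>{l * 2 ^ j..<Suc l * 2 ^ j}. y k x)^2) / M (Suc l * 2 ^ j))
   \<le> (\<Sum>l<2 ^ (m - j). c * ((G (Suc l) - G l) / G (Suc l)))"
  proof (intro sum_mono)
   fix l assume l: "l \<in> {..<(2::nat) ^ (m - j)}"
   have "Suc l * 2 ^ j \<le> 2 ^ (m - j) * 2 ^ j" using l by (intro mult_right_mono) auto
   also have "... = 2 ^ m" using j by (simp flip: power_add)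
   finally have "(LINT x|P. (\<Sum>k\<in>{l * 2 ^ j..<Suc l * 2 ^ j}. y k x)^2) \<le> c * (G (Suc l) - G l)"
    unfolding inc[symmetric] by (intro le) auto
   moreover have "G (Suc l) > 0" unfolding G_def by (rule Mpos) simp
   ultimately show "(LINT x|P. (\<Sum>k\<in>{l * 2 ^ j..<Suc l * 2 ^ j}. y k x)^2) / M (Suc l * 2 ^ j) \<le> c * ((G (Suc l) - G l) / G (Suc l))"
    by (simp add: divide_right_mono G_def)
  qed
  also have "... \<le> c * (1 + ln (G (2 ^ (m - j)) / G 1))"
   unfolding sum_distrib_left[symmetric] using c Ginc
   by (intro mult_left_mono sum_relative_increments_le) (auto simp: G_def M_def)
  also have "... \<le> c * (1 + ln (M (2 ^ m) / M 1))"
  proof -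
   have "M 1 \<le> G 1" unfolding G_def M_def using \<mu> by (intro sum_mono2) (auto intro: less_imp_le)
   then have "M (2 ^ m) / G 1 \<le> M (2 ^ m) / M 1" using Mpos[of 1] Mpos[of "2 ^ m"] by (intro divide_left_mono) (auto intro!: mult_pos_pos)
   moreover have "G 1 > 0" using \<open>M 1 \<le> G 1\<close> Mpos[of 1] by simp
   ultimately have "ln (M (2 ^ m) / G 1) \<le> ln (M (2 ^ m) / M 1)"
    using Mpos[of "2 ^ m"] by (intro ln_mono) auto
   then show ?thesis unfolding Gm using c by (intro mult_left_mono add_left_mono) auto
  qed
  finally show "(\<Sum>l<2 ^ (m - j). (LINT x|P. (\<Sum>k\<in>{l * 2 ^ j..<Suc l * 2 ^ j}. y k x)^2) / M (Suc l * 2 ^ j))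
   \<le> c * (1 + ln (M (2 ^ m) / M 1))" .
 qed
 also have "... = c * real (Suc m) * (1 + ln (M (2 ^ m) / M 1))" by simp
 finally show ?thesis unfolding M_def by simp
qed

section \<open>The stochastic error of cross-validation\<close>

lemma (in prob_space) centered_sq_le:
 fixes g :: "'a \<Rightarrow> real"
 assumes [measurable]: "g \<in> borel_measurable M" and b: "\<And>x. \<bar>g x\<bar> \<le> B" and e: "(LINT x|M. g x) = e"
 shows "(LINT x|M. (g x - e)^2) \<le> (LINT x|M. (g x)^2)"
proof -
 have i: "integrable M g" by (rule integrable_bounded[OF _ b]) measurable
 have i2: "integrable M (\<lambda>x. (g x)^2)"
  by (rule integrable_bounded[where B="B\<^sup>2"]) (use power_mono[OF b, of _ 2] in auto)
 have "(LINT x|M. (g x - e)^2) = (LINT x|M. (g x)^2) - e\<^sup>2"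
  using i i2 e by (simp add: power2_diff prob_space) (simp add: power2_eq_square)
 then show ?thesis by simp
qed

text \<open>The almost everywhere bound \<open>C\<close> allows expectations of nonnegative
  functions to be replaced by Lebesgue integrals, to which Plancherel applies.\<close>

locale sample_density =
 fixes f :: "real \<Rightarrow> real" and n :: nat and C :: real
 assumes f_nonneg: "\<And>x. 0 \<le> f x" and f_int: "integrable lborel f" and f_mass: "(LBINT x. f x) = 1"
  and f_sq: "integrable lborel (\<lambda>x. (f x)^2)" and n2: "n \<ge> 2"
  and f_le: "AE x in lborel. f x \<le> C"
begin

abbreviation "\<phi> \<equiv> fourier f"

definition M :: "real measure" where "M = density lborel (\<lambda>x. ennreal (f x))"

abbreviation "P \<equiv> Pi\<^sub>M {..<n} (\<lambda>_. M)"

lemma f_measurable[measurable]: "f \<in> borel_measurable borel" using f_int by auto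

lemma phi_measurable[measurable]: "\<phi> \<in> borel_measurable borel" unfolding fourier_eq_FT by measurable

lemma sets_M[simp, measurable_cong]: "sets M = sets borel" by (simp add: M_def)
lemma space_M[simp]: "space M = UNIV" by (simp add: M_def)

lemma prob_space_M: "prob_space M"
proof
 have "emeasure M (space M) = (\<integral>\<^sup>+ x. ennreal (f x) \<partial>lborel)" by (simp add: M_def emeasure_density)
 also have "... = ennreal (LBINT x. f x)"
  using f_int f_nonneg by (intro nn_integral_eq_integral) auto
 finally show "emeasure M (space M) = 1" by (simp add: f_mass)
qed

sublocale M: prob_space M by (rule prob_space_M)

lemma prob_UNIV[simp]: "M.prob UNIV = 1" using M.prob_space by simp

lemma prob_space_P: "prob_space P" by (rule prob_space_PiM) (rule prob_space_M)

sublocale S: prob_space P by (rule prob_space_P)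

lemma iid_sample_eq: "iid_sample n f = P" by (simp add: iid_sample_def M_def)

lemma integral_M: "(LINT x|M. g x) = (LBINT x. f x *\<^sub>R g x)"
 if "g \<in> borel_measurable borel" for g :: "real \<Rightarrow> 'b::{banach, second_countable_topology}"
 unfolding M_def using that f_nonneg by (intro integral_density) auto

lemma phi_eq: "\<phi> w = (LINT x|M. iexp (w * x))"
 unfolding fourier_def by (subst integral_M) (auto simp: scaleR_conv_of_real)

lemma norm_phi_le: "norm (\<phi> w) \<le> 1"
proof -
 have "norm (\<phi> w) \<le> (LINT x|M. norm (iexp (w * x)))" unfolding phi_eq by (rule integral_norm_bound)
 then show ?thesis by (simp add: M.prob_space)
qed

lemma integral_M_le:
 fixes g :: "real \<Rightarrow> real"
 assumes "integrable lborel g" "\<And>x. 0 \<le> g x"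
 shows "(LINT x|M. g x) \<le> C * (LBINT x. g x)"
proof -
 have [measurable]: "g \<in> borel_measurable borel" using assms by auto
 have "(LINT x|M. g x) = (LBINT x. f x *\<^sub>R g x)" by (rule integral_M) measurable
 also have "... \<le> (LBINT x. C * g x)"
 proof (rule integral_mono_AE')
  show "AE x in lborel. f x *\<^sub>R g x \<le> C * g x"
   using f_le by eventually_elim (use assms(2) in "auto intro: mult_right_mono")
  show "AE x in lborel. 0 \<le> C * g x"
   using f_le by eventually_elim (use assms(2) f_nonneg in "auto intro!: mult_nonneg_nonneg intro: order_trans")
 qed (use assms in simp)
 finally show ?thesis by simp
qed

lemma C_nonneg: "0 \<le> C"
proof -
 have "0 \<le> (LINT x|M. indicator {0..1} x :: real)" by (intro integral_nonneg_AE AE_I2) simp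
 also have "... \<le> C * (LBINT x. indicator {0..1::real} x)" by (rule integral_M_le) auto
 finally show ?thesis by simp
qed

definition weight :: "(real \<Rightarrow> real) \<Rightarrow> bool" where
 "weight \<psi> \<longleftrightarrow> \<psi> \<in> borel_measurable borel \<and> (\<forall>w. \<bar>\<psi> w\<bar> \<le> 1) \<and> (\<forall>w. \<bar>w\<bar> > real n \<longrightarrow> \<psi> w = 0)"

lemma weight_integrable:
 fixes g :: "real \<Rightarrow> real"
 assumes "weight \<psi>" "g \<in> borel_measurable borel" "\<And>w. \<bar>g w\<bar> \<le> B"
 shows "integrable lborel (\<lambda>w. \<psi> w * g w)"
proof (rule integrable_compact_support[where C=B and r="real n"])
 show "norm (\<psi> w * g w) \<le> B" for w
  using assms(1,3) mult_mono[of "\<bar>\<psi> w\<bar>" 1 "\<bar>g w\<bar>" B] by (auto simp: weight_def abs_mult)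
qed (use assms in "auto simp: weight_def")

lemma weight_integral_le:
 fixes g :: "real \<Rightarrow> real"
 assumes "weight \<psi>" "g \<in> borel_measurable borel" "\<And>w. \<bar>g w\<bar> \<le> B"
 shows "\<bar>LBINT w. \<psi> w * g w\<bar> \<le> 2 * real n * B"
proof -
 have B: "B \<ge> 0" using assms(3)[of 0] by simp
 have "\<bar>LBINT w. \<psi> w * g w\<bar> \<le> (LBINT w. \<bar>\<psi> w * g w\<bar>)" by (rule integral_abs_bound)
 also have "... \<le> (LBINT w. B * indicator {- real n..real n} w)"
 proof (intro integral_mono)
  show "integrable lborel (\<lambda>w. \<bar>\<psi> w * g w\<bar>)" using weight_integrable[OF assms] by auto
  show "\<bar>\<psi> w * g w\<bar> \<le> B * indicator {- real n..real n} w" for w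
   using assms(1,3) B mult_mono[of "\<bar>\<psi> w\<bar>" 1 "\<bar>g w\<bar>" B]
   by (cases "\<bar>w\<bar> \<le> real n") (auto simp: weight_def abs_mult indicator_def abs_le_iff)
 qed auto
 also have "... = 2 * real n * B" by simp
 finally show ?thesis .
qed

text \<open>With \<open>errV\<close> this is the Hoeffding decomposition ustat - |phi|^2 = 2 errB +
  errV: \<open>errB\<close> is an average of centred independent terms, \<open>errV\<close> the
  completely degenerate remainder.\<close>

definition errB :: "(nat \<Rightarrow> real) \<Rightarrow> real \<Rightarrow> real" where
 "errB X w = Re (ecf n X w * cnj (\<phi> w)) - (norm (\<phi> w))\<^sup>2"

definition errV :: "(nat \<Rightarrow> real) \<Rightarrow> real \<Rightarrow> real" where
 "errV X w = ustat n X w + (norm (\<phi> w))^2 - 2 * Re (ecf n X w * cnj (\<phi> w))"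

lemma err_measurable[measurable]: "errB X \<in> borel_measurable borel" "errV X \<in> borel_measurable borel"
 unfolding errB_def[abs_def] errV_def[abs_def] by measurable

lemma err_bounded: "\<bar>errB X w\<bar> \<le> 4" "\<bar>errV X w\<bar> \<le> 4"
proof -
 have 1: "\<bar>Re (ecf n X w * cnj (\<phi> w))\<bar> \<le> 1"
  by (rule order_trans[OF abs_Re_le_cmod]) (auto simp: norm_mult intro!: mult_le_one norm_ecf_le norm_phi_le)
 have 2: "(norm (\<phi> w))^2 \<le> 1" "0 \<le> (norm (\<phi> w))^2" using norm_phi_le[of w] by (auto simp: power_le_one)
 show "\<bar>errB X w\<bar> \<le> 4" "\<bar>errV X w\<bar> \<le> 4"
  using 1 2 abs_ustat_le[OF n2, of X w] unfolding errB_def errV_def by linarith+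
qed

abbreviation "intB \<psi> X \<equiv> (LBINT w. \<psi> w * errB X w)"
abbreviation "intV \<psi> X \<equiv> (LBINT w. \<psi> w * errV X w)"

text \<open>Kernel, projection and mean of the U-statistic obtained by integrating against \<psi>:
  \<open>mean_u\<close> and \<open>mean_u1\<close> show that averaging one argument at a time leads
  from \<open>u\<close> to \<open>u1\<close> and to \<open>u0\<close>.\<close>

definition "u \<psi> x y = (LBINT w. \<psi> w * cos (w * (x - y)))"
definition "u1 \<psi> x = (LBINT w. \<psi> w * Re (iexp (w * x) * cnj (\<phi> w)))"
definition "u0 \<psi> = (LBINT w. \<psi> w * (norm (\<phi> w))^2)"

lemma Re_phi_le: "\<bar>Re (iexp (w * x) * cnj (\<phi> w))\<bar> \<le> 1"
 by (rule order_trans[OF abs_Re_le_cmod]) (auto simp: norm_mult norm_phi_le)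

lemma phi_sq_le: "\<bar>(norm (\<phi> w))\<^sup>2\<bar> \<le> 1" using norm_phi_le[of w] by (simp add: power_le_one)

context
 fixes \<psi> assumes w\<psi>: "weight \<psi>"
begin

lemma psi_measurable[measurable]: "\<psi> \<in> borel_measurable borel" using w\<psi> by (simp add: weight_def)

lemma u_measurable[measurable]:
 "(\<lambda>(x, y). u \<psi> x y) \<in> borel_measurable (borel \<Otimes>\<^sub>M borel)" "u1 \<psi> \<in> borel_measurable borel"
 unfolding u_def u1_def[abs_def] by measurable

lemma u_bounded: "\<bar>u \<psi> x y\<bar> \<le> 2 * real n" "\<bar>u1 \<psi> x\<bar> \<le> 2 * real n" "\<bar>u0 \<psi>\<bar> \<le> 2 * real n"
proof -
 show "\<bar>u \<psi> x y\<bar> \<le> 2 * real n" unfolding u_def using weight_integral_le[OF w\<psi>, of "\<lambda>w. cos (w * (x - y))" 1] by simp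
 show "\<bar>u1 \<psi> x\<bar> \<le> 2 * real n" unfolding u1_def
  using weight_integral_le[OF w\<psi>, of "\<lambda>w. Re (iexp (w * x) * cnj (\<phi> w))" 1] Re_phi_le by simp
 show "\<bar>u0 \<psi>\<bar> \<le> 2 * real n" unfolding u0_def
  using weight_integral_le[OF w\<psi>, of "\<lambda>w. (norm (\<phi> w))^2" 1] phi_sq_le by simp
qed

lemma u_integrals:
 "integrable lborel (\<lambda>w. \<psi> w * cos (w * (x - y)))"
 "integrable lborel (\<lambda>w. \<psi> w * Re (iexp (w * x) * cnj (\<phi> w)))"
 "integrable lborel (\<lambda>w. \<psi> w * (norm (\<phi> w))^2)"
 by (rule weight_integrable[OF w\<psi>, where B=1]; (use Re_phi_le phi_sq_le in simp)?; measurable)+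

lemma Re_ecf: "Re (ecf n X w * cnj (\<phi> w)) = (\<Sum>i<n. Re (iexp (w * X i) * cnj (\<phi> w))) / real n"
 unfolding ecf_def by (simp add: sum_distrib_right sum_divide_distrib del: times_complex.sel)

lemma intB_eq: "intB \<psi> X = (\<Sum>i<n. u1 \<psi> (X i) - u0 \<psi>) / real n"
proof -
 have "\<psi> w * errB X w = (\<Sum>i<n. \<psi> w * Re (iexp (w * X i) * cnj (\<phi> w)) - \<psi> w * (norm (\<phi> w))^2) / real n" for w
  using n2 unfolding errB_def Re_ecf
  by (simp add: sum_subtractf sum_distrib_left right_diff_distrib diff_divide_distrib del: times_complex.sel)
 then have "intB \<psi> X = (LBINT w. (\<Sum>i<n. \<psi> w * Re (iexp (w * X i) * cnj (\<phi> w)) - \<psi> w * (norm (\<phi> w))^2)) / real n"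
  by (simp only: integral_divide_zero)
 also have "(LBINT w. (\<Sum>i<n. \<psi> w * Re (iexp (w * X i) * cnj (\<phi> w)) - \<psi> w * (norm (\<phi> w))^2)) = (\<Sum>i<n. u1 \<psi> (X i) - u0 \<psi>)"
  unfolding u1_def u0_def
  by (simp only: LINT_sum[OF L1_diff[OF u_integrals(2,3)]]
    LINT_diff[OF u_integrals(2,3)])
 finally show ?thesis .
qed

text \<open>In a sum over i \<noteq> j each projection term occurs n - 1 times in either argument.
  This accounts for the factor 2 in \<open>errV\<close> and exhibits a U-statistic with doubly
  centred kernel.\<close>

lemma intV_eq: "intV \<psi> X = (\<Sum>i<n. \<Sum>j\<in>{..<n} - {i}. u \<psi> (X i) (X j) - u1 \<psi> (X i) - u1 \<psi> (X j) + u0 \<psi>) / (real n * (real n - 1))"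
proof -
 let ?r = "\<lambda>w x. Re (iexp (w * x) * cnj (\<phi> w))" and ?p = "\<lambda>w. (norm (\<phi> w))^2" and ?N = "real n * (real n - 1)"
 have N: "?N \<noteq> 0" using n2 by simp
 have card: "(\<Sum>j\<in>{..<n} - {i}. c) = (real n - 1) * c" if "i < n" for i and c :: real
  using that n2 by (simp add: card_Diff_singleton of_nat_diff)
 have s2: "(\<Sum>i<n. \<Sum>j\<in>{..<n} - {i}. g j) = (real n - 1) * (\<Sum>i<n. g i)" for g :: "nat \<Rightarrow> real"
 proof -
  have "(\<Sum>j\<in>{..<n} - {i}. g j) = (\<Sum>j<n. g j) - g i" if "i < n" for i using that by (simp add: sum_diff1)
  then show ?thesis by (simp add: sum_subtractf left_diff_distrib)
 qed
 have e: "errV X w = (\<Sum>i<n. \<Sum>j\<in>{..<n} - {i}. cos (w * (X i - X j)) - ?r w (X i) - ?r w (X j) + ?p w) / ?N" for w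
 proof -
  have "(\<Sum>i<n. \<Sum>j\<in>{..<n} - {i}. cos (w * (X i - X j)) - ?r w (X i) - ?r w (X j) + ?p w) =
   (\<Sum>i<n. \<Sum>j\<in>{..<n} - {i}. cos (w * (X i - X j))) - (\<Sum>i<n. \<Sum>j\<in>{..<n} - {i}. ?r w (X i))
    - (\<Sum>i<n. \<Sum>j\<in>{..<n} - {i}. ?r w (X j)) + (\<Sum>i<n. \<Sum>j\<in>{..<n} - {i}. ?p w)"
   by (simp only: sum.distrib sum_subtractf)
  also have "(\<Sum>i<n. \<Sum>j\<in>{..<n} - {i}. ?r w (X i)) = (real n - 1) * (\<Sum>i<n. ?r w (X i))"
   unfolding sum_distrib_left by (intro sum.cong refl card) simp
  also have "(\<Sum>i<n. \<Sum>j\<in>{..<n} - {i}. ?r w (X j)) = (real n - 1) * (\<Sum>i<n. ?r w (X i))" by (rule s2)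
  also have "(\<Sum>i<n. \<Sum>j\<in>{..<n} - {i}. ?p w) = (\<Sum>i<n. (real n - 1) * ?p w)" by (intro sum.cong refl card) simp
  also have "... = ?N * ?p w" by simp
  finally have A: "(\<Sum>i<n. \<Sum>j\<in>{..<n} - {i}. cos (w * (X i - X j)) - ?r w (X i) - ?r w (X j) + ?p w) =
    (\<Sum>i<n. \<Sum>j\<in>{..<n} - {i}. cos (w * (X i - X j))) - 2 * ((real n - 1) * (\<Sum>i<n. ?r w (X i))) + ?N * ?p w" by linarith
  have cancel: "(a - 2 * ((real n - 1) * b) + ?N * p) / ?N = a / ?N + p - 2 * (b / real n)" for a b p
   using n2 N by (simp add: add_divide_distrib diff_divide_distrib)
  show ?thesis unfolding A cancel unfolding errV_def ustat_def Re_ecf ..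
 qed
 have "\<psi> w * errV X w = (\<Sum>i<n. \<Sum>j\<in>{..<n} - {i}. \<psi> w * cos (w * (X i - X j)) - \<psi> w * ?r w (X i) - \<psi> w * ?r w (X j) + \<psi> w * ?p w) / ?N" for w
  unfolding e by (simp add: sum_distrib_left distrib_left right_diff_distrib del: times_complex.sel)
 then have "intV \<psi> X = (LBINT w. (\<Sum>i<n. \<Sum>j\<in>{..<n} - {i}. \<psi> w * cos (w * (X i - X j)) - \<psi> w * ?r w (X i) - \<psi> w * ?r w (X j) + \<psi> w * ?p w)) / ?N"
  by (simp only: integral_divide_zero)
 also have "(LBINT w. (\<Sum>i<n. \<Sum>j\<in>{..<n} - {i}. \<psi> w * cos (w * (X i - X j)) - \<psi> w * ?r w (X i) - \<psi> w * ?r w (X j) + \<psi> w * ?p w))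
   = (\<Sum>i<n. \<Sum>j\<in>{..<n} - {i}. u \<psi> (X i) (X j) - u1 \<psi> (X i) - u1 \<psi> (X j) + u0 \<psi>)"
 proof -
  note i3 = L1_diff[OF u_integrals(1,2)]
  note i4 = L1_diff[OF i3 u_integrals(2)]
  note i5 = L1_add[OF i4 u_integrals(3)]
  show ?thesis unfolding u_def u1_def u0_def
   by (simp only: LINT_sum i5 L1_sum
     LINT_diff[OF u_integrals(1,2)] LINT_diff[OF i3 u_integrals(2)]
     LINT_add[OF i4 u_integrals(3)])
 qed
 finally show ?thesis .
qed

lemma integral_M_weight_swap:
 assumes [measurable]: "(\<lambda>(y, w). g y w) \<in> borel_measurable (borel \<Otimes>\<^sub>M borel)" and b: "\<And>y w. \<bar>g y w\<bar> \<le> 1"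
 shows "(LINT y|M. LINT w|lborel. \<psi> w * g y w) = (LBINT w. \<psi> w * (LINT y|M. g y w))"
proof -
 interpret pair_sigma_finite M "lborel :: real measure"
  by (intro pair_sigma_finite.intro sigma_finite_lborel M.sigma_finite_measure_axioms)
 have "integrable (M \<Otimes>\<^sub>M lborel) (\<lambda>(y, w). \<psi> w * g y w)"
 proof (rule Fubini_integrable)
  have gi: "integrable lborel (\<lambda>w. \<psi> w * g y w)" for y by (rule weight_integrable[OF w\<psi> _ b]) measurable
  then show "AE x in M. integrable lborel (\<lambda>y. case (x, y) of (y, w) \<Rightarrow> \<psi> w * g y w)" by simp
  have n1: "\<bar>LBINT w. \<bar>\<psi> w * g y w\<bar>\<bar> \<le> 2 * real n * 1" for y
  proof -
   have "weight (\<lambda>w. \<bar>\<psi> w\<bar>)" using w\<psi> by (auto simp: weight_def)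
   from weight_integral_le[OF this, of "\<lambda>w. \<bar>g y w\<bar>" 1] b[of y] show ?thesis by (simp add: abs_mult)
  qed
  show "integrable M (\<lambda>x. LBINT y. norm (case (x, y) of (y, w) \<Rightarrow> \<psi> w * g y w))"
   by (rule M.integrable_bounded[where B="2 * real n * 1"]) (measurable, use n1 in simp)
 qed measurable
 from Fubini_integral[OF this] show ?thesis by simp
qed

lemma mean_u: "(LINT y|M. u \<psi> x y) = u1 \<psi> x"
proof -
 have i: "integrable M (\<lambda>y. iexp (w * y))" for w
  by (rule M.integrable_const_bound[where B=1]) auto
 have "(LINT y|M. cos (w * (x - y))) = Re (iexp (w * x) * cnj (\<phi> w))" for w
 proof -
  have "(LINT y|M. cos (w * (x - y))) = (LINT y|M. Re (iexp (w * x) * cnj (iexp (w * y))))"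
   by (intro LINT_cong refl) (simp add: exp_cnj Re_exp right_diff_distrib flip: exp_add)
  also have "... = Re (LINT y|M. iexp (w * x) * cnj (iexp (w * y)))"
   using i by (intro integral_Re) (simp add: integrable_mult_right)
  also have "(LINT y|M. iexp (w * x) * cnj (iexp (w * y))) = iexp (w * x) * cnj (\<phi> w)"
   unfolding phi_eq by (simp only: integral_mult_right_zero LINT_cnj)
  finally show ?thesis .
 qed
 then show ?thesis unfolding u_def u1_def
  by (subst integral_M_weight_swap) (simp_all del: times_complex.sel)
qed

lemma mean_u1: "(LINT x|M. u1 \<psi> x) = u0 \<psi>"
proof -
 have i: "integrable M (\<lambda>y. iexp (w * y))" for w
  by (rule M.integrable_const_bound[where B=1]) auto
 have "(LINT x|M. Re (iexp (w * x) * cnj (\<phi> w))) = (norm (\<phi> w))^2" for w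
 proof -
  have "(LINT x|M. Re (iexp (w * x) * cnj (\<phi> w))) = Re (LINT x|M. iexp (w * x) * cnj (\<phi> w))"
   using i by (intro integral_Re) (simp add: integrable_mult_left)
  also have "(LINT x|M. iexp (w * x) * cnj (\<phi> w)) = \<phi> w * cnj (\<phi> w)"
   unfolding phi_eq by (simp only: integral_mult_left_zero)
  finally show ?thesis by (simp add: cmod_power2 flip: power2_eq_square)
 qed
 then show ?thesis unfolding u0_def u1_def
  by (subst integral_M_weight_swap) (use Re_phi_le in auto)
qed

text \<open>\<open>u1\<close> is the real part of the transform of \<psi> times the conjugate of
  phi, so the density bound and Plancherel apply. The factor |phi|^2 that survives is the weight of
  the squared bias.\<close>

lemma u1_second_moment: "(LINT x|M. (u1 \<psi> x)^2) \<le> C * (2 * pi * (LBINT w. (\<psi> w)^2 * (norm (\<phi> w))^2))"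
proof -
 let ?g = "\<lambda>w. complex_of_real (\<psi> w) * cnj (\<phi> w)"
 have b: "norm (?g w) \<le> 1" for w using w\<psi> norm_phi_le[of w] by (auto simp: norm_mult weight_def intro!: mult_le_one)
 have z: "?g w = 0" if "\<bar>w\<bar> > real n" for w using that w\<psi> by (auto simp: weight_def)
 have g: "integrable lborel ?g" by (rule integrable_compact_support[OF _ b z]) measurable
 have g2: "integrable lborel (\<lambda>w. (norm (?g w))^2)"
  by (rule integrable_compact_support[where C=1 and r="real n"]) (use b z in "auto simp: power_le_one")
 have u1: "u1 \<psi> x = Re (FT ?g x)" for x
 proof -
  have "u1 \<psi> x = (LBINT w. Re (?g w * iexp (x * w)))"
   unfolding u1_def by (intro LINT_cong refl) (simp add: mult_ac)
  then show ?thesis unfolding FT_def using integral_Re[OF integrable_mult_iexp[OF g]] by simp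
 qed
 have le: "(u1 \<psi> x)^2 \<le> (norm (FT ?g x))^2" for x
  unfolding u1 by (simp add: cmod_power2)
 have i: "integrable lborel (\<lambda>x. (u1 \<psi> x)^2)"
  by (rule L1_bound[OF Plancherel(1)[OF g g2]]) (use le in auto)
 have "(LINT x|M. (u1 \<psi> x)^2) \<le> C * (LBINT x. (u1 \<psi> x)^2)"
  by (rule integral_M_le[OF i]) simp
 also have "... \<le> C * (LBINT x. (norm (FT ?g x))^2)"
 proof (rule mult_left_mono)
  show "(LBINT x. (u1 \<psi> x)^2) \<le> (LBINT x. (norm (FT ?g x))^2)"
   using i Plancherel(1)[OF g g2] le by (rule integral_mono)
 qed (rule C_nonneg)
 finally show ?thesis unfolding Plancherel(2)[OF g g2] by (simp add: norm_mult power_mult_distrib)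
qed

text \<open>As for \<open>u1\<close>, but the function transformed is \<psi> alone and is evaluated
  at a shifted point; no phi enters, whence the flat weight of the degenerate part.\<close>

lemma u_second_moment: "(LINT x|M. (u \<psi> x y)^2) \<le> C * (2 * pi * (LBINT w. (\<psi> w)^2))"
proof -
 let ?g = "\<lambda>w. complex_of_real (\<psi> w)"
 have b: "norm (?g w) \<le> 1" for w using w\<psi> by (auto simp: weight_def)
 have z: "?g w = 0" if "\<bar>w\<bar> > real n" for w using that w\<psi> by (auto simp: weight_def)
 have g: "integrable lborel ?g" by (rule integrable_compact_support[OF _ b z]) measurable
 have g2: "integrable lborel (\<lambda>w. (norm (?g w))^2)"
  by (rule integrable_compact_support[where C=1 and r="real n"]) (use b z in "auto simp: abs_square_le_1")
 have u: "u \<psi> x y = Re (FT ?g (x - y))" for x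
 proof -
  have "u \<psi> x y = (LBINT w. Re (?g w * iexp ((x - y) * w)))"
   unfolding u_def by (intro LINT_cong refl) (simp add: Re_exp mult_ac)
  then show ?thesis unfolding FT_def by (simp only: integral_Re[OF integrable_mult_iexp[OF g]])
 qed
 have le: "(u \<psi> x y)^2 \<le> (norm (FT ?g (- y + 1 * x)))^2" for x
  unfolding u by (simp add: cmod_power2)
 have iF: "integrable lborel (\<lambda>x. (norm (FT ?g (- y + 1 * x)))^2)"
  using lborel_integrable_real_affine[OF Plancherel(1)[OF g g2], of 1 "- y"] by simp
 have [measurable]: "(\<lambda>x. u \<psi> x y) \<in> borel_measurable borel" unfolding u_def by measurable
 have i: "integrable lborel (\<lambda>x. (u \<psi> x y)^2)"
  by (rule L1_bound[OF iF]) (use le in auto)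
 have "(LINT x|M. (u \<psi> x y)^2) \<le> C * (LBINT x. (u \<psi> x y)^2)"
  by (rule integral_M_le[OF i]) simp
 also have "... \<le> C * (LBINT x. (norm (FT ?g (- y + 1 * x)))^2)"
  using C_nonneg i iF le by (intro mult_left_mono integral_mono)
 also have "(LBINT x. (norm (FT ?g (- y + 1 * x)))^2) = (LBINT x. (norm (FT ?g x))^2)"
  using lborel_integral_real_affine[of 1 "\<lambda>x. (norm (FT ?g x))^2" "- y"] by simp
 finally show ?thesis unfolding Plancherel(2)[OF g g2] by simp
qed

lemma intB_measurable[measurable]: "intB \<psi> \<in> borel_measurable P"
 unfolding intB_eq by measurable

lemma intV_measurable[measurable]: "intV \<psi> \<in> borel_measurable P"
 unfolding intV_eq by measurable

lemma int_bounded: "\<bar>intB \<psi> X\<bar> \<le> 2 * real n * 4" "\<bar>intV \<psi> X\<bar> \<le> 2 * real n * 4"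
 using weight_integral_le[OF w\<psi> _ err_bounded(1)] weight_integral_le[OF w\<psi> _ err_bounded(2)] by auto

lemma intB_moments:
 "(LINT X|P. intB \<psi> X) = 0"
 "(LINT X|P. (intB \<psi> X)^2) \<le> 2 * pi * C / real n * (LBINT w. (\<psi> w)^2 * (norm (\<phi> w))^2)"
proof -
 have bd: "\<bar>u1 \<psi> x - u0 \<psi>\<bar> \<le> 4 * real n" for x using u_bounded(2)[of x] u_bounded(3) by linarith
 have iu: "integrable M (u1 \<psi>)" by (rule M.integrable_bounded[OF _ u_bounded(2)]) measurable
 have z: "(LINT x|M. u1 \<psi> x - u0 \<psi>) = 0" using iu by (simp add: mean_u1 M.prob_space)
 note I = iid_sum_moments[of "{..<n}" "\<lambda>_. M" "\<lambda>_ x. u1 \<psi> x - u0 \<psi>" "4 * real n", OF _ prob_space_M _ bd z]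
 show "(LINT X|P. intB \<psi> X) = 0" unfolding intB_eq using I(1) by simp
 have "(LINT X|P. (intB \<psi> X)^2) = (real n * (LINT x|M. (u1 \<psi> x - u0 \<psi>)^2)) / (real n)^2"
  unfolding intB_eq power_divide using I(2) by simp
 also have "... = (LINT x|M. (u1 \<psi> x - u0 \<psi>)^2) / real n" using n2 by (simp add: power2_eq_square)
 also have "... \<le> (C * (2 * pi * (LBINT w. (\<psi> w)^2 * (norm (\<phi> w))^2))) / real n"
  by (intro divide_right_mono order_trans[OF M.centered_sq_le[OF _ u_bounded(2) mean_u1] u1_second_moment]) auto
 finally show "(LINT X|P. (intB \<psi> X)^2) \<le> 2 * pi * C / real n * (LBINT w. (\<psi> w)^2 * (norm (\<phi> w))^2)"
  by (simp add: mult_ac)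
qed

text \<open>Subtracting the projections one argument at a time can only lower the second moment, so
  the bound for \<open>u\<close> carries over to the doubly centred kernel. The variance factor 2 /
  (n (n - 1)) is at most 4 / n^2.\<close>

lemma intV_moments:
 "(LINT X|P. intV \<psi> X) = 0"
 "(LINT X|P. (intV \<psi> X)^2) \<le> 8 * pi * C / (real n)^2 * (LBINT w. (\<psi> w)^2)"
proof -
 define v where "v x y = u \<psi> x y - u1 \<psi> x - u1 \<psi> y + u0 \<psi>" for x y
 have mv[measurable]: "(\<lambda>(x, y). v x y) \<in> borel_measurable (M \<Otimes>\<^sub>M M)" unfolding v_def by measurable
 have bv: "\<bar>v x y\<bar> \<le> 8 * real n" for x y
  unfolding v_def using u_bounded(1)[of x y] u_bounded(2)[of x] u_bounded(2)[of y] u_bounded(3) by linarith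
 have us: "u \<psi> x y = u \<psi> y x" for x y
 proof -
  have "cos (w * (x - y)) = cos (w * (y - x))" for w
   using cos_minus[of "w * (x - y)"] by (simp add: algebra_simps)
  then show ?thesis by (simp add: u_def)
 qed
 have sym: "v x y = v y x" for x y unfolding v_def us[of x] by simp
 have iu: "integrable M (u \<psi> x)" "integrable M (\<lambda>x. u \<psi> x y)" "integrable M (u1 \<psi>)" for x y
 proof -
  have [measurable]: "u \<psi> x \<in> borel_measurable borel" "(\<lambda>x. u \<psi> x y) \<in> borel_measurable borel" unfolding u_def[abs_def] by measurable
  show "integrable M (u \<psi> x)" by (rule M.integrable_bounded[OF _ u_bounded(1)]) measurable
  show "integrable M (\<lambda>x. u \<psi> x y)" by (rule M.integrable_bounded[OF _ u_bounded(1)]) measurable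
  show "integrable M (u1 \<psi>)" by (rule M.integrable_bounded[OF _ u_bounded(2)]) measurable
 qed
 have mean: "(LINT y|M. v x y) = 0" for x
  unfolding v_def using iu by (simp add: mean_u mean_u1 M.prob_space)
 note U = degenerate_ustat_moments[OF prob_space_M mv bv sym mean, of n]
 have eq: "intV \<psi> X = (\<Sum>i<n. \<Sum>j\<in>{..<n} - {i}. v (X i) (X j)) / (real n * (real n - 1))" for X
  unfolding intV_eq v_def ..
 show "(LINT X|P. intV \<psi> X) = 0" unfolding eq using U(1) by simp
 define q where "q = C * (2 * pi * (LBINT w. (\<psi> w)^2))"
 interpret MM: pair_prob_space M M ..
 let ?g = "\<lambda>x y. u \<psi> x y - u1 \<psi> x"
 have bg: "\<bar>?g x y\<bar> \<le> 4 * real n" for x y using u_bounded(1)[of x y] u_bounded(2)[of x] by linarith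
 have mg[measurable]: "(\<lambda>(x, y). ?g x y) \<in> borel_measurable (M \<Otimes>\<^sub>M M)" by measurable
 have mg1[measurable]: "(\<lambda>y. ?g x y) \<in> borel_measurable M" "(\<lambda>x. ?g x y) \<in> borel_measurable M" "(\<lambda>x. v x y) \<in> borel_measurable M"
   "u \<psi> x \<in> borel_measurable M" for x y
  unfolding v_def u_def[abs_def] by measurable
 have "(LINT y|M. LINT x|M. (v x y)^2) \<le> (LINT y|M. LINT x|M. (?g x y)^2)"
 proof (rule integral_mono)
  show "integrable M (\<lambda>y. LINT x|M. (v x y)^2)"
   by (rule MM.integrable_snd, rule MM.integrable_bounded[where B="(8 * real n)^2"])
     (use power_mono[OF bv, of _ _ 2] in auto)
  show "integrable M (\<lambda>y. LINT x|M. (?g x y)^2)"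
   by (rule MM.integrable_snd, rule MM.integrable_bounded[where B="(4 * real n)^2"])
     (use power_mono[OF bg, of _ _ 2] in auto)
  fix y
  have "(LINT x|M. ?g x y) = u1 \<psi> y - u0 \<psi>"
   using iu mean_u[of y] by (simp add: mean_u1 us[of _ y])
  from M.centered_sq_le[OF mg1(2) bg this]
  show "(LINT x|M. (v x y)^2) \<le> (LINT x|M. (?g x y)^2)"
   unfolding v_def by (simp add: algebra_simps)
 qed
 also have "... = (LINT x|M. LINT y|M. (?g x y)^2)"
  by (rule MM.Fubini_integral, rule MM.integrable_bounded[where B="(4 * real n)^2"])
    (use power_mono[OF bg, of _ _ 2] in auto)
 also have "... \<le> (LINT x|M. q)"
 proof (rule integral_mono)
  show "integrable M (\<lambda>x. LINT y|M. (?g x y)^2)"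
   by (rule MM.integrable_fst, rule MM.integrable_bounded[where B="(4 * real n)^2"])
     (use power_mono[OF bg, of _ _ 2] in auto)
  fix x
  have "(LINT y|M. (?g x y)^2) \<le> (LINT y|M. (u \<psi> x y)^2)"
   by (rule M.centered_sq_le[OF mg1(4) u_bounded(1) mean_u])
  also have "... \<le> q" unfolding us[of x] q_def by (rule u_second_moment)
  finally show "(LINT y|M. (?g x y)^2) \<le> q" .
 qed simp
 finally have vq: "(LINT y|M. LINT x|M. (v x y)^2) \<le> q" by (simp add: M.prob_space)
 have q0: "q \<ge> 0" unfolding q_def using C_nonneg by (intro mult_nonneg_nonneg) auto
 have n1: "real n / 2 \<le> real n - 1" "real n - 1 > 0" using n2 by auto
 have "(LINT X|P. (intV \<psi> X)^2) = (2 * real n * (real n - 1) * (LINT y|M. LINT x|M. (v x y)^2)) / (real n * (real n - 1))^2"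
  unfolding eq power_divide using U(2) by simp
 also have "... = 2 * (LINT y|M. LINT x|M. (v x y)^2) / (real n * (real n - 1))"
  using n1 n2 by (simp add: power2_eq_square)
 also have "... \<le> 2 * q / (real n * (real n / 2))"
  using vq n1 n2 q0 by (intro frac_le mult_left_mono mult_pos_pos) auto
 also have "... = 8 * pi * C / (real n)^2 * (LBINT w. (\<psi> w)^2)"
  unfolding q_def using n2 by (simp add: power2_eq_square mult_ac)
 finally show "(LINT X|P. (intV \<psi> X)^2) \<le> 8 * pi * C / (real n)^2 * (LBINT w. (\<psi> w)^2)" .
qed

end

end

section \<open>Chaining bounds for the two error processes\<close>

context sample_density
begin

lemma weight_indicator: "A \<in> sets borel \<Longrightarrow> A \<subseteq> {- real n..real n} \<Longrightarrow> weight (indicator A)"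
 by (force simp: weight_def indicator_def)

text \<open>On the cells g lies between consecutive entries of a, so it is replaced by a step
  function, to which \<open>monotone_sum_dyadic\<close> applies with the \<omega>-masses of the
  cells. The order of quantifiers is essential: R is fixed before g, so the bound may be used for a
  spectrum that depends on the sample.\<close>

lemma chaining:
 fixes Y :: "(nat \<Rightarrow> real) \<Rightarrow> real \<Rightarrow> real" and \<omega> :: "real \<Rightarrow> real" and D :: "nat \<Rightarrow> real set"
 assumes Y: "\<And>X. Y X \<in> borel_measurable borel" "\<And>X w. \<bar>Y X w\<bar> \<le> 4"
  and Ym: "\<And>\<psi>. weight \<psi> \<Longrightarrow> (\<lambda>X. LBINT w. \<psi> w * Y X w) \<in> borel_measurable P"
  and Y2: "\<And>\<psi>. weight \<psi> \<Longrightarrow> (LINT X|P. (LBINT w. \<psi> w * Y X w)^2) \<le> c * (LBINT w. (\<psi> w)^2 * \<omega> w)"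
  and c: "c \<ge> 0" and \<omega>[measurable]: "\<omega> \<in> borel_measurable borel"
  and \<omega>b: "\<And>w. \<omega>0 \<le> \<omega> w" "\<And>w. \<omega> w \<le> \<omega>1" "\<omega>0 > 0"
  and D[measurable]: "\<And>k. D k \<in> sets borel" and Dd: "disjoint_family D" and Dn: "\<And>k. D k \<subseteq> {- real n..real n}"
  and DN: "\<And>k. k \<ge> 2 ^ m \<Longrightarrow> D k = {}" and D\<Delta>: "\<And>k. k < 2 ^ m \<Longrightarrow> measure lborel (D k) = 2 * \<Delta>" and \<Delta>: "\<Delta> > 0"
 shows "\<exists>R. R \<in> borel_measurable P \<and> integrable P R \<and> (\<forall>X. 0 \<le> R X) \<and>
  (LINT X|P. R X) \<le> c * (real (Suc m) * (1 + ln (\<omega>1 / \<omega>0 * 2 ^ m)))^2 \<and>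
  (\<forall>X g a. g \<in> borel_measurable borel \<longrightarrow> (\<forall>w. 0 \<le> g w \<and> g w \<le> 1) \<longrightarrow> (\<forall>k. a (Suc k) \<le> a k \<and> 0 \<le> a k) \<longrightarrow>
    (\<forall>k w. w \<in> D k \<longrightarrow> a k \<le> g w \<and> g w \<le> (if k = 0 then 1 else a (k - 1))) \<longrightarrow>
    \<bar>LBINT w. indicator (\<Union>k. D k) w * g w * Y X w\<bar> \<le>
     sqrt ((LBINT w. indicator (\<Union>k. D k) w * (g w)^2 * \<omega> w) * R X) + 8 * \<Delta>)"
proof -
 note [measurable] = Y(1)
 let ?N = "2 ^ m :: nat"
 have \<omega>1: "\<omega>1 \<ge> \<omega>0" "\<omega>1 > 0" using \<omega>b(1)[of 0] \<omega>b(2)[of 0] \<omega>b(3) by linarith+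
 have abs\<omega>: "\<bar>\<omega> w\<bar> \<le> \<omega>1" for w using \<omega>b(1)[of w] \<omega>b(2)[of w] \<omega>b(3) by linarith
 have wD: "weight (indicator (D k))" for k by (rule weight_indicator[OF D Dn])
 \<comment> \<open>The value 1 beyond the last cell only keeps all masses positive.\<close>
 define \<mu> where "\<mu> k = (if k < ?N then LBINT w. indicator (D k) w * \<omega> w else 1)" for k
 define y where "y k X = (LBINT w. indicator (D k) w * Y X w)" for k X
 have iD: "integrable lborel (indicator (D k) :: real \<Rightarrow> real)" for k
  using weight_integrable[OF wD, of "\<lambda>_. 1" 1 k] by simp
 have iD\<omega>: "integrable lborel (\<lambda>w. indicator (D k) w * \<omega> w)" for k
  by (rule weight_integrable[OF wD \<omega> abs\<omega>])
 have iDY: "integrable lborel (\<lambda>w. indicator (D k) w * Y X w)" for k X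
  by (rule weight_integrable[OF wD Y])
 have \<mu>b: "\<omega>0 * (2 * \<Delta>) \<le> \<mu> k" "\<mu> k \<le> \<omega>1 * (2 * \<Delta>)" if "k < ?N" for k
 proof -
  have i: "(LBINT w. indicator (D k) w :: real) = 2 * \<Delta>" using D\<Delta>[OF that] by simp
  have "(LBINT w. indicator (D k) w * \<omega>0) \<le> (LBINT w. indicator (D k) w * \<omega> w)"
   using iD iD\<omega> \<omega>b by (intro integral_mono) (auto intro: mult_left_mono)
  then show "\<omega>0 * (2 * \<Delta>) \<le> \<mu> k" using that i by (simp add: \<mu>_def mult.commute)
  have "(LBINT w. indicator (D k) w * \<omega> w) \<le> (LBINT w. indicator (D k) w * \<omega>1)"
   using iD iD\<omega> \<omega>b by (intro integral_mono) (auto intro: mult_left_mono)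
  then show "\<mu> k \<le> \<omega>1 * (2 * \<Delta>)" using that i by (simp add: \<mu>_def mult.commute)
 qed
 have \<mu>pos: "\<mu> k > 0" for k
 proof (cases "k < ?N")
  case True
  then show ?thesis using less_le_trans[OF _ \<mu>b(1)[OF True], of 0] \<omega>b(3) \<Delta> by simp
 qed (simp add: \<mu>_def)
 have ind: "indicator (\<Union>k\<in>I. D k) w = (\<Sum>k\<in>I. indicator (D k) w :: real)" if "finite I" for I w
  by (rule indicator_UN_disjoint[OF that]) (use Dd in "auto simp: disjoint_family_on_def")
 have wU: "weight (indicator (\<Union>k\<in>I. D k))" if "finite I" for I
  by (rule weight_indicator) (use that Dn in auto)
 have block: "(\<Sum>k\<in>I. y k X) = (LBINT w. indicator (\<Union>k\<in>I. D k) w * Y X w)" if "finite I" for I X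
  unfolding y_def ind[OF that] sum_distrib_right using iDY by (simp add: LINT_sum)
 have sqI: "integrable P (\<lambda>X. (\<Sum>k\<in>I. y k X)^2)" if "finite I" for I
 proof -
  have "\<bar>LBINT w. indicator (\<Union>k\<in>I. D k) w * Y X w\<bar> \<le> 2 * real n * 4" for X
   by (rule weight_integral_le[OF wU[OF that] Y])
  from power_mono[OF this, of _ 2] show ?thesis
   unfolding block[OF that]
   by (intro S.integrable_bounded[where B="(2 * real n * 4)^2"] borel_measurable_power Ym wU[OF that]) auto
 qed
 have le: "(LINT X|P. (\<Sum>k\<in>{s..<t}. y k X)^2) \<le> c * (\<Sum>k\<in>{s..<t}. \<mu> k)" if "t \<le> ?N" for s t
 proof -
  have "(LINT X|P. (\<Sum>k\<in>{s..<t}. y k X)^2) \<le> c * (LBINT w. (indicator (\<Union>k\<in>{s..<t}. D k) w)^2 * \<omega> w)"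
   unfolding block[OF finite_atLeastLessThan] by (rule Y2[OF wU]) simp
  also have "(LBINT w. (indicator (\<Union>k\<in>{s..<t}. D k) w)^2 * \<omega> w) = (LBINT w. (\<Sum>k\<in>{s..<t}. indicator (D k) w * \<omega> w))"
  proof (intro LINT_cong refl)
   have sq: "(indicator A w)^2 = (indicator A w :: real)" for A and w :: real by (simp add: indicator_def)
   show "(indicator (\<Union>k\<in>{s..<t}. D k) w)^2 * \<omega> w = (\<Sum>k\<in>{s..<t}. indicator (D k) w * \<omega> w)" for w
    unfolding sq unfolding ind[OF finite_atLeastLessThan] sum_distrib_right ..
  qed
  also have "... = (\<Sum>k\<in>{s..<t}. \<mu> k)"
   using that iD\<omega> by (subst LINT_sum) (auto simp: \<mu>_def intro!: sum.cong)
  finally show ?thesis .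
 qed
 define E where "E X = (\<Sum>j\<le>m. \<Sum>l<2 ^ (m - j). (\<Sum>k\<in>{l * 2 ^ j..<Suc l * 2 ^ j}. y k X)^2 / (\<Sum>k<Suc l * 2 ^ j. \<mu> k))" for X
 define \<Lambda> where "\<Lambda> = 1 + ln ((\<Sum>k<?N. \<mu> k) / \<mu> 0)"
 define \<Lambda>' where "\<Lambda>' = 1 + ln (\<omega>1 / \<omega>0 * 2 ^ m)"
 have E0: "E X \<ge> 0" for X unfolding E_def using \<mu>pos by (intro sum_nonneg divide_nonneg_nonneg) (auto intro: less_imp_le)
 have EE: "(LINT X|P. E X) \<le> c * real (Suc m) * \<Lambda>"
  unfolding E_def \<Lambda>_def by (rule dyadic_energy_expectation[OF \<mu>pos c sqI le]) auto
 have \<mu>0: "\<mu> 0 \<le> (\<Sum>k<?N. \<mu> k)" using \<mu>pos by (intro member_le_sum) (auto intro: less_imp_le)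
 then have \<Lambda>0: "\<Lambda> \<ge> 1" unfolding \<Lambda>_def using \<mu>pos[of 0] by simp
 have \<Lambda>\<Lambda>': "\<Lambda> \<le> \<Lambda>'"
 proof -
  have "(\<Sum>k<?N. \<mu> k) \<le> (\<Sum>k<?N. \<omega>1 * (2 * \<Delta>))" by (intro sum_mono \<mu>b) auto
  then have "(\<Sum>k<?N. \<mu> k) / \<mu> 0 \<le> (2 ^ m * (\<omega>1 * (2 * \<Delta>))) / (\<omega>0 * (2 * \<Delta>))"
   using \<mu>b(1)[of 0] \<omega>b(3) \<omega>1 \<Delta> \<mu>pos by (intro frac_le) (auto intro!: sum_nonneg less_imp_le[OF \<mu>pos])
  also have "... = \<omega>1 / \<omega>0 * 2 ^ m" using \<Delta> by simp
  finally show ?thesis unfolding \<Lambda>_def \<Lambda>'_def using \<mu>pos[of 0] \<mu>0 by (intro add_left_mono ln_mono) (auto intro: less_le_trans)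
 qed
 define R where "R X = \<Lambda> * (real (Suc m) * E X)" for X
 have ym[measurable]: "y k \<in> borel_measurable P" for k unfolding y_def[abs_def] by (rule Ym[OF wD])
 have iE: "integrable P E" unfolding E_def[abs_def] using sqI by (intro L1_sum integrable_divide) auto
 show ?thesis
 proof (intro exI[of _ R] conjI allI impI)
  show "R \<in> borel_measurable P" "integrable P R" unfolding R_def[abs_def] using iE by auto
  show "0 \<le> R X" for X unfolding R_def using \<Lambda>0 E0[of X] by (intro mult_nonneg_nonneg) auto
  have "(LINT X|P. R X) = \<Lambda> * (real (Suc m) * (LINT X|P. E X))" unfolding R_def by simp
  also have "... \<le> \<Lambda> * (real (Suc m) * (c * real (Suc m) * \<Lambda>))" using \<Lambda>0 EE by (intro mult_left_mono) auto
  also have "... = c * (real (Suc m) * \<Lambda>)^2" by (simp add: power2_eq_square)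
  also have "... \<le> c * (real (Suc m) * \<Lambda>')^2" using c \<Lambda>0 \<Lambda>\<Lambda>' by (intro mult_left_mono power_mono mult_left_mono) auto
  finally show "(LINT X|P. R X) \<le> c * (real (Suc m) * (1 + ln (\<omega>1 / \<omega>0 * 2 ^ m)))^2" unfolding \<Lambda>'_def .
  fix X g and a :: "nat \<Rightarrow> real"
  assume g[measurable]: "g \<in> borel_measurable borel" and g01: "\<forall>w. 0 \<le> g w \<and> g w \<le> 1"
   and a: "\<forall>k. a (Suc k) \<le> a k \<and> 0 \<le> a k"
   and ag: "\<forall>k w. w \<in> D k \<longrightarrow> a k \<le> g w \<and> g w \<le> (if k = 0 then 1 else a (k - 1))"
  let ?U = "\<Union>k. D k"
  have U: "?U = (\<Union>k<?N. D k)"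
  proof -
   have "D k \<subseteq> (\<Union>k<?N. D k)" for k using DN[of k] by (cases "k < ?N") auto
   then show ?thesis by auto
  qed
  \<comment> \<open>The lower value on the preceding cell bounds g from above on this one; on the
    first cell the bound is 1. The differences b k - a k telescope to at most 1.\<close>
  define b where "b k = (if k = 0 then 1 else a (k - 1))" for k
  have gY: "\<bar>g w * Y X w\<bar> \<le> 4" for w
   using g01 Y(2)[of X w] mult_mono[of "\<bar>g w\<bar>" 1 "\<bar>Y X w\<bar>" 4] by (simp add: abs_mult)
  have igY: "integrable lborel (\<lambda>w. indicator (D k) w * (g w * Y X w))" for k
   by (rule weight_integrable[OF wD _ gY]) measurable
  have ig\<omega>: "integrable lborel (\<lambda>w. indicator (D k) w * ((g w)^2 * \<omega> w))" for k
  proof (rule weight_integrable[OF wD, where B="1 * \<omega>1"])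
   show "\<bar>(g w)\<^sup>2 * \<omega> w\<bar> \<le> 1 * \<omega>1" for w
    unfolding abs_mult using g01 abs\<omega>[of w] by (intro mult_mono) (auto simp: power_le_one)
  qed measurable
  have s1: "(LBINT w. indicator ?U w * g w * Y X w) = (\<Sum>k<?N. LBINT w. indicator (D k) w * (g w * Y X w))"
   unfolding U ind[OF finite_lessThan] sum_distrib_right mult.assoc
   by (simp only: LINT_sum[OF igY])
  have s2: "(LBINT w. indicator ?U w * (g w)^2 * \<omega> w) = (\<Sum>k<?N. LBINT w. indicator (D k) w * ((g w)^2 * \<omega> w))"
   unfolding U ind[OF finite_lessThan] sum_distrib_right mult.assoc
   by (simp only: LINT_sum[OF ig\<omega>])
  \<comment> \<open>The factor 8 \<Delta> is the bound 4 on |Y| times the measure 2 \<Delta> of a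
    cell.\<close>
  have disc: "\<bar>(LBINT w. indicator (D k) w * (g w * Y X w)) - a k * y k X\<bar> \<le> (b k - a k) * (8 * \<Delta>)" if k: "k < ?N" for k
  proof -
   define F where "F w = indicator (D k) w * (g w * Y X w) - a k * (indicator (D k) w * Y X w)" for w
   have iF: "integrable lborel F"
    unfolding F_def by (intro L1_diff integrable_mult_right igY iDY)
   have Fle: "\<bar>F w\<bar> \<le> (b k - a k) * 4 * indicator (D k) w" for w
   proof (cases "w \<in> D k")
    case True
    then have "a k \<le> g w" "g w \<le> b k" using ag unfolding b_def by blast+
    then have "\<bar>g w - a k\<bar> * \<bar>Y X w\<bar> \<le> (b k - a k) * 4"
     using Y(2)[of X w] by (intro mult_mono) auto
    moreover have "F w = (g w - a k) * Y X w"
     using True by (simp add: F_def left_diff_distrib)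
    ultimately show ?thesis using True by (simp add: abs_mult)
   qed (simp add: F_def)
   have "(LBINT w. indicator (D k) w * (g w * Y X w)) - a k * y k X = (LBINT w. F w)"
    unfolding F_def y_def
    by (subst LINT_diff) (intro igY integrable_mult_right iDY | simp)+
   also have "\<bar>...\<bar> \<le> (LBINT w. \<bar>F w\<bar>)"
    using integral_abs_bound[of lborel F] .
   also have "... \<le> (LBINT w. (b k - a k) * 4 * indicator (D k) w)"
    by (intro integral_mono Fle integrable_abs iF integrable_mult_right iD)
   also have "... = (b k - a k) * (8 * \<Delta>)" using D\<Delta>[OF k] by simp
   finally show ?thesis .
  qed
  have tel: "(\<Sum>k<K. b k - a k) = (if K = 0 then 0 else 1 - a (K - 1))" for K
   by (induction K) (auto simp: b_def)
  have "\<bar>(LBINT w. indicator ?U w * g w * Y X w) - (\<Sum>k<?N. a k * y k X)\<bar> \<le> (\<Sum>k<?N. (b k - a k) * (8 * \<Delta>))"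
   unfolding s1 sum_subtractf[symmetric] by (rule order_trans[OF sum_abs sum_mono]) (use disc in auto)
  also have "... = (1 - a (?N - 1)) * (8 * \<Delta>)" unfolding sum_distrib_right[symmetric] tel by simp
  also have "... \<le> 1 * (8 * \<Delta>)" using a \<Delta> by (intro mult_right_mono) auto
  finally have d1: "\<bar>(LBINT w. indicator ?U w * g w * Y X w) - (\<Sum>k<?N. a k * y k X)\<bar> \<le> 8 * \<Delta>" by simp
  have "(\<Sum>k<?N. a k * y k X)^2 \<le> (\<Sum>k<?N. (a k)^2 * \<mu> k) * R X"
   unfolding R_def \<Lambda>_def E_def using a by (intro monotone_sum_dyadic \<mu>pos) auto
  also have "... \<le> (LBINT w. indicator ?U w * (g w)^2 * \<omega> w) * R X"
  proof (rule mult_right_mono)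
   show "(\<Sum>k<?N. (a k)^2 * \<mu> k) \<le> (LBINT w. indicator ?U w * (g w)^2 * \<omega> w)"
    unfolding s2
   proof (intro sum_mono)
    fix k assume "k \<in> {..<?N}"
    then have "(a k)^2 * \<mu> k = (LBINT w. (a k)^2 * (indicator (D k) w * \<omega> w))" by (simp add: \<mu>_def)
    also have "... \<le> (LBINT w. indicator (D k) w * ((g w)^2 * \<omega> w))"
    proof (intro integral_mono)
     show "(a k)^2 * (indicator (D k) w * \<omega> w) \<le> indicator (D k) w * ((g w)^2 * \<omega> w)" for w
     proof (cases "w \<in> D k")
      case True
      then have "(a k)^2 * \<omega> w \<le> (g w)^2 * \<omega> w"
       using ag a \<omega>b(1)[of w] \<omega>b(3) by (intro mult_right_mono power_mono) auto
      then show ?thesis using True by simp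
     qed simp
    qed (use iD\<omega> ig\<omega> in auto)
    finally show "(a k)^2 * \<mu> k \<le> (LBINT w. indicator (D k) w * ((g w)^2 * \<omega> w))" .
   qed
   show "0 \<le> R X" unfolding R_def using \<Lambda>0 E0[of X] by (intro mult_nonneg_nonneg) auto
  qed
  finally have "\<bar>\<Sum>k<?N. a k * y k X\<bar> \<le> sqrt ((LBINT w. indicator ?U w * (g w)^2 * \<omega> w) * R X)"
   by (rule real_le_rsqrt[of "\<bar>_\<bar>", unfolded power2_abs])
  then show "\<bar>LBINT w. indicator ?U w * g w * Y X w\<bar> \<le> sqrt ((LBINT w. indicator ?U w * (g w)^2 * \<omega> w) * R X) + 8 * \<Delta>"
   using d1 by linarith
 qed
qed

end

definition shell :: "real \<Rightarrow> nat \<Rightarrow> real set" where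
 "shell \<Delta> k = {w. real k * \<Delta> \<le> \<bar>w\<bar> \<and> \<bar>w\<bar> < real (Suc k) * \<Delta>}"

lemma shell_measurable[measurable]: "shell \<Delta> k \<in> sets borel"
 unfolding shell_def by measurable

lemma measure_shell: "\<Delta> > 0 \<Longrightarrow> measure lborel (shell \<Delta> k) = 2 * \<Delta>"
proof -
 assume \<Delta>: "\<Delta> > 0"
 let ?a = "real k * \<Delta>" and ?b = "real (Suc k) * \<Delta>"
 have "shell \<Delta> k = {- ?b<..<?b} - {- ?a<..<?a}" by (auto simp: shell_def)
 moreover have "measure lborel ({- ?b<..<?b} - {- ?a<..<?a}) = measure lborel {- ?b<..<?b} - measure lborel {- ?a<..<?a}"
  using \<Delta> by (intro measure_Diff) (auto simp: algebra_simps intro: less_imp_le)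
 ultimately show ?thesis using \<Delta> by (simp add: algebra_simps)
qed

lemma shell_index: "\<Delta> > 0 \<Longrightarrow> w \<in> shell \<Delta> k \<longleftrightarrow> k = nat \<lfloor>\<bar>w\<bar> / \<Delta>\<rfloor>"
proof -
 assume \<Delta>: "\<Delta> > 0"
 have "w \<in> shell \<Delta> k \<longleftrightarrow> real k \<le> \<bar>w\<bar> / \<Delta> \<and> \<bar>w\<bar> / \<Delta> < real k + 1"
  using \<Delta> by (simp add: shell_def pos_le_divide_eq pos_divide_less_eq add.commute)
 also have "... \<longleftrightarrow> \<lfloor>\<bar>w\<bar> / \<Delta>\<rfloor> = int k" by (auto simp: floor_eq_iff)
 also have "... \<longleftrightarrow> k = nat \<lfloor>\<bar>w\<bar> / \<Delta>\<rfloor>" using \<Delta> by (auto simp: nat_eq_iff)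
 finally show ?thesis .
qed

lemma shell_Union:
 assumes \<Delta>: "\<Delta> > 0"
 shows "(\<Union>k<N. shell \<Delta> k) = {w. \<bar>w\<bar> < real N * \<Delta>}"
proof -
 have *: "nat \<lfloor>\<bar>w\<bar> / \<Delta>\<rfloor> < N \<longleftrightarrow> \<bar>w\<bar> < real N * \<Delta>" for w
 proof -
  have "nat \<lfloor>\<bar>w\<bar> / \<Delta>\<rfloor> < N \<longleftrightarrow> \<lfloor>\<bar>w\<bar> / \<Delta>\<rfloor> < int N" using \<Delta> by (auto simp: nat_less_iff)
  also have "... \<longleftrightarrow> \<bar>w\<bar> < real N * \<Delta>" using \<Delta> by (simp add: floor_less_iff pos_divide_less_eq)
  finally show ?thesis .
 qed
 show ?thesis
 proof (rule set_eqI)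
  fix w show "w \<in> (\<Union>k<N. shell \<Delta> k) \<longleftrightarrow> w \<in> {w. \<bar>w\<bar> < real N * \<Delta>}"
   unfolding UN_iff shell_index[OF \<Delta>] mem_Collect_eq *[symmetric] lessThan_iff Bex_def by blast
 qed
qed

text \<open>The n diagonal pairs contribute 1/n. In the criterion this becomes the variance term of
  \<open>D\<close>.\<close>

lemma norm_ecf_sq: "n > 0 \<Longrightarrow> (norm (ecf n X w))\<^sup>2 = 1 / real n + (1 - 1 / real n) * ustat n X w"
proof -
 assume n: "n > 0"
 let ?N = "real n * (real n - 1)"
 have "(norm (\<Sum>i<n. iexp (w * X i)))^2 = Re ((\<Sum>i<n. iexp (w * X i)) * cnj (\<Sum>i<n. iexp (w * X i)))"
  unfolding complex_norm_square[symmetric] by simp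
 also have "... = (\<Sum>i<n. \<Sum>j<n. Re (iexp (w * X i) * cnj (iexp (w * X j))))"
  by (simp add: sum_product del: times_complex.sel)
 also have "... = (\<Sum>i<n. \<Sum>j<n. cos (w * (X i - X j)))"
  by (simp add: Re_exp exp_cnj right_diff_distrib flip: exp_add)
 also have "... = (\<Sum>i<n. 1 + (\<Sum>j\<in>{..<n} - {i}. cos (w * (X i - X j))))"
  by (intro sum.cong refl) (subst sum.remove[of _ "_::nat"], auto)
 also have "... = real n + (\<Sum>i<n. \<Sum>j\<in>{..<n} - {i}. cos (w * (X i - X j)))" by (simp add: sum.distrib)
 finally have e: "(norm (\<Sum>i<n. iexp (w * X i)))^2 = real n + (\<Sum>i<n. \<Sum>j\<in>{..<n} - {i}. cos (w * (X i - X j)))" .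
 show ?thesis
 proof (cases "n = 1")
  case True
  then show ?thesis using e by (simp add: ecf_def)
 next
  case False
  then have "real n - 1 \<noteq> 0" using n by simp
  then show ?thesis
   unfolding ecf_def ustat_def norm_divide power_divide e using n by (simp add: field_simps power2_eq_square)
 qed
qed

text \<open>Here L is the loss, D the risk proxy and cr the criterion of the minimizer; T bounds cr
  plus the energy and R is the chaining variable. The errors G1, G2 belong to 1 - h and its square,
  V1, V2 to h and its square. As they are bounded through D itself, D is first bounded crudely by
  absorbing half of it, and this enters the sharp bound for L with the small factor \<epsilon>. The
  term b stays linear because its mean is zero.\<close>

lemma oracle_inequality_algebra:
 fixes L D T R r s \<epsilon> :: real
 assumes L: "L = cr + \<Phi> + 2 * (b - G1) + 2 * V1"
  and cr: "cr = D - \<Phi> - e0 + 2 * c * (b - 2 * G1 + G2) - 4 * (b - G1) + c * V2 - 2 * V1"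
  and T: "cr + \<Phi> \<le> T" and c: "0 \<le> c" "c \<le> 1" and D: "0 \<le> D" and R: "0 \<le> R" and s: "0 \<le> s"
  and b: "\<bar>G1\<bar> \<le> sqrt ((D + s) * R) + r" "\<bar>G2\<bar> \<le> sqrt ((D + s) * R) + r"
   "\<bar>V1\<bar> \<le> sqrt ((D + s) * R) + r" "\<bar>V2\<bar> \<le> sqrt ((D + s) * R) + r"
  and \<epsilon>: "\<epsilon> > 0"
 shows "L \<le> (1 + 2 * \<epsilon>) * T + (2 + \<epsilon> * (8 - 4 * c)) * b + 4 * r + \<epsilon> * (2 * e0 + 18 * r + 2 * s + 81 * R) + 4 / \<epsilon> * R"
proof -
 define q where "q = sqrt ((D + s) * R)"
 \<comment> \<open>AM-GM with a free parameter t: used with t = 1/2 for the crude bound and with t =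
   \<epsilon> for the sharp one.\<close>
 have am: "k * q \<le> t * (D + s) + k\<^sup>2 / (4 * t) * R" if t: "t > 0" for k t
 proof -
  have q: "q = sqrt (D + s) * sqrt R" by (simp add: q_def real_sqrt_mult)
  have "0 \<le> (2 * t * sqrt (D + s) - k * sqrt R)^2 / (4 * t)" using t by simp
  also have "... = t * (D + s) - k * q + k\<^sup>2 / (4 * t) * R"
   using t D s R by (simp add: q power2_diff power_mult_distrib) (simp add: field_simps power2_eq_square)
  finally show ?thesis by simp
 qed
 have kG: "k * G \<le> K * \<bar>G\<bar>" if "\<bar>k\<bar> \<le> K" for k G K :: real
  using mult_right_mono[OF that abs_ge_zero[of G]] abs_ge_self[of "k * G"] by (simp add: abs_mult)
 have "(4 * c - 4) * G1 \<le> 4 * \<bar>G1\<bar>" "- (2 * c) * G2 \<le> 2 * \<bar>G2\<bar>" "- c * V2 \<le> 1 * \<bar>V2\<bar>"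
  using c by (intro kG; simp)+
 moreover have "D = cr + \<Phi> + e0 + (4 - 2 * c) * b + (4 * c - 4) * G1 + (- (2 * c) * G2) + (- c * V2) + 2 * V1"
  unfolding cr by (simp add: algebra_simps)
 \<comment> \<open>The coefficient 9 is 4 + 2 + 1 + 2, from G1, G2, V2 and V1.\<close>
 ultimately have "D \<le> T + e0 + (4 - 2 * c) * b + 9 * q + 9 * r"
  using b T unfolding q_def by linarith
 moreover have "9 * q \<le> (D + s) / 2 + 81 / 2 * R" using am[of "1/2" 9] by simp
 moreover have "D \<le> 2 * T + 2 * e0 + 2 * Z + 18 * r + s + 81 * R"
  if "D \<le> T + e0 + Z + 9 * q + 9 * r" "9 * q \<le> (D + s) / 2 + 81 / 2 * R" for Z
  using that by (simp add: field_simps)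
 ultimately have D2: "D \<le> 2 * T + 2 * e0 + 2 * ((4 - 2 * c) * b) + 18 * r + s + 81 * R" by blast
 have "L \<le> T + 2 * b + 4 * q + 4 * r" proof -
  have "- G1 \<le> q + r" "V1 \<le> q + r" using b(1,3) by (auto simp: q_def)
  then show ?thesis using T unfolding L by (simp add: algebra_simps)
 qed
 also have "4 * q \<le> \<epsilon> * (D + s) + 4 / \<epsilon> * R" using am[OF \<epsilon>, of 4] \<epsilon> by simp
 also have "\<epsilon> * (D + s) \<le> \<epsilon> * (2 * T + 2 * e0 + 2 * ((4 - 2 * c) * b) + 18 * r + s + 81 * R + s)"
  using D2 \<epsilon> by (intro mult_left_mono) auto
 finally show ?thesis by (simp add: algebra_simps)
qed

context sample_density
begin

lemma weight_power2: "weight \<psi> \<Longrightarrow> weight (\<lambda>w. (\<psi> w)^2)"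
 unfolding weight_def using power_mono[of "\<bar>\<psi> _\<bar>" 1 2]
 by (intro conjI allI impI borel_measurable_power) simp_all

text \<open>The shells run outward from the origin, so a decreasing h has decreasing values along
  them; the flat variance weight of \<open>errV\<close> is \<omega> = 1.\<close>

lemma chain_V:
 assumes \<Delta>: "\<Delta> = real n / 2 ^ m"
 shows "\<exists>R. R \<in> borel_measurable P \<and> integrable P R \<and> (\<forall>X. 0 \<le> R X) \<and>
  (LINT X|P. R X) \<le> 8 * pi * C / (real n)^2 * (real (Suc m) * (1 + ln (2 ^ m)))^2 \<and>
  (\<forall>X h. (\<forall>w. h (- w) = h w) \<longrightarrow> antimono_on {0..} h \<longrightarrow> (\<forall>w. 0 \<le> h w \<and> h w \<le> 1) \<longrightarrow>
    \<bar>LBINT w. indicator {w. \<bar>w\<bar> < real n} w * h w * errV X w\<bar> \<le>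
     sqrt ((LBINT w. indicator {w. \<bar>w\<bar> < real n} w * (h w)^2) * R X) + 8 * \<Delta>)"
proof -
 have \<Delta>0: "\<Delta> > 0" and N\<Delta>: "real (2 ^ m) * \<Delta> = real n" using n2 by (auto simp: \<Delta>)
 define D where "D k = (if k < 2 ^ m then shell \<Delta> k else {})" for k
 have U: "(\<Union>k. D k) = {w. \<bar>w\<bar> < real n}"
 proof -
  have "(\<Union>k. D k) = (\<Union>k<2 ^ m. shell \<Delta> k)" by (auto simp: D_def split: if_splits)
  then show ?thesis unfolding shell_Union[OF \<Delta>0] N\<Delta> .
 qed
 have Dn: "D k \<subseteq> {- real n..real n}" for k
 proof -
  have "D k \<subseteq> {w. \<bar>w\<bar> < real n}" unfolding U[symmetric] by auto
  then show ?thesis by force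
 qed
 have V2: "(LINT X|P. (intV \<psi> X)^2) \<le> 8 * pi * C / (real n)^2 * (LBINT w. (\<psi> w)^2 * 1)" if "weight \<psi>" for \<psi>
  using intV_moments(2)[OF that] by simp
 have "\<exists>R. R \<in> borel_measurable P \<and> integrable P R \<and> (\<forall>X. 0 \<le> R X) \<and>
  (LINT X|P. R X) \<le> 8 * pi * C / (real n)^2 * (real (Suc m) * (1 + ln (1 / 1 * 2 ^ m)))^2 \<and>
  (\<forall>X g a. g \<in> borel_measurable borel \<longrightarrow> (\<forall>w. 0 \<le> g w \<and> g w \<le> 1) \<longrightarrow> (\<forall>k. a (Suc k) \<le> a k \<and> 0 \<le> a k) \<longrightarrow>
    (\<forall>k w. w \<in> D k \<longrightarrow> a k \<le> g w \<and> g w \<le> (if k = 0 then 1 else a (k - 1))) \<longrightarrow>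
    \<bar>LBINT w. indicator (\<Union>k. D k) w * g w * errV X w\<bar> \<le>
     sqrt ((LBINT w. indicator (\<Union>k. D k) w * (g w)^2 * 1) * R X) + 8 * \<Delta>)"
 proof (rule chaining[where \<omega>="\<lambda>_. 1" and Y=errV and D=D])
  show "disjoint_family D"
   unfolding disjoint_family_on_def
  proof (intro ballI impI)
   fix j k :: nat assume "j \<noteq> k"
   then have "shell \<Delta> j \<inter> shell \<Delta> k = {}" by (auto simp: shell_index[OF \<Delta>0])
   then show "D j \<inter> D k = {}" by (simp add: D_def)
  qed
  show "D k \<in> sets borel" for k by (simp add: D_def)
  show "measure lborel (D k) = 2 * \<Delta>" if "k < 2 ^ m" for k using that measure_shell[OF \<Delta>0] by (simp add: D_def)
  show "(\<lambda>X. intV \<psi> X) \<in> borel_measurable P" if "weight \<psi>" for \<psi> by (rule intV_measurable[OF that])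
 qed (use C_nonneg \<Delta>0 Dn err_bounded V2 in "auto simp: D_def")
 then obtain R where R: "R \<in> borel_measurable P" "integrable P R" "\<forall>X. 0 \<le> R X"
   "(LINT X|P. R X) \<le> 8 * pi * C / (real n)^2 * (real (Suc m) * (1 + ln (2 ^ m)))^2"
  and ch: "\<And>X g a. g \<in> borel_measurable borel \<Longrightarrow> (\<forall>w. 0 \<le> g w \<and> g w \<le> 1) \<Longrightarrow> (\<forall>k. a (Suc k) \<le> a k \<and> 0 \<le> a k) \<Longrightarrow>
    (\<forall>k w. w \<in> D k \<longrightarrow> a k \<le> g w \<and> g w \<le> (if k = 0 then 1 else a (k - 1))) \<Longrightarrow>
    \<bar>LBINT w. indicator {w. \<bar>w\<bar> < real n} w * g w * errV X w\<bar> \<le>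
     sqrt ((LBINT w. indicator {w. \<bar>w\<bar> < real n} w * (g w)^2) * R X) + 8 * \<Delta>"
  unfolding U by (auto simp only: div_by_1 mult_1_left mult_1_right)
 show ?thesis
 proof (intro exI[of _ R] conjI R allI impI)
  fix X and h :: "real \<Rightarrow> real" assume ev: "\<forall>w. h (- w) = h w" and anti: "antimono_on {0..} h" and h01: "\<forall>w. 0 \<le> h w \<and> h w \<le> 1"
  define a where "a k = h (real (Suc k) * \<Delta>)" for k
  have mono: "h y \<le> h x" if "0 \<le> x" "x \<le> y" for x y using anti that by (auto simp: monotone_on_def)
  have habs: "h w = h \<bar>w\<bar>" for w using ev by (auto simp: abs_if)
  show "\<bar>LBINT w. indicator {w. \<bar>w\<bar> < real n} w * h w * errV X w\<bar> \<le>
     sqrt ((LBINT w. indicator {w. \<bar>w\<bar> < real n} w * (h w)^2) * R X) + 8 * \<Delta>"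
  proof (rule ch[of h a])
   show "h \<in> borel_measurable borel" by (rule even_antimono_measurable) (use ev anti in auto)
   show "\<forall>k. a (Suc k) \<le> a k \<and> 0 \<le> a k"
    unfolding a_def using h01 \<Delta>0 by (auto intro!: mono mult_right_mono)
   show "\<forall>k w. w \<in> D k \<longrightarrow> a k \<le> h w \<and> h w \<le> (if k = 0 then 1 else a (k - 1))"
   proof (intro allI impI)
    fix k w assume "w \<in> D k"
    then have w: "real k * \<Delta> \<le> \<bar>w\<bar>" "\<bar>w\<bar> < real (Suc k) * \<Delta>" by (auto simp: D_def shell_def split: if_splits)
    have "a k \<le> h w" unfolding a_def habs[of w] using w by (intro mono) auto
    moreover have "h w \<le> a (k - 1)" if "k \<noteq> 0"
     unfolding a_def habs[of w] using w that \<Delta>0 by (intro mono) auto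
    ultimately show "a k \<le> h w \<and> h w \<le> (if k = 0 then 1 else a (k - 1))" using h01 by auto
   qed
  qed (use h01 in auto)
 qed
qed

text \<open>The increasing functions 1 - h require the shells in reverse order, from n inward. Since
  |phi|^2 may vanish, 1/n^2 is added to it: this makes \<omega>1 / \<omega>0 = 2 n^2, which enters
  only through a logarithm.\<close>

lemma chain_B:
 assumes \<Delta>: "\<Delta> = real n / 2 ^ m"
 shows "\<exists>R. R \<in> borel_measurable P \<and> integrable P R \<and> (\<forall>X. 0 \<le> R X) \<and>
  (LINT X|P. R X) \<le> 2 * pi * C / real n * (real (Suc m) * (1 + ln (2 * (real n)^2 * 2 ^ m)))^2 \<and>
  (\<forall>X g. (\<forall>w. g (- w) = g w) \<longrightarrow> mono_on {0..} g \<longrightarrow> (\<forall>w. 0 \<le> g w \<and> g w \<le> 1) \<longrightarrow>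
    \<bar>LBINT w. indicator {w. \<bar>w\<bar> < real n} w * g w * errB X w\<bar> \<le>
     sqrt ((LBINT w. indicator {w. \<bar>w\<bar> < real n} w * (g w)^2 * ((norm (\<phi> w))^2 + 1 / (real n)^2)) * R X) + 8 * \<Delta>)"
proof -
 let ?N = "2 ^ m :: nat"
 have \<Delta>0: "\<Delta> > 0" and N\<Delta>: "real (2 ^ m) * \<Delta> = real n" using n2 by (auto simp: \<Delta>)
 define D where "D k = (if k < ?N then shell \<Delta> (?N - 1 - k) else {})" for k
 have U: "(\<Union>k. D k) = {w. \<bar>w\<bar> < real n}"
 proof -
  have "(\<Union>k. D k) = (\<Union>k<?N. shell \<Delta> k)"
  proof (intro equalityI subsetI)
   fix w assume "w \<in> (\<Union>k. D k)"
   then show "w \<in> (\<Union>k<?N. shell \<Delta> k)" by (auto simp: D_def split: if_splits intro!: bexI[of _ "?N - 1 - _"])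
  next
   fix w assume "w \<in> (\<Union>k<?N. shell \<Delta> k)"
   then obtain k where "k < ?N" "w \<in> shell \<Delta> k" by auto
   then have "w \<in> D (?N - 1 - k)" by (auto simp: D_def)
   then show "w \<in> (\<Union>k. D k)" by blast
  qed
  then show ?thesis unfolding shell_Union[OF \<Delta>0] N\<Delta> .
 qed
 have Dn: "D k \<subseteq> {- real n..real n}" for k
 proof -
  have "D k \<subseteq> {w. \<bar>w\<bar> < real n}" unfolding U[symmetric] by auto
  then show ?thesis by force
 qed
 let ?\<omega> = "\<lambda>w. (norm (\<phi> w))^2 + 1 / (real n)^2"
 have n1: "1 / (real n)^2 \<le> 1" "1 / (real n)^2 > 0" using n2 by auto
 have B2: "(LINT X|P. (intB \<psi> X)^2) \<le> 2 * pi * C / real n * (LBINT w. (\<psi> w)^2 * ?\<omega> w)" if w: "weight \<psi>" for \<psi>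
 proof -
  have w2: "weight (\<lambda>w. (\<psi> w)^2)" by (rule weight_power2[OF w])
  have "(LBINT w. (\<psi> w)^2 * (norm (\<phi> w))^2) \<le> (LBINT w. (\<psi> w)^2 * ?\<omega> w)"
  proof (rule integral_mono)
   show "integrable lborel (\<lambda>w. (\<psi> w)^2 * (norm (\<phi> w))^2)"
    by (rule weight_integrable[OF w2 _ phi_sq_le]) measurable
   have "\<bar>?\<omega> w\<bar> \<le> 2" for w using phi_sq_le[of w] n1 zero_le_power2[of "norm (\<phi> w)"] unfolding abs_power2 by linarith
   then show "integrable lborel (\<lambda>w. (\<psi> w)^2 * ?\<omega> w)" by (intro weight_integrable[OF w2]) auto
  qed (auto intro!: mult_left_mono)
  then show ?thesis
   using C_nonneg by (intro order_trans[OF intB_moments(2)[OF w]] mult_left_mono) auto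
 qed
 have "\<exists>R. R \<in> borel_measurable P \<and> integrable P R \<and> (\<forall>X. 0 \<le> R X) \<and>
  (LINT X|P. R X) \<le> 2 * pi * C / real n * (real (Suc m) * (1 + ln (2 / (1 / (real n)^2) * 2 ^ m)))^2 \<and>
  (\<forall>X g a. g \<in> borel_measurable borel \<longrightarrow> (\<forall>w. 0 \<le> g w \<and> g w \<le> 1) \<longrightarrow> (\<forall>k. a (Suc k) \<le> a k \<and> 0 \<le> a k) \<longrightarrow>
    (\<forall>k w. w \<in> D k \<longrightarrow> a k \<le> g w \<and> g w \<le> (if k = 0 then 1 else a (k - 1))) \<longrightarrow>
    \<bar>LBINT w. indicator (\<Union>k. D k) w * g w * errB X w\<bar> \<le>
     sqrt ((LBINT w. indicator (\<Union>k. D k) w * (g w)^2 * ?\<omega> w) * R X) + 8 * \<Delta>)"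
 proof (rule chaining[where \<omega>="?\<omega>" and Y=errB and D=D])
  show "disjoint_family D"
   unfolding disjoint_family_on_def
  proof (intro ballI impI)
   fix j k :: nat assume "j \<noteq> k"
   then have "shell \<Delta> (?N - 1 - j) \<inter> shell \<Delta> (?N - 1 - k) = {}" if "j < ?N" "k < ?N"
    using that by (auto simp: shell_index[OF \<Delta>0])
   then show "D j \<inter> D k = {}" by (simp add: D_def)
  qed
  show "D k \<in> sets borel" for k by (simp add: D_def)
  show "measure lborel (D k) = 2 * \<Delta>" if "k < ?N" for k using that measure_shell[OF \<Delta>0] by (simp add: D_def)
  show "(\<lambda>X. intB \<psi> X) \<in> borel_measurable P" if "weight \<psi>" for \<psi> by (rule intB_measurable[OF that])
  show "(norm (\<phi> w))^2 + 1 / (real n)^2 \<le> 2" for w using phi_sq_le[of w] n1(1) unfolding abs_power2 by linarith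
 qed (use C_nonneg \<Delta>0 Dn err_bounded B2 n1 in "auto simp: D_def")
 then obtain R where R: "R \<in> borel_measurable P" "integrable P R" "\<forall>X. 0 \<le> R X"
   "(LINT X|P. R X) \<le> 2 * pi * C / real n * (real (Suc m) * (1 + ln (2 * (real n)^2 * 2 ^ m)))^2"
  and ch: "\<And>X g a. g \<in> borel_measurable borel \<Longrightarrow> (\<forall>w. 0 \<le> g w \<and> g w \<le> 1) \<Longrightarrow> (\<forall>k. a (Suc k) \<le> a k \<and> 0 \<le> a k) \<Longrightarrow>
    (\<forall>k w. w \<in> D k \<longrightarrow> a k \<le> g w \<and> g w \<le> (if k = 0 then 1 else a (k - 1))) \<Longrightarrow>
    \<bar>LBINT w. indicator {w. \<bar>w\<bar> < real n} w * g w * errB X w\<bar> \<le>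
     sqrt ((LBINT w. indicator {w. \<bar>w\<bar> < real n} w * (g w)^2 * ?\<omega> w) * R X) + 8 * \<Delta>"
  unfolding U by auto
 show ?thesis
 proof (intro exI[of _ R] conjI R allI impI)
  fix X and g :: "real \<Rightarrow> real" assume ev: "\<forall>w. g (- w) = g w" and m: "mono_on {0..} g" and g01: "\<forall>w. 0 \<le> g w \<and> g w \<le> 1"
  \<comment> \<open>The value of g at the inner edge of the shell, its minimum there; the default 0
    after the last cell keeps the sequence decreasing.\<close>
  define a where "a k = (if k < ?N then g (real (?N - 1 - k) * \<Delta>) else 0)" for k
  have mono: "g x \<le> g y" if "0 \<le> x" "x \<le> y" for x y using m that by (auto simp: monotone_on_def)
  have gabs: "g w = g \<bar>w\<bar>" for w using ev by (auto simp: abs_if)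
  show "\<bar>LBINT w. indicator {w. \<bar>w\<bar> < real n} w * g w * errB X w\<bar> \<le>
     sqrt ((LBINT w. indicator {w. \<bar>w\<bar> < real n} w * (g w)^2 * ?\<omega> w) * R X) + 8 * \<Delta>"
  proof (rule ch[of g a])
   have "antimono_on {0..} (\<lambda>w. - g w)" using mono by (auto simp: monotone_on_def)
   then have "(\<lambda>w. - g w) \<in> borel_measurable borel" by (intro even_antimono_measurable) (use ev in auto)
   then show "g \<in> borel_measurable borel" by simp
   have "g (real (?N - 1 - Suc k) * \<Delta>) \<le> g (real (?N - 1 - k) * \<Delta>)" for k
    using \<Delta>0 by (intro mono mult_right_mono mult_nonneg_nonneg of_nat_mono diff_le_mono2) auto
   then show "\<forall>k. a (Suc k) \<le> a k \<and> 0 \<le> a k"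
    unfolding a_def using g01 by (simp del: of_nat_diff)
   show "\<forall>k w. w \<in> D k \<longrightarrow> a k \<le> g w \<and> g w \<le> (if k = 0 then 1 else a (k - 1))"
   proof (intro allI impI)
    fix k w assume "w \<in> D k"
    then have k: "k < ?N" and w: "real (?N - 1 - k) * \<Delta> \<le> \<bar>w\<bar>" "\<bar>w\<bar> < real (Suc (?N - 1 - k)) * \<Delta>"
     by (auto simp: D_def shell_def split: if_splits)
    have "g (real (?N - 1 - k) * \<Delta>) \<le> g \<bar>w\<bar>" using w(1) \<Delta>0 by (intro mono mult_nonneg_nonneg) auto
    then have "a k \<le> g w" unfolding a_def gabs[of w] using k by simp
    moreover have "g w \<le> a (k - 1)" if "k \<noteq> 0"
    proof -
     have "?N - 1 - (k - 1) = Suc (?N - 1 - k)" using k that by simp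
     moreover have "g \<bar>w\<bar> \<le> g (real (Suc (?N - 1 - k)) * \<Delta>)" using w(2) by (intro mono) auto
     moreover have "k - 1 < ?N" using k by simp
     ultimately show ?thesis unfolding a_def gabs[of w] by (simp only: if_True)
    qed
    ultimately show "a k \<le> g w \<and> g w \<le> (if k = 0 then 1 else a (k - 1))" using g01 by auto
   qed
  qed (use g01 in auto)
 qed
qed

end

section \<open>The oracle inequality for the minimizer\<close>

context sample_density
begin

declare psi_measurable[measurable del]

definition "energy = (LBINT w. (norm (\<phi> w))^2)"
text \<open>2 pi times the risk of the estimator with spectrum h, up to the omitted nonpositive term
  - (1/n) \<integral> h^2 |phi|^2 of the variance.\<close>

definition "D h = (LBINT w. (h w)^2) / real n + (LBINT w. (1 - h w)^2 * (norm (\<phi> w))^2)"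

lemma phi_sq_integrable: "integrable lborel (\<lambda>w. (norm (\<phi> w))^2)"
 unfolding fourier_eq_FT by (rule Plancherel(1)) (use f_int f_sq in auto)

lemma spectra_weight: "h \<in> spectra n \<Longrightarrow> weight h"
 unfolding weight_def using spectra_measurable[of h n] by (simp add: spectra_def)

lemma spectra_integrals:
 assumes h: "h \<in> spectra n"
 shows "integrable lborel (\<lambda>w. (h w)^2)" "integrable lborel (\<lambda>w. (1 - h w)^2 * (norm (\<phi> w))^2)"
  "integrable lborel (\<lambda>w. (h w)^2 * (norm (\<phi> w))^2)"
  "integrable lborel (\<lambda>w. h w * errB X w)" "integrable lborel (\<lambda>w. (h w)^2 * errB X w)"
  "integrable lborel (\<lambda>w. h w * errV X w)" "integrable lborel (\<lambda>w. (h w)^2 * errV X w)"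
proof -
 have [measurable]: "h \<in> borel_measurable borel" by (rule spectra_measurable[OF h])
 note w = spectra_weight[OF h] and w2 = weight_power2[OF spectra_weight[OF h]]
 show "integrable lborel (\<lambda>w. (h w)^2)" using weight_integrable[OF w2, of "\<lambda>_. 1" 1] by simp
 have "\<bar>1 - h w\<bar> \<le> 1" for w using h by (auto simp: spectra_def)
 then have "(1 - h w)^2 \<le> 1" for w using power_mono[of "\<bar>1 - h w\<bar>" 1 2] by simp
 then show "integrable lborel (\<lambda>w. (1 - h w)^2 * (norm (\<phi> w))^2)"
  by (intro L1_bound[OF phi_sq_integrable]) (auto simp: abs_mult intro!: mult_left_le_one_le)
qed (rule weight_integrable[OF weight_power2[OF spectra_weight[OF h]] _ phi_sq_le]
   weight_integrable[OF spectra_weight[OF h] _ err_bounded(1)] weight_integrable[OF weight_power2[OF spectra_weight[OF h]] _ err_bounded(1)]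
   weight_integrable[OF spectra_weight[OF h] _ err_bounded(2)] weight_integrable[OF weight_power2[OF spectra_weight[OF h]] _ err_bounded(2)]; measurable)+

text \<open>In the expansion of the square the true cross term Re (ecf * cnj phi) stands where the
  criterion has \<open>ustat\<close>; their difference is errB + errV by the Hoeffding
  decomposition.\<close>

lemma loss_eq_crit:
 assumes h: "h \<in> spectra n"
 shows "(LBINT w. (norm (of_real (h w) * ecf n X w - \<phi> w))^2) =
  crit n X h + energy + 2 * intB h X + 2 * intV h X"
proof -
 note I = spectra_integrals[OF h]
 have ic: "integrable lborel (\<lambda>w. (h w)^2 * (norm (ecf n X w))^2 - 2 * h w * ustat n X w)"
  using spectra_integrable_terms[OF h h n2, of X] by (simp add: power2_eq_square mult.assoc)
 have exp: "(norm (a - b))^2 = (norm a)^2 + (norm b)^2 - 2 * Re (a * cnj b)" for a b :: complex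
  unfolding cmod_power2 by (simp add: algebra_simps power2_eq_square)
 have e: "(norm (of_real (h w) * ecf n X w - \<phi> w))^2 =
   ((h w)^2 * (norm (ecf n X w))^2 - 2 * h w * ustat n X w) + (norm (\<phi> w))^2 + 2 * (h w * errB X w) + 2 * (h w * errV X w)" for w
 proof -
  have "Re (of_real (h w) * ecf n X w * cnj (\<phi> w)) = h w * Re (ecf n X w * cnj (\<phi> w))" by (simp add: algebra_simps)
  then show ?thesis unfolding exp errB_def errV_def norm_mult power_mult_distrib norm_of_real power2_abs
   by (simp add: algebra_simps del: times_complex.sel)
 qed
 show ?thesis
  unfolding e crit_def energy_def
  by (subst LINT_add, (intro L1_add integrable_mult_right ic phi_sq_integrable I)+,
    subst LINT_add, (intro L1_add integrable_mult_right ic phi_sq_integrable I)+,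
    subst LINT_add[OF ic phi_sq_integrable], simp only: integral_mult_right_zero)
qed

text \<open>Writing |ecf|^2 and \<open>ustat\<close> through |phi|^2, \<open>errB\<close> and
  \<open>errV\<close> separates the mean of the criterion from its centred part. The constant c is
  the weight of the off-diagonal pairs in |ecf|^2.\<close>

lemma crit_eq:
 assumes h: "h \<in> spectra n"
 defines "c \<equiv> 1 - 1 / real n"
 shows "crit n X h = D h - energy - (LBINT w. (h w)^2 * (norm (\<phi> w))^2) / real n
  + 2 * c * intB (\<lambda>w. (h w)^2) X - 4 * intB h X + c * intV (\<lambda>w. (h w)^2) X - 2 * intV h X"
proof -
 note I = spectra_integrals[OF h]
 have e: "(h w)^2 * (norm (ecf n X w))^2 - 2 * h w * ustat n X w =
   (h w)\<^sup>2 / real n + (1 - h w)^2 * (norm (\<phi> w))^2 - (norm (\<phi> w))\<^sup>2 - ((h w)^2 * (norm (\<phi> w))^2) / real n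
   + 2 * c * ((h w)^2 * errB X w) - 4 * (h w * errB X w) + c * ((h w)^2 * errV X w) - 2 * (h w * errV X w)" for w
 proof -
  define b where "b = Re (ecf n X w * cnj (\<phi> w))"
  define p where "p = (norm (\<phi> w))^2"
  have E: "(norm (ecf n X w))^2 = 1 / real n + c * ustat n X w" unfolding c_def using n2 by (intro norm_ecf_sq) simp
  show ?thesis unfolding E errB_def errV_def b_def[symmetric] p_def[symmetric] using n2
   by (simp add: c_def field_simps power2_eq_square)
 qed
 show ?thesis
  unfolding e crit_def energy_def D_def
  by (simp only: LINT_add LINT_diff L1_add
    L1_diff integrable_mult_right integrable_divide I phi_sq_integrable
    integral_mult_right_zero integral_divide_zero)
qed

text \<open>The linear error must be paired with functions that the bias controls, so h and h^2 are
  expanded in powers of 1 - h. The constant term \<open>intB (indicator A) X\<close> is the same for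
  all spectra; the two points with |w| = n form a null set.\<close>

lemma interior_split:
 assumes h: "h \<in> spectra n"
 defines "A \<equiv> {w. \<bar>w\<bar> < real n}"
 shows "intB h X = intB (indicator A) X - (LBINT w. indicator A w * (1 - h w) * errB X w)"
  "intB (\<lambda>w. (h w)^2) X = intB (indicator A) X - 2 * (LBINT w. indicator A w * (1 - h w) * errB X w)
    + (LBINT w. indicator A w * (1 - h w)^2 * errB X w)"
  "intV h X = (LBINT w. indicator A w * h w * errV X w)"
  "intV (\<lambda>w. (h w)^2) X = (LBINT w. indicator A w * (h w)^2 * errV X w)"
proof -
 have [measurable]: "h \<in> borel_measurable borel" by (rule spectra_measurable[OF h])
 have [measurable]: "A \<in> sets borel" unfolding A_def by measurable
 have wA: "weight (indicator A)" by (rule weight_indicator) (auto simp: A_def)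
 have ae: "AE w in lborel. w \<notin> {- real n, real n}" by (rule AE_not_in) (simp add: finite_imp_null_set_lborel)
 have z: "h w = 0" if "w \<notin> {- real n, real n}" "w \<notin> A" for w using that h by (auto simp: A_def spectra_def abs_if split: if_splits)
 have b: "\<bar>1 - h w\<bar> \<le> 1" "\<bar>h w\<bar> \<le> 1" for w using h by (auto simp: spectra_def)
 then have b2: "(1 - h w)^2 \<le> 1" "(h w)^2 \<le> 1" for w using power_mono[of "\<bar>1 - h w\<bar>" 1 2] power_mono[of "\<bar>h w\<bar>" 1 2] by simp_all
 have i: "integrable lborel (\<lambda>w. indicator A w * errB X w)" by (rule weight_integrable[OF wA _ err_bounded(1)]) measurable
 have "\<bar>(1 - h w) * errB X w\<bar> \<le> 1 * 4" for w
  unfolding abs_mult by (intro mult_mono b err_bounded) auto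
 then have i1: "integrable lborel (\<lambda>w. indicator A w * (1 - h w) * errB X w)" unfolding mult.assoc
  by (intro weight_integrable[OF wA]) auto
 have "\<bar>(1 - h w)\<^sup>2 * errB X w\<bar> \<le> 1 * 4" for w
  unfolding abs_mult abs_power2 by (intro mult_mono b2 err_bounded) auto
 then have i2: "integrable lborel (\<lambda>w. indicator A w * (1 - h w)^2 * errB X w)" unfolding mult.assoc
  by (intro weight_integrable[OF wA]) auto
 have "intB h X = (LBINT w. indicator A w * errB X w - indicator A w * (1 - h w) * errB X w)"
  by (rule integral_cong_AE; measurable?) (use ae in eventually_elim, use z in "auto simp: indicator_def algebra_simps")
 then show "intB h X = intB (indicator A) X - (LBINT w. indicator A w * (1 - h w) * errB X w)"
  using i i1 by simp
 have "intB (\<lambda>w. (h w)^2) X = (LBINT w. indicator A w * errB X w - 2 * (indicator A w * (1 - h w) * errB X w) + indicator A w * (1 - h w)^2 * errB X w)"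
  by (rule integral_cong_AE; measurable?) (use ae in eventually_elim, use z in "auto simp: indicator_def algebra_simps power2_eq_square")
 then show "intB (\<lambda>w. (h w)^2) X = intB (indicator A) X - 2 * (LBINT w. indicator A w * (1 - h w) * errB X w)
    + (LBINT w. indicator A w * (1 - h w)^2 * errB X w)"
  using i i1 i2 by simp
 show "intV h X = (LBINT w. indicator A w * h w * errV X w)"
  "intV (\<lambda>w. (h w)^2) X = (LBINT w. indicator A w * (h w)^2 * errV X w)"
  by (rule integral_cong_AE; measurable?; use ae in eventually_elim, use z in "auto simp: indicator_def")+
qed

text \<open>The pathwise inequality is applied to the random spectrum \<open>H X\<close>;
  expectations are taken only afterwards, of quantities belonging to the fixed h, to the chaining
  variables and to the centred \<open>b\<close>.\<close>

theorem cv_oracle_inequality: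
 fixes m :: nat
 assumes H: "\<And>X. H X \<in> spectra n" and min: "\<And>X g. g \<in> spectra n \<Longrightarrow> crit n X (H X) \<le> crit n X g"
  and h: "h \<in> spectra n" and \<epsilon>: "\<epsilon> > 0"
 defines "r \<equiv> 8 * (real n / 2 ^ m)"
 shows "(\<integral>\<^sup>+ X. ennreal ((LBINT w. (norm (of_real (H X w) * ecf n X w - \<phi> w))^2) / (2 * pi)) \<partial>P) \<le>
  ennreal (((1 + 2 * \<epsilon>) * D h + 4 * r + \<epsilon> * (2 * energy / real n + 18 * r + 4 / real n)
   + (81 * \<epsilon> + 4 / \<epsilon>) * (10 * pi * C / real n * (real (Suc m) * (1 + ln (2 * (real n)^2 * 2 ^ m)))^2)) / (2 * pi))"
proof -
 define A where "A = {w. \<bar>w\<bar> < real n}"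
 define c where "c = 1 - 1 / real n"
 \<comment> \<open>The price of adding 1/n^2 to |phi|^2 on an interval of length 2n.\<close>
 define s where "s = 2 / real n"
 have c: "0 \<le> c" "c \<le> 1" using n2 by (auto simp: c_def)
 obtain RV where RV[measurable]: "RV \<in> borel_measurable P" and iRV: "integrable P RV" and RV0: "\<And>X. 0 \<le> RV X"
  and ERV: "(LINT X|P. RV X) \<le> 8 * pi * C / (real n)^2 * (real (Suc m) * (1 + ln (2 ^ m)))^2"
  and chV: "\<And>X h. (\<forall>w. h (- w) = h w) \<Longrightarrow> antimono_on {0..} h \<Longrightarrow> (\<forall>w. 0 \<le> h w \<and> h w \<le> 1) \<Longrightarrow>
    \<bar>LBINT w. indicator A w * h w * errV X w\<bar> \<le> sqrt ((LBINT w. indicator A w * (h w)^2) * RV X) + r"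
  using chain_V[OF refl, of m] unfolding A_def r_def by blast
 obtain RB where RB[measurable]: "RB \<in> borel_measurable P" and iRB: "integrable P RB" and RB0: "\<And>X. 0 \<le> RB X"
  and ERB: "(LINT X|P. RB X) \<le> 2 * pi * C / real n * (real (Suc m) * (1 + ln (2 * (real n)^2 * 2 ^ m)))^2"
  and chB: "\<And>X g. (\<forall>w. g (- w) = g w) \<Longrightarrow> mono_on {0..} g \<Longrightarrow> (\<forall>w. 0 \<le> g w \<and> g w \<le> 1) \<Longrightarrow>
    \<bar>LBINT w. indicator A w * g w * errB X w\<bar> \<le>
     sqrt ((LBINT w. indicator A w * (g w)^2 * ((norm (\<phi> w))^2 + 1 / (real n)^2)) * RB X) + r"
  using chain_B[OF refl, of m] unfolding A_def r_def by blast
 \<comment> \<open>The factor n compensates that the integral of h^2 is bounded by n times D; both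
   chaining variables then have mean of order 1/n up to logarithms.\<close>
 define R where "R X = RB X + real n * RV X" for X
 have R0: "0 \<le> R X" for X unfolding R_def using RB0 RV0 by simp
 have iR: "integrable P R" unfolding R_def[abs_def] using iRB iRV by auto
 have ER: "(LINT X|P. R X) \<le> 10 * pi * C / real n * (real (Suc m) * (1 + ln (2 * (real n)^2 * 2 ^ m)))^2"
 proof -
  have "1 \<le> (real n)^2" using n2 by simp
  then have "(1::real) * 2 ^ m \<le> 2 * (real n)^2 * 2 ^ m" by (intro mult_right_mono) auto
  then have l: "ln (2 ^ m) \<le> ln (2 * (real n)^2 * 2 ^ m)" using n2 by (intro ln_mono) auto
  have "0 \<le> ln (2 ^ m :: real)" by simp
  then have "(real (Suc m) * (1 + ln (2 ^ m)))^2 \<le> (real (Suc m) * (1 + ln (2 * (real n)^2 * 2 ^ m)))^2"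
   using l by (intro power_mono mult_left_mono) auto
  then have "8 * pi * C / (real n)^2 * (real (Suc m) * (1 + ln (2 ^ m)))^2 \<le> 8 * pi * C / (real n)^2 * (real (Suc m) * (1 + ln (2 * (real n)^2 * 2 ^ m)))^2"
   using C_nonneg by (intro mult_left_mono) auto
  then have "real n * (LINT X|P. RV X) \<le> real n * (8 * pi * C / (real n)^2 * (real (Suc m) * (1 + ln (2 * (real n)^2 * 2 ^ m)))^2)"
   using ERV by (intro mult_left_mono) auto
  also have "... = 8 * pi * C / real n * (real (Suc m) * (1 + ln (2 * (real n)^2 * 2 ^ m)))^2"
   using n2 by (simp add: power2_eq_square)
  finally have "(LINT X|P. RB X) + real n * (LINT X|P. RV X) \<le>
   2 * pi * C / real n * (real (Suc m) * (1 + ln (2 * (real n)^2 * 2 ^ m)))^2 + 8 * pi * C / real n * (real (Suc m) * (1 + ln (2 * (real n)^2 * 2 ^ m)))^2"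
   using ERB by linarith
  also have "... = 10 * pi * C / real n * (real (Suc m) * (1 + ln (2 * (real n)^2 * 2 ^ m)))^2"
   by (simp add: add_divide_distrib[symmetric] distrib_right[symmetric])
  finally show ?thesis unfolding R_def using iRB iRV by simp
 qed
 define T where "T X = crit n X h + energy" for X
 define b where "b X = intB (indicator A) X" for X
 have wA: "weight (indicator A)" unfolding A_def by (rule weight_indicator) auto
 have wh: "weight h" "weight (\<lambda>w. (h w)^2)" using spectra_weight[OF h] weight_power2 by auto
 have iint: "integrable P (intB \<psi>)" "integrable P (intV \<psi>)" if "weight \<psi>" for \<psi>
  by (rule S.integrable_bounded[OF intB_measurable[OF that] int_bounded(1)[OF that]]
       S.integrable_bounded[OF intV_measurable[OF that] int_bounded(2)[OF that]])+
 define e0 where "e0 g = (LBINT w. (g w)^2 * (norm (\<phi> w))^2) / real n" for g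
 have Teq: "T X = D h - e0 h + 2 * c * intB (\<lambda>w. (h w)^2) X - 4 * intB h X + c * intV (\<lambda>w. (h w)^2) X - 2 * intV h X" for X
  unfolding T_def crit_eq[OF h] c_def e0_def by simp
 have iT: "integrable P T" unfolding Teq[abs_def] using wh
  by (intro L1_add L1_diff integrable_mult_right iint) auto
 have e0_nonneg: "e0 g \<ge> 0" for g unfolding e0_def by (intro divide_nonneg_nonneg integral_nonneg_AE AE_I2) auto
 have ET: "(LINT X|P. T X) \<le> D h"
 proof -
  have "(LINT X|P. T X) = D h - e0 h"
   unfolding Teq using wh by (simp add: iint intB_moments(1) intV_moments(1) S.prob_space)
  then show ?thesis using e0_nonneg[of h] by simp
 qed
 have ib: "integrable P b" and Eb: "(LINT X|P. b X) = 0" unfolding b_def using wA iint intB_moments(1) by auto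
 define Z where "Z X = (1 + 2 * \<epsilon>) * T X + (2 + \<epsilon> * (8 - 4 * c)) * b X + 4 * r + \<epsilon> * (2 * (energy / real n) + 18 * r + 2 * s + 81 * R X) + 4 / \<epsilon> * R X" for X
 have path: "(LBINT w. (norm (of_real (H X w) * ecf n X w - \<phi> w))^2) \<le> Z X" for X
 proof -
  define k where "k = H X"
  have k: "k \<in> spectra n" unfolding k_def by (rule H)
  have [measurable]: "k \<in> borel_measurable borel" by (rule spectra_measurable[OF k])
  have k01: "0 \<le> k w" "k w \<le> 1" "k (- w) = k w" for w using k by (auto simp: spectra_def)
  have anti: "antimono_on {0..} k" using k by (auto simp: spectra_def)
  have D0: "0 \<le> D k" unfolding D_def using n2 by (intro add_nonneg_nonneg divide_nonneg_nonneg integral_nonneg_AE AE_I2) auto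
  have s0: "0 \<le> s" by (simp add: s_def)
  have [measurable]: "A \<in> sets borel" unfolding A_def by measurable
  have iA: "integrable lborel (indicator A :: real \<Rightarrow> real)" using weight_integrable[OF wA, of "\<lambda>_. 1" 1] by simp
  have Aint: "(LBINT w. indicator A w) = 2 * real n"
  proof -
   have "A = {- real n<..<real n}" by (auto simp: A_def)
   then show ?thesis by simp
  qed
  have Vb: "\<bar>LBINT w. indicator A w * g w * errV X w\<bar> \<le> sqrt ((D k + s) * R X) + r"
   if g: "\<And>w. g (- w) = g w" "antimono_on {0..} g" "\<And>w. 0 \<le> g w" "\<And>w. g w \<le> k w" for g
  proof -
   have [measurable]: "g \<in> borel_measurable borel" by (rule even_antimono_measurable[OF g(1,2)])
   have g1: "g w \<le> 1" for w using g(4)[of w] k01(2)[of w] by simp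
   have "(LBINT w. indicator A w * (g w)^2) \<le> (LBINT w. (k w)^2)"
   proof (rule integral_mono)
    have "\<bar>(g w)\<^sup>2\<bar> \<le> 1" for w using g(3)[of w] g1[of w] by (simp add: power_le_one)
    then show "integrable lborel (\<lambda>w. indicator A w * (g w)^2)" by (intro weight_integrable[OF wA]) auto
    show "indicator A w * (g w)^2 \<le> (k w)^2" for w using g(3,4)[of w] by (auto simp: indicator_def intro!: power_mono)
   qed (rule spectra_integrals(1)[OF k])
   also have "... \<le> real n * D k"
   proof -
    have "0 \<le> (LBINT w. (1 - k w)^2 * (norm (\<phi> w))^2)" by (intro integral_nonneg_AE AE_I2) auto
    then have "(LBINT w. (k w)^2) / real n \<le> D k" unfolding D_def by simp
    then show ?thesis using n2 by (simp add: pos_divide_le_eq mult.commute)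
   qed
   finally have "(LBINT w. indicator A w * (g w)^2) * RV X \<le> real n * D k * RV X"
    using RV0 by (intro mult_right_mono)
   also have "... = D k * (real n * RV X)" by simp
   also have "... \<le> (D k + s) * R X"
    unfolding R_def using D0 s0 RB0 RV0 by (intro mult_mono) auto
   finally have "sqrt ((LBINT w. indicator A w * (g w)^2) * RV X) \<le> sqrt ((D k + s) * R X)" by simp
   moreover have "\<bar>LBINT w. indicator A w * g w * errV X w\<bar> \<le> sqrt ((LBINT w. indicator A w * (g w)^2) * RV X) + r"
    using g g1 by (intro chV) auto
   ultimately show ?thesis by linarith
  qed
  have Bb: "\<bar>LBINT w. indicator A w * g w * errB X w\<bar> \<le> sqrt ((D k + s) * R X) + r"
   if g: "\<And>w. g (- w) = g w" "mono_on {0..} g" "\<And>w. 0 \<le> g w" "\<And>w. g w \<le> 1 - k w" for g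
  proof -
   have "(\<lambda>w. - g w) \<in> borel_measurable borel"
    by (rule even_antimono_measurable) (use g(1,2) in "auto simp: monotone_on_def")
   then have [measurable]: "g \<in> borel_measurable borel" by simp
   have g1: "g w \<le> 1" for w using g(4)[of w] k01(1)[of w] by simp
   have "(LBINT w. indicator A w * (g w)^2 * ((norm (\<phi> w))^2 + 1 / (real n)^2)) \<le>
    (LBINT w. (1 - k w)^2 * (norm (\<phi> w))^2 + 1 / (real n)^2 * indicator A w)"
   proof (rule integral_mono)
    have le: "(g w)^2 \<le> (1 - k w)^2" "(g w)^2 \<le> 1" for w
     using g(3,4)[of w] g1[of w] by (auto intro!: power_mono simp: power_le_one)
    have "indicator A w * (g w)^2 * ((norm (\<phi> w))^2 + 1 / (real n)^2) \<le> (1 - k w)^2 * (norm (\<phi> w))^2 + 1 / (real n)^2 * indicator A w" for w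
     using mult_right_mono[OF le(1)[of w], of "(norm (\<phi> w))^2"] mult_right_mono[OF le(2)[of w], of "1 / (real n)^2"]
     by (auto simp: indicator_def distrib_left)
    then show le2: "indicator A w * (g w)^2 * ((norm (\<phi> w))^2 + 1 / (real n)^2) \<le> (1 - k w)^2 * (norm (\<phi> w))^2 + 1 / (real n)^2 * indicator A w" for w .
    show i: "integrable lborel (\<lambda>w. (1 - k w)^2 * (norm (\<phi> w))^2 + 1 / (real n)^2 * indicator A w)"
     by (intro L1_add spectra_integrals(2)[OF k] integrable_mult_right iA)
    show "integrable lborel (\<lambda>w. indicator A w * (g w)^2 * ((norm (\<phi> w))^2 + 1 / (real n)^2))"
     by (rule L1_bound[OF i]) (measurable, use le2 in "auto intro!: AE_I2 simp: abs_mult intro: order_trans[OF _ abs_ge_self]")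
   qed
   also have "... = (LBINT w. (1 - k w)^2 * (norm (\<phi> w))^2) + 1 / (real n)^2 * (2 * real n)"
    unfolding Aint[symmetric] using spectra_integrals(2)[OF k] iA
    by (subst LINT_add) (auto simp del: integral_indicator)
   also have "... \<le> D k + s"
    unfolding D_def s_def using n2 by (auto simp: power2_eq_square intro!: divide_nonneg_nonneg integral_nonneg_AE)
   finally have "(LBINT w. indicator A w * (g w)^2 * ((norm (\<phi> w))^2 + 1 / (real n)^2)) * RB X \<le> (D k + s) * R X"
    using D0 s0 RB0 RV0 by (intro mult_mono) (auto simp: R_def)
   then have "sqrt ((LBINT w. indicator A w * (g w)^2 * ((norm (\<phi> w))^2 + 1 / (real n)^2)) * RB X) \<le> sqrt ((D k + s) * R X)" by simp
   moreover have "\<bar>LBINT w. indicator A w * g w * errB X w\<bar> \<le> sqrt ((LBINT w. indicator A w * (g w)^2 * ((norm (\<phi> w))^2 + 1 / (real n)^2)) * RB X) + r"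
    using g g1 by (intro chB) auto
   ultimately show ?thesis by linarith
  qed
  have m1: "mono_on {0..} (\<lambda>w. 1 - k w)" "mono_on {0..} (\<lambda>w. (1 - k w)^2)" "antimono_on {0..} (\<lambda>w. (k w)^2)"
   using anti k01 by (auto simp: monotone_on_def intro!: power_mono)
  have sq: "x\<^sup>2 \<le> x" if "0 \<le> x" "x \<le> 1" for x :: real
   using that mult_left_le[of x x] by (simp add: power2_eq_square)
  note S = interior_split[OF k, of X, folded A_def, folded b_def]
  have e0: "e0 k \<le> energy / real n"
   unfolding e0_def energy_def
  proof (intro divide_right_mono integral_mono)
   show "(k w)^2 * (norm (\<phi> w))^2 \<le> (norm (\<phi> w))^2" for w
    using k01[of w] by (intro mult_left_le_one_le) (auto simp: power_le_one)
  qed (use spectra_integrals(3)[OF k] phi_sq_integrable in auto)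
  have "(LBINT w. (norm (of_real (k w) * ecf n X w - \<phi> w))^2) \<le>
   (1 + 2 * \<epsilon>) * T X + (2 + \<epsilon> * (8 - 4 * c)) * b X + 4 * r + \<epsilon> * (2 * e0 k + 18 * r + 2 * s + 81 * R X) + 4 / \<epsilon> * R X"
  proof (rule oracle_inequality_algebra[where cr="crit n X k" and \<Phi>=energy and D="D k"])
   show "(LBINT w. (norm (of_real (k w) * ecf n X w - \<phi> w))^2) = crit n X k + energy +
     2 * (b X - (LBINT w. indicator A w * (1 - k w) * errB X w)) + 2 * (LBINT w. indicator A w * k w * errV X w)"
    unfolding loss_eq_crit[OF k] S(1,3)[symmetric] ..
   show "crit n X k = D k - energy - e0 k + 2 * c * (b X - 2 * (LBINT w. indicator A w * (1 - k w) * errB X w) + (LBINT w. indicator A w * (1 - k w)^2 * errB X w))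
     - 4 * (b X - (LBINT w. indicator A w * (1 - k w) * errB X w)) + c * (LBINT w. indicator A w * (k w)^2 * errV X w)
     - 2 * (LBINT w. indicator A w * k w * errV X w)"
    unfolding crit_eq[OF k] c_def e0_def S(1,2,3,4)[symmetric] ..
   show "crit n X k + energy \<le> T X" unfolding T_def k_def using min[OF h] by simp
   show "\<bar>LBINT w. indicator A w * (1 - k w) * errB X w\<bar> \<le> sqrt ((D k + s) * R X) + r"
    by (rule Bb) (use m1 k01 in auto)
   show "\<bar>LBINT w. indicator A w * (1 - k w)^2 * errB X w\<bar> \<le> sqrt ((D k + s) * R X) + r"
    by (rule Bb) (use m1 k01 sq in auto)
   show "\<bar>LBINT w. indicator A w * k w * errV X w\<bar> \<le> sqrt ((D k + s) * R X) + r"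
    by (rule Vb) (use anti k01 in auto)
   show "\<bar>LBINT w. indicator A w * (k w)^2 * errV X w\<bar> \<le> sqrt ((D k + s) * R X) + r"
    by (rule Vb) (use m1 k01 sq in auto)
  qed (use c D0 R0 s0 \<epsilon> in auto)
  also have "... \<le> Z X" unfolding Z_def using e0 \<epsilon> by (intro add_right_mono add_left_mono mult_left_mono) auto
  finally show ?thesis unfolding k_def .
 qed
 have iZ: "integrable P Z" unfolding Z_def[abs_def] using iT ib iR by auto
 have Z0: "0 \<le> Z X" for X
  by (rule order_trans[OF _ path]) (intro integral_nonneg_AE AE_I2, simp)
 have "(\<integral>\<^sup>+ X. ennreal ((LBINT w. (norm (of_real (H X w) * ecf n X w - \<phi> w))^2) / (2 * pi)) \<partial>P) \<le> (\<integral>\<^sup>+ X. ennreal (Z X / (2 * pi)) \<partial>P)"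
  by (intro nn_integral_mono ennreal_leI divide_right_mono path) simp
 also have "... = ennreal ((LINT X|P. Z X) / (2 * pi))" using iZ Z0 by (subst nn_integral_eq_integral) auto
 also have "(LINT X|P. Z X) = (1 + 2 * \<epsilon>) * (LINT X|P. T X) + 4 * r + \<epsilon> * (2 * (energy / real n) + 18 * r + 2 * s + 81 * (LINT X|P. R X)) + 4 / \<epsilon> * (LINT X|P. R X)"
  unfolding Z_def using iT ib iR by (simp add: Eb S.prob_space)
 also have "... = (1 + 2 * \<epsilon>) * (LINT X|P. T X) + 4 * r + \<epsilon> * (2 * energy / real n + 18 * r + 4 / real n) + (81 * \<epsilon> + 4 / \<epsilon>) * (LINT X|P. R X)"
  by (simp add: s_def algebra_simps)
 also have "ennreal (... / (2 * pi)) \<le> ennreal (((1 + 2 * \<epsilon>) * D h + 4 * r + \<epsilon> * (2 * energy / real n + 18 * r + 4 / real n)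
   + (81 * \<epsilon> + 4 / \<epsilon>) * (10 * pi * C / real n * (real (Suc m) * (1 + ln (2 * (real n)^2 * 2 ^ m)))^2)) / (2 * pi))"
  using ET ER \<epsilon> by (intro ennreal_leI divide_right_mono add_mono mult_left_mono) auto
 finally show ?thesis .
qed

end

section \<open>The risk of the cross-validated estimator over a Sobolev class\<close>

text \<open>The cut-off W that makes the spectral variances ((W / |w|)^\<beta> - 1) / n on |w| <= W
  exhaust the budget: integrated against |w|^(2 \<beta>) / (2 pi) they give L.\<close>

definition pinsker_W :: "real \<Rightarrow> real \<Rightarrow> nat \<Rightarrow> real" where
 "pinsker_W \<beta> L n = (pi * real n * L * (\<beta> + 1) * (2 * \<beta> + 1) / \<beta>) powr (1 / (2 * \<beta> + 1))"

text \<open>The integral of the Pinsker filter over the line, divided by 2 pi n: the asymptotic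
  minimax risk.\<close>

definition pinsker :: "real \<Rightarrow> real \<Rightarrow> nat \<Rightarrow> real" where
 "pinsker \<beta> L n = pinsker_W \<beta> L n / (pi * real n) * (\<beta> / (\<beta> + 1))"

section \<open>Boundedness of Sobolev densities and the risk of the Pinsker filter\<close>

lemma has_bochner_integral_has_integral:
 fixes f :: "real \<Rightarrow> real"
 assumes "\<And>x. x \<in> S \<Longrightarrow> 0 \<le> f x" "(f has_integral I) S" "0 \<le> I"
  and [measurable]: "S \<in> sets borel" "f \<in> borel_measurable borel"
 shows "has_bochner_integral lborel (\<lambda>x. indicator S x * f x) I"
proof (rule has_bochner_integral_nn_integral)
 show "(\<integral>\<^sup>+ x. ennreal (indicator S x * f x) \<partial>lborel) = ennreal I"
  using nn_integral_has_integral_lebesgue[OF assms(1,2)] by simp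
qed (use assms in "auto simp: indicator_def")

lemma integral_even_abs:
 fixes f :: "real \<Rightarrow> real"
 assumes "has_bochner_integral lborel (\<lambda>x. indicator {0<..} x * f x) I" and [measurable]: "f \<in> borel_measurable borel"
 shows "has_bochner_integral lborel (\<lambda>x. f \<bar>x\<bar>) (2 * I)"
proof -
 have i: "integrable lborel (\<lambda>x. indicator {0<..} x * f x)" and I: "(LBINT x. indicator {0<..} x * f x) = I"
  using assms(1) by (auto simp: hbi_iff)
 have i2: "integrable lborel (\<lambda>x. indicator {0<..} (0 + - 1 * x) * f (0 + - 1 * x))"
  by (rule lborel_integrable_real_affine[OF i]) simp
 have I2: "(LBINT x. indicator {0<..} (0 + - 1 * x) * f (0 + - 1 * x)) = I"
  using lborel_integral_real_affine[of "-1" "\<lambda>x. indicator {0<..} x * f x" 0] I by simp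
 have "has_bochner_integral lborel (\<lambda>x. indicator {0<..} x * f x + indicator {0<..} (0 + - 1 * x) * f (0 + - 1 * x)) (I + I)"
  by (intro has_bochner_integral_add) (use i i2 I I2 in "auto simp: hbi_iff")
 moreover have "AE x in lborel. x \<noteq> (0::real)" by (rule AE_lborel_singleton)
 then have "AE x in lborel. indicator {0<..} x * f x + indicator {0<..} (0 + - 1 * x) * f (0 + - 1 * x) = f \<bar>x\<bar>"
  by eventually_elim (auto simp: indicator_def abs_if)
 ultimately show ?thesis
  by (subst has_bochner_integral_cong_AE[where g="\<lambda>x. indicator {0<..} x * f x + indicator {0<..} (0 + - 1 * x) * f (0 + - 1 * x)"])
    (auto elim: eventually_mono)
qed

lemma integral_powr_tail:
 assumes "\<beta> > 1 / 2"
 shows "has_bochner_integral lborel (\<lambda>x::real. indicator {1<..} \<bar>x\<bar> * \<bar>x\<bar> powr (- 2 * \<beta>)) (2 / (2 * \<beta> - 1))"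
proof -
 have "((\<lambda>x::real. x powr (- 2 * \<beta>)) has_integral - (1 powr (- 2 * \<beta> + 1)) / (- 2 * \<beta> + 1)) {1..}"
  using assms by (intro has_integral_powr_to_inf) auto
 moreover have "- (1 powr (- 2 * \<beta> + 1)) / (- 2 * \<beta> + 1) = 1 / (2 * \<beta> - 1)"
  using assms by (simp add: divide_simps)
 ultimately have "has_bochner_integral lborel (\<lambda>x. indicator {1..} x * x powr (- 2 * \<beta>)) (1 / (2 * \<beta> - 1))"
  using assms by (intro has_bochner_integral_has_integral) auto
 moreover have "AE x in lborel. x \<noteq> (1::real)" by (rule AE_lborel_singleton)
 then have "AE x in lborel. indicator {1..} x * x powr (- 2 * \<beta>) = indicator {0<..} x * (indicator {1<..} x * x powr (- 2 * \<beta>))"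
  by eventually_elim (auto simp: indicator_def)
 ultimately have "has_bochner_integral lborel (\<lambda>x. indicator {0<..} x * (indicator {1<..} x * x powr (- 2 * \<beta>))) (1 / (2 * \<beta> - 1))"
  by (subst (asm) has_bochner_integral_cong_AE) auto
 from integral_even_abs[OF this] show ?thesis by simp
qed

lemma sobolev_props:
 assumes f: "f \<in> sobolev_densities \<beta> L" and \<beta>: "\<beta> > 1 / 2" and L: "L > 0"
 shows "\<And>x. 0 \<le> f x" "integrable lborel f" "(LBINT x. f x) = 1" "integrable lborel (\<lambda>x. (f x)^2)"
  "integrable lborel (\<lambda>w. (\<bar>w\<bar> powr \<beta> * norm (fourier f w))^2)"
  "(LBINT w. (\<bar>w\<bar> powr \<beta> * norm (fourier f w))^2) \<le> 2 * pi * L"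
proof -
 have [measurable]: "f \<in> borel_measurable borel" and f0: "\<And>x. 0 \<le> f x" and f1: "(\<integral>\<^sup>+ x. ennreal (f x) \<partial>lborel) = 1"
  and f2: "integrable lborel (\<lambda>x. (f x)^2)"
  and S: "ennreal (1 / (2 * pi)) * (\<integral>\<^sup>+ \<omega>. ennreal ((\<bar>\<omega>\<bar> powr \<beta> * norm (fourier f \<omega>))^2) \<partial>lborel) \<le> ennreal L"
  using f by (auto simp: sobolev_densities_def L2_real_def)
 have hb: "has_bochner_integral lborel f 1" using f0 f1 by (intro has_bochner_integral_nn_integral) auto
 show "\<And>x. 0 \<le> f x" "integrable lborel (\<lambda>x. (f x)^2)" by fact+
 show "integrable lborel f" "(LBINT x. f x) = 1" using hb by (auto simp: hbi_iff)
 have [measurable]: "fourier f \<in> borel_measurable borel" unfolding fourier_eq_FT by measurable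
 let ?I = "\<integral>\<^sup>+ \<omega>. ennreal ((\<bar>\<omega>\<bar> powr \<beta> * norm (fourier f \<omega>))^2) \<partial>lborel"
 have "?I = ennreal (2 * pi) * (ennreal (1 / (2 * pi)) * ?I)"
  by (simp add: mult.assoc[symmetric] ennreal_mult'[symmetric])
 also have "... \<le> ennreal (2 * pi) * ennreal L" by (intro mult_left_mono S) simp
 also have "... = ennreal (2 * pi * L)" by (rule ennreal_mult'[symmetric]) simp
 finally have I: "?I \<le> ennreal (2 * pi * L)" .
 show i: "integrable lborel (\<lambda>w. (\<bar>w\<bar> powr \<beta> * norm (fourier f w))^2)"
  by (rule integrableI_nonneg) (use I in "auto intro: le_less_trans")
 have "ennreal (LBINT w. (\<bar>w\<bar> powr \<beta> * norm (fourier f w))^2) \<le> ennreal (2 * pi * L)"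
  using I nn_integral_eq_integral[OF i] by simp
 then show "(LBINT w. (\<bar>w\<bar> powr \<beta> * norm (fourier f w))^2) \<le> 2 * pi * L"
  using L by (simp add: ennreal_le_iff)
qed

definition sobolev_bound :: "real \<Rightarrow> real \<Rightarrow> real" where
 "sobolev_bound \<beta> L = 2 + 1 / (2 * \<beta> - 1) + pi * L"

text \<open>For |w| > 1 the AM-GM inequality bounds |phi| by half of |w|^(-2 \<beta>) + |w|^(2
  \<beta>) |phi|^2, which is integrable because \<beta> > 1/2. So phi is integrable and f, the
  inverse transform of phi, is bounded uniformly over the class. The three parts of
  \<open>sobolev_bound\<close> are the three integrals.\<close>

lemma sobolev_sample_density:
 assumes f: "f \<in> sobolev_densities \<beta> L" and \<beta>: "\<beta> > 1 / 2" and L: "L > 0" and n: "n \<ge> 2"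
 shows "sample_density f n (sobolev_bound \<beta> L)" "(LBINT w. (norm (fourier f w))^2) \<le> sobolev_bound \<beta> L"
proof -
 let ?\<phi> = "fourier f"
 note F = sobolev_props[OF f \<beta> L]
 have [measurable]: "f \<in> borel_measurable borel" using F(2) by auto
 have [measurable]: "?\<phi> \<in> borel_measurable borel" unfolding fourier_eq_FT by measurable
 have f': "integrable lborel (\<lambda>x. complex_of_real (f x))" "integrable lborel (\<lambda>x. (norm (complex_of_real (f x)))^2)"
  using F by auto
 have n1: "norm (?\<phi> w) \<le> 1" for w
 proof -
  have "norm (?\<phi> w) \<le> (LBINT x. norm (complex_of_real (f x)))"
   unfolding fourier_eq_FT by (rule norm_FT_le[OF f'(1)])
  then show ?thesis using F(1,3) by simp
 qed
 define G where "G w = indicator {-1..1} w + (indicator {1<..} \<bar>w\<bar> * \<bar>w\<bar> powr (- 2 * \<beta>) + (\<bar>w\<bar> powr \<beta> * norm (?\<phi> w))^2) / 2" for w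
 note T = integral_powr_tail[OF \<beta>, unfolded hbi_iff]
 have iG: "integrable lborel G" unfolding G_def[abs_def] using T F(5) by auto
 have IG: "(LBINT w. G w) \<le> sobolev_bound \<beta> L"
 proof -
  have "(LBINT w. G w) = 2 + (2 / (2 * \<beta> - 1) + (LBINT w. (\<bar>w\<bar> powr \<beta> * norm (?\<phi> w))^2)) / 2"
   unfolding G_def using T F(5) by simp
  also have "... \<le> 2 + (2 / (2 * \<beta> - 1) + 2 * pi * L) / 2" using F(6) by (simp add: mult_ac)
  also have "... = sobolev_bound \<beta> L" by (simp add: sobolev_bound_def)
  finally show ?thesis .
 qed
 have le: "norm (?\<phi> w) \<le> G w" for w
 proof (cases "\<bar>w\<bar> \<le> 1")
  case True
  then have "indicator {-1..1} w = (1::real)" by (auto simp: indicator_def)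
  moreover have "0 \<le> (indicator {1<..} \<bar>w\<bar> * \<bar>w\<bar> powr (- 2 * \<beta>) + (\<bar>w\<bar> powr \<beta> * norm (?\<phi> w))^2) / 2" by simp
  ultimately show ?thesis using n1[of w] unfolding G_def by linarith
 next
  case False
  have e: "norm (?\<phi> w) = \<bar>w\<bar> powr (- \<beta>) * (\<bar>w\<bar> powr \<beta> * norm (?\<phi> w))"
   using False by (simp add: powr_minus)
  have "\<bar>w\<bar> powr (- \<beta>) * (\<bar>w\<bar> powr \<beta> * norm (?\<phi> w)) \<le> ((\<bar>w\<bar> powr (- \<beta>))^2 + (\<bar>w\<bar> powr \<beta> * norm (?\<phi> w))^2) / 2"
   using sum_squares_bound[of "\<bar>w\<bar> powr (- \<beta>)" "\<bar>w\<bar> powr \<beta> * norm (?\<phi> w)"] by (simp add: mult_ac)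
  with e have "norm (?\<phi> w) \<le> ((\<bar>w\<bar> powr (- \<beta>))^2 + (\<bar>w\<bar> powr \<beta> * norm (?\<phi> w))^2) / 2"
   by (rule ord_eq_le_trans)
  also have "(\<bar>w\<bar> powr (- \<beta>))^2 = \<bar>w\<bar> powr (- 2 * \<beta>)" by (simp add: power2_eq_square powr_add[symmetric])
  finally show ?thesis using False by (auto simp: G_def indicator_def)
 qed
 have i\<phi>: "integrable lborel ?\<phi>"
  by (rule L1_bound[OF iG]) (measurable, use le in "auto intro: order_trans[OF le abs_ge_self]")
 have I\<phi>: "(LBINT w. norm (?\<phi> w)) \<le> sobolev_bound \<beta> L"
  using i\<phi> iG le by (intro order_trans[OF integral_mono IG]) auto
 have sq: "(norm (?\<phi> w))^2 \<le> norm (?\<phi> w)" for w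
  using mult_left_le[OF n1[of w], of "norm (?\<phi> w)"] by (simp add: power2_eq_square)
 have i\<phi>2: "integrable lborel (\<lambda>w. (norm (?\<phi> w))^2)"
  using Plancherel(1)[OF f'] by (simp add: fourier_eq_FT)
 show "(LBINT w. (norm (?\<phi> w))^2) \<le> sobolev_bound \<beta> L"
  using i\<phi> i\<phi>2 sq by (intro order_trans[OF integral_mono I\<phi>]) auto
 note P = Plancherel_mixed[OF f' i\<phi> i\<phi>2]
 \<comment> \<open>With G = phi the mixed isometry becomes Fourier inversion: the distance between f
   and \<open>IFT\<close> of its transform is zero.\<close>
 have "(LBINT x. (norm (complex_of_real (f x) - IFT ?\<phi> x))^2) = 0"
  using P(3) by (simp add: fourier_eq_FT)
 then have "AE x in lborel. (norm (complex_of_real (f x) - IFT ?\<phi> x))^2 = 0"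
  using P(1) by (subst (asm) integral_nonneg_eq_0_iff_AE) auto
 then have "AE x in lborel. f x \<le> sobolev_bound \<beta> L"
 proof eventually_elim
  case (elim x)
  have "f x = norm (IFT ?\<phi> x)" using elim F(1)[of x] by (metis abs_of_nonneg norm_of_real right_minus_eq zero_eq_power2 norm_eq_zero)
  also have "... \<le> (LBINT w. norm (?\<phi> w)) / (2 * pi)"
   unfolding IFT_def by (simp add: norm_divide norm_mult divide_right_mono norm_FT_le[OF i\<phi>])
  also have "... \<le> sobolev_bound \<beta> L / 1"
   using I\<phi> pi_gt3 by (intro frac_le order_trans[OF _ I\<phi>] integral_nonneg_AE) auto
  finally show ?case by simp
 qed
 then show "sample_density f n (sobolev_bound \<beta> L)"
  by unfold_locales (use F n in auto)
qed

definition pinsker_filter :: "real \<Rightarrow> real \<Rightarrow> real \<Rightarrow> real" where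
 "pinsker_filter \<beta> W w = max 0 (1 - (\<bar>w\<bar> / W) powr \<beta>)"

lemma pinsker_filter_spectra:
 assumes "\<beta> > 0" "0 < W" "W \<le> real n"
 shows "pinsker_filter \<beta> W \<in> spectra n"
proof -
 have "antimono_on {0..} (pinsker_filter \<beta> W)"
  unfolding monotone_on_def
 proof (intro ballI impI)
  fix x y :: real assume "x \<in> {0..}" "x \<le> y"
  then have "(\<bar>x\<bar> / W) powr \<beta> \<le> (\<bar>y\<bar> / W) powr \<beta>" using assms by (intro powr_mono2 divide_right_mono) auto
  then show "pinsker_filter \<beta> W y \<le> pinsker_filter \<beta> W x" unfolding pinsker_filter_def by (intro max.mono) auto
 qed
 moreover have "1 \<le> (\<bar>w\<bar> / W) powr \<beta>" if "\<bar>w\<bar> > real n" for w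
  using assms that by (intro ge_one_powr_ge_zero) auto
 ultimately show ?thesis by (auto simp: spectra_def pinsker_filter_def)
qed

lemma pinsker_filter_norm:
 assumes \<beta>: "\<beta> > 0" and W: "0 < W"
 shows "has_bochner_integral lborel (\<lambda>w. (pinsker_filter \<beta> W w)^2) (2 * (W * (2 * \<beta>\<^sup>2 / ((\<beta> + 1) * (2 * \<beta> + 1)))))"
proof -
 have "((\<lambda>x. 1 - (2 / W powr \<beta>) * x powr \<beta> + (1 / W powr (2 * \<beta>)) * x powr (2 * \<beta>)) has_integral
   (W - 0) - (2 / W powr \<beta>) * (W powr (\<beta> + 1) / (\<beta> + 1)) + (1 / W powr (2 * \<beta>)) * (W powr (2 * \<beta> + 1) / (2 * \<beta> + 1))) {0..W}"
  using W \<beta> has_integral_const_real[of "1::real" 0 W]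
  by (intro has_integral_add has_integral_diff has_integral_mult_right has_integral_powr_from_0) auto
 moreover have "(W - 0) - (2 / W powr \<beta>) * (W powr (\<beta> + 1) / (\<beta> + 1)) + (1 / W powr (2 * \<beta>)) * (W powr (2 * \<beta> + 1) / (2 * \<beta> + 1))
   = W * (2 * \<beta>\<^sup>2 / ((\<beta> + 1) * (2 * \<beta> + 1)))"
 proof -
  have "\<beta> + 1 \<noteq> 0" "2 * \<beta> + 1 \<noteq> 0" using \<beta> by auto
  then have "W - 2 * W / (\<beta> + 1) + W / (2 * \<beta> + 1) = W * (2 * \<beta>\<^sup>2 / ((\<beta> + 1) * (2 * \<beta> + 1)))"
   by (simp add: divide_simps) (simp add: algebra_simps power2_eq_square)
  then show ?thesis using W by (simp add: powr_add)
 qed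
 moreover have sq: "1 - (2 / W powr \<beta>) * x powr \<beta> + (1 / W powr (2 * \<beta>)) * x powr (2 * \<beta>) = (1 - (x / W) powr \<beta>)^2" if "0 \<le> x" for x
 proof -
  have "x powr (2 * \<beta>) = (x powr \<beta>)^2" "W powr (2 * \<beta>) = (W powr \<beta>)^2" by (simp_all add: power2_eq_square powr_add[symmetric])
  then show ?thesis using W that by (simp add: powr_divide power2_diff power_divide)
 qed
 ultimately have "((\<lambda>x. (1 - (x / W) powr \<beta>)^2) has_integral W * (2 * \<beta>\<^sup>2 / ((\<beta> + 1) * (2 * \<beta> + 1)))) {0..W}"
  by (subst has_integral_cong[of _ _ "\<lambda>x. 1 - (2 / W powr \<beta>) * x powr \<beta> + (1 / W powr (2 * \<beta>)) * x powr (2 * \<beta>)"]) auto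
 then have "has_bochner_integral lborel (\<lambda>x. indicator {0..W} x * (1 - (x / W) powr \<beta>)^2) (W * (2 * \<beta>\<^sup>2 / ((\<beta> + 1) * (2 * \<beta> + 1))))"
  using W \<beta> by (intro has_bochner_integral_has_integral) auto
 moreover have "AE x in lborel. x \<noteq> (0::real)" by (rule AE_lborel_singleton)
 then have "AE x in lborel. indicator {0..W} x * (1 - (x / W) powr \<beta>)^2 = indicator {0<..} x * (max 0 (1 - (x / W) powr \<beta>))^2"
 proof eventually_elim
  case (elim x)
  have "(x / W) powr \<beta> \<le> 1" if "0 < x" "x \<le> W" using that \<beta> W by (intro powr_le1) auto
  moreover have "1 \<le> (x / W) powr \<beta>" if "x > W" using that \<beta> W by (intro ge_one_powr_ge_zero) auto
  ultimately show ?case using elim by (cases "x \<le> W") (auto simp: indicator_def max_def)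
 qed
 ultimately have "has_bochner_integral lborel (\<lambda>x. indicator {0<..} x * (max 0 (1 - (x / W) powr \<beta>))^2) (W * (2 * \<beta>\<^sup>2 / ((\<beta> + 1) * (2 * \<beta> + 1))))"
  by (subst (asm) has_bochner_integral_cong_AE) auto
 from integral_even_abs[OF this] show ?thesis unfolding pinsker_filter_def by simp
qed

text \<open>The filter satisfies (1 - h)^2 <= (|w| / W)^(2 \<beta>), so the squared bias is at most
  W^(-2 \<beta>) times the Sobolev budget for every f in the class. For this W, bias and variance
  add up to the Pinsker value.\<close>

lemma pinsker_filter_risk:
 assumes f: "f \<in> sobolev_densities \<beta> L" and \<beta>: "\<beta> > 1 / 2" and L: "L > 0" and n: "n \<ge> 2"
 shows "sample_density.D f n (pinsker_filter \<beta> (pinsker_W \<beta> L n)) \<le> 2 * pi * pinsker \<beta> L n"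
proof -
 interpret sample_density f n "sobolev_bound \<beta> L" by (rule sobolev_sample_density[OF f \<beta> L n])
 define W where "W = pinsker_W \<beta> L n"
 note F = sobolev_props[OF f \<beta> L]
 have W: "W > 0" using \<beta> L n unfolding W_def pinsker_W_def by simp
 have W2: "W powr (2 * \<beta> + 1) = pi * real n * L * (\<beta> + 1) * (2 * \<beta> + 1) / \<beta>"
  unfolding W_def pinsker_W_def using \<beta> L n by (simp add: powr_powr)
 have pt: "(1 - pinsker_filter \<beta> W w)^2 * (norm (\<phi> w))^2 \<le> W powr (- 2 * \<beta>) * (\<bar>w\<bar> powr \<beta> * norm (\<phi> w))^2" for w
 proof -
  have "\<bar>1 - pinsker_filter \<beta> W w\<bar> \<le> (\<bar>w\<bar> / W) powr \<beta>" unfolding pinsker_filter_def by (auto simp: max_def)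
  then have "\<bar>1 - pinsker_filter \<beta> W w\<bar>\<^sup>2 \<le> ((\<bar>w\<bar> / W) powr \<beta>)^2" by (intro power_mono) auto
  also have "... = W powr (- 2 * \<beta>) * (\<bar>w\<bar> powr \<beta>)^2"
  proof -
   have "(\<bar>w\<bar> / W) powr \<beta> = W powr (- \<beta>) * \<bar>w\<bar> powr \<beta>" using W by (simp add: powr_divide powr_minus_divide)
   moreover have "(W powr (- \<beta>))^2 = W powr (- 2 * \<beta>)" by (simp add: power2_eq_square powr_add[symmetric])
   ultimately show ?thesis by (simp add: power_mult_distrib)
  qed
  finally have "(1 - pinsker_filter \<beta> W w)^2 * (norm (\<phi> w))^2 \<le> W powr (- 2 * \<beta>) * (\<bar>w\<bar> powr \<beta>)^2 * (norm (\<phi> w))^2"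
   by (intro mult_right_mono) auto
  then show ?thesis by (simp add: power_mult_distrib mult.assoc)
 qed
 have "(LBINT w. (1 - pinsker_filter \<beta> W w)^2 * (norm (\<phi> w))^2) \<le> (LBINT w. W powr (- 2 * \<beta>) * (\<bar>w\<bar> powr \<beta> * norm (\<phi> w))^2)"
  using F(5) pt by (intro integral_mono_AE') auto
 also have "... \<le> W powr (- 2 * \<beta>) * (2 * pi * L)" using F(6) by (simp add: mult_left_mono)
 finally have b: "(LBINT w. (1 - pinsker_filter \<beta> W w)^2 * (norm (\<phi> w))^2) \<le> W powr (- 2 * \<beta>) * (2 * pi * L)" .
 have "D (pinsker_filter \<beta> W) \<le> 2 * (W * (2 * \<beta>\<^sup>2 / ((\<beta> + 1) * (2 * \<beta> + 1)))) / real n + W powr (- 2 * \<beta>) * (2 * pi * L)"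
  unfolding D_def using b pinsker_filter_norm[of \<beta> W] \<beta> W by (simp add: hbi_iff)
 also have "W powr (- 2 * \<beta>) * (2 * pi * L) = 2 * W * \<beta> / (real n * ((\<beta> + 1) * (2 * \<beta> + 1)))"
 proof -
  have "2 * pi * L = 2 * W powr (2 * \<beta> + 1) * \<beta> / (real n * ((\<beta> + 1) * (2 * \<beta> + 1)))"
   unfolding W2 using \<beta> n by (simp add: divide_simps)
  moreover have "W powr (- 2 * \<beta>) * W powr (2 * \<beta> + 1) = W" using W by (simp add: powr_add[symmetric])
  then have "W powr (- 2 * \<beta>) * (2 * W powr (2 * \<beta> + 1) * \<beta> / K) = 2 * W * \<beta> / K" for K
   by (simp add: mult.assoc[symmetric] mult.commute[of _ 2])
  ultimately show ?thesis by metis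
 qed
 also have "2 * (W * (2 * \<beta>\<^sup>2 / ((\<beta> + 1) * (2 * \<beta> + 1)))) / real n + 2 * W * \<beta> / (real n * ((\<beta> + 1) * (2 * \<beta> + 1))) = 2 * pi * (W / (pi * real n) * (\<beta> / (\<beta> + 1)))"
 proof -
  have "\<beta> + 1 \<noteq> 0" "2 * \<beta> + 1 \<noteq> 0" "real n \<noteq> 0" using \<beta> n by auto
  then show ?thesis by (simp add: divide_simps) (simp add: algebra_simps power2_eq_square)
 qed
 finally show ?thesis unfolding W_def pinsker_def .
qed

lemma pinsker_W_eq:
 "pinsker_W \<beta> L n = (pi * L * (\<beta> + 1) * (2 * \<beta> + 1) / \<beta>) powr (1 / (2 * \<beta> + 1)) * real n powr (1 / (2 * \<beta> + 1))"
proof -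
 have "pi * real n * L * (\<beta> + 1) * (2 * \<beta> + 1) / \<beta> = (pi * L * (\<beta> + 1) * (2 * \<beta> + 1) / \<beta>) * real n" by simp
 then show ?thesis unfolding pinsker_W_def by (simp only: powr_mult)
qed

lemma mise_cv_le:
 assumes K: "\<And>X. X \<in> {..<n} \<rightarrow>\<^sub>E UNIV \<Longrightarrow> is_arg_min (cv n X) (\<lambda>K. K \<in> bandlimited_kernels n) (K X)"
  and f: "f \<in> sobolev_densities \<beta> L" and \<beta>: "\<beta> > 1 / 2" and L: "L > 0" and n: "n \<ge> 2"
  and W: "pinsker_W \<beta> L n \<le> real n" and \<epsilon>: "\<epsilon> > 0"
 defines "B \<equiv> sobolev_bound \<beta> L"
 shows "mise n (\<lambda>X. kde n (K X) X) f \<le> ennreal ((1 + 2 * \<epsilon>) * pinsker \<beta> L n +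
  (32 + \<epsilon> * (2 * B + 148) + (81 * \<epsilon> + 4 / \<epsilon>) * (10 * pi * B)) * (3 + 5 * ln (real n)) ^ 4 / real n)"
proof -
 interpret sample_density f n "sobolev_bound \<beta> L" by (rule sobolev_sample_density[OF f \<beta> L n])
 let ?h = "pinsker_filter \<beta> (pinsker_W \<beta> L n)"
 have B0: "B > 0" unfolding B_def sobolev_bound_def using \<beta> L by (intro add_pos_pos) auto
 \<comment> \<open>The mesh n / 2^m is then at most n^(-2), so the discretization error is of order
   1/n, while m and ln (2^m) stay of order ln n.\<close>
 define m where "m = nat \<lceil>3 * log 2 (real n)\<rceil>"
 define r where "r = 8 * (real n / 2 ^ m)"
 define H where "H X = (SOME h. h \<in> spectra n \<and> K (restrict X {..<n}) = kernel_of h \<and> (\<forall>g\<in>spectra n. crit n X h \<le> crit n X g))" for X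
 have H: "H X \<in> spectra n" "K (restrict X {..<n}) = kernel_of (H X)" "\<And>g. g \<in> spectra n \<Longrightarrow> crit n X (H X) \<le> crit n X g" for X
  using someI_ex[OF minimizer_spectrum[OF K], of X] unfolding H_def[symmetric] by auto
 have W0: "pinsker_W \<beta> L n > 0" using \<beta> L n unfolding pinsker_W_def by simp
 have h: "?h \<in> spectra n" by (rule pinsker_filter_spectra) (use \<beta> W W0 in auto)
 define Q where "Q = (1 + 2 * \<epsilon>) * D ?h + 4 * r + \<epsilon> * (2 * energy / real n + 18 * r + 4 / real n)
   + (81 * \<epsilon> + 4 / \<epsilon>) * (10 * pi * B / real n * (real (Suc m) * (1 + ln (2 * (real n)^2 * 2 ^ m)))^2)"
 let ?loss = "\<lambda>X. LBINT w. (norm (of_real (H X w) * ecf n X w - \<phi> w))^2"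
 have "mise n (\<lambda>X. kde n (K X) X) f = (\<integral>\<^sup>+ X. ennreal (?loss X / (2 * pi)) \<partial>P)"
  unfolding mise_def iid_sample_eq
 proof (rule nn_integral_cong)
  fix X assume "X \<in> space P"
  then have "restrict X {..<n} = X" by (auto simp: space_PiM PiE_def extensional_restrict)
  then have KX: "K X = kernel_of (H X)" using H(2)[of X] by simp
  note kl = kde_loss[OF H(1)[of X] f_int f_sq, of X]
  show "(\<integral>\<^sup>+ x. ennreal ((kde n (K X) X x - f x)^2) \<partial>lborel) = ennreal (?loss X / (2 * pi))"
   unfolding KX kl(3)[symmetric] by (intro nn_integral_eq_integral kl) auto
 qed
 also have "... \<le> ennreal (Q / (2 * pi))"
  unfolding Q_def B_def r_def by (rule cv_oracle_inequality[OF H(1,3) h \<epsilon>])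
 also have "... \<le> ennreal ((1 + 2 * \<epsilon>) * pinsker \<beta> L n +
  (32 + \<epsilon> * (2 * B + 148) + (81 * \<epsilon> + 4 / \<epsilon>) * (10 * pi * B)) * (3 + 5 * ln (real n)) ^ 4 / real n)"
 proof (rule ennreal_leI)
  \<comment> \<open>One quantity that dominates both m + 1 and the logarithmic factor of
    \<open>chain_B\<close>; their product enters squared, hence l ^ 4.\<close>
  define l where "l = 3 + 5 * ln (real n)"
  have ln0: "ln (real n) \<ge> 0" using n by simp
  have l1: "1 \<le> l ^ 4" "3 \<le> l" using ln0 by (auto simp: l_def intro!: one_le_power)
  have n0: "real n > 0" using n by simp
  have m: "real m \<ge> 3 * log 2 (real n)" "real m \<le> 3 * log 2 (real n) + 1"
   using n unfolding m_def by (auto simp: of_nat_nat ceiling_correct)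
  have log2: "log 2 (real n) * 3 \<le> 5 * ln (real n)"
  proof -
   have "3 / 5 \<le> ln (2::real)" using ln2_ge_two_thirds by simp
   then have "3 * ln (real n) \<le> 5 * ln 2 * ln (real n)" using ln0 by (intro mult_right_mono) auto
   then show ?thesis by (simp add: log_def divide_le_eq mult_ac)
  qed
  have pw: "2 powr (3 * log 2 (real n)) = real n ^ 3"
   using n0 by (simp add: powr_powr[symmetric] powr_log_cancel mult.commute[of 3] powr_numeral)
  have "real n ^ 3 \<le> 2 powr real m" unfolding pw[symmetric] using m(1) by simp
  then have m3: "real n ^ 3 \<le> 2 ^ m" by (simp add: powr_realpow)
  have "2 powr real m \<le> 2 powr (3 * log 2 (real n) + 1)" using m(2) by simp
  then have m4: "2 ^ m \<le> 2 * real n ^ 3" by (simp add: powr_realpow powr_add pw)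
  have r: "r \<le> 8 / real n" 
  proof -
   have "real n / 2 ^ m \<le> real n / real n ^ 3" using m3 n0 by (intro divide_left_mono) auto
   also have "... = 1 / (real n * real n)" using n0 by (simp add: power3_eq_cube)
   also have "... \<le> 1 / (real n * 1)" using n0 n by (intro divide_left_mono mult_left_mono) auto
   finally show ?thesis unfolding r_def by simp
  qed
  have q: "real (Suc m) * (1 + ln (2 * (real n)^2 * 2 ^ m)) \<le> l * l"
  proof (rule mult_mono)
   show "real (Suc m) \<le> l" using m(2) log2 unfolding l_def by simp
   have "2 * (real n)^2 * 2 ^ m \<le> 2 * (real n)^2 * (2 * real n ^ 3)" using m4 by (intro mult_left_mono) auto
   also have "... = 4 * real n ^ 5" by (simp add: power_add[symmetric] numeral_eq_Suc)
   finally have "ln (2 * (real n)^2 * 2 ^ m) \<le> ln (4 * real n ^ 5)" using n0 by (intro ln_mono) auto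
   also have "... = ln 4 + 5 * ln (real n)" using n0 by (simp add: ln_mult ln_realpow)
   also have "ln 4 \<le> (2::real)" using ln_add_one_self_le_self2[of 3] ln2_le_25_over_36 ln_realpow[of 2 2] by simp
   finally show "1 + ln (2 * (real n)^2 * 2 ^ m) \<le> l" by (simp add: l_def)
   have "1 \<le> 2 * (real n)^2 * 2 ^ m"
   proof -
    have "(1::real) * 1 * 1 \<le> 2 * (real n)^2 * 2 ^ m" using n by (intro mult_mono) auto
    then show ?thesis by simp
   qed
   then show "0 \<le> 1 + ln (2 * (real n)^2 * 2 ^ m)" by simp
  qed (use l1 in simp)
  have q0: "0 \<le> real (Suc m) * (1 + ln (2 * (real n)^2 * 2 ^ m))"
  proof -
   have "(1::real) * 1 * 1 \<le> 2 * (real n)^2 * 2 ^ m" using n by (intro mult_mono) auto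
   then show ?thesis by (intro mult_nonneg_nonneg add_nonneg_nonneg) auto
  qed
  have q2: "(real (Suc m) * (1 + ln (2 * (real n)^2 * 2 ^ m)))^2 \<le> l ^ 4"
   using power_mono[OF q q0, of 2] by (simp add: power_mult_distrib flip: power_add)
  have Dh: "D ?h \<le> 2 * pi * pinsker \<beta> L n" by (rule pinsker_filter_risk[OF f \<beta> L n])
  have en: "energy \<le> B" unfolding energy_def B_def by (rule sobolev_sample_density(2)[OF f \<beta> L n])
  have en0: "0 \<le> energy" unfolding energy_def by (intro integral_nonneg_AE AE_I2) simp
  define R where "R = 32 + \<epsilon> * (2 * B + 148) + (81 * \<epsilon> + 4 / \<epsilon>) * (10 * pi * B)"
  have "Q \<le> (1 + 2 * \<epsilon>) * (2 * pi * pinsker \<beta> L n) + 4 * (8 / real n) + \<epsilon> * (2 * B / real n + 18 * (8 / real n) + 4 / real n)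
   + (81 * \<epsilon> + 4 / \<epsilon>) * (10 * pi * B / real n * l ^ 4)"
   unfolding Q_def using Dh r en \<epsilon> q2 B0 n0
   by (intro add_mono mult_left_mono divide_right_mono) auto
  also have "... = (1 + 2 * \<epsilon>) * (2 * pi * pinsker \<beta> L n) + ((32 + \<epsilon> * (2 * B + 148)) * 1 + (81 * \<epsilon> + 4 / \<epsilon>) * (10 * pi * B) * l ^ 4) / real n"
   using n0 by (simp add: add_divide_distrib ring_distribs)
  also have "... \<le> (1 + 2 * \<epsilon>) * (2 * pi * pinsker \<beta> L n) + ((32 + \<epsilon> * (2 * B + 148)) * l ^ 4 + (81 * \<epsilon> + 4 / \<epsilon>) * (10 * pi * B) * l ^ 4) / real n"
   using l1 \<epsilon> B0 n0 by (intro add_left_mono divide_right_mono add_right_mono mult_left_mono) auto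
  also have "... = (1 + 2 * \<epsilon>) * (2 * pi * pinsker \<beta> L n) + R * l ^ 4 / real n"
   unfolding R_def by (simp add: distrib_right)
  finally have "Q / (2 * pi) \<le> ((1 + 2 * \<epsilon>) * (2 * pi * pinsker \<beta> L n) + R * l ^ 4 / real n) / (2 * pi)"
   by (intro divide_right_mono) auto
  also have "... = (1 + 2 * \<epsilon>) * pinsker \<beta> L n + R * l ^ 4 / real n / (2 * pi)"
   by (simp add: add_divide_distrib)
  also have "... \<le> (1 + 2 * \<epsilon>) * pinsker \<beta> L n + R * l ^ 4 / real n / 1"
  proof (intro add_left_mono divide_left_mono)
   show "0 \<le> R * l ^ 4 / real n"
    unfolding R_def using \<epsilon> B0 by (intro divide_nonneg_nonneg mult_nonneg_nonneg add_nonneg_nonneg) auto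
   show "1 \<le> 2 * pi" using pi_gt3 by linarith
  qed auto
  finally show "Q / (2 * pi) \<le> (1 + 2 * \<epsilon>) * pinsker \<beta> L n +
   (32 + \<epsilon> * (2 * B + 148) + (81 * \<epsilon> + 4 / \<epsilon>) * (10 * pi * B)) * (3 + 5 * ln (real n)) ^ 4 / real n"
   unfolding R_def l_def by simp
 qed
 finally show ?thesis .
qed

text \<open>The Pinsker value is of order n^(\<gamma> - 1) with \<gamma> > 0, so a remainder (ln
  n)^4 / n is negligible. Eventually W <= n as well, which makes the Pinsker filter an admissible
  competitor.\<close>

theorem max_risk_cv_upper:
 assumes K: "\<And>n X. n \<ge> 2 \<Longrightarrow> X \<in> {..<n} \<rightarrow>\<^sub>E UNIV \<Longrightarrow>
    is_arg_min (cv n X) (\<lambda>K. K \<in> bandlimited_kernels n) (K0 n X)"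
  and \<beta>: "\<beta> > 1 / 2" and L: "L > 0" and \<delta>: "\<delta> > 0"
 shows "\<forall>\<^sub>F n in sequentially. max_risk n \<beta> L (\<lambda>X. kde n (K0 n X) X) \<le> ennreal ((1 + \<delta>) * pinsker \<beta> L n)"
proof -
 define \<gamma> where "\<gamma> = 1 / (2 * \<beta> + 1)"
 define c where "c = (pi * L * (\<beta> + 1) * (2 * \<beta> + 1) / \<beta>) powr \<gamma>"
 define p where "p = c / pi * (\<beta> / (\<beta> + 1))"
 define B where "B = sobolev_bound \<beta> L"
 define \<epsilon> where "\<epsilon> = \<delta> / 4"
 define R where "R = 32 + \<epsilon> * (2 * B + 148) + (81 * \<epsilon> + 4 / \<epsilon>) * (10 * pi * B)"
 have \<gamma>: "\<gamma> > 0" "\<gamma> < 1" using \<beta> by (auto simp: \<gamma>_def)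
 have c: "c > 0" unfolding c_def using \<beta> L by simp
 have p: "p > 0" unfolding p_def using c \<beta> by simp
 have \<epsilon>: "\<epsilon> > 0" using \<delta> by (simp add: \<epsilon>_def)
 have pin: "pinsker \<beta> L n = p * (real n powr \<gamma> / real n)" for n
  by (simp add: pinsker_def pinsker_W_eq p_def c_def \<gamma>_def mult_ac)
 have "((\<lambda>n::nat. (3 + 5 * ln (real n)) ^ 4 / real n powr \<gamma>) \<longlonglongrightarrow> 0)" using \<gamma> by real_asymp
 then have "((\<lambda>n::nat. R * ((3 + 5 * ln (real n)) ^ 4 / real n powr \<gamma>)) \<longlonglongrightarrow> R * 0)" by (intro tendsto_intros)
 then have e1: "\<forall>\<^sub>F n::nat in sequentially. R * ((3 + 5 * ln (real n)) ^ 4 / real n powr \<gamma>) < \<delta> / 2 * p"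
  using \<delta> p by (intro order_tendstoD) auto
 have "((\<lambda>n::nat. c * real n powr \<gamma> / real n) \<longlonglongrightarrow> 0)" using \<gamma> by real_asymp
 then have e2: "\<forall>\<^sub>F n::nat in sequentially. c * real n powr \<gamma> / real n < 1" by (intro order_tendstoD) auto
 show ?thesis
  using e1 e2 eventually_ge_at_top[of 2]
 proof eventually_elim
  case (elim n)
  have n0: "real n > 0" using elim by simp
  have "pinsker_W \<beta> L n = c * real n powr \<gamma>" unfolding c_def \<gamma>_def by (rule pinsker_W_eq)
  then have W: "pinsker_W \<beta> L n \<le> real n" using elim(2) n0 by (simp add: divide_less_eq)
  have "R * (3 + 5 * ln (real n)) ^ 4 / real n \<le> \<delta> / 2 * pinsker \<beta> L n"
  proof -
   have "R * (3 + 5 * ln (real n)) ^ 4 / real n = R * ((3 + 5 * ln (real n)) ^ 4 / real n powr \<gamma>) * (real n powr \<gamma> / real n)"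
    using n0 by simp
   also have "... \<le> (\<delta> / 2 * p) * (real n powr \<gamma> / real n)" using elim(1) n0 by (intro mult_right_mono) auto
   finally show ?thesis unfolding pin by simp
  qed
  then have le: "(1 + 2 * \<epsilon>) * pinsker \<beta> L n + R * (3 + 5 * ln (real n)) ^ 4 / real n \<le> (1 + \<delta>) * pinsker \<beta> L n"
  proof -
   assume a: "R * (3 + 5 * ln (real n)) ^ 4 / real n \<le> \<delta> / 2 * pinsker \<beta> L n"
   have "(1 + \<delta>) * pinsker \<beta> L n = (1 + 2 * \<epsilon>) * pinsker \<beta> L n + \<delta> / 2 * pinsker \<beta> L n" by (simp add: \<epsilon>_def algebra_simps)
   then show ?thesis using a by linarith
  qed
  show ?case
   unfolding max_risk_def
  proof (rule SUP_least)
   fix f assume f: "f \<in> sobolev_densities \<beta> L"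
   have "mise n (\<lambda>X. kde n (K0 n X) X) f \<le> ennreal ((1 + 2 * \<epsilon>) * pinsker \<beta> L n + R * (3 + 5 * ln (real n)) ^ 4 / real n)"
    unfolding R_def B_def by (rule mise_cv_le[OF K f \<beta> L _ W \<epsilon>]) (use elim in auto)
   also have "... \<le> ennreal ((1 + \<delta>) * pinsker \<beta> L n)" by (rule ennreal_leI[OF le])
   finally show "mise n (\<lambda>X. kde n (K0 n X) X) f \<le> ennreal ((1 + \<delta>) * pinsker \<beta> L n)" .
  qed
 qed
qed

section \<open>The van Trees inequality\<close>

lemma PiM_density:
 fixes f :: "'i \<Rightarrow> 'a \<Rightarrow> real"
 assumes "finite I" "sigma_finite_measure N" "\<And>i. f i \<in> borel_measurable N" "\<And>i x. 0 \<le> f i x"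
  "\<And>i. (\<integral>\<^sup>+ x. ennreal (f i x) \<partial>N) = 1"
 shows "Pi\<^sub>M I (\<lambda>i. density N (\<lambda>x. ennreal (f i x))) = density (Pi\<^sub>M I (\<lambda>_. N)) (\<lambda>x. ennreal (\<Prod>i\<in>I. f i (x i)))"
proof -
 note [measurable] = assms(3)
 have ps: "prob_space (density N (\<lambda>x. ennreal (f i x)))" for i
  using assms(3,5) by (intro prob_spaceI) (simp add: emeasure_density)
 interpret D: product_sigma_finite "\<lambda>i. density N (\<lambda>x. ennreal (f i x))"
  using ps by (auto simp: product_sigma_finite_def intro: prob_space_imp_sigma_finite)
 interpret N: product_sigma_finite "\<lambda>_. N" using assms(2) by (auto simp: product_sigma_finite_def)
 show ?thesis
 proof (rule D.PiM_eqI[symmetric])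
  fix A assume A: "\<And>i. i \<in> I \<Longrightarrow> A i \<in> sets (density N (\<lambda>x. ennreal (f i x)))"
  then have [measurable]: "i \<in> I \<Longrightarrow> A i \<in> sets N" for i by simp
  have "Pi\<^sub>E I A \<in> sets (Pi\<^sub>M I (\<lambda>_. N))" using assms(1) by (intro sets_PiM_I_finite) auto
  then have "emeasure (density (Pi\<^sub>M I (\<lambda>_. N)) (\<lambda>x. ennreal (\<Prod>i\<in>I. f i (x i)))) (Pi\<^sub>E I A)
   = (\<integral>\<^sup>+ x. ennreal (\<Prod>i\<in>I. f i (x i)) * indicator (Pi\<^sub>E I A) x \<partial>Pi\<^sub>M I (\<lambda>_. N))"
   by (subst emeasure_density) auto
  also have "... = (\<integral>\<^sup>+ x. (\<Prod>i\<in>I. ennreal (f i (x i)) * indicator (A i) (x i)) \<partial>Pi\<^sub>M I (\<lambda>_. N))"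
  proof (rule nn_integral_cong)
   fix x assume "x \<in> space (Pi\<^sub>M I (\<lambda>_. N))"
   then have "indicator (Pi\<^sub>E I A) x = (\<Prod>i\<in>I. indicator (A i) (x i) :: ennreal)"
    using assms(1) by (auto simp: indicator_def space_PiM PiE_def prod_zero_iff Pi_def)
   then show "ennreal (\<Prod>i\<in>I. f i (x i)) * indicator (Pi\<^sub>E I A) x = (\<Prod>i\<in>I. ennreal (f i (x i)) * indicator (A i) (x i))"
    using assms(4) by (simp add: prod.distrib prod_ennreal)
  qed
  also have "... = (\<Prod>i\<in>I. \<integral>\<^sup>+ x. ennreal (f i x) * indicator (A i) x \<partial>N)"
   by (rule N.product_nn_integral_prod) (use assms(1) in auto)
  also have "... = (\<Prod>i\<in>I. emeasure (density N (\<lambda>x. ennreal (f i x))) (A i))"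
   by (intro prod.cong refl) (simp add: emeasure_density)
  finally show "emeasure (density (Pi\<^sub>M I (\<lambda>_. N)) (\<lambda>x. ennreal (\<Prod>i\<in>I. f i (x i)))) (Pi\<^sub>E I A) = ..." .
 qed (use assms(1) in "auto intro!: sets_PiM_cong")
qed

section \<open>Beta priors on [-1, 1]\<close>

definition beta_norm :: "nat \<Rightarrow> real" where
 "beta_norm a = (LBINT s. indicator {-1..1::real} s * (1 - s\<^sup>2) ^ a)"

lemma beta_norm_integrable: "integrable lborel (\<lambda>s. indicator {-1..1::real} s * (1 - s\<^sup>2) ^ a)"
proof -
 have "continuous_on {-1..1::real} (\<lambda>s. (1 - s\<^sup>2) ^ a)" by (intro continuous_intros)
 from borel_integrable_compact[OF compact_Icc this] show ?thesis by simp
qed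

text \<open>The derivative of s (1 - s^2)^(a + 1) integrates to 0 over [-1, 1].\<close>

lemma beta_norm_Suc: "real (2 * a + 3) * beta_norm (Suc a) = real (2 * a + 2) * beta_norm a"
proof -
 have "has_bochner_integral lborel (\<lambda>s. ((1 - s\<^sup>2) ^ Suc a - 2 * real (Suc a) * (s\<^sup>2 * (1 - s\<^sup>2) ^ a)) * indicator {-1..1} s)
   (1 * (1 - 1\<^sup>2) ^ Suc a - (-1) * (1 - (-1)\<^sup>2) ^ Suc a)"
 proof (rule has_bochner_integral_FTC_Icc_real)
  fix s :: real
  show "((\<lambda>s. s * (1 - s\<^sup>2) ^ Suc a) has_field_derivative (1 - s\<^sup>2) ^ Suc a - 2 * real (Suc a) * (s\<^sup>2 * (1 - s\<^sup>2) ^ a)) (at s)"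
   by (rule DERIV_cong, (rule derivative_eq_intros refl)+) (simp add: power2_eq_square algebra_simps del: power_Suc)
 qed (auto intro!: continuous_intros)
 then have "(LBINT s. (real (2 * a + 3)) * (indicator {-1..1} s * (1 - s\<^sup>2) ^ Suc a) - real (2 * a + 2) * (indicator {-1..1} s * (1 - s\<^sup>2) ^ a)) = 0"
  by (simp add: hbi_iff algebra_simps)
 then show ?thesis unfolding beta_norm_def using beta_norm_integrable[of a] beta_norm_integrable[of "Suc a"]
  by (subst (asm) LINT_diff) auto
qed

lemma beta_norm_pos: "beta_norm a > 0"
proof (induction a)
 case 0
 then show ?case by (simp add: beta_norm_def)
next
 case (Suc a)
 have "real (2 * a + 3) * beta_norm (Suc a) > 0" unfolding beta_norm_Suc using Suc by simp
 then show ?case by (simp add: zero_less_mult_iff)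
qed

definition beta_prior :: "nat \<Rightarrow> real measure" where
 "beta_prior a = density lborel (\<lambda>s. ennreal (indicator {-1..1} s * (1 - s\<^sup>2) ^ a / beta_norm a))"

lemma sets_beta_prior[measurable_cong, simp]: "sets (beta_prior a) = sets borel"
 and space_beta_prior[simp]: "space (beta_prior a) = UNIV"
 by (auto simp: beta_prior_def)

lemma beta_density_nonneg: "0 \<le> indicator {-1..1} s * (1 - s\<^sup>2) ^ a / beta_norm a"
 using beta_norm_pos[of a] by (auto simp: indicator_def abs_square_le_1 abs_le_iff intro!: divide_nonneg_pos zero_le_power)

lemma prob_space_beta_prior: "prob_space (beta_prior a)"
proof
 have i: "integrable lborel (\<lambda>s. indicator {-1..1::real} s * (1 - s\<^sup>2) ^ a / beta_norm a)"
  using beta_norm_integrable[of a] by simp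
 have "emeasure (beta_prior a) UNIV = ennreal (LBINT s. indicator {-1..1} s * (1 - s\<^sup>2) ^ a / beta_norm a)"
  unfolding beta_prior_def using nn_integral_eq_integral[OF i AE_I2[OF beta_density_nonneg]]
  by (subst emeasure_density) auto
 also have "... = 1" using beta_norm_pos[of a] by (simp add: beta_norm_def[symmetric])
 finally show "emeasure (beta_prior a) (space (beta_prior a)) = 1" by simp
qed

text \<open>Since s^2 = 1 - (1 - s^2), the moment is a difference of consecutive normalizing
  constants.\<close>

lemma beta_prior_moment2: "(LINT s|beta_prior a. s\<^sup>2) = 1 / real (2 * a + 3)"
proof -
 have "(LINT s|beta_prior a. s\<^sup>2) = (LBINT s. (indicator {-1..1} s * (1 - s\<^sup>2) ^ a - indicator {-1..1} s * (1 - s\<^sup>2) ^ Suc a) / beta_norm a)"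
  unfolding beta_prior_def using beta_density_nonneg
  by (subst integral_density) (auto simp: algebra_simps intro!: LINT_cong)
 also have "... = (beta_norm a - beta_norm (Suc a)) / beta_norm a"
  using beta_norm_integrable[of a] beta_norm_integrable[of "Suc a"]
  by (simp only: integral_divide_zero beta_norm_def LINT_diff)
 also have "beta_norm (Suc a) = real (2 * a + 2) * beta_norm a / real (2 * a + 3)"
  using beta_norm_Suc[of a] by (simp add: field_simps)
 also have "(beta_norm a - real (2 * a + 2) * beta_norm a / real (2 * a + 3)) / beta_norm a = 1 / real (2 * a + 3)"
 proof -
  have "(b - (N - 1) * b / N) / b = 1 / N" if "N > 0" "b > 0" for b N :: real using that by (simp add: field_simps)
  from this[of "real (2 * a + 3)", OF _ beta_norm_pos[of a]] show ?thesis by simp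
 qed
 finally show ?thesis .
qed

lemma ennreal_integral_le_nn_integral:
 assumes "integrable M f"
 shows "ennreal (integral\<^sup>L M f) \<le> (\<integral>\<^sup>+ x. ennreal (f x) \<partial>M)"
proof -
 have "integral\<^sup>L M f \<le> (LINT x|M. max 0 (f x))" using assms by (intro integral_mono) auto
 then have "ennreal (integral\<^sup>L M f) \<le> ennreal (LINT x|M. max 0 (f x))" by (rule ennreal_leI)
 also have "... = (\<integral>\<^sup>+ x. ennreal (max 0 (f x)) \<partial>M)" using assms by (intro nn_integral_eq_integral[symmetric]) auto
 finally show ?thesis by simp
qed

lemma has_bochner_integral_cmult:
 fixes f :: "'a \<Rightarrow> real"
 shows "has_bochner_integral M f x \<Longrightarrow> has_bochner_integral M (\<lambda>y. c * f y) (c * x)"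
 by (rule has_bochner_integral_mult_right)

text \<open>Clipping makes the perturbed densities positive for every parameter value, which avoids
 almost-everywhere statements about the support of the prior.\<close>

definition clip :: "real \<Rightarrow> real" where "clip s = max (-1) (min 1 s)"

lemma clip_measurable[measurable]: "clip \<in> borel_measurable borel" unfolding clip_def by measurable
lemma abs_clip: "\<bar>clip s\<bar> \<le> 1" and clip_eq: "\<bar>s\<bar> \<le> 1 \<Longrightarrow> clip s = s"
 by (auto simp: clip_def abs_le_iff)

text \<open>The Fisher information of \<open>beta_prior a\<close> as a location family. Multiplied
  by the variance 1 / (2a + 3) it tends to 1 as a grows, the value for a Gaussian prior, so the loss
  against Pinsker's optimal prior vanishes.\<close>

definition beta_info :: "nat \<Rightarrow> real" where "beta_info a = real a * real (2 * a + 1) / real (a - 1)"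

text \<open>The integrand is q'^2 / q for q = (1 - s^2)^a; for a >= 2 the exponent a - 2 is an
  honest difference, and the recursion of \<open>beta_norm\<close> evaluates the integral.\<close>

lemma beta_info_integral:
 assumes "a \<ge> 2"
 shows "has_bochner_integral lborel (\<lambda>s. indicator {-1..1} s * (4 * (real a)^2 * s\<^sup>2 * (1 - s\<^sup>2) ^ (a - 2))) (beta_info a * beta_norm a)"
proof -
 from assms obtain b where b: "a = Suc (Suc b)" by (metis add_2_eq_Suc le_Suc_ex)
 have "has_bochner_integral lborel (\<lambda>s. indicator {-1..1::real} s * (1 - s\<^sup>2) ^ k) (beta_norm k)" for k
  using beta_norm_integrable by (simp add: hbi_iff beta_norm_def)
 from has_bochner_integral_cmult[OF has_bochner_integral_diff[OF this[of b] this[of "Suc b"]], of "4 * (real a)^2"]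
 have "has_bochner_integral lborel (\<lambda>s. indicator {-1..1} s * (4 * (real a)^2 * s\<^sup>2 * (1 - s\<^sup>2) ^ b)) (4 * (real a)^2 * (beta_norm b - beta_norm (Suc b)))"
  by (simp add: algebra_simps)
 moreover have "4 * (real a)^2 * (beta_norm b - beta_norm (Suc b)) = beta_info a * beta_norm a"
 proof -
  have "beta_norm (Suc b) = real (2 * Suc b + 3) * beta_norm a / real (2 * Suc b + 2)"
   using beta_norm_Suc[of "Suc b"] by (simp add: b field_simps)
  moreover have "beta_norm b - beta_norm (Suc b) = beta_norm (Suc b) / real (2 * b + 2)"
   using beta_norm_Suc[of b] by (simp add: field_simps)
  ultimately have "beta_norm b - beta_norm (Suc b) = real (2 * b + 5) * beta_norm a / real (2 * b + 4) / real (2 * b + 2)" by (simp add: add.commute)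
  then show ?thesis unfolding beta_info_def b by (simp add: divide_simps power2_eq_square) (simp add: algebra_simps)
 qed
 ultimately show ?thesis by (simp add: b)
qed

text \<open>Integration by parts in the parameter \<open>s\<close> for each fixed sample replaces the usual
 Cauchy-Schwarz argument with scores by an elementary inequality, valid because the density
 is affine in "s" and the prior vanishes at both ends.\<close>

lemma van_trees:
 fixes u v :: "real \<Rightarrow> real"
 assumes a: "a \<ge> 2" and uv[measurable]: "u \<in> borel_measurable borel" "v \<in> borel_measurable borel"
  and T: "T \<in> borel_measurable (Pi\<^sub>M {..<n} (\<lambda>_. lborel))" "\<And>X. \<bar>T X\<bar> \<le> B"
  and pos: "\<And>s x. \<bar>s\<bar> \<le> 1 \<Longrightarrow> 0 < u x + s * v x"
  and score: "\<And>s x. \<bar>s\<bar> \<le> 1 \<Longrightarrow> \<bar>v x\<bar> \<le> K * (u x + s * v x)"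
  and u: "has_bochner_integral lborel u 1" and v: "has_bochner_integral lborel v 0"
  and info: "\<And>s. \<bar>s\<bar> \<le> 1 \<Longrightarrow> (LBINT x. (v x)^2 / (u x + s * v x)) \<le> I"
 shows "ennreal (m\<^sup>2 / (real n * I + beta_info a)) \<le>
  (\<integral>\<^sup>+ s. (\<integral>\<^sup>+ X. ennreal ((T X - (b + m * clip s))^2) \<partial>iid_sample n (\<lambda>x. u x + clip s * v x)) \<partial>beta_prior a)"
proof -
 define \<mu> where "\<mu> = Pi\<^sub>M {..<n} (\<lambda>_. lborel :: real measure)"
 interpret product_sigma_finite "\<lambda>_. lborel :: real measure" by standard
 interpret \<mu>: sigma_finite_measure \<mu> unfolding \<mu>_def by (rule sigma_finite) simp
 interpret pair_sigma_finite lborel \<mu> ..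
 define f where "f s x = u x + s * v x" for s x
 define h where "h s X = (\<Prod>i<n. f s (X i))" for s :: real and X :: "nat \<Rightarrow> real"
 define S where "S s X = (\<Sum>i<n. v (X i) / f s (X i))" for s :: real and X :: "nat \<Rightarrow> real"
 define q where "q s = (1 - s\<^sup>2) ^ a" for s :: real
 define q' where "q' s = - 2 * real a * s * (1 - s\<^sup>2) ^ (a - 1)" for s :: real
 \<comment> \<open>The score q' / q of the prior. At s = 1 and s = -1 division by zero makes it 0,
   and there q r^2 <= w replaces equality.\<close>
 define r where "r s = - 2 * real a * s / (1 - s\<^sup>2)" for s :: real
 define w where "w s = 4 * (real a)^2 * s\<^sup>2 * (1 - s\<^sup>2) ^ (a - 2)" for s :: real
 define Z where "Z = beta_norm a"
 define V where "V = real n * I + beta_info a"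
 \<comment> \<open>The maximizer of 2 c m - c^2 V, which turns the final bound into m^2 / V.\<close>
 define c where "c = m / V"
 have [measurable]: "T \<in> borel_measurable \<mu>" using T(1) by (simp add: \<mu>_def)
 have [measurable]: "(\<lambda>(s, X). h s X) \<in> borel_measurable (lborel \<Otimes>\<^sub>M \<mu>)" "(\<lambda>(s, X). S s X) \<in> borel_measurable (lborel \<Otimes>\<^sub>M \<mu>)"
  unfolding h_def S_def f_def \<mu>_def by measurable
 have [measurable]: "h s \<in> borel_measurable \<mu>" "S s \<in> borel_measurable \<mu>" "f s \<in> borel_measurable borel" for s
  unfolding h_def S_def f_def \<mu>_def by measurable
 have [measurable]: "q \<in> borel_measurable borel" "q' \<in> borel_measurable borel" unfolding q_def q'_def by measurable
 have f0: "0 < f s x" if "\<bar>s\<bar> \<le> 1" for s x using pos that by (simp add: f_def)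
 have h0: "0 < h s X" if "\<bar>s\<bar> \<le> 1" for s X unfolding h_def using f0 that by (intro prod_pos) auto
 have fI: "has_bochner_integral lborel (f s) 1" for s
  using has_bochner_integral_add[OF u has_bochner_integral_cmult[OF v, of s]] unfolding f_def by simp
 have fnn: "(\<integral>\<^sup>+ x. ennreal (f s x) \<partial>lborel) = 1" if "\<bar>s\<bar> \<le> 1" for s
  using fI[of s] f0[OF that] by (subst nn_integral_eq_integral) (auto simp: hbi_iff less_imp_le)
 have Ps: "prob_space (density lborel (\<lambda>x. ennreal (f s x)))" if "\<bar>s\<bar> \<le> 1" for s
  using fnn[OF that] by (intro prob_spaceI) (simp add: emeasure_density)
 have dens: "iid_sample n (f s) = density \<mu> (\<lambda>X. ennreal (h s X))" if "\<bar>s\<bar> \<le> 1" for s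
  unfolding iid_sample_def \<mu>_def h_def
  by (rule PiM_density) (use f0[OF that] fnn[OF that] in "auto simp: less_imp_le lborel.sigma_finite_measure_axioms")
 have PS: "prob_space (iid_sample n (f s))" if "\<bar>s\<bar> \<le> 1" for s
  unfolding iid_sample_def by (rule prob_space_PiM[OF Ps[OF that]])
 have hnn: "(\<integral>\<^sup>+ X. ennreal (h s X) \<partial>\<mu>) = 1" if "\<bar>s\<bar> \<le> 1" for s
  using prob_space.emeasure_space_1[OF PS[OF that]] unfolding dens[OF that] by (simp add: emeasure_density cong: nn_integral_cong)
 have hI: "has_bochner_integral \<mu> (h s) 1" if "\<bar>s\<bar> \<le> 1" for s
  by (rule has_bochner_integral_nn_integral) (use h0[OF that] hnn[OF that] in "auto simp: less_imp_le")
 have K0: "0 \<le> K"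
 proof -
  have "0 \<le> K * f 0 0" using score[of 0 0] by (simp add: f_def)
  then show ?thesis using f0[of 0 0] by (simp add: zero_le_mult_iff)
 qed
 have sc: "\<bar>v x / f s x\<bar> \<le> K" if "\<bar>s\<bar> \<le> 1" for s x
  using score[OF that, of x] f0[OF that, of x] by (simp add: f_def abs_divide divide_le_eq)
 have S_le: "\<bar>S s X\<bar> \<le> real n * K" if "\<bar>s\<bar> \<le> 1" for s X
 proof -
  have "\<bar>S s X\<bar> \<le> (\<Sum>i<n. K)" unfolding S_def by (intro order_trans[OF sum_abs] sum_mono sc that)
  then show ?thesis by simp
 qed
 have mom: "(LINT X|iid_sample n (f s). S s X) = 0" "(LINT X|iid_sample n (f s). (S s X)^2) \<le> real n * I" if s: "\<bar>s\<bar> \<le> 1" for s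
 proof -
  have m0: "(LINT x|density lborel (\<lambda>x. ennreal (f s x)). v x / f s x) = 0"
   using v f0[OF s] by (subst integral_density) (auto simp: less_imp_le less_imp_neq[symmetric] hbi_iff)
  have "(LINT x|density lborel (\<lambda>x. ennreal (f s x)). (v x / f s x)^2) = (LBINT x. (v x)^2 / f s x)"
   using f0[OF s] by (subst integral_density)
    (auto simp: less_imp_le less_imp_neq[symmetric] power2_eq_square intro!: LINT_cong)
  also have "... \<le> I" using info[OF s] by (simp add: f_def)
  finally have m2: "(LINT x|density lborel (\<lambda>x. ennreal (f s x)). (v x / f s x)^2) \<le> I" .
  note mm = iid_sum_moments[of "{..<n}" "\<lambda>_. density lborel (\<lambda>x. ennreal (f s x))" "\<lambda>_ x. v x / f s x" K,
    OF finite_lessThan Ps[OF s] _ sc[OF s] m0, folded iid_sample_def S_def]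
  show "(LINT X|iid_sample n (f s). S s X) = 0" by (rule mm(1)) simp
  have "(LINT X|iid_sample n (f s). (S s X)^2) = (\<Sum>i<n. LINT x|density lborel (\<lambda>x. ennreal (f s x)). (v x / f s x)^2)" by (rule mm(2)) simp
  also have "... \<le> (\<Sum>i<n. I)" by (intro sum_mono m2)
  finally show "(LINT X|iid_sample n (f s). (S s X)^2) \<le> real n * I" by simp
 qed
 \<comment> \<open>The part of the s-derivative of (T - (b + m s)) h q in which the product h q is
   differentiated; the other part is - m h q.\<close>
 define G where "G s X = (T X - (b + m * s)) * (h s X * S s X * q s + h s X * q' s)" for s X
 have q01: "0 \<le> q s" "q s \<le> 1" "\<bar>q' s\<bar> \<le> 2 * real a" "q' s = q s * r s" "q s * (r s)^2 \<le> w s" if s: "\<bar>s\<bar> \<le> 1" for s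
 proof -
  have s2: "0 \<le> 1 - s\<^sup>2" "1 - s\<^sup>2 \<le> 1" using s by (auto simp: abs_square_le_1)
  show "0 \<le> q s" "q s \<le> 1" unfolding q_def using s2 by (auto intro: power_le_one)
  have "\<bar>s\<bar> * (1 - s\<^sup>2) ^ (a - 1) \<le> 1 * 1" using s s2 by (intro mult_mono power_le_one) auto
  then have "2 * real a * (\<bar>s\<bar> * (1 - s\<^sup>2) ^ (a - 1)) \<le> 2 * real a * 1" by (intro mult_left_mono) auto
  then show "\<bar>q' s\<bar> \<le> 2 * real a" unfolding q'_def using s2 by (simp add: abs_mult power_abs mult.assoc)
  from a obtain d where d: "a = Suc (Suc d)" by (metis add_2_eq_Suc le_Suc_ex)
  show "q' s = q s * r s" unfolding q_def q'_def r_def d by (cases "1 - s\<^sup>2 = 0") auto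
  have "0 \<le> w s" unfolding w_def using s2 by simp
  have "y ^ Suc (Suc d) * (- 2 * A * s / y)^2 = 4 * A\<^sup>2 * s\<^sup>2 * y ^ d" if "y \<noteq> 0" for y A :: real
   using that by (simp add: power2_eq_square)
  from this[of "1 - s\<^sup>2" "real a"] have "1 - s\<^sup>2 \<noteq> 0 \<Longrightarrow> q s * (r s)^2 = w s" unfolding q_def r_def w_def d by simp
  with \<open>0 \<le> w s\<close> show "q s * (r s)^2 \<le> w s"
   by (cases "1 - s\<^sup>2 = 0") (auto simp: r_def)
 qed
 have w0: "has_bochner_integral lborel (\<lambda>s. indicator {-1..1} s * w s) (beta_info a * Z)"
  unfolding w_def Z_def by (rule beta_info_integral[OF a])
 have I0: "0 \<le> I"
 proof -
  have "0 \<le> (LBINT x. (v x)^2 / (u x + 0 * v x))" using pos[of 0] by (intro integral_nonneg_AE AE_I2) (auto simp: less_imp_le)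
  then show ?thesis using info[of 0] by simp
 qed
 have V: "V > 0"
 proof -
  have "beta_info a > 0" unfolding beta_info_def using a by (intro divide_pos_pos mult_pos_pos) auto
  then show ?thesis unfolding V_def using I0 by (intro add_nonneg_pos) auto
 qed
 have Z: "Z > 0" unfolding Z_def by (rule beta_norm_pos)
 define E where "E s = (LINT X|iid_sample n (f s). (T X - (b + m * s))^2)" for s
 have B0: "0 \<le> B" using T(2)[of undefined] by linarith
 have Tb: "\<bar>T X - (b + m * s)\<bar> \<le> B + \<bar>b\<bar> + \<bar>m\<bar>" if "\<bar>s\<bar> \<le> 1" for s X
 proof -
  have "\<bar>m * s\<bar> \<le> \<bar>m\<bar>" using that by (simp add: abs_mult mult_left_le)
  then show ?thesis using T(2)[of X] by linarith
 qed
 have per_s: "2 * c * (LINT X|\<mu>. G s X) \<le> q s * E s + c\<^sup>2 * (q s * (real n * I) + w s)" if s: "\<bar>s\<bar> \<le> 1" for s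
 proof -
  interpret P: prob_space "iid_sample n (f s)" by (rule PS[OF s])
  have [measurable_cong]: "sets (iid_sample n (f s)) = sets \<mu>" unfolding dens[OF s] by simp
  have i1: "integrable (iid_sample n (f s)) (\<lambda>X. (T X - (b + m * s))^2)"
   by (rule P.integrable_bounded[where B = "(B + \<bar>b\<bar> + \<bar>m\<bar>)^2"]) (use power_mono[OF Tb[OF s], of _ 2] in auto)
  have i2: "integrable (iid_sample n (f s)) (S s)" by (rule P.integrable_bounded[where B = "real n * K"]) (use S_le[OF s] in auto)
  have i3: "integrable (iid_sample n (f s)) (\<lambda>X. (S s X)^2)"
   by (rule P.integrable_bounded[where B = "(real n * K)^2"]) (use power_mono[OF S_le[OF s], of _ 2] in auto)
  have i4: "integrable (iid_sample n (f s)) (\<lambda>X. (T X - (b + m * s)) * (S s X * q s + q' s))"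
  proof (rule P.integrable_bounded[where B = "(B + \<bar>b\<bar> + \<bar>m\<bar>) * (real n * K * \<bar>q s\<bar> + \<bar>q' s\<bar>)"])
   fix X
   have "\<bar>S s X * q s + q' s\<bar> \<le> real n * K * \<bar>q s\<bar> + \<bar>q' s\<bar>"
    by (rule order_trans[OF abs_triangle_ineq]) (auto simp: abs_mult intro!: mult_right_mono S_le[OF s])
   then show "\<bar>(T X - (b + m * s)) * (S s X * q s + q' s)\<bar> \<le> (B + \<bar>b\<bar> + \<bar>m\<bar>) * (real n * K * \<bar>q s\<bar> + \<bar>q' s\<bar>)"
    unfolding abs_mult using Tb[OF s, of X] by (intro mult_mono) auto
  qed measurable
  have G: "(LINT X|\<mu>. G s X) = (LINT X|iid_sample n (f s). (T X - (b + m * s)) * (S s X * q s + q' s))"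
   unfolding dens[OF s] using h0[OF s] by (subst integral_density)
    (auto simp: G_def less_imp_le algebra_simps intro!: LINT_cong)
  have "2 * c * (LINT X|\<mu>. G s X) = (LINT X|iid_sample n (f s). 2 * c * ((T X - (b + m * s)) * (S s X * q s + q' s)))" unfolding G by simp
  also have "... \<le> (LINT X|iid_sample n (f s). q s * (T X - (b + m * s))^2 + c\<^sup>2 * q s * ((S s X)^2 + 2 * r s * S s X + (r s)^2))"
  proof (rule integral_mono)
   fix X
   \<comment> \<open>This square takes the place of Cauchy-Schwarz. Expanded and integrated it
     bounds the risk from below by 2 c times the G-term minus c^2 times the information.\<close>
   have "0 \<le> q s * ((T X - (b + m * s)) - c * (S s X + r s))^2" using q01(1)[OF s] by (intro mult_nonneg_nonneg) auto
   then show "2 * c * ((T X - (b + m * s)) * (S s X * q s + q' s)) \<le> q s * (T X - (b + m * s))^2 + c\<^sup>2 * q s * ((S s X)^2 + 2 * r s * S s X + (r s)^2)"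
    unfolding q01(4)[OF s] by (simp add: power2_eq_square algebra_simps)
  qed (intro integrable_mult_right L1_add i1 i2 i3 i4 P.integrable_const)+
  also have "... = q s * E s + c\<^sup>2 * q s * ((LINT X|iid_sample n (f s). (S s X)^2) + (r s)^2)"
   using i1 i2 i3 mom(1)[OF s] by (simp add: E_def P.prob_space)
  also have "... \<le> q s * E s + c\<^sup>2 * q s * (real n * I + (r s)^2)"
   using mom(2)[OF s] q01(1)[OF s] by (intro add_left_mono mult_left_mono add_right_mono) auto
  also have "... = q s * E s + c\<^sup>2 * (q s * (real n * I) + q s * (r s)^2)" by (simp add: algebra_simps)
  also have "... \<le> q s * E s + c\<^sup>2 * (q s * (real n * I) + w s)" using q01(5)[OF s] by (intro add_left_mono mult_left_mono) auto
  finally show ?thesis .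
 qed
 have hint: "integrable (lborel \<Otimes>\<^sub>M \<mu>) (\<lambda>(s, X). indicator {-1..1} s * h s X)"
 proof (rule integrableI_bounded)
  have "(\<integral>\<^sup>+ p. ennreal (norm (case p of (s, X) \<Rightarrow> indicator {-1..1} s * h s X)) \<partial>(lborel \<Otimes>\<^sub>M \<mu>))
   = (\<integral>\<^sup>+ s. \<integral>\<^sup>+ X. ennreal (norm (indicator {-1..1} s * h s X)) \<partial>\<mu> \<partial>lborel)"
   by (subst \<mu>.nn_integral_fst[symmetric]) auto
  also have "... = (\<integral>\<^sup>+ s. indicator {-1..1::real} s \<partial>lborel)"
  proof (rule nn_integral_cong)
   fix s :: real
   show "(\<integral>\<^sup>+ X. ennreal (norm (indicator {-1..1} s * h s X)) \<partial>\<mu>) = indicator {-1..1} s"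
    using hnn[of s] h0[of s] by (cases "s \<in> {-1..1}") (auto simp: abs_le_iff less_imp_le)
  qed
  also have "... < \<infinity>" by simp
  finally show "(\<integral>\<^sup>+ p. ennreal (norm (case p of (s, X) \<Rightarrow> indicator {-1..1} s * h s X)) \<partial>(lborel \<Otimes>\<^sub>M \<mu>)) < \<infinity>" .
 qed simp
 define C where "C = (B + \<bar>b\<bar> + \<bar>m\<bar>) * (real n * K + 2 * real a)"
 have Gint: "integrable (lborel \<Otimes>\<^sub>M \<mu>) (\<lambda>(s, X). indicator {-1..1} s * G s X)"
 proof (rule L1_bound[OF integrable_mult_right[OF hint, of C]])
  show "(\<lambda>(s, X). indicator {-1..1} s * G s X) \<in> borel_measurable (lborel \<Otimes>\<^sub>M \<mu>)" unfolding G_def by measurable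
  show "AE p in lborel \<Otimes>\<^sub>M \<mu>. norm (case p of (s, X) \<Rightarrow> indicator {-1..1} s * G s X) \<le> norm (C * (case p of (s, X) \<Rightarrow> indicator {-1..1} s * h s X))"
  proof (intro AE_I2)
   fix p :: "real \<times> (nat \<Rightarrow> real)"
   obtain s X where p: "p = (s, X)" by force
   have "\<bar>G s X\<bar> \<le> C * h s X" if s: "\<bar>s\<bar> \<le> 1"
   proof -
    have "\<bar>S s X\<bar> * \<bar>q s\<bar> \<le> (real n * K) * 1" using S_le[OF s] q01(1,2)[OF s] K0 by (intro mult_mono) auto
    then have "\<bar>S s X * q s + q' s\<bar> \<le> real n * K + 2 * real a"
     using q01(3)[OF s] abs_triangle_ineq[of "S s X * q s" "q' s"] by (simp add: abs_mult)
    then have "\<bar>T X - (b + m * s)\<bar> * \<bar>S s X * q s + q' s\<bar> \<le> C"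
     unfolding C_def using Tb[OF s, of X] by (intro mult_mono) auto
    then have "\<bar>T X - (b + m * s)\<bar> * \<bar>S s X * q s + q' s\<bar> * h s X \<le> C * h s X" using h0[OF s, of X] by (intro mult_right_mono) auto
    moreover have "G s X = (T X - (b + m * s)) * (S s X * q s + q' s) * h s X" by (simp add: G_def algebra_simps)
    ultimately show ?thesis using h0[OF s, of X] by (simp add: abs_mult)
   qed
   then show "norm (case p of (s, X) \<Rightarrow> indicator {-1..1} s * G s X) \<le> norm (C * (case p of (s, X) \<Rightarrow> indicator {-1..1} s * h s X))"
    using h0[of s X] B0 K0 by (auto simp: p indicator_def abs_le_iff[of s] abs_mult C_def)
  qed
 qed
 \<comment> \<open>The boundary values vanish because q is 0 at both ends, so the integral of G
   equals that of m h q for every sample.\<close>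
 have ibp: "(LBINT s. indicator {-1..1} s * G s X) = m * (LBINT s. indicator {-1..1} s * (h s X * q s))" if "X \<in> space \<mu>" for X
 proof -
  have "has_bochner_integral lborel (\<lambda>s. (G s X - m * (h s X * q s)) * indicator {-1..1} s)
   ((T X - (b + m * 1)) * (h 1 X * q 1) - (T X - (b + m * (-1))) * (h (-1) X * q (-1)))"
  proof (rule has_bochner_integral_FTC_Icc_real)
   fix s :: real assume "-1 \<le> s" "s \<le> 1"
   then have s: "\<bar>s\<bar> \<le> 1" by auto
   have dh: "((\<lambda>s. h s X) has_field_derivative h s X * S s X) (at s)"
    unfolding h_def S_def by (rule has_field_derivative_prod')
     (use f0[OF s] in "auto simp: f_def less_imp_neq[symmetric] intro!: derivative_eq_intros")
   have dq: "(q has_field_derivative q' s) (at s)"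
    unfolding q_def q'_def by (rule DERIV_cong, (rule derivative_eq_intros refl)+) simp
   show "((\<lambda>s. (T X - (b + m * s)) * (h s X * q s)) has_field_derivative G s X - m * (h s X * q s)) (at s)"
    by (rule DERIV_cong, (rule derivative_eq_intros refl dh dq)+) (simp add: G_def algebra_simps)
   have "isCont (\<lambda>s. h s X) s" "isCont q s" using dh dq by (auto intro: DERIV_isCont)
   moreover have "isCont (\<lambda>s. S s X) s" unfolding S_def f_def
    using pos[OF s] by (intro continuous_intros) (auto simp: less_imp_neq[symmetric])
   moreover have "isCont q' s" unfolding q'_def by (intro continuous_intros)
   ultimately show "isCont (\<lambda>s. G s X - m * (h s X * q s)) s" unfolding G_def by (intro continuous_intros)
  qed simp
  moreover have "q 1 = 0" "q (-1) = 0" using a by (auto simp: q_def)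
  ultimately have d: "has_bochner_integral lborel (\<lambda>s. indicator {-1..1} s * G s X - m * (indicator {-1..1} s * (h s X * q s))) 0"
   by (simp add: algebra_simps)
  have "continuous_on {-1..1} (\<lambda>s. h s X * q s)" unfolding h_def q_def f_def by (intro continuous_intros)
  from borel_integrable_compact[OF compact_Icc this] have "integrable lborel (\<lambda>s. indicator {-1..1} s * (h s X * q s))" by simp
  from has_bochner_integral_add[OF d has_bochner_integral_cmult[OF has_bochner_integral_integrable[OF this], of m]]
  show ?thesis by (simp add: hbi_iff)
 qed
 have hq: "integrable (lborel \<Otimes>\<^sub>M \<mu>) (\<lambda>(s, X). indicator {-1..1} s * (h s X * q s))"
 proof (rule L1_bound[OF hint])
  have "\<bar>h s X * q s\<bar> \<le> \<bar>h s X\<bar>" if "\<bar>s\<bar> \<le> 1" for s X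
   using h0[OF that, of X] q01(1,2)[OF that] by (simp add: abs_mult mult_left_le)
  then show "AE p in lborel \<Otimes>\<^sub>M \<mu>. norm (case p of (s, X) \<Rightarrow> indicator {-1..1} s * (h s X * q s)) \<le> norm (case p of (s, X) \<Rightarrow> indicator {-1..1} s * h s X)"
   by (intro AE_I2) (auto simp: indicator_def abs_le_iff)
 qed measurable
 have total: "(LBINT s. indicator {-1..1} s * (LINT X|\<mu>. G s X)) = m * Z"
 proof -
  have "(LBINT s. indicator {-1..1} s * (LINT X|\<mu>. G s X)) = (LBINT s. LINT X|\<mu>. indicator {-1..1} s * G s X)" by simp
  also have "... = (LINT X|\<mu>. LINT s|lborel. indicator {-1..1} s * G s X)" by (rule Fubini_integral[symmetric, OF Gint])
  also have "... = (LINT X|\<mu>. m * (LBINT s. indicator {-1..1} s * (h s X * q s)))"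
   by (intro LINT_cong refl ibp)
  also have "... = m * (LBINT s. LINT X|\<mu>. indicator {-1..1} s * (h s X * q s))"
   using Fubini_integral[OF hq] by simp
  also have "... = m * (LBINT s. indicator {-1..1} s * q s)"
  proof -
   have "(LINT X|\<mu>. indicator {-1..1} s * (h s X * q s)) = indicator {-1..1} s * q s" for s
    using hI[of s] by (cases "s \<in> {-1..1}") (auto simp: hbi_iff abs_le_iff)
   then show ?thesis by (simp only:)
  qed
  finally show ?thesis by (simp add: q_def Z_def beta_norm_def)
 qed
 have qI: "has_bochner_integral lborel (\<lambda>s. indicator {-1..1} s * q s) Z"
  unfolding q_def Z_def beta_norm_def using beta_norm_integrable[of a] by (simp add: hbi_iff)
 \<comment> \<open>The inequality \<open>per_s\<close> solved for the risk at s; its integral is 2 c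
   m - c^2 V = m^2 / V.\<close>
 define g where "g s = (2 * c * (indicator {-1..1} s * (LINT X|\<mu>. G s X)) - c\<^sup>2 * (indicator {-1..1} s * q s * (real n * I) + indicator {-1..1} s * w s)) / Z" for s
 have GI: "integrable lborel (\<lambda>s. indicator {-1..1} s * (LINT X|\<mu>. G s X))"
  using integrable_fst'[OF Gint] by simp
 have gI: "has_bochner_integral lborel g (m\<^sup>2 / V)"
 proof -
  have "has_bochner_integral lborel g ((2 * c * (m * Z) - c\<^sup>2 * (Z * (real n * I) + beta_info a * Z)) / Z)"
   unfolding g_def using GI total qI w0
   by (intro has_bochner_integral_divide_zero has_bochner_integral_diff has_bochner_integral_mult_right has_bochner_integral_add has_bochner_integral_mult_left)
    (auto simp: hbi_iff)
  moreover have "(2 * c * (m * Z) - c\<^sup>2 * (Z * (real n * I) + beta_info a * Z)) / Z = 2 * c * m - c\<^sup>2 * V"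
   using Z by (simp add: V_def field_simps)
  moreover have "2 * c * m - c\<^sup>2 * V = m\<^sup>2 / V" using V by (simp add: c_def field_simps power2_eq_square)
  ultimately show ?thesis by simp
 qed
 define F where "F s = (\<integral>\<^sup>+ X. ennreal (h (clip s) X) * ennreal ((T X - (b + m * clip s))^2) \<partial>\<mu>)" for s
 have F: "(\<integral>\<^sup>+ X. ennreal ((T X - (b + m * clip s))^2) \<partial>iid_sample n (\<lambda>x. u x + clip s * v x)) = F s" for s
  unfolding F_def f_def[symmetric] dens[OF abs_clip] by (subst nn_integral_density) auto
 have Fm: "F \<in> borel_measurable lborel"
 proof -
  have "(\<lambda>(s, X). h (clip s) X) \<in> borel_measurable (lborel \<Otimes>\<^sub>M \<mu>)" unfolding h_def f_def \<mu>_def by measurable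
  note [measurable] = this
  show ?thesis unfolding F_def by measurable
 qed
 have EF: "ennreal (E s) = F s" if s: "\<bar>s\<bar> \<le> 1" for s
 proof -
  interpret P: prob_space "iid_sample n (f s)" by (rule PS[OF s])
  have [measurable_cong]: "sets (iid_sample n (f s)) = sets \<mu>" unfolding dens[OF s] by simp
  have i1: "integrable (iid_sample n (f s)) (\<lambda>X. (T X - (b + m * s))^2)"
   by (rule P.integrable_bounded[where B = "(B + \<bar>b\<bar> + \<bar>m\<bar>)^2"]) (use power_mono[OF Tb[OF s], of _ 2] in auto)
  have "ennreal (E s) = (\<integral>\<^sup>+ X. ennreal ((T X - (b + m * s))^2) \<partial>iid_sample n (f s))"
   unfolding E_def by (rule nn_integral_eq_integral[symmetric, OF i1]) auto
  then show ?thesis using F[of s] by (simp add: clip_eq[OF s] f_def[symmetric])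
 qed
 have "ennreal (m\<^sup>2 / V) \<le> (\<integral>\<^sup>+ s. ennreal (g s) \<partial>lborel)"
  using ennreal_integral_le_nn_integral[of lborel g] gI by (simp add: hbi_iff)
 also have "... \<le> (\<integral>\<^sup>+ s. ennreal (indicator {-1..1} s * (1 - s\<^sup>2) ^ a / beta_norm a) * F s \<partial>lborel)"
 proof (rule nn_integral_mono)
  fix s :: real
  show "ennreal (g s) \<le> ennreal (indicator {-1..1} s * (1 - s\<^sup>2) ^ a / beta_norm a) * F s"
  proof (cases "s \<in> {-1..1}")
   case True
   then have s: "\<bar>s\<bar> \<le> 1" by auto
   have E0: "0 \<le> E s" unfolding E_def by (intro integral_nonneg_AE AE_I2) simp
   have "g s \<le> q s / Z * E s" using per_s[OF s] True Z by (simp add: g_def divide_right_mono)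
   then have "ennreal (g s) \<le> ennreal (q s / Z) * ennreal (E s)"
    using Z q01(1)[OF s] E0 by (subst ennreal_mult[symmetric]) (auto intro: ennreal_leI)
   then show ?thesis using True EF[OF s] by (simp add: q_def Z_def)
  qed (simp add: g_def)
 qed
 also have "... = (\<integral>\<^sup>+ s. F s \<partial>beta_prior a)"
  unfolding beta_prior_def using Fm by (subst nn_integral_density) auto
 finally show ?thesis unfolding F V_def .
qed

section \<open>A Bayesian lower bound over a perturbation family\<close>

lemma abs_mult_le_squares: "\<bar>y * z\<bar> \<le> y\<^sup>2 + z\<^sup>2" for y z :: real
proof -
 have "0 \<le> \<bar>y\<bar> * \<bar>z\<bar>" by simp
 then show ?thesis using sum_squares_bound[of "\<bar>y\<bar>" "\<bar>z\<bar>"] unfolding abs_mult mult.assoc power2_abs by linarith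
qed

lemma integrable_mult_L2:
 fixes g h :: "real \<Rightarrow> real"
 assumes [measurable]: "g \<in> borel_measurable borel" "h \<in> borel_measurable borel"
  and "integrable lborel (\<lambda>x. (g x)^2)" "integrable lborel (\<lambda>x. (h x)^2)"
 shows "integrable lborel (\<lambda>x. g x * h x)"
proof (rule L1_bound)
 show "integrable lborel (\<lambda>x. (g x)^2 + (h x)^2)" using assms by simp
 show "AE x in lborel. norm (g x * h x) \<le> norm ((g x)^2 + (h x)^2)" using abs_mult_le_squares by simp
qed measurable

text \<open>Orthonormality is with respect to the density \<open>f0\<close>; \<open>f0_le\<close>
  transfers it to Lebesgue measure with the constant c. The bound on the sum of 2 w p keeps every
  perturbed density above (1 - \<delta>) f0, which yields positivity and limits the Fisher
  information.\<close>

locale perturbation =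
 fixes f0 :: "real \<Rightarrow> real" and e :: "'p \<Rightarrow> real \<Rightarrow> real" and P :: "'p set" and w :: "'p \<Rightarrow> real"
  and c \<delta> :: real and n a :: nat
 assumes a: "a \<ge> 2" and P: "finite P"
  and f0_measurable[measurable]: "f0 \<in> borel_measurable borel"
  and e_measurable[measurable]: "\<And>p. e p \<in> borel_measurable borel"
  and f0_pos: "\<And>x. 0 < f0 x" and f0_le: "\<And>x. f0 x \<le> c"
  and f0_int: "has_bochner_integral lborel f0 1"
  and e_le: "\<And>p x. \<bar>e p x\<bar> \<le> 2"
  and e_mean: "\<And>p. p \<in> P \<Longrightarrow> (LBINT x. f0 x * e p x) = 0"
  and e_orth: "\<And>p q. p \<in> P \<Longrightarrow> q \<in> P \<Longrightarrow> (LBINT x. f0 x * (e p x * e q x)) = (if p = q then 1 else 0)"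
  and w0: "\<And>p. 0 \<le> w p" and w_sum: "(\<Sum>p\<in>P. 2 * w p) \<le> \<delta>" and \<delta>: "0 < \<delta>" "\<delta> < 1"
begin

definition dens :: "('p \<Rightarrow> real) \<Rightarrow> real \<Rightarrow> real" where
 "dens s x = f0 x * (1 + (\<Sum>p\<in>P. w p * clip (s p) * e p x))"

text \<open>Inner products with respect to Lebesgue measure. They need not be diagonal, since the
  functions are orthonormal under \<open>f0\<close> instead.\<close>

definition gram :: "'p \<Rightarrow> 'p \<Rightarrow> real" where "gram p q = (LBINT x. (f0 x * e p x) * (f0 x * e q x))"

definition \<rho> :: real where "\<rho> = c * (\<Sum>p\<in>P. (w p)^2)"

lemma c0: "0 < c" using f0_pos[of 0] f0_le[of 0] by linarith

lemma f0_mult_int: "integrable lborel (\<lambda>x. f0 x * g x)"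
 if [measurable]: "g \<in> borel_measurable borel" and "\<And>x. \<bar>g x\<bar> \<le> K" for g K
proof (rule L1_bound)
 show "integrable lborel (\<lambda>x. K * f0 x)" using f0_int by (simp add: hbi_iff)
 have "\<bar>f0 x * g x\<bar> \<le> \<bar>K * f0 x\<bar>" for x
  using that(2)[of x] f0_pos[of x] by (simp add: abs_mult)
 then show "AE x in lborel. norm (f0 x * g x) \<le> norm (K * f0 x)" by simp
qed measurable

lemma f0_sq_mult_int: "integrable lborel (\<lambda>x. (f0 x * g x)^2)"
  "(LBINT x. (f0 x * g x)^2) \<le> c * (LBINT x. f0 x * (g x)^2)"
 if [measurable]: "g \<in> borel_measurable borel" and K: "\<And>x. \<bar>g x\<bar> \<le> K" for g K
proof -
 have i: "integrable lborel (\<lambda>x. f0 x * (g x)^2)"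
  by (rule f0_mult_int[where K = "K\<^sup>2"]) (use power_mono[OF K, of _ 2] in auto)
 have b: "(f0 x * g x)^2 \<le> c * (f0 x * (g x)^2)" for x
 proof -
  have "f0 x * (f0 x * (g x)^2) \<le> c * (f0 x * (g x)^2)"
   using f0_le[of x] f0_pos[of x] by (intro mult_right_mono) auto
  then show ?thesis by (simp add: power2_eq_square mult_ac)
 qed
 show "integrable lborel (\<lambda>x. (f0 x * g x)^2)"
  by (rule L1_bound[OF integrable_mult_right[OF i, of c]]) (use b in "auto intro!: AE_I2 order_trans[OF b]")
 then show "(LBINT x. (f0 x * g x)^2) \<le> c * (LBINT x. f0 x * (g x)^2)"
  using i b by (subst integral_mult_right_zero[symmetric]) (intro integral_mono; simp)
qed

lemma comb_le: "\<bar>\<Sum>p\<in>P. \<alpha> p * e p x\<bar> \<le> (\<Sum>p\<in>P. 2 * \<bar>\<alpha> p\<bar>)"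
proof -
 have "\<bar>\<alpha> p * e p x\<bar> \<le> 2 * \<bar>\<alpha> p\<bar>" for p using mult_left_mono[OF e_le[of p x] abs_ge_zero[of "\<alpha> p"]] by (simp add: abs_mult)
 then show ?thesis by (intro order_trans[OF sum_abs] sum_mono)
qed

lemma comb_sq:
 "integrable lborel (\<lambda>x. (f0 x * (\<Sum>p\<in>P. \<alpha> p * e p x))^2)"
 "(LBINT x. (f0 x * (\<Sum>p\<in>P. \<alpha> p * e p x))^2) \<le> c * (\<Sum>p\<in>P. (\<alpha> p)^2)"
proof -
 note F = f0_sq_mult_int[where g = "\<lambda>x. \<Sum>p\<in>P. \<alpha> p * e p x", OF _ comb_le]
 show "integrable lborel (\<lambda>x. (f0 x * (\<Sum>p\<in>P. \<alpha> p * e p x))^2)" by (rule F(1)) measurable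
 have ie: "integrable lborel (\<lambda>x. f0 x * (e p x * e q x))" for p q
  by (rule f0_mult_int[where K = 4]) (use mult_mono[OF e_le e_le] in "auto simp: abs_mult")
 have "(LBINT x. f0 x * (\<Sum>p\<in>P. \<alpha> p * e p x)^2) = (LBINT x. (\<Sum>p\<in>P. \<Sum>q\<in>P. \<alpha> p * \<alpha> q * (f0 x * (e p x * e q x))))"
  by (intro LINT_cong refl) (simp add: power2_eq_square sum_product sum_distrib_left mult_ac)
 also have "... = (\<Sum>p\<in>P. \<Sum>q\<in>P. \<alpha> p * \<alpha> q * (LBINT x. f0 x * (e p x * e q x)))"
  using ie by (simp add: LINT_sum)
 also have "... = (\<Sum>p\<in>P. \<Sum>q\<in>P. if p = q then \<alpha> p * \<alpha> q else 0)"
  using e_orth by (intro sum.cong refl) auto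
 also have "... = (\<Sum>p\<in>P. (\<alpha> p)^2)" using P by (simp add: power2_eq_square sum.delta)
 finally show "(LBINT x. (f0 x * (\<Sum>p\<in>P. \<alpha> p * e p x))^2) \<le> c * (\<Sum>p\<in>P. (\<alpha> p)^2)"
  using F(2) by simp
qed

lemma fe_sq: "integrable lborel (\<lambda>x. (f0 x * e p x)^2)"
 by (rule f0_sq_mult_int[OF _ e_le]) measurable

text \<open>By duality: the sum of squared coefficients is the inner product of D with the
  combination h formed from these very coefficients, and the squared norm of h is at most c times
  that sum. AM-GM with weight c absorbs half of it.\<close>

lemma bessel:
 assumes [measurable]: "D \<in> borel_measurable borel" and D: "integrable lborel (\<lambda>x. (D x)^2)"
 shows "(\<Sum>p\<in>P. (LBINT x. D x * (f0 x * e p x))^2) \<le> c * (LBINT x. (D x)^2)"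
proof -
 define \<alpha> where "\<alpha> p = (LBINT x. D x * (f0 x * e p x))" for p
 let ?h = "\<lambda>x. f0 x * (\<Sum>p\<in>P. \<alpha> p * e p x)"
 have i: "integrable lborel (\<lambda>x. D x * (f0 x * e p x))" for p
  by (rule integrable_mult_L2) (use D fe_sq in auto)
 have iD: "integrable lborel (\<lambda>x. D x * ?h x)" by (rule integrable_mult_L2) (use D comb_sq in auto)
 have "(\<Sum>p\<in>P. (\<alpha> p)^2) = (\<Sum>p\<in>P. LBINT x. \<alpha> p * (D x * (f0 x * e p x)))"
  by (simp add: \<alpha>_def power2_eq_square)
 also have "... = (LBINT x. (\<Sum>p\<in>P. \<alpha> p * (D x * (f0 x * e p x))))"
  using i by (intro LINT_sum[symmetric]) simp
 also have "... = (LBINT x. D x * ?h x)"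
  by (intro LINT_cong refl) (simp add: sum_distrib_left mult_ac)
 also have "... \<le> (LBINT x. c / 2 * (D x)^2 + 1 / (2 * c) * (?h x)^2)"
 proof (rule integral_mono[OF iD])
  show "integrable lborel (\<lambda>x. c / 2 * (D x)^2 + 1 / (2 * c) * (?h x)^2)"
   by (intro L1_add integrable_mult_right D comb_sq)
  have "y * z \<le> c / 2 * y\<^sup>2 + 1 / (2 * c) * z\<^sup>2" for y z
  proof -
   have "0 \<le> (c * y - z)^2 / (2 * c)" using c0 by simp
   also have "... = c / 2 * y\<^sup>2 + 1 / (2 * c) * z\<^sup>2 - y * z" using c0 by (simp add: power2_eq_square field_simps)
   finally show ?thesis by simp
  qed
  then show "D x * ?h x \<le> c / 2 * (D x)^2 + 1 / (2 * c) * (?h x)^2" for x by blast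
 qed
 also have "... = c / 2 * (LBINT x. (D x)^2) + 1 / (2 * c) * (LBINT x. (?h x)^2)"
  using D comb_sq(1) by (subst LINT_add) (simp_all only: integrable_mult_right integral_mult_right_zero)
 also have "... \<le> c / 2 * (LBINT x. (D x)^2) + 1 / (2 * c) * (c * (\<Sum>p\<in>P. (\<alpha> p)^2))"
  using comb_sq(2)[of \<alpha>] c0 by (intro add_left_mono mult_left_mono) auto
 also have "... = c / 2 * (LBINT x. (D x)^2) + (\<Sum>p\<in>P. (\<alpha> p)^2) / 2" using c0 by simp
 finally show ?thesis unfolding \<alpha>_def by simp
qed

lemma dens_measurable[measurable]: "dens s \<in> borel_measurable borel" unfolding dens_def by measurable

lemma clip_sum_le: "\<bar>\<Sum>p\<in>P. w p * clip (s p) * e p x\<bar> \<le> \<delta>"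
proof -
 have "(\<Sum>p\<in>P. 2 * \<bar>w p * clip (s p)\<bar>) \<le> (\<Sum>p\<in>P. 2 * w p)"
  using w0 abs_clip by (intro sum_mono) (simp add: abs_mult mult_left_le)
 then show ?thesis using comb_le[of "\<lambda>p. w p * clip (s p)" x] w_sum by simp
qed

lemma dens_ge: "(1 - \<delta>) * f0 x \<le> dens s x"
 using mult_left_mono[of "1 - \<delta>" "1 + (\<Sum>p\<in>P. w p * clip (s p) * e p x)" "f0 x"] clip_sum_le[of s x] f0_pos[of x]
 unfolding dens_def by (simp add: mult.commute abs_le_iff)

lemma dens_pos: "0 < dens s x"
 by (rule less_le_trans[OF mult_pos_pos dens_ge]) (use f0_pos \<delta> in auto)

lemma dens_int: "has_bochner_integral lborel (dens s) 1"
proof -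
 have i: "integrable lborel (\<lambda>x. f0 x * e p x)" for p by (rule f0_mult_int[OF _ e_le]) measurable
 then have "has_bochner_integral lborel (\<lambda>x. \<Sum>p\<in>P. w p * clip (s p) * (f0 x * e p x)) (\<Sum>p\<in>P. w p * clip (s p) * 0)"
  using e_mean by (intro has_bochner_integral_sum has_bochner_integral_cmult) (auto simp: hbi_iff)
 from has_bochner_integral_add[OF f0_int this] show ?thesis
  unfolding dens_def by (simp add: distrib_left sum_distrib_left mult_ac)
qed

lemma dens_diff: "dens s x - f0 x = f0 x * (\<Sum>p\<in>P. (w p * clip (s p)) * e p x)"
 by (simp add: dens_def algebra_simps)

lemma dens_diff_sq:
 "integrable lborel (\<lambda>x. (dens s x - f0 x)^2)" "(LBINT x. (dens s x - f0 x)^2) \<le> \<rho>"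
proof -
 show "integrable lborel (\<lambda>x. (dens s x - f0 x)^2)" unfolding dens_diff by (rule comb_sq)
 have "(LBINT x. (dens s x - f0 x)^2) \<le> c * (\<Sum>p\<in>P. (w p * clip (s p))^2)" unfolding dens_diff by (rule comb_sq)
 also have "... \<le> \<rho>" unfolding \<rho>_def using c0 power_mono[OF abs_clip, of _ 2]
  by (intro mult_left_mono sum_mono) (auto simp: power_mult_distrib mult_left_le)
 finally show "(LBINT x. (dens s x - f0 x)^2) \<le> \<rho>" .
qed

text \<open>The coefficient of dens - f0 along f0 * e p, see \<open>\<tau>_eq\<close>. It is affine
  in \<open>clip (s p)\<close> with slope w p * gram p p, which is the form of parameter that
  \<open>van_trees\<close> treats.\<close>

definition \<tau> :: "('p \<Rightarrow> real) \<Rightarrow> 'p \<Rightarrow> real" where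
 "\<tau> s p = (\<Sum>q\<in>P. w q * clip (s q) * gram q p)"

lemma \<tau>_eq: "\<tau> s p = (LBINT x. (dens s x - f0 x) * (f0 x * e p x))"
proof -
 have i: "integrable lborel (\<lambda>x. (f0 x * e q x) * (f0 x * e p x))" for q
  by (rule integrable_mult_L2) (use fe_sq in auto)
 have "(LBINT x. (dens s x - f0 x) * (f0 x * e p x)) = (LBINT x. (\<Sum>q\<in>P. w q * clip (s q) * ((f0 x * e q x) * (f0 x * e p x))))"
  unfolding dens_diff by (intro LINT_cong refl) (simp add: sum_distrib_left sum_distrib_right mult_ac)
 also have "... = (\<Sum>q\<in>P. LBINT x. w q * clip (s q) * ((f0 x * e q x) * (f0 x * e p x)))"
  using i by (intro LINT_sum integrable_mult_right)
 finally show ?thesis by (simp add: \<tau>_def gram_def)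
qed

lemma density_product: "iid_sample n (dens s) = density (Pi\<^sub>M {..<n} (\<lambda>_. lborel)) (\<lambda>X. ennreal (\<Prod>i<n. dens s (X i)))"
proof -
 have "(\<integral>\<^sup>+ x. ennreal (dens s x) \<partial>lborel) = 1"
  using dens_int[of s] dens_pos[of s] by (subst nn_integral_eq_integral) (auto simp: hbi_iff less_imp_le)
 then show ?thesis unfolding iid_sample_def
  by (intro PiM_density) (use dens_pos in "auto simp: less_imp_le lborel.sigma_finite_measure_axioms")
qed

section \<open>Coefficient estimates derived from an arbitrary estimator\<close>

context
 fixes T assumes T: "T \<in> estimators n"
begin

definition \<Delta> :: "(nat \<Rightarrow> real) \<Rightarrow> ennreal" where "\<Delta> X = (\<integral>\<^sup>+ x. ennreal ((T X x - f0 x)^2) \<partial>lborel)"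

text \<open>Estimators far from the unperturbed density are discarded, so that the parameters outside
 the Sobolev class contribute at most a multiple of \<open>\<rho>\<close> times their prior probability.\<close>

definition est :: "'p \<Rightarrow> (nat \<Rightarrow> real) \<Rightarrow> real" where
 "est p X = (if X \<in> space (Pi\<^sub>M {..<n} (\<lambda>_. lborel :: real measure)) \<and> \<Delta> X \<le> ennreal (4 * \<rho>)
   then LBINT x. (T X x - f0 x) * (f0 x * e p x) else 0)"

lemma T_measurable[measurable]: "(\<lambda>(X, x). T X x) \<in> borel_measurable (Pi\<^sub>M {..<n} (\<lambda>_. lborel) \<Otimes>\<^sub>M lborel)"
 using T by (simp add: estimators_def)

lemma est_measurable[measurable]: "est p \<in> borel_measurable (Pi\<^sub>M {..<n} (\<lambda>_. lborel))"
 unfolding est_def \<Delta>_def by measurable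

lemma \<rho>0: "0 \<le> \<rho>" unfolding \<rho>_def using c0 by (intro mult_nonneg_nonneg sum_nonneg) auto

lemma small_loss:
 assumes X: "X \<in> space (Pi\<^sub>M {..<n} (\<lambda>_. lborel :: real measure))" and \<Delta>: "\<Delta> X \<le> ennreal (4 * \<rho>)"
 shows "T X \<in> borel_measurable borel" "integrable lborel (\<lambda>x. (T X x - f0 x)^2)" "(LBINT x. (T X x - f0 x)^2) \<le> 4 * \<rho>"
proof -
 show [measurable]: "T X \<in> borel_measurable borel" using measurable_Pair2[OF T_measurable X] by simp
 show i: "integrable lborel (\<lambda>x. (T X x - f0 x)^2)"
  using \<Delta> unfolding \<Delta>_def by (intro integrableI_bounded) (auto intro: le_less_trans)
 show "(LBINT x. (T X x - f0 x)^2) \<le> 4 * \<rho>"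
  using \<Delta> \<rho>0 nn_integral_eq_integral[OF i] unfolding \<Delta>_def by simp
qed

lemma est_bounded: "\<bar>est p X\<bar> \<le> 4 * \<rho> + (LBINT x. (f0 x * e p x)^2)"
proof (cases "X \<in> space (Pi\<^sub>M {..<n} (\<lambda>_. lborel :: real measure)) \<and> \<Delta> X \<le> ennreal (4 * \<rho>)")
 case True
 note S = small_loss[OF conjunct1[OF True] conjunct2[OF True]]
 note [measurable] = S(1)
 have i: "integrable lborel (\<lambda>x. (T X x - f0 x) * (f0 x * e p x))" by (rule integrable_mult_L2) (use S fe_sq in auto)
 have "\<bar>est p X\<bar> \<le> (LBINT x. \<bar>(T X x - f0 x) * (f0 x * e p x)\<bar>)" using True by (simp add: est_def integral_abs_bound)
 also have "... \<le> (LBINT x. (T X x - f0 x)^2 + (f0 x * e p x)^2)"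
 proof (rule integral_mono)
  show "\<bar>(T X x - f0 x) * (f0 x * e p x)\<bar> \<le> (T X x - f0 x)^2 + (f0 x * e p x)^2" for x by (rule abs_mult_le_squares)
 qed (use i S fe_sq in auto)
 also have "... \<le> 4 * \<rho> + (LBINT x. (f0 x * e p x)^2)" using S fe_sq by simp
 finally show ?thesis .
next
 case False
 have "0 \<le> (LBINT x. (f0 x * e p x)^2)" by (intro integral_nonneg_AE AE_I2) simp
 then show ?thesis using False \<rho>0 by (auto simp: est_def)
qed

text \<open>Near f0, Bessel's inequality bounds the coefficient errors by the loss, which is at most
  2 * 4 \<rho> + 2 \<rho>. Far from f0, the estimate 0 has error at most \<rho>, and the loss itself
  is at least \<rho>.\<close>

lemma est_loss:
 assumes X: "X \<in> space (Pi\<^sub>M {..<n} (\<lambda>_. lborel :: real measure))"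
 shows "ennreal (1 / c * (\<Sum>p\<in>P. (est p X - \<tau> s p)^2)) \<le> (\<integral>\<^sup>+ x. ennreal ((T X x - dens s x)^2) \<partial>lborel)"
  "1 / c * (\<Sum>p\<in>P. (est p X - \<tau> s p)^2) \<le> 10 * \<rho>"
proof -
 have [measurable]: "T X \<in> borel_measurable borel" using measurable_Pair2[OF T_measurable X] by simp
 have "ennreal (1 / c * (\<Sum>p\<in>P. (est p X - \<tau> s p)^2)) \<le> (\<integral>\<^sup>+ x. ennreal ((T X x - dens s x)^2) \<partial>lborel)
  \<and> 1 / c * (\<Sum>p\<in>P. (est p X - \<tau> s p)^2) \<le> 10 * \<rho>"
 proof (cases "\<Delta> X \<le> ennreal (4 * \<rho>)")
  case True
  note S = small_loss[OF X True]
  have b: "(T X x - dens s x)^2 \<le> 2 * (T X x - f0 x)^2 + 2 * (dens s x - f0 x)^2" for x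
  proof -
   have "0 \<le> ((T X x - f0 x) + (dens s x - f0 x))^2" by simp
   then show ?thesis by (simp add: power2_eq_square algebra_simps)
  qed
  have iD: "integrable lborel (\<lambda>x. (T X x - dens s x)^2)"
   by (rule L1_bound[where f = "\<lambda>x. 2 * (T X x - f0 x)^2 + 2 * (dens s x - f0 x)^2"])
    (use S dens_diff_sq b in auto)
  have "(LBINT x. (T X x - dens s x)^2) \<le> (LBINT x. 2 * (T X x - f0 x)^2 + 2 * (dens s x - f0 x)^2)"
   using S dens_diff_sq b iD by (intro integral_mono) auto
  also have "... \<le> 10 * \<rho>" using S dens_diff_sq[of s] by simp
  finally have D10: "(LBINT x. (T X x - dens s x)^2) \<le> 10 * \<rho>" .
  have "est p X - \<tau> s p = (LBINT x. (T X x - dens s x) * (f0 x * e p x))" for p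
  proof -
   have "est p X - \<tau> s p = (LBINT x. (T X x - f0 x) * (f0 x * e p x) - (dens s x - f0 x) * (f0 x * e p x))"
    unfolding \<tau>_eq est_def using True X S dens_diff_sq fe_sq
    by (subst LINT_diff) (auto intro!: integrable_mult_L2)
   then show ?thesis by (simp add: algebra_simps)
  qed
  then have "(\<Sum>p\<in>P. (est p X - \<tau> s p)^2) \<le> c * (LBINT x. (T X x - dens s x)^2)"
   using bessel[OF _ iD] by simp
  then have B: "1 / c * (\<Sum>p\<in>P. (est p X - \<tau> s p)^2) \<le> (LBINT x. (T X x - dens s x)^2)"
   using c0 by (simp add: divide_le_eq mult.commute)
  then show ?thesis using D10 ennreal_leI[OF B] nn_integral_eq_integral[OF iD] by simp
 next
  case False
  then have "(\<Sum>p\<in>P. (est p X - \<tau> s p)^2) = (\<Sum>p\<in>P. (LBINT x. (dens s x - f0 x) * (f0 x * e p x))^2)"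
   by (simp add: est_def \<tau>_eq)
  also have "... \<le> c * (LBINT x. (dens s x - f0 x)^2)" by (rule bessel) (use dens_diff_sq in auto)
  also have "... \<le> c * \<rho>" using c0 dens_diff_sq by simp
  finally have B: "1 / c * (\<Sum>p\<in>P. (est p X - \<tau> s p)^2) \<le> \<rho>" using c0 by (simp add: divide_le_eq mult.commute)
  let ?N = "\<integral>\<^sup>+ x. ennreal ((T X x - dens s x)^2) \<partial>lborel"
  \<comment> \<open>With loss below \<rho>, the distance of the estimate from f0 would be at most 2
    \<rho> + 2 \<rho>, and the estimate would not have been discarded.\<close>
  have "ennreal \<rho> \<le> ?N"
  proof (rule ccontr)
   assume N: "\<not> ennreal \<rho> \<le> ?N"
   have "\<Delta> X \<le> (\<integral>\<^sup>+ x. 2 * ennreal ((T X x - dens s x)^2) + ennreal (2 * (dens s x - f0 x)^2) \<partial>lborel)"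
    unfolding \<Delta>_def
   proof (rule nn_integral_mono)
    fix x
    have "0 \<le> ((T X x - dens s x) - (dens s x - f0 x))^2" by simp
    then have "(T X x - f0 x)^2 \<le> 2 * (T X x - dens s x)^2 + 2 * (dens s x - f0 x)^2" by (simp add: power2_eq_square algebra_simps)
    then show "ennreal ((T X x - f0 x)^2) \<le> 2 * ennreal ((T X x - dens s x)^2) + ennreal (2 * (dens s x - f0 x)^2)"
     by (simp add: ennreal_leI ennreal_mult[of 2, simplified, symmetric] flip: ennreal_plus)
   qed
   also have "... = 2 * ?N + (\<integral>\<^sup>+ x. ennreal (2 * (dens s x - f0 x)^2) \<partial>lborel)"
    by (subst nn_integral_add) (auto simp: nn_integral_cmult)
   also have "(\<integral>\<^sup>+ x. ennreal (2 * (dens s x - f0 x)^2) \<partial>lborel) = ennreal (2 * (LBINT x. (dens s x - f0 x)^2))"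
    using dens_diff_sq(1)[of s] by (subst nn_integral_eq_integral) auto
   also have "... \<le> ennreal (2 * \<rho>)" using dens_diff_sq(2)[of s] by (intro ennreal_leI) simp
   also have "2 * ?N \<le> 2 * ennreal \<rho>" using N by (intro mult_left_mono) auto
   also have "2 * ennreal \<rho> + ennreal (2 * \<rho>) = ennreal (4 * \<rho>)" using \<rho>0 by (simp add: ennreal_mult[of 2, simplified, symmetric] flip: ennreal_plus)
   finally show False using False by (simp add: add_mono)
  qed
  then show ?thesis using B \<rho>0 order_trans[OF ennreal_leI[OF B]] by auto
 qed
 then show "ennreal (1 / c * (\<Sum>p\<in>P. (est p X - \<tau> s p)^2)) \<le> (\<integral>\<^sup>+ x. ennreal ((T X x - dens s x)^2) \<partial>lborel)"
  "1 / c * (\<Sum>p\<in>P. (est p X - \<tau> s p)^2) \<le> 10 * \<rho>" by auto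
qed

text \<open>With all other coordinates frozen the density is u + clip y * v, affine in the free one,
  and the target is affine as well. The lower bound (1 - \<delta>) f0 gives the information (w p)^2
  / (1 - \<delta>).\<close>

lemma coordinate_bound:
 assumes p: "p \<in> P"
 shows "ennreal ((w p * gram p p)^2 / (real n * ((w p)^2 / (1 - \<delta>)) + beta_info a)) \<le>
  (\<integral>\<^sup>+ y. (\<integral>\<^sup>+ X. ennreal ((est p X - \<tau> (s(p := y)) p)^2) \<partial>iid_sample n (dens (s(p := y)))) \<partial>beta_prior a)"
proof -
 define u where "u x = f0 x * (1 + (\<Sum>q\<in>P - {p}. w q * clip (s q) * e q x))" for x
 define v where "v x = w p * (f0 x * e p x)" for x
 define b where "b = (\<Sum>q\<in>P - {p}. w q * clip (s q) * gram q p)"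
 have d: "dens (s(p := y)) = (\<lambda>x. u x + clip y * v x)" for y
 proof
  fix x
  have "(\<Sum>q\<in>P - {p}. w q * clip ((s(p := y)) q) * e q x) = (\<Sum>q\<in>P - {p}. w q * clip (s q) * e q x)"
   by (intro sum.cong) auto
  then show "dens (s(p := y)) x = u x + clip y * v x"
   unfolding dens_def u_def v_def by (simp add: sum.remove[OF P p] algebra_simps)
 qed
 have t: "\<tau> (s(p := y)) p = b + (w p * gram p p) * clip y" for y
 proof -
  have "(\<Sum>q\<in>P - {p}. w q * clip ((s(p := y)) q) * gram q p) = b" unfolding b_def by (intro sum.cong) auto
  then show ?thesis unfolding \<tau>_def by (simp add: sum.remove[OF P p])
 qed
 have ge: "(1 - \<delta>) * f0 x \<le> u x + r * v x" if "\<bar>r\<bar> \<le> 1" for r x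
  using dens_ge[of x "s(p := r)"] unfolding d clip_eq[OF that] .
 have pos: "0 < u x + r * v x" if "\<bar>r\<bar> \<le> 1" for r x
  using dens_pos[of "s(p := r)" x] unfolding d clip_eq[OF that] .
 have i: "integrable lborel (\<lambda>x. f0 x * (e p x)^2)"
  by (rule f0_mult_int[where K = "2\<^sup>2"]) (use power_mono[OF e_le, of _ _ 2] in auto)
 show ?thesis unfolding d t
 proof (rule van_trees[OF a])
  show [measurable]: "u \<in> borel_measurable borel" "v \<in> borel_measurable borel" unfolding u_def v_def by measurable
  show "est p \<in> borel_measurable (Pi\<^sub>M {..<n} (\<lambda>_. lborel))" by measurable
  show "\<bar>est p X\<bar> \<le> 4 * \<rho> + (LBINT x. (f0 x * e p x)^2)" for X by (rule est_bounded)
  fix r x :: real assume r: "\<bar>r\<bar> \<le> 1"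
  show "0 < u x + r * v x" by (rule pos[OF r])
  have "\<bar>v x\<bar> = w p * f0 x * \<bar>e p x\<bar>" using w0[of p] f0_pos[of x] by (simp add: v_def abs_mult)
  also have "... \<le> w p * f0 x * 2" using w0[of p] f0_pos[of x] e_le[of p x] by (intro mult_left_mono) auto
  also have "... = 2 * w p / (1 - \<delta>) * ((1 - \<delta>) * f0 x)" using \<delta> by simp
  also have "... \<le> 2 * w p / (1 - \<delta>) * (u x + r * v x)" using ge[OF r] w0[of p] \<delta> by (intro mult_left_mono) auto
  finally show "\<bar>v x\<bar> \<le> 2 * w p / (1 - \<delta>) * (u x + r * v x)" .
 next
  show "has_bochner_integral lborel u 1"
  proof -
   have "has_bochner_integral lborel (dens (s(p := 0))) 1" by (rule dens_int)
   then show ?thesis unfolding d by (simp add: clip_def)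
  qed
  have "has_bochner_integral lborel (\<lambda>x. w p * (f0 x * e p x)) (w p * 0)"
   using f0_mult_int[OF e_measurable[of p] e_le] e_mean[OF p] by (intro has_bochner_integral_cmult) (simp add: hbi_iff)
  then show "has_bochner_integral lborel v 0" unfolding v_def by simp
  fix r :: real assume r: "\<bar>r\<bar> \<le> 1"
  have b: "(v x)^2 / (u x + r * v x) \<le> (w p)^2 / (1 - \<delta>) * (f0 x * (e p x)^2)" for x
  proof -
   have "(v x)^2 / (u x + r * v x) \<le> (v x)^2 / ((1 - \<delta>) * f0 x)"
    using ge[OF r, of x] f0_pos[of x] \<delta> pos[OF r, of x] by (intro divide_left_mono) auto
   also have "... = (w p)^2 / (1 - \<delta>) * (f0 x * (e p x)^2)"
    using f0_pos[of x] \<delta> by (simp add: v_def power2_eq_square field_simps)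
   finally show ?thesis .
  qed
  have "(LBINT x. (v x)^2 / (u x + r * v x)) \<le> (LBINT x. (w p)^2 / (1 - \<delta>) * (f0 x * (e p x)^2))"
   using i b pos[OF r] \<delta> f0_pos by (intro integral_mono_AE') (auto simp: less_imp_le)
  also have "... = (w p)^2 / (1 - \<delta>)" using e_orth[OF p p] by (simp add: power2_eq_square)
  finally show "(LBINT x. (v x)^2 / (u x + r * v x)) \<le> (w p)^2 / (1 - \<delta>)" .
 qed
qed

text \<open>The coordinate bounds are averaged over the remaining coordinates and added up.
  Parameters in \<open>Gd\<close> are charged to the maximal risk; for the others the uniform bound
  10 \<rho> on the coefficient loss is weighted by their prior probability.\<close>

theorem bayes_lower_bound:
 assumes Gd: "Gd \<in> sets (Pi\<^sub>M P (\<lambda>_. beta_prior a))" "\<And>s. s \<in> Gd \<Longrightarrow> dens s \<in> S"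
 shows "ennreal (\<Sum>p\<in>P. 1 / c * ((w p * gram p p)^2 / (real n * ((w p)^2 / (1 - \<delta>)) + beta_info a))) \<le>
  (SUP f\<in>S. mise n T f) + ennreal (10 * \<rho>) * emeasure (Pi\<^sub>M P (\<lambda>_. beta_prior a)) (space (Pi\<^sub>M P (\<lambda>_. beta_prior a)) - Gd)"
proof -
 let ?\<Pi> = "Pi\<^sub>M P (\<lambda>_. beta_prior a)"
 let ?\<mu> = "Pi\<^sub>M {..<n} (\<lambda>_. lborel :: real measure)"
 note finP = P
 interpret product_prob_space "\<lambda>_. beta_prior a" by (rule product_prob_spaceI) (rule prob_space_beta_prior)
 interpret L: product_sigma_finite "\<lambda>_. lborel :: real measure" by standard
 interpret \<mu>: sigma_finite_measure ?\<mu> by (rule L.sigma_finite) simp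
 interpret \<Pi>: prob_space ?\<Pi> by (rule prob_space_PiM) (rule prob_space_beta_prior)
 define LB where "LB p = (w p * gram p p)^2 / (real n * ((w p)^2 / (1 - \<delta>)) + beta_info a)" for p
 have info0: "0 \<le> beta_info a" unfolding beta_info_def using a by simp
 have LB0: "0 \<le> LB p" for p unfolding LB_def using info0 \<delta> by (intro divide_nonneg_nonneg add_nonneg_nonneg mult_nonneg_nonneg) auto
 define R where "R p s = (\<integral>\<^sup>+ X. ennreal ((est p X - \<tau> s p)^2) \<partial>iid_sample n (dens s))" for p s
 have [measurable]: "(\<lambda>s. \<tau> s p) \<in> borel_measurable ?\<Pi>" for p unfolding \<tau>_def by measurable
 have R: "R p s = (\<integral>\<^sup>+ X. ennreal (\<Prod>i<n. dens s (X i)) * ennreal ((est p X - \<tau> s p)^2) \<partial>?\<mu>)" for p s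
  unfolding R_def density_product by (subst nn_integral_density) measurable
 have [measurable]: "(\<lambda>(s, X). ennreal (\<Prod>i<n. dens s (X i))) \<in> borel_measurable (?\<Pi> \<Otimes>\<^sub>M ?\<mu>)"
  unfolding dens_def by measurable
 have Rm[measurable]: "R p \<in> borel_measurable ?\<Pi>" for p unfolding R by measurable
 have LB: "ennreal (LB p) \<le> (\<integral>\<^sup>+ s. R p s \<partial>?\<Pi>)" if p: "p \<in> P" for p
 proof -
  have P': "insert p (P - {p}) = P" using p by auto
  interpret Q: prob_space "Pi\<^sub>M (P - {p}) (\<lambda>_. beta_prior a)" by (rule prob_space_PiM) (rule prob_space_beta_prior)
  have "ennreal (LB p) = (\<integral>\<^sup>+ s. ennreal (LB p) \<partial>Pi\<^sub>M (P - {p}) (\<lambda>_. beta_prior a))" by (simp add: Q.emeasure_space_1)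
  also have "... \<le> (\<integral>\<^sup>+ s. (\<integral>\<^sup>+ y. R p (s(p := y)) \<partial>beta_prior a) \<partial>Pi\<^sub>M (P - {p}) (\<lambda>_. beta_prior a))"
   unfolding R_def LB_def by (intro nn_integral_mono coordinate_bound p)
  also have "... = (\<integral>\<^sup>+ s. R p s \<partial>?\<Pi>)"
   using product_nn_integral_insert[of "P - {p}" p "R p"] finP Rm[of p] unfolding P' by simp
  finally show ?thesis .
 qed
 have tot: "(\<Sum>p\<in>P. ennreal (1 / c) * R p s) = (\<integral>\<^sup>+ X. ennreal (1 / c * (\<Sum>p\<in>P. (est p X - \<tau> s p)^2)) \<partial>iid_sample n (dens s))" for s
 proof -
  have [measurable_cong]: "sets (iid_sample n (dens s)) = sets ?\<mu>" unfolding density_product by simp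
  have "(\<Sum>p\<in>P. ennreal (1 / c) * R p s) = (\<integral>\<^sup>+ X. (\<Sum>p\<in>P. ennreal (1 / c) * ennreal ((est p X - \<tau> s p)^2)) \<partial>iid_sample n (dens s))"
   unfolding R_def by (simp add: nn_integral_cmult nn_integral_sum)
  also have "... = (\<integral>\<^sup>+ X. ennreal (1 / c * (\<Sum>p\<in>P. (est p X - \<tau> s p)^2)) \<partial>iid_sample n (dens s))"
  proof (rule nn_integral_cong)
   fix X
   have "(\<Sum>p\<in>P. ennreal (1 / c) * ennreal ((est p X - \<tau> s p)^2)) = (\<Sum>p\<in>P. ennreal (1 / c * (est p X - \<tau> s p)^2))"
    using c0 by (intro sum.cong refl ennreal_mult[symmetric]) auto
   also have "... = ennreal (1 / c * (\<Sum>p\<in>P. (est p X - \<tau> s p)^2))"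
    unfolding sum_distrib_left using c0 by (intro sum_ennreal) auto
   finally show "(\<Sum>p\<in>P. ennreal (1 / c) * ennreal ((est p X - \<tau> s p)^2)) = ennreal (1 / c * (\<Sum>p\<in>P. (est p X - \<tau> s p)^2))" .
  qed
  finally show ?thesis .
 qed
 have sp: "space (iid_sample n (dens s)) = space ?\<mu>" for s unfolding density_product by simp
 have t1: "(\<Sum>p\<in>P. ennreal (1 / c) * R p s) \<le> mise n T (dens s)" for s
  unfolding tot mise_def by (intro nn_integral_mono est_loss(1)) (simp add: sp)
 have t2: "(\<Sum>p\<in>P. ennreal (1 / c) * R p s) \<le> ennreal (10 * \<rho>)" for s
 proof -
  have "prob_space (density lborel (\<lambda>x. ennreal (dens s x)))"
   using dens_int[of s] dens_pos[of s]
   by (intro prob_spaceI) (auto simp: emeasure_density hbi_iff less_imp_le nn_integral_eq_integral)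
  then have "prob_space (iid_sample n (dens s))" unfolding iid_sample_def by (intro prob_space_PiM)
  then have "emeasure (iid_sample n (dens s)) (space (iid_sample n (dens s))) = 1" by (rule prob_space.emeasure_space_1)
  then have "ennreal (10 * \<rho>) = (\<integral>\<^sup>+ X. ennreal (10 * \<rho>) \<partial>iid_sample n (dens s))" by simp
  moreover have "(\<Sum>p\<in>P. ennreal (1 / c) * R p s) \<le> (\<integral>\<^sup>+ X. ennreal (10 * \<rho>) \<partial>iid_sample n (dens s))"
   unfolding tot by (intro nn_integral_mono ennreal_leI est_loss(2)) (simp add: sp)
  ultimately show ?thesis by simp
 qed
 let ?M = "SUP f\<in>S. mise n T f"
 have "ennreal (\<Sum>p\<in>P. 1 / c * LB p) = (\<Sum>p\<in>P. ennreal (1 / c * LB p))"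
  using c0 LB0 by (intro sum_ennreal[symmetric]) auto
 also have "... = (\<Sum>p\<in>P. ennreal (1 / c) * ennreal (LB p))"
  by (intro sum.cong refl ennreal_mult) (use c0 LB0 in auto)
 also have "... \<le> (\<Sum>p\<in>P. ennreal (1 / c) * (\<integral>\<^sup>+ s. R p s \<partial>?\<Pi>))" by (intro sum_mono mult_left_mono LB) auto
 also have "... = (\<integral>\<^sup>+ s. (\<Sum>p\<in>P. ennreal (1 / c) * R p s) \<partial>?\<Pi>)" by (simp add: nn_integral_cmult nn_integral_sum)
 also have "... \<le> (\<integral>\<^sup>+ s. ?M * indicator Gd s + ennreal (10 * \<rho>) * indicator (space ?\<Pi> - Gd) s \<partial>?\<Pi>)"
 proof (rule nn_integral_mono)
  fix s assume s: "s \<in> space ?\<Pi>"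
  show "(\<Sum>p\<in>P. ennreal (1 / c) * R p s) \<le> ?M * indicator Gd s + ennreal (10 * \<rho>) * indicator (space ?\<Pi> - Gd) s"
  proof (cases "s \<in> Gd")
   case True
   have "(\<Sum>p\<in>P. ennreal (1 / c) * R p s) \<le> ?M" by (rule order_trans[OF t1]) (auto intro: SUP_upper Gd(2)[OF True])
   then show ?thesis using True by simp
  qed (use t2[of s] s in simp)
 qed
 also have "... = ?M * emeasure ?\<Pi> Gd + ennreal (10 * \<rho>) * emeasure ?\<Pi> (space ?\<Pi> - Gd)"
  using Gd(1) by (subst nn_integral_add) (auto simp: nn_integral_cmult_indicator)
 also have "... \<le> ?M * 1 + ennreal (10 * \<rho>) * emeasure ?\<Pi> (space ?\<Pi> - Gd)"
  by (intro add_mono mult_left_mono \<Pi>.emeasure_le_1) auto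
 finally show ?thesis unfolding LB_def by simp
qed

end

end

section \<open>The uniform density smoothed by a Gaussian\<close>

text \<open>The density of a uniform variable on [-A, A] plus an independent standard normal one.
  The convolution keeps the zeros of the sinc factor and adds Gaussian decay to the
  transform.\<close>

definition sunif :: "real \<Rightarrow> real \<Rightarrow> real" where
 "sunif A x = (LBINT y. indicator {-A..A} y * gauss (x - y)) / (2 * A)"

lemma sunif_measurable[measurable]: "sunif A \<in> borel_measurable borel"
 unfolding sunif_def[abs_def] by measurable

lemma std_normal_translate:
 "has_bochner_integral lborel (\<lambda>x. gauss (x - y)) 1" "has_bochner_integral lborel (\<lambda>y. gauss (x - y)) 1"
proof -
 have "has_bochner_integral lborel gauss 1"
  using integrable_std_normal_moment[of 0] integral_std_normal_moment_even[of 0] by (simp add: hbi_iff)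
 then show "has_bochner_integral lborel (\<lambda>x. gauss (x - y)) 1" "has_bochner_integral lborel (\<lambda>y. gauss (x - y)) 1"
  using lborel_has_bochner_integral_real_affine_iff[of 1 gauss 1 "-y"] lborel_has_bochner_integral_real_affine_iff[of "-1" gauss 1 x]
  by simp_all
qed

lemma sunif_integral:
 fixes g :: "real \<Rightarrow> 'b::{banach, second_countable_topology}"
 assumes A: "A > 0" and [measurable]: "g \<in> borel_measurable borel" and K: "\<And>x. norm (g x) \<le> K"
 shows "integrable lborel (\<lambda>x. sunif A x *\<^sub>R g x)"
  "(LBINT x. sunif A x *\<^sub>R g x) = (1 / (2 * A)) *\<^sub>R (LBINT y. indicator {-A..A} y *\<^sub>R (LBINT z. gauss z *\<^sub>R g (y + z)))"
proof -
 let ?s = "\<lambda>y x. indicator {-A..A} y * gauss (x - y)"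
 have s0: "0 \<le> ?s y x" for x y by simp
 have sI: "has_bochner_integral lborel (?s y) (indicator {-A..A} y)" for y
  using has_bochner_integral_cmult[OF std_normal_translate(1)[of y], of "indicator {-A..A} y"] by simp
 have I: "integrable (lborel \<Otimes>\<^sub>M lborel) (\<lambda>(y, x). ?s y x)"
 proof (rule lborel_pair.Fubini_integrable)
  show "integrable lborel (\<lambda>y. LBINT x. norm (case (y, x) of (y, x) \<Rightarrow> ?s y x))"
   using std_normal_translate(1) by (simp add: hbi_iff)
  show "AE y in lborel. integrable lborel (\<lambda>x. case (y, x) of (y, x) \<Rightarrow> ?s y x)"
   using sI by (simp add: hbi_iff)
 qed measurable
 have J: "integrable (lborel \<Otimes>\<^sub>M lborel) (\<lambda>(y, x). ?s y x *\<^sub>R g x)"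
 proof (rule L1_bound[OF integrable_mult_right[OF I, of K]])
  have "norm (?s y x *\<^sub>R g x) \<le> norm (K * ?s y x)" for x y
   using mult_left_mono[OF K[of x] s0[of y x]] order_trans[OF norm_ge_zero K[of x]] by (simp add: abs_mult mult_ac)
  then show "AE p in lborel \<Otimes>\<^sub>M lborel. norm (case p of (y, x) \<Rightarrow> ?s y x *\<^sub>R g x) \<le> norm (K * (case p of (y, x) \<Rightarrow> ?s y x))"
   by (intro AE_I2) auto
 qed measurable
 have y: "integrable lborel (\<lambda>y. ?s y x)" for x
  by (rule L1_bound[of lborel "\<lambda>y. gauss (x - y)"])
   (use std_normal_translate(2)[of x] in "auto simp: hbi_iff indicator_def")
 have e: "sunif A x *\<^sub>R g x = (1 / (2 * A)) *\<^sub>R (LBINT y. ?s y x *\<^sub>R g x)" for x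
  using y[of x] by (simp add: sunif_def)
 show "integrable lborel (\<lambda>x. sunif A x *\<^sub>R g x)"
  unfolding e using lborel_pair.integrable_snd[OF J] by simp
 have t: "(LBINT x. ?s y x *\<^sub>R g x) = indicator {-A..A} y *\<^sub>R (LBINT z. gauss z *\<^sub>R g (y + z))" for y
  by (subst lborel_integral_real_affine[of 1 _ y]) (auto simp flip: scaleR_scaleR)
 show "(LBINT x. sunif A x *\<^sub>R g x) = (1 / (2 * A)) *\<^sub>R (LBINT y. indicator {-A..A} y *\<^sub>R (LBINT z. gauss z *\<^sub>R g (y + z)))"
  unfolding e t[symmetric] using lborel_pair.Fubini_integral[OF J] by simp
qed

lemma sunif_props:
 assumes A: "A > 0"
 shows "0 < sunif A x" "sunif A x \<le> 1 / (2 * A)" "has_bochner_integral lborel (sunif A) 1"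
proof -
 have i: "integrable lborel (\<lambda>y. indicator {-A..A} y * gauss (x - y))"
  by (rule L1_bound[of lborel "\<lambda>y. gauss (x - y)"])
   (use std_normal_translate(2)[of x] in "auto simp: hbi_iff indicator_def")
 have "(LBINT y. indicator {-A..A} y * gauss (x - y)) \<le> (LBINT y. gauss (x - y))"
  using i std_normal_translate(2)[of x] by (intro integral_mono) (auto simp: hbi_iff indicator_def)
 also have "... = 1" using std_normal_translate(2)[of x] by (simp add: hbi_iff)
 finally show "sunif A x \<le> 1 / (2 * A)" unfolding sunif_def using A by (intro divide_right_mono) auto
 have "0 < gauss (\<bar>x\<bar> + A) * (2 * A)" using A by (simp add: normal_density_pos)
 also have "... = (LBINT y. indicator {-A..A} y * gauss (\<bar>x\<bar> + A))" using A by simp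
 also have "... \<le> (LBINT y. indicator {-A..A} y * gauss (x - y))"
 proof (rule integral_mono[OF _ i])
  fix y
  have "gauss (\<bar>x\<bar> + A) \<le> gauss (x - y)" if "\<bar>y\<bar> \<le> A"
  proof -
   have "\<bar>x - y\<bar> \<le> \<bar>x\<bar> + A" using that by linarith
   then have "(x - y)^2 \<le> (\<bar>x\<bar> + A)^2" using A by (simp flip: abs_le_square_iff)
   then show ?thesis by (simp add: std_normal_density_def divide_right_mono)
  qed
  then show "indicator {-A..A} y * gauss (\<bar>x\<bar> + A) \<le> indicator {-A..A} y * gauss (x - y)"
   by (auto simp: indicator_def abs_le_iff)
 qed simp
 finally show "0 < sunif A x" unfolding sunif_def using A by simp
 show "has_bochner_integral lborel (sunif A) 1"
  using sunif_integral[OF A, of "\<lambda>_. 1::real" 1] std_normal_translate(1)[of 0] A by (simp add: hbi_iff)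
qed

text \<open>The tangent bound f^2 >= 2 c f - c^2 with c = 1 / (2A), the height of the uniform
  density, is used on [-A - R, A + R]; Chebyshev's inequality for the normal part bounds the mass
  outside by 1 / R^2.\<close>

lemma sunif_sq:
 assumes A: "A > 0" and R: "R > 0"
 shows "integrable lborel (\<lambda>x. (sunif A x)^2)"
  "(1 - 2 / R\<^sup>2 - R / A) / (2 * A) \<le> (LBINT x. (sunif A x)^2)"
proof -
 note f = sunif_props[OF A]
 show i2: "integrable lborel (\<lambda>x. (sunif A x)^2)"
 proof (rule L1_bound)
  show "integrable lborel (\<lambda>x. 1 / (2 * A) * sunif A x)" using f(3) by (simp add: hbi_iff)
  have "(sunif A x)^2 \<le> 1 / (2 * A) * sunif A x" for x
   unfolding power2_eq_square using f(1,2)[of x] by (intro mult_right_mono) auto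
  then show "AE x in lborel. norm ((sunif A x)^2) \<le> norm (1 / (2 * A) * sunif A x)"
   by (intro AE_I2) (metis abs_ge_self norm_power order_trans power2_abs real_norm_def)
 qed measurable
 define B where "B = {-(A + R)..A + R}"
 define c where "c = 1 / (2 * A)"
 have c: "c > 0" using A by (simp add: c_def)
 have B: "has_bochner_integral lborel (indicator B :: real \<Rightarrow> real) (2 * (A + R))"
  using A R by (simp add: hbi_iff B_def)
 have iB: "integrable lborel (\<lambda>x. sunif A x * (1 - indicator B x))"
  using sunif_integral(1)[OF A, of "\<lambda>x. 1 - indicator B x :: real" 1] by (simp add: B_def indicator_def)
 have m2: "has_bochner_integral lborel (\<lambda>z. gauss z * z\<^sup>2) 1"
  using integrable_std_normal_moment[of 2] integral_std_normal_moment_even[of 1] by (simp add: hbi_iff fact_numeral)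
 have "(LBINT x. sunif A x * (1 - indicator B x)) = c * (LBINT y. indicator {-A..A} y * (LBINT z. gauss z * (1 - indicator B (y + z))))"
  using sunif_integral(2)[OF A, of "\<lambda>x. 1 - indicator B x :: real" 1] by (simp add: B_def indicator_def c_def)
 also have "... \<le> c * (LBINT y. indicator {-A..A} y * (1 / R\<^sup>2))"
 proof (rule mult_left_mono[OF integral_mono_AE'])
  show "AE y in lborel. indicator {-A..A} y * (LBINT z. gauss z * (1 - indicator B (y + z))) \<le> indicator {-A..A} y * (1 / R\<^sup>2)"
  proof (intro AE_I2)
   fix y
   have "(LBINT z. gauss z * (1 - indicator B (y + z))) \<le> (LBINT z. (gauss z * z\<^sup>2) / R\<^sup>2)" if "\<bar>y\<bar> \<le> A"
   proof (rule integral_mono_AE')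
    have "gauss z * (1 - indicator B (y + z)) \<le> gauss z * (z\<^sup>2 / R\<^sup>2)" for z
    proof (intro mult_left_mono)
     have "R\<^sup>2 \<le> z\<^sup>2" if "y + z \<notin> B"
     proof -
      have "\<bar>R\<bar> \<le> \<bar>z\<bar>" using that \<open>\<bar>y\<bar> \<le> A\<close> R unfolding B_def by auto
      then show ?thesis by (simp flip: abs_le_square_iff)
     qed
     then show "1 - indicator B (y + z) \<le> z\<^sup>2 / R\<^sup>2" using R by (auto simp: indicator_def)
    qed simp
    then show "AE z in lborel. gauss z * (1 - indicator B (y + z)) \<le> gauss z * z\<^sup>2 / R\<^sup>2" by simp
   qed (use m2 in "auto simp: hbi_iff indicator_def")
   also have "... = 1 / R\<^sup>2" using m2 by (simp add: hbi_iff)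
   finally show "indicator {-A..A} y * (LBINT z. gauss z * (1 - indicator B (y + z))) \<le> indicator {-A..A} y * (1 / R\<^sup>2)"
    by (auto simp: indicator_def abs_le_iff)
  qed
 qed (use c in auto)
 also have "... = 1 / R\<^sup>2" using A by (simp add: c_def)
 finally have tail: "(LBINT x. sunif A x * (1 - indicator B x)) \<le> 1 / R\<^sup>2" .
 have fi: "integrable lborel (sunif A)" "(LBINT x. sunif A x) = 1" using f(3) by (auto simp: hbi_iff)
 have "2 * c * (1 - 1 / R\<^sup>2) - c\<^sup>2 * (2 * (A + R)) \<le> (LBINT x. 2 * c * (sunif A x - sunif A x * (1 - indicator B x)) - c\<^sup>2 * indicator B x)"
 proof -
  have "(LBINT x. 2 * c * (sunif A x - sunif A x * (1 - indicator B x)) - c\<^sup>2 * indicator B x)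
   = 2 * c * (1 - (LBINT x. sunif A x * (1 - indicator B x))) - c\<^sup>2 * (2 * (A + R))"
   using fi iB B by (subst LINT_diff)
    (auto simp: hbi_iff simp del: right_diff_distrib_numeral)
  moreover have "2 * c * (1 - 1 / R\<^sup>2) \<le> 2 * c * (1 - (LBINT x. sunif A x * (1 - indicator B x)))"
   using tail c by (intro mult_left_mono) auto
  ultimately show ?thesis by simp
 qed
 also have "... \<le> (LBINT x. (sunif A x)^2)"
 proof (rule integral_mono[OF _ i2])
  show "integrable lborel (\<lambda>x. 2 * c * (sunif A x - sunif A x * (1 - indicator B x)) - c\<^sup>2 * indicator B x)"
   using fi iB B by (intro L1_diff integrable_mult_right) (auto simp: hbi_iff)
  fix x
  have "0 \<le> (sunif A x - c)^2" by simp
  then show "2 * c * (sunif A x - sunif A x * (1 - indicator B x)) - c\<^sup>2 * indicator B x \<le> (sunif A x)^2"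
   by (simp add: indicator_def power2_eq_square algebra_simps)
 qed
 also have "2 * c * (1 - 1 / R\<^sup>2) - c\<^sup>2 * (2 * (A + R)) = (1 - 2 / R\<^sup>2 - R / A) / (2 * A)"
 proof -
  have "2 * (1 / (2 * A)) * (1 - q) - (1 / (2 * A))\<^sup>2 * (2 * (A + R)) = (1 - 2 * q - R / A) / (2 * A)" for q
   using A by (simp add: power2_eq_square divide_simps) (simp add: algebra_simps)
  from this[of "1 / R\<^sup>2"] show ?thesis by (simp add: c_def)
 qed
 finally show "(1 - 2 / R\<^sup>2 - R / A) / (2 * A) \<le> (LBINT x. (sunif A x)^2)" .
qed

definition sinc :: "real \<Rightarrow> real" where "sinc t = (if t = 0 then 1 else sin t / t)"

definition sunif_FT :: "real \<Rightarrow> real \<Rightarrow> real" where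
 "sunif_FT A w = exp (- w\<^sup>2 / 2) * sinc (A * w)"

lemma fourier_smooth_unif:
 assumes A: "A > 0"
 shows "fourier (sunif A) w = of_real (sunif_FT A w)"
proof -
 have g: "(LBINT z. gauss z *\<^sub>R iexp (w * (y + z))) = iexp (w * y) * of_real (exp (- w\<^sup>2 / 2))" for y
 proof -
  have "(LBINT z. gauss z *\<^sub>R iexp (w * (y + z))) = (LBINT z. (iexp (w * y) / of_real (sqrt (2 * pi))) * (complex_of_real (exp (- (1 * z)\<^sup>2 / 2)) * iexp (w * z)))"
   by (intro LINT_cong refl) (simp add: std_normal_density_def scaleR_conv_of_real distrib_left exp_add)
  also have "... = iexp (w * y) / of_real (sqrt (2 * pi)) * of_real (2 * pi * gauss w)"
   using FT_gaussian(2)[of 1 w] by (simp add: FT_def)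
  also have "... = iexp (w * y) * of_real (2 * pi * gauss w / sqrt (2 * pi))" by simp
  also have "2 * pi * gauss w / sqrt (2 * pi) = exp (- w\<^sup>2 / 2)"
  proof -
   have "2 * pi = sqrt (2 * pi) * sqrt (2 * pi)" by simp
   then show ?thesis unfolding std_normal_density_def by (simp add: field_simps)
  qed
  finally show ?thesis .
 qed
 have s: "(LBINT y. indicator {-A..A} y *\<^sub>R iexp (w * y)) = of_real (2 * A * sinc (A * w))"
 proof (cases "w = 0")
  case True
  then show ?thesis using A by (simp add: sinc_def scaleR_conv_of_real)
 next
  case False
  have "(LBINT y. indicator {-A..A} y *\<^sub>R iexp (w * y)) = iexp (w * A) / (\<i> * w) - iexp (w * (- A)) / (\<i> * w)"
  proof (rule integral_FTC_Icc)
   show "((\<lambda>y. iexp (w * y) / (\<i> * w)) has_vector_derivative iexp (w * x)) (at x within {- A..A})" for x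
    unfolding of_real_mult using False
    by (auto intro!: derivative_eq_intros has_vector_derivative_real_field) (simp add: mult_ac)
  qed (use A in "auto intro!: continuous_intros")
  also have "... = (iexp (w * A) - iexp (w * (- A))) / (\<i> * w)" by (simp only: diff_divide_distrib)
  also have "iexp (w * A) - iexp (w * (- A)) = 2 * \<i> * of_real (sin (A * w))"
   by (simp add: complex_eq_iff Re_exp Im_exp mult.commute)
  also have "2 * \<i> * of_real (sin (A * w)) / (\<i> * w) = of_real (2 * sin (A * w) / w)" using False by simp
  finally show ?thesis using False A by (simp add: sinc_def)
 qed
 have "fourier (sunif A) w = (LBINT x. sunif A x *\<^sub>R iexp (w * x))"
  by (simp add: fourier_def scaleR_conv_of_real)
 also have "... = (1 / (2 * A)) *\<^sub>R (LBINT y. (indicator {-A..A} y *\<^sub>R iexp (w * y)) * of_real (exp (- w\<^sup>2 / 2)))"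
  using sunif_integral(2)[OF A, of "\<lambda>x. iexp (w * x)" 1] unfolding g by simp
 also have "... = of_real (sunif_FT A w)"
  unfolding integral_mult_left_zero s using A by (simp add: sunif_FT_def scaleR_conv_of_real)
 finally show ?thesis .
qed

text \<open>The second bound multiplies |sinc t| <= 1 by |sinc t| <= 1 / |t|. The point t = 0 is set
  apart because 1 / 0 = 0.\<close>

lemma sinc_bounds: "\<bar>sinc t\<bar> \<le> 1" "(sinc t)^2 \<le> 1 / \<bar>t\<bar> \<or> t = 0"
proof -
 show b: "\<bar>sinc t\<bar> \<le> 1" using abs_sin_x_le_abs_x[of t] by (simp add: sinc_def abs_divide divide_le_eq)
 show "(sinc t)^2 \<le> 1 / \<bar>t\<bar> \<or> t = 0"
 proof (cases "t = 0")
  case False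
  have "\<bar>sinc t\<bar> * \<bar>sinc t\<bar> \<le> 1 * (1 / \<bar>t\<bar>)"
   using b False by (intro mult_mono) (auto simp: sinc_def abs_divide divide_right_mono)
  then show ?thesis by (simp add: power2_eq_square flip: abs_mult)
 qed simp
qed

lemma sunif_cos:
 assumes A: "A > 0"
 shows "(LBINT x. sunif A x * cos (w * x)) = sunif_FT A w" "(LBINT x. sunif A x * sin (w * x)) = 0"
proof -
 have i: "integrable lborel (\<lambda>x. sunif A x *\<^sub>R iexp (w * x))"
  by (rule sunif_integral(1)[OF A, of _ 1]) auto
 have e: "(LBINT x. sunif A x *\<^sub>R iexp (w * x)) = of_real (sunif_FT A w)"
  using fourier_smooth_unif[OF A, of w] by (simp add: fourier_def scaleR_conv_of_real)
 have "(LBINT x. Re (sunif A x *\<^sub>R iexp (w * x))) = sunif_FT A w"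
  "(LBINT x. Im (sunif A x *\<^sub>R iexp (w * x))) = 0"
  using integral_Re[OF i] integral_Im[OF i] unfolding e by simp_all
 then show "(LBINT x. sunif A x * cos (w * x)) = sunif_FT A w" "(LBINT x. sunif A x * sin (w * x)) = 0"
  by (simp_all add: Re_exp Im_exp)
qed

section \<open>Trigonometric perturbations and their Sobolev norms\<close>

text \<open>Subadditivity for \<beta> <= 1, the mean value theorem otherwise. The factor in the
  distance |y - v| will be absorbed by Gaussian decay, and the remaining growth (1 + v)^max(\<beta>
  - 1, 0) is of lower order than v^\<beta>.\<close>

lemma powr_diff_le:
 fixes y v \<beta> :: real
 assumes \<beta>: "\<beta> > 0" and y: "y \<ge> 0" and v: "v \<ge> 0"
 shows "\<bar>y powr \<beta> - v powr \<beta>\<bar> \<le> (\<beta> + 1) * (1 + \<bar>y - v\<bar>) powr (\<beta> + 1) * (1 + v) powr (max (\<beta> - 1) 0)"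
proof -
 define l m d where "l = min y v" and "m = max y v" and "d = \<bar>y - v\<bar>"
 have lm: "0 \<le> l" "m = l + d" "0 \<le> d" "m \<le> v + d" using y v by (auto simp: l_def m_def d_def)
 have e: "\<bar>y powr \<beta> - v powr \<beta>\<bar> = m powr \<beta> - l powr \<beta>"
  using y v \<beta> powr_mono2[of \<beta> y v] powr_mono2[of \<beta> v y] by (auto simp: l_def m_def max_def min_def)
 have one: "1 \<le> (1 + v) powr (max (\<beta> - 1) 0)" using v by (intro ge_one_powr_ge_zero) auto
 show ?thesis
 proof (cases "\<beta> \<le> 1")
  case True
  have "m powr \<beta> - l powr \<beta> \<le> d powr \<beta>"
  proof (cases "l = 0 \<or> d = 0")
   case False
   then have p: "0 < l" "0 < d" "0 < m" using lm by auto
   have "m powr \<beta> = l * m powr (\<beta> - 1) + d * m powr (\<beta> - 1)"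
    using p powr_add[of m 1 "\<beta> - 1"] by (simp add: lm(2) distrib_right)
   also have "... \<le> l * l powr (\<beta> - 1) + d * d powr (\<beta> - 1)"
    using p True lm by (intro add_mono mult_left_mono powr_mono2') auto
   also have "... = l powr \<beta> + d powr \<beta>" using p powr_add[of l 1 "\<beta> - 1"] powr_add[of d 1 "\<beta> - 1"] by simp
   finally show ?thesis by simp
  qed (use lm in auto)
  also have "... \<le> (1 + d) powr \<beta>" using lm \<beta> by (intro powr_mono2) auto
  also have "... \<le> (1 + d) powr (\<beta> + 1)" using lm by (intro powr_mono) auto
  also have "... = 1 * (1 + d) powr (\<beta> + 1) * 1" by simp
  also have "... \<le> (\<beta> + 1) * (1 + d) powr (\<beta> + 1) * (1 + v) powr (max (\<beta> - 1) 0)"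
   using \<beta> one by (intro mult_mono) auto
  finally show ?thesis unfolding e d_def .
 next
  case False
  have "m powr \<beta> - l powr \<beta> \<le> \<beta> * m powr (\<beta> - 1) * d"
  proof (cases "l = 0 \<or> d = 0")
   case True
   then show ?thesis
   proof
    assume "l = 0"
    then have "m = d" using lm by simp
    have "m powr \<beta> = m powr (\<beta> - 1) * m" using lm powr_add[of m "\<beta> - 1" 1] by (cases "m = 0") auto
    also have "... \<le> \<beta> * (m powr (\<beta> - 1) * m)" using False lm \<open>m = d\<close> mult_right_mono[of 1 \<beta> "m powr (\<beta> - 1) * m"] by simp
    finally show ?thesis using \<open>m = d\<close> \<open>l = 0\<close> \<beta> by (simp add: mult.assoc)
   qed (use lm in simp)
  next
   case F: False
   then have p: "0 < l" "l < m" using lm by auto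
   have "\<exists>z>l. z < m \<and> m powr \<beta> - l powr \<beta> = (m - l) * (\<beta> * z powr (\<beta> - 1))"
    by (rule MVT2[OF p(2)]) (use p in "auto intro!: derivative_eq_intros")
   then obtain z where z: "z > l" "z < m" "m powr \<beta> - l powr \<beta> = (m - l) * (\<beta> * z powr (\<beta> - 1))" by blast
   have "z powr (\<beta> - 1) \<le> m powr (\<beta> - 1)" using z p False by (intro powr_mono2) auto
   then have "(m - l) * (\<beta> * z powr (\<beta> - 1)) \<le> (m - l) * (\<beta> * m powr (\<beta> - 1))" using p \<beta> by (intro mult_left_mono) auto
   then show ?thesis using z(3) lm(2) by (simp add: mult_ac)
  qed
  also have "... \<le> (\<beta> + 1) * ((1 + v) * (1 + d)) powr (\<beta> - 1) * (1 + d)"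
  proof (intro mult_mono powr_mono2)
   have "v + d \<le> (1 + v) * (1 + d)" using v lm mult_nonneg_nonneg[of v d] by (simp add: algebra_simps)
   then show "m \<le> (1 + v) * (1 + d)" using lm(4) by simp
  qed (use lm v \<beta> False in auto)
  also have "... = (\<beta> + 1) * (1 + d) powr \<beta> * (1 + v) powr (\<beta> - 1)"
   using lm v powr_add[of "1 + d" "\<beta> - 1" 1] by (simp add: powr_mult)
  also have "... \<le> (\<beta> + 1) * (1 + d) powr (\<beta> + 1) * (1 + v) powr (\<beta> - 1)"
   using lm \<beta> by (intro mult_right_mono mult_left_mono powr_mono) auto
  finally show ?thesis unfolding e d_def using False by (simp add: max_def)
 qed
qed

lemma gaussian_moment_integrable:
 fixes q :: real
 assumes "q \<ge> 0"
 shows "integrable lborel (\<lambda>w. (1 + \<bar>w\<bar>) powr q * exp (- w\<^sup>2))"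
proof -
 define N where "N = nat \<lceil>q\<rceil>"
 have N: "q \<le> real N" using assms unfolding N_def by linarith
 define G where "G w = 2 ^ N * sqrt (2 * pi) * (gauss w * \<bar>w\<bar> ^ 0 + gauss w * \<bar>w\<bar> ^ N)" for w
 have "integrable lborel G" unfolding G_def
  by (intro integrable_mult_right L1_add integrable_std_normal_moment_abs)
 then show ?thesis
 proof (rule L1_bound)
  have "(1 + \<bar>w\<bar>) powr q * exp (- w\<^sup>2) \<le> G w" for w
  proof -
   have "(1 + \<bar>w\<bar>) powr q \<le> (1 + \<bar>w\<bar>) powr real N" using N by (intro powr_mono) auto
   also have "... = (1 + \<bar>w\<bar>) ^ N" by (simp add: powr_realpow)
   also have "... \<le> (2 * max 1 \<bar>w\<bar>) ^ N" by (intro power_mono) auto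
   also have "... = 2 ^ N * max 1 \<bar>w\<bar> ^ N" by (simp add: power_mult_distrib)
   also have "... \<le> 2 ^ N * (1 + \<bar>w\<bar> ^ N)" by (intro mult_left_mono) (auto simp: max_def)
   finally have "(1 + \<bar>w\<bar>) powr q * exp (- w\<^sup>2) \<le> 2 ^ N * (1 + \<bar>w\<bar> ^ N) * exp (- w\<^sup>2 / 2)"
    by (intro mult_mono) auto
   also have "... = G w" unfolding G_def std_normal_density_def by (simp add: algebra_simps)
   finally show ?thesis .
  qed
  then show "AE w in lborel. norm ((1 + \<bar>w\<bar>) powr q * exp (- w\<^sup>2)) \<le> norm (G w)"
   by (intro AE_I2) (simp add: abs_mult, metis abs_ge_self order_trans)
 qed measurable
qed

section \<open>Trigonometric functions on the lattice of zeros\<close>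

definition freq :: "real \<Rightarrow> nat \<Rightarrow> real" where "freq A j = pi * real j / A"

definition trig :: "real \<Rightarrow> bool \<times> nat \<Rightarrow> real \<Rightarrow> real" where
 "trig A p x = sqrt 2 * (if fst p then cos (freq A (snd p) * x) else sin (freq A (snd p) * x))"

lemma trig_measurable[measurable]: "trig A p \<in> borel_measurable borel" unfolding trig_def[abs_def] by measurable

lemma trig_le: "\<bar>trig A p x\<bar> \<le> 2"
proof -
 have "sqrt 2 \<le> (2::real)" by (rule real_le_lsqrt) auto
 then have "sqrt 2 * \<bar>if fst p then cos (freq A (snd p) * x) else sin (freq A (snd p) * x)\<bar> \<le> 2 * 1" by (intro mult_mono) auto
 then show ?thesis by (simp add: trig_def abs_mult)
qed

text \<open>The sine vanishes at multiples of pi. Sums and differences of frequencies stay on this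
  lattice, so the trigonometric functions are exactly orthonormal although \<open>sunif A\<close> is
  positive on the whole line.\<close>

lemma sunif_FT_lattice:
 assumes "A > 0"
 shows "sunif_FT A (pi * real_of_int m / A) = (if m = 0 then 1 else 0)"
 using assms by (simp add: sunif_FT_def sinc_def sin_int_times_real)

lemma trig_mean: "A > 0 \<Longrightarrow> snd p > 0 \<Longrightarrow> (LBINT x. sunif A x * trig A p x) = 0"
 using sunif_cos[of A "freq A (snd p)"] sunif_FT_lattice[of A "int (snd p)"]
 by (cases "fst p") (simp_all add: trig_def freq_def mult.left_commute[of _ "sqrt 2"])

lemma trig_orth:
 assumes A: "A > 0" and p: "snd p > 0" and q: "snd q > 0"
 shows "(LBINT x. sunif A x * (trig A p x * trig A q x)) = (if p = q then 1 else 0)"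
proof -
 obtain b j where p': "p = (b, j)" by force
 obtain d k where q': "q = (d, k)" by force
 let ?u = "freq A j" and ?v = "freq A k"
 have i: "integrable lborel (\<lambda>x. sunif A x * cos (w * x))" "integrable lborel (\<lambda>x. sunif A x * sin (w * x))" for w
  using sunif_integral(1)[OF A, of "\<lambda>x. cos (w * x)" 1] sunif_integral(1)[OF A, of "\<lambda>x. sin (w * x)" 1] by auto
 have d: "?u - ?v = pi * real_of_int (int j - int k) / A" and s: "?u + ?v = pi * real_of_int (int j + int k) / A"
  by (simp_all add: freq_def diff_divide_distrib add_divide_distrib right_diff_distrib distrib_left)
 have F: "sunif_FT A (?u - ?v) = (if j = k then 1 else 0)" "sunif_FT A (?u + ?v) = 0"
  unfolding d s sunif_FT_lattice[OF A] using p q by (auto simp: p' q')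
 have s2: "sqrt 2 * X * (sqrt 2 * Y) = 2 * (X * Y)" for X Y by (simp add: mult.left_commute mult.assoc[symmetric])
 consider "b" "d" | "\<not> b" "\<not> d" | "b" "\<not> d" | "\<not> b" "d" by blast
 then show ?thesis
 proof cases
  case 1
  have "(LBINT x. sunif A x * (trig A p x * trig A q x)) = (LBINT x. sunif A x * cos ((?u - ?v) * x) + sunif A x * cos ((?u + ?v) * x))"
   using 1 by (intro LINT_cong refl) (simp add: p' q' trig_def s2 cos_times_cos distrib_left left_diff_distrib distrib_right)
  also have "... = sunif_FT A (?u - ?v) + sunif_FT A (?u + ?v)" using i by (simp add: sunif_cos[OF A])
  finally show ?thesis using 1 by (simp add: F p' q')
 next
  case 2
  have "(LBINT x. sunif A x * (trig A p x * trig A q x)) = (LBINT x. sunif A x * cos ((?u - ?v) * x) - sunif A x * cos ((?u + ?v) * x))"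
   using 2 by (intro LINT_cong refl) (simp add: p' q' trig_def s2 sin_times_sin right_diff_distrib left_diff_distrib distrib_right)
  also have "... = sunif_FT A (?u - ?v) - sunif_FT A (?u + ?v)" using i by (simp add: sunif_cos[OF A])
  finally show ?thesis using 2 by (simp add: F p' q')
 next
  case 3
  have "(LBINT x. sunif A x * (trig A p x * trig A q x)) = (LBINT x. sunif A x * sin ((?u + ?v) * x) - sunif A x * sin ((?u - ?v) * x))"
   using 3 by (intro LINT_cong refl) (simp add: p' q' trig_def s2 cos_times_sin right_diff_distrib left_diff_distrib distrib_right)
  also have "... = 0" using i by (simp add: sunif_cos[OF A])
  finally show ?thesis using 3 by (simp add: p' q')
 next
  case 4
  have "(LBINT x. sunif A x * (trig A p x * trig A q x)) = (LBINT x. sunif A x * sin ((?u + ?v) * x) + sunif A x * sin ((?u - ?v) * x))"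
   using 4 by (intro LINT_cong refl) (simp add: p' q' trig_def s2 sin_times_cos distrib_left left_diff_distrib distrib_right)
  also have "... = 0" using i by (simp add: sunif_cos[OF A])
  finally show ?thesis using 4 by (simp add: p' q')
 qed
qed

text \<open>From cos^2 + sin^2 = 1: pairing the two functions of one frequency makes it unnecessary
  to evaluate their diagonal entries separately.\<close>

lemma trig_gram:
 assumes A: "A > 0"
 shows "(LBINT x. (sunif A x * trig A (True, j) x) * (sunif A x * trig A (True, j) x))
   + (LBINT x. (sunif A x * trig A (False, j) x) * (sunif A x * trig A (False, j) x)) = 2 * (LBINT x. (sunif A x)^2)"
proof -
 have eq: "(sunif A x * trig A p x) * (sunif A x * trig A p x) = (sunif A x)^2 * (trig A p x)^2" for x p
  by (simp add: power2_eq_square mult_ac)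
 have i: "integrable lborel (\<lambda>x. (sunif A x * trig A p x) * (sunif A x * trig A p x))" for p
 proof (rule L1_bound[OF integrable_mult_right[OF sunif_sq(1)[OF A, of 1], of 4]])
  have "(trig A p x)^2 \<le> 4" for x using power_mono[OF trig_le, of A p x 2] by simp
  then have "(sunif A x)^2 * (trig A p x)^2 \<le> (sunif A x)^2 * 4" for x by (intro mult_left_mono) auto
  then show "AE x in lborel. norm ((sunif A x * trig A p x) * (sunif A x * trig A p x)) \<le> norm (4 * (sunif A x)^2)"
   unfolding eq by (intro AE_I2) (simp add: abs_mult mult.commute)
 qed auto
 have "(LBINT x. (sunif A x * trig A (True, j) x) * (sunif A x * trig A (True, j) x))
   + (LBINT x. (sunif A x * trig A (False, j) x) * (sunif A x * trig A (False, j) x))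
  = (LBINT x. (sunif A x * trig A (True, j) x) * (sunif A x * trig A (True, j) x)
   + (sunif A x * trig A (False, j) x) * (sunif A x * trig A (False, j) x))"
  using i by (intro LINT_add[symmetric])
 also have "... = (LBINT x. 2 * (sunif A x)^2)"
 proof (intro LINT_cong refl)
  fix x
  have "(s * (sqrt 2 * C)) * (s * (sqrt 2 * C)) + (s * (sqrt 2 * S)) * (s * (sqrt 2 * S)) = 2 * (s\<^sup>2 * (C\<^sup>2 + S\<^sup>2))" for s C S :: real
   by (simp add: power2_eq_square algebra_simps)
  then show "(sunif A x * trig A (True, j) x) * (sunif A x * trig A (True, j) x)
   + (sunif A x * trig A (False, j) x) * (sunif A x * trig A (False, j) x) = 2 * (sunif A x)^2"
   unfolding trig_def by (simp only: fst_conv snd_conv if_True if_False sin_cos_squared_add2 mult_1_right)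
 qed
 finally show ?thesis by simp
qed

lemma fourier_trig:
 assumes A: "A > 0"
 shows "norm (fourier (\<lambda>x. sunif A x * trig A p x) w)
  \<le> \<bar>sunif_FT A (w + freq A (snd p))\<bar> + \<bar>sunif_FT A (w - freq A (snd p))\<bar>"
proof -
 let ?v = "freq A (snd p)"
 define s where "s = (if fst p then 1 else - \<i>)"
 define s' where "s' = (if fst p then 1 else \<i>)"
 have hb: "has_bochner_integral lborel (\<lambda>x. complex_of_real (sunif A x) * iexp (u * x)) (of_real (sunif_FT A u))" for u
  using sunif_integral(1)[OF A, of "\<lambda>x. iexp (u * x)" 1] fourier_smooth_unif[OF A, of u]
  by (simp add: scaleR_conv_of_real hbi_iff fourier_def)
 have alg: "a * (r / 2 * (s * X + s' * Y)) * Z = r / 2 * s * (a * (Z * X)) + r / 2 * s' * (a * (Z * Y))" for a r X Y Z :: complex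
  by (simp add: algebra_simps)
 have "fourier (\<lambda>x. sunif A x * trig A p x) w = (LBINT x. of_real (sqrt 2) / 2 * s * (of_real (sunif A x) * iexp ((w + ?v) * x))
   + of_real (sqrt 2) / 2 * s' * (of_real (sunif A x) * iexp ((w - ?v) * x)))"
  unfolding fourier_def
 proof (intro LINT_cong refl)
  fix x
  have e: "iexp ((w + ?v) * x) = iexp (w * x) * iexp (?v * x)" "iexp ((w - ?v) * x) = iexp (w * x) * iexp (- (?v * x))"
   by (simp_all add: exp_add[symmetric] algebra_simps)
  have t: "of_real (trig A p x) = of_real (sqrt 2) / 2 * (s * iexp (?v * x) + s' * iexp (- (?v * x)))"
   by (simp add: trig_def s_def s'_def complex_eq_iff Re_exp Im_exp)
  show "complex_of_real (sunif A x * trig A p x) * iexp (w * x) = of_real (sqrt 2) / 2 * s * (of_real (sunif A x) * iexp ((w + ?v) * x))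
   + of_real (sqrt 2) / 2 * s' * (of_real (sunif A x) * iexp ((w - ?v) * x))"
   unfolding e of_real_mult[of "sunif A x"] t by (rule alg)
 qed
 also have "... = of_real (sqrt 2) / 2 * s * of_real (sunif_FT A (w + ?v)) + of_real (sqrt 2) / 2 * s' * of_real (sunif_FT A (w - ?v))"
  by (intro has_bochner_integral_integral_eq has_bochner_integral_add has_bochner_integral_mult_right hb)
 also have "norm ... \<le> norm (of_real (sqrt 2) / 2 * s * of_real (sunif_FT A (w + ?v))) + norm (of_real (sqrt 2) / 2 * s' * of_real (sunif_FT A (w - ?v)))"
  by (rule norm_triangle_ineq)
 also have "... = sqrt 2 / 2 * \<bar>sunif_FT A (w + ?v)\<bar> + sqrt 2 / 2 * \<bar>sunif_FT A (w - ?v)\<bar>"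
  by (simp add: norm_mult norm_divide s_def s'_def)
 also have "... \<le> 1 * \<bar>sunif_FT A (w + ?v)\<bar> + 1 * \<bar>sunif_FT A (w - ?v)\<bar>"
 proof -
  have "sqrt 2 / 2 \<le> (1::real)" using real_le_lsqrt[of 2 2] by simp
  then show ?thesis by (intro add_mono mult_right_mono) auto
 qed
 finally show ?thesis by simp
qed

lemma sinc_sq_le: "(sinc t)^2 \<le> 1"
 using power_mono[OF sinc_bounds(1), of t 2] by simp

text \<open>The base transform multiplied by the distance factor of \<open>powr_diff_le\<close>;
  Gaussian decay keeps it square integrable.\<close>

definition kk :: "real \<Rightarrow> real \<Rightarrow> real \<Rightarrow> real" where
 "kk A \<beta> u = (1 + \<bar>u\<bar>) powr (\<beta> + 1) * sunif_FT A u"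

lemma sunif_FT_measurable[measurable]: "sunif_FT A \<in> borel_measurable borel"
 unfolding sunif_FT_def[abs_def] sinc_def by measurable

lemma sunif_FT_sq: "(sunif_FT A u)^2 = exp (- u\<^sup>2) * (sinc (A * u))^2"
 by (simp add: sunif_FT_def power_mult_distrib power2_eq_square[of "exp _"] exp_add[symmetric])

lemma kk_sq_integrable:
 assumes "\<beta> > 0"
 shows "integrable lborel (\<lambda>u. (kk A \<beta> u)^2)"
proof (rule L1_bound[OF gaussian_moment_integrable[of "2 * \<beta> + 2"]])
 have "(kk A \<beta> u)^2 \<le> (1 + \<bar>u\<bar>) powr (2 * \<beta> + 2) * exp (- u\<^sup>2)" for u
 proof -
  have "(kk A \<beta> u)^2 = (1 + \<bar>u\<bar>) powr (2 * \<beta> + 2) * (exp (- u\<^sup>2) * (sinc (A * u))^2)"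
   unfolding kk_def power_mult_distrib sunif_FT_sq by (simp add: power2_eq_square powr_add[symmetric])
  also have "... \<le> (1 + \<bar>u\<bar>) powr (2 * \<beta> + 2) * (exp (- u\<^sup>2) * 1)"
   by (intro mult_left_mono sinc_sq_le) auto
  finally show ?thesis by simp
 qed
 then show "AE u in lborel. norm ((kk A \<beta> u)^2) \<le> norm ((1 + \<bar>u\<bar>) powr (2 * \<beta> + 2) * exp (- u\<^sup>2))"
  by (intro AE_I2) (simp add: abs_mult)
qed (use assms in "auto simp: kk_def")

text \<open>The bound sinc^2 <= 1 / |A w| trades one power of |w| for a factor 1 / A and leaves the
  exponent 2 \<beta> - 1 > 0. A large A makes the base density use only a small share of L.\<close>

lemma sunif_sobolev:
 assumes A: "A > 0" and \<beta>: "\<beta> > 1 / 2"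
 shows "integrable lborel (\<lambda>w. (\<bar>w\<bar> powr \<beta> * sunif_FT A w)^2)"
  "(LBINT w. (\<bar>w\<bar> powr \<beta> * sunif_FT A w)^2) \<le> (LBINT w. (1 + \<bar>w\<bar>) powr (2 * \<beta> - 1) * exp (- w\<^sup>2)) / A"
proof -
 have g: "integrable lborel (\<lambda>w. (1 + \<bar>w\<bar>) powr (2 * \<beta> - 1) * exp (- w\<^sup>2))" by (rule gaussian_moment_integrable) (use \<beta> in simp)
 have b: "(\<bar>w\<bar> powr \<beta> * sunif_FT A w)^2 \<le> (1 + \<bar>w\<bar>) powr (2 * \<beta> - 1) * exp (- w\<^sup>2) / A" for w
 proof (cases "w = 0")
  case False
  then have w: "\<bar>w\<bar> > 0" by simp
  have "(\<bar>w\<bar> powr \<beta> * sunif_FT A w)^2 = (\<bar>w\<bar> powr \<beta>)^2 * exp (- w\<^sup>2) * (sinc (A * w))^2"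
   unfolding power_mult_distrib sunif_FT_sq by simp
  also have "... \<le> (\<bar>w\<bar> powr \<beta>)^2 * exp (- w\<^sup>2) * (1 / \<bar>A * w\<bar>)"
   using sinc_bounds(2)[of "A * w"] False A by (intro mult_left_mono) auto
  also have "... = (\<bar>w\<bar> powr (2 * \<beta>) / \<bar>w\<bar>) * exp (- w\<^sup>2) / A"
   using A by (simp add: power2_eq_square powr_add[symmetric] abs_mult)
  also have "\<bar>w\<bar> powr (2 * \<beta>) / \<bar>w\<bar> = \<bar>w\<bar> powr (2 * \<beta> - 1)" using w by (simp add: powr_diff)
  also have "\<bar>w\<bar> powr (2 * \<beta> - 1) * exp (- w\<^sup>2) / A \<le> (1 + \<bar>w\<bar>) powr (2 * \<beta> - 1) * exp (- w\<^sup>2) / A"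
   using A \<beta> by (intro divide_right_mono mult_right_mono powr_mono2) auto
  finally show ?thesis .
 qed (use A \<beta> in simp)
 show i: "integrable lborel (\<lambda>w. (\<bar>w\<bar> powr \<beta> * sunif_FT A w)^2)"
  by (rule L1_bound[OF integrable_divide[OF g, of A]]) (use b A in "auto simp: abs_mult")
 show "(LBINT w. (\<bar>w\<bar> powr \<beta> * sunif_FT A w)^2) \<le> (LBINT w. (1 + \<bar>w\<bar>) powr (2 * \<beta> - 1) * exp (- w\<^sup>2)) / A"
  unfolding integral_divide_zero[symmetric] using g i b by (intro integral_mono) auto
qed

locale trig_perturbation = perturbation "sunif A" "trig A" P w "1 / (2 * A)" \<delta> n a
 for A :: real and P w \<delta> n a +
 assumes A: "A > 0"
begin

lemma fourier_comb:
 "fourier (\<lambda>x. sunif A x * (\<Sum>p\<in>P. \<alpha> p * trig A p x)) t = (\<Sum>p\<in>P. of_real (\<alpha> p) * fourier (\<lambda>x. sunif A x * trig A p x) t)"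
 "integrable lborel (\<lambda>x. complex_of_real (sunif A x * (\<Sum>p\<in>P. \<alpha> p * trig A p x)))"
proof -
 have i: "integrable lborel (\<lambda>x. complex_of_real (sunif A x * trig A p x) * iexp (t * x))" for p
  by (rule integrable_mult_unimodular[where C = 1]) (use f0_mult_int[OF e_measurable[of p] e_le] in "auto simp del: of_real_mult")
 have e: "complex_of_real (sunif A x * (\<Sum>p\<in>P. \<alpha> p * trig A p x)) * z = (\<Sum>p\<in>P. of_real (\<alpha> p) * (complex_of_real (sunif A x * trig A p x) * z))" for x z
  by (simp add: sum_distrib_left sum_distrib_right mult_ac)
 show "fourier (\<lambda>x. sunif A x * (\<Sum>p\<in>P. \<alpha> p * trig A p x)) t = (\<Sum>p\<in>P. of_real (\<alpha> p) * fourier (\<lambda>x. sunif A x * trig A p x) t)"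
  unfolding fourier_def e using i by (subst LINT_sum) (simp_all only: integrable_mult_right integral_mult_right_zero)
 have "integrable lborel (\<lambda>x. sunif A x * (\<Sum>p\<in>P. \<alpha> p * trig A p x))"
  by (rule f0_mult_int[OF _ comb_le]) measurable
 then show "integrable lborel (\<lambda>x. complex_of_real (sunif A x * (\<Sum>p\<in>P. \<alpha> p * trig A p x)))" by (rule integrable_of_real)
qed

lemma fourier_dens:
 "fourier (dens s) t = of_real (sunif_FT A t) + (\<Sum>p\<in>P. of_real (w p * clip (s p)) * fourier (\<lambda>x. sunif A x * trig A p x) t)"
proof -
 let ?h = "\<lambda>x. sunif A x * (\<Sum>p\<in>P. (w p * clip (s p)) * trig A p x)"
 have i: "integrable lborel (\<lambda>x. complex_of_real (sunif A x) * iexp (t * x))"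
  using sunif_integral(1)[OF A, of "\<lambda>x. iexp (t * x)" 1] by (simp add: scaleR_conv_of_real)
 have j: "integrable lborel (\<lambda>x. complex_of_real (?h x) * iexp (t * x))"
  by (rule integrable_mult_unimodular[where C = 1, OF fourier_comb(2)]) auto
 have "fourier (dens s) t = (LBINT x. complex_of_real (sunif A x) * iexp (t * x) + complex_of_real (?h x) * iexp (t * x))"
  unfolding fourier_def dens_def by (intro LINT_cong refl) (simp add: distrib_left distrib_right)
 also have "... = fourier (sunif A) t + fourier ?h t"
  unfolding fourier_def using i j by (rule LINT_add)
 finally show ?thesis unfolding fourier_comb fourier_smooth_unif[OF A] .
qed

text \<open>Multiplying the transform of a modulated function by |t|^\<beta> almost amounts to
  multiplying its coefficient by the \<beta>-th power of its frequency. That main part is estimated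
  sharply, up to 1 + \<epsilon>; the base density and the error of the exchange are lower-order
  terms and may carry the factor 1 + 1 / \<epsilon>.\<close>

lemma energy_bound:
 assumes \<beta>: "\<beta> > 1 / 2" and \<epsilon>: "\<epsilon> > 0"
 shows "(\<integral>\<^sup>+ t. ennreal ((\<bar>t\<bar> powr \<beta> * cmod (fourier (dens s) t))^2) \<partial>lborel) \<le>
  ennreal (2 * pi * ((1 + \<epsilon>) * (1 / (2 * A) * (\<Sum>p\<in>P. (w p * clip (s p) * freq A (snd p) powr \<beta>)^2)))
   + 2 * (1 + 1 / \<epsilon>) * ((LBINT t. (1 + \<bar>t\<bar>) powr (2 * \<beta> - 1) * exp (- t\<^sup>2)) / A
    + real (card P) * (\<Sum>p\<in>P. (w p * clip (s p) * ((\<beta> + 1) * (1 + freq A (snd p)) powr (max (\<beta> - 1) 0)))^2) * (4 * (LBINT t. (kk A \<beta> t)^2))))"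
proof -
 define \<theta> where "\<theta> p = w p * clip (s p)" for p
 define v where "v p = freq A (snd p)" for p :: "bool \<times> nat"
 define E where "E p = fourier (\<lambda>x. sunif A x * trig A p x)" for p
 define B where "B p = (\<beta> + 1) * (1 + v p) powr (max (\<beta> - 1) 0)" for p
 \<comment> \<open>The main part: as the transform of a single combination of orthonormal functions,
   its norm follows from Plancherel and \<open>comb_sq\<close>.\<close>
 define Y where "Y = fourier (\<lambda>x. sunif A x * (\<Sum>p\<in>P. (\<theta> p * v p powr \<beta>) * trig A p x))"
 define \<kappa> where "\<kappa> = (LBINT t. (kk A \<beta> t)^2)"
 define M where "M = (LBINT t. (1 + \<bar>t\<bar>) powr (2 * \<beta> - 1) * exp (- t\<^sup>2))"
 define a' where "a' t = (\<bar>t\<bar> powr \<beta> * sunif_FT A t)^2" for t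
 have v: "0 \<le> v p" for p using A by (simp add: v_def freq_def)
 have \<beta>0: "\<beta> > 0" using \<beta> by simp
 have "integrable lborel (\<lambda>x. (sunif A x * (\<Sum>p\<in>P. (\<theta> p * v p powr \<beta>) * trig A p x))^2)" by (rule comb_sq)
 then have u2: "integrable lborel (\<lambda>x. (norm (complex_of_real (sunif A x * (\<Sum>p\<in>P. (\<theta> p * v p powr \<beta>) * trig A p x))))^2)"
  unfolding norm_of_real power2_abs .
 note Pl = Plancherel[OF fourier_comb(2) u2, folded fourier_eq_FT]
 have Y: "integrable lborel (\<lambda>t. (norm (Y t))^2)" "(LBINT t. (norm (Y t))^2) \<le> 2 * pi * (1 / (2 * A) * (\<Sum>p\<in>P. (\<theta> p * v p powr \<beta>)^2))"
  unfolding Y_def Pl(2) norm_of_real power2_abs by (rule Pl(1), rule mult_left_mono[OF comb_sq(2)]) simp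
 define G where "G t = (1 + \<epsilon>) * (norm (Y t))^2 + 2 * (1 + 1 / \<epsilon>) * (a' t
   + real (card P) * (\<Sum>p\<in>P. (\<theta> p * B p)^2 * (2 * ((kk A \<beta> (v p + t))^2 + (kk A \<beta> (- v p + t))^2))))" for t
 have k: "has_bochner_integral lborel (\<lambda>t. (kk A \<beta> (x + t))^2) \<kappa>" for x
  using lborel_has_bochner_integral_real_affine_iff[of 1 "\<lambda>u. (kk A \<beta> u)^2" \<kappa> x] kk_sq_integrable[OF \<beta>0, of A]
  by (simp add: hbi_iff \<kappa>_def)
 have a': "has_bochner_integral lborel a' (integral\<^sup>L lborel a')" "integral\<^sup>L lborel a' \<le> M / A"
  using sunif_sobolev[OF A \<beta>] unfolding a'_def M_def by (auto simp: hbi_iff)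
 have GI: "has_bochner_integral lborel G ((1 + \<epsilon>) * (LBINT t. (norm (Y t))^2) + 2 * (1 + 1 / \<epsilon>) * (integral\<^sup>L lborel a'
   + real (card P) * (\<Sum>p\<in>P. (\<theta> p * B p)^2 * (2 * (\<kappa> + \<kappa>)))))"
  unfolding G_def[abs_def]
  by (intro has_bochner_integral_add has_bochner_integral_cmult has_bochner_integral_sum k a' has_bochner_integral_integrable Y(1))
 have pt: "(\<bar>t\<bar> powr \<beta> * cmod (fourier (dens s) t))^2 \<le> G t" for t
 proof -
  define X where "X = complex_of_real (\<bar>t\<bar> powr \<beta> * sunif_FT A t)"
  \<comment> \<open>The error of replacing |t|^\<beta> by the power of each frequency. A crude
    Cauchy-Schwarz bound with \<open>card P\<close> suffices.\<close>
  define Z where "Z = (\<Sum>p\<in>P. of_real (\<theta> p * (\<bar>t\<bar> powr \<beta> - v p powr \<beta>)) * E p t)"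
  have e: "of_real (\<bar>t\<bar> powr \<beta>) * fourier (dens s) t = X + Z + Y t"
   unfolding fourier_dens Y_def fourier_comb X_def Z_def E_def \<theta>_def
   by (simp add: distrib_left sum_distrib_left sum.distrib[symmetric] algebra_simps)
  have "norm Z \<le> (\<Sum>p\<in>P. \<bar>\<theta> p\<bar> * B p * (\<bar>kk A \<beta> (v p + t)\<bar> + \<bar>kk A \<beta> (- v p + t)\<bar>))"
   unfolding Z_def
  proof (rule order_trans[OF norm_sum sum_mono])
   fix p
   let ?d = "\<bar>\<bar>t\<bar> powr \<beta> - v p powr \<beta>\<bar>"
   have d: "?d * \<bar>sunif_FT A u\<bar> \<le> B p * \<bar>kk A \<beta> u\<bar>" if "\<bar>\<bar>t\<bar> - v p\<bar> \<le> \<bar>u\<bar>" for u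
   proof -
    have "?d \<le> (\<beta> + 1) * (1 + \<bar>\<bar>t\<bar> - v p\<bar>) powr (\<beta> + 1) * (1 + v p) powr (max (\<beta> - 1) 0)"
     by (rule powr_diff_le) (use \<beta>0 v in auto)
    also have "... \<le> (\<beta> + 1) * (1 + \<bar>u\<bar>) powr (\<beta> + 1) * (1 + v p) powr (max (\<beta> - 1) 0)"
     using that \<beta>0 by (intro mult_right_mono mult_left_mono powr_mono2) auto
    finally have "?d * \<bar>sunif_FT A u\<bar> \<le> ((\<beta> + 1) * (1 + \<bar>u\<bar>) powr (\<beta> + 1) * (1 + v p) powr (max (\<beta> - 1) 0)) * \<bar>sunif_FT A u\<bar>"
     by (intro mult_right_mono) auto
    also have "... = B p * \<bar>kk A \<beta> u\<bar>" by (simp add: B_def kk_def abs_mult)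
    finally show ?thesis .
   qed
   have "norm (of_real (\<theta> p * (\<bar>t\<bar> powr \<beta> - v p powr \<beta>)) * E p t) = \<bar>\<theta> p\<bar> * (?d * norm (E p t))"
    by (simp only: norm_mult norm_of_real abs_mult mult.assoc)
   also have "... \<le> \<bar>\<theta> p\<bar> * (?d * (\<bar>sunif_FT A (v p + t)\<bar> + \<bar>sunif_FT A (- v p + t)\<bar>))"
    using fourier_trig[OF A, of p t] unfolding E_def v_def by (intro mult_left_mono) (auto simp: add.commute)
   also have "... \<le> \<bar>\<theta> p\<bar> * (B p * \<bar>kk A \<beta> (v p + t)\<bar> + B p * \<bar>kk A \<beta> (- v p + t)\<bar>)"
    unfolding distrib_left[of ?d] using v[of p] by (intro mult_left_mono add_mono d) auto
   finally show "norm (of_real (\<theta> p * (\<bar>t\<bar> powr \<beta> - v p powr \<beta>)) * E p t) \<le> \<bar>\<theta> p\<bar> * B p * (\<bar>kk A \<beta> (v p + t)\<bar> + \<bar>kk A \<beta> (- v p + t)\<bar>)"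
    by (simp add: distrib_left mult.assoc)
  qed
  then have "(norm Z)^2 \<le> (\<Sum>p\<in>P. \<bar>\<theta> p\<bar> * B p * (\<bar>kk A \<beta> (v p + t)\<bar> + \<bar>kk A \<beta> (- v p + t)\<bar>))^2" by (intro power_mono) auto
  also have "... \<le> (\<Sum>p\<in>P. (\<bar>\<theta> p\<bar> * B p * (\<bar>kk A \<beta> (v p + t)\<bar> + \<bar>kk A \<beta> (- v p + t)\<bar>))^2) * real (card P)"
   by (rule sum_squared_le_sum_of_squares)
  also have "... \<le> (\<Sum>p\<in>P. (\<theta> p * B p)^2 * (2 * ((kk A \<beta> (v p + t))^2 + (kk A \<beta> (- v p + t))^2))) * real (card P)"
  proof (intro mult_right_mono sum_mono)
   fix p
   have "(\<bar>y\<bar> + \<bar>z\<bar>)^2 \<le> 2 * (y\<^sup>2 + z\<^sup>2)" for y z :: real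
   proof -
    have "0 \<le> (\<bar>y\<bar> - \<bar>z\<bar>)^2" by simp
    then show ?thesis by (simp add: power2_diff power2_sum)
   qed
   then have "(\<theta> p * B p)^2 * (\<bar>kk A \<beta> (v p + t)\<bar> + \<bar>kk A \<beta> (- v p + t)\<bar>)^2 \<le> (\<theta> p * B p)^2 * (2 * ((kk A \<beta> (v p + t))^2 + (kk A \<beta> (- v p + t))^2))"
    by (intro mult_left_mono) auto
   then show "(\<bar>\<theta> p\<bar> * B p * (\<bar>kk A \<beta> (v p + t)\<bar> + \<bar>kk A \<beta> (- v p + t)\<bar>))^2 \<le> (\<theta> p * B p)^2 * (2 * ((kk A \<beta> (v p + t))^2 + (kk A \<beta> (- v p + t))^2))"
    by (simp add: power_mult_distrib)
  qed simp
  finally have Z: "(norm Z)^2 \<le> real (card P) * (\<Sum>p\<in>P. (\<theta> p * B p)^2 * (2 * ((kk A \<beta> (v p + t))^2 + (kk A \<beta> (- v p + t))^2)))"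
   by (simp add: mult.commute)
  have "\<bar>t\<bar> powr \<beta> * cmod (fourier (dens s) t) = norm (X + Z + Y t)" unfolding e[symmetric] by (simp add: norm_mult)
  also have "... \<le> norm X + norm Z + norm (Y t)" by (intro norm_triangle_le add_mono) auto
  finally have "(\<bar>t\<bar> powr \<beta> * cmod (fourier (dens s) t))^2 \<le> (norm X + norm Z + norm (Y t))^2" by (intro power_mono) auto
  also have "... \<le> (1 + \<epsilon>) * (norm (Y t))^2 + 2 * (1 + 1 / \<epsilon>) * ((norm X)^2 + (norm Z)^2)"
  proof -
   have "(x + z + y)^2 \<le> (1 + \<epsilon>) * y\<^sup>2 + 2 * (1 + 1 / \<epsilon>) * (x\<^sup>2 + z\<^sup>2)" for x y z :: real
   proof -
    have "0 \<le> (\<epsilon> * y - (x + z))^2 / \<epsilon> + (1 + 1 / \<epsilon>) * (x - z)^2" using \<epsilon> by simp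
    also have "... = (1 + \<epsilon>) * y\<^sup>2 + 2 * (1 + 1 / \<epsilon>) * (x\<^sup>2 + z\<^sup>2) - (x + z + y)\<^sup>2"
     using \<epsilon> by (simp add: power2_eq_square divide_simps) (simp add: algebra_simps)
    finally show ?thesis by simp
   qed
   then show ?thesis .
  qed
  also have "... \<le> G t" unfolding G_def a'_def X_def norm_of_real power2_abs using Z \<epsilon>
   by (intro add_mono mult_left_mono order_refl) auto
  finally show ?thesis .
 qed
 have "(\<integral>\<^sup>+ t. ennreal ((\<bar>t\<bar> powr \<beta> * cmod (fourier (dens s) t))^2) \<partial>lborel) \<le> (\<integral>\<^sup>+ t. ennreal (G t) \<partial>lborel)"
  using pt by (intro nn_integral_mono ennreal_leI) auto
 also have "... = ennreal (integral\<^sup>L lborel G)"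
  using GI order_trans[OF zero_le_power2 pt] by (intro nn_integral_eq_integral) (auto simp: hbi_iff)
 also have "integral\<^sup>L lborel G = (1 + \<epsilon>) * (LBINT t. (norm (Y t))^2) + 2 * (1 + 1 / \<epsilon>) * (integral\<^sup>L lborel a'
   + real (card P) * (\<Sum>p\<in>P. (\<theta> p * B p)^2 * (2 * (\<kappa> + \<kappa>))))"
  using GI by (simp only: hbi_iff)
 also have "... \<le> (1 + \<epsilon>) * (2 * pi * (1 / (2 * A) * (\<Sum>p\<in>P. (\<theta> p * v p powr \<beta>)^2))) + 2 * (1 + 1 / \<epsilon>) * (M / A
   + real (card P) * (\<Sum>p\<in>P. (\<theta> p * B p)^2 * (2 * (\<kappa> + \<kappa>))))"
  using Y(2) a'(2) \<epsilon> by (intro add_mono mult_left_mono order_refl) auto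
 also have "... = 2 * pi * ((1 + \<epsilon>) * (1 / (2 * A) * (\<Sum>p\<in>P. (\<theta> p * v p powr \<beta>)^2))) + 2 * (1 + 1 / \<epsilon>) * (M / A
   + real (card P) * (\<Sum>p\<in>P. (\<theta> p * B p)^2) * (4 * \<kappa>))"
  by (simp add: sum_distrib_right mult.assoc)
 finally show ?thesis unfolding \<theta>_def v_def B_def M_def \<kappa>_def by (simp add: ennreal_leI)
qed

end

section \<open>The Pinsker lower bound\<close>

lemma power_sum_bounds:
 assumes \<gamma>: "\<gamma> > 0"
 shows "real J powr (\<gamma> + 1) / (\<gamma> + 1) \<le> (\<Sum>j=1..J. real j powr \<gamma>)"
  "(\<Sum>j=1..J. real j powr \<gamma>) \<le> real J powr (\<gamma> + 1) / (\<gamma> + 1) + real J powr \<gamma>"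
proof -
 have step: "real J powr \<gamma> \<le> real (Suc J) powr (\<gamma> + 1) / (\<gamma> + 1) - real J powr (\<gamma> + 1) / (\<gamma> + 1)
  \<and> real (Suc J) powr (\<gamma> + 1) / (\<gamma> + 1) - real J powr (\<gamma> + 1) / (\<gamma> + 1) \<le> real (Suc J) powr \<gamma>" for J
 proof (cases "J = 0")
  case False
  have "\<exists>z>real J. z < real (Suc J) \<and> real (Suc J) powr (\<gamma> + 1) / (\<gamma> + 1) - real J powr (\<gamma> + 1) / (\<gamma> + 1) = (real (Suc J) - real J) * z powr \<gamma>"
   by (rule MVT2) (use False \<gamma> in "auto intro!: derivative_eq_intros")
  then obtain z where z: "real J < z" "z < real (Suc J)"
   "real (Suc J) powr (\<gamma> + 1) / (\<gamma> + 1) - real J powr (\<gamma> + 1) / (\<gamma> + 1) = z powr \<gamma>" by auto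
  then show ?thesis using \<gamma> by (auto intro!: powr_mono2)
 qed (use \<gamma> in simp)
 show "real J powr (\<gamma> + 1) / (\<gamma> + 1) \<le> (\<Sum>j=1..J. real j powr \<gamma>)"
 proof (induction J)
  case (Suc J)
  then show ?case using step[of J] by (simp del: of_nat_Suc)
 qed simp
 show "(\<Sum>j=1..J. real j powr \<gamma>) \<le> real J powr (\<gamma> + 1) / (\<gamma> + 1) + real J powr \<gamma>"
 proof (induction J)
  case (Suc J)
  then show ?case using step[of J] by (simp del: of_nat_Suc)
 qed simp
qed

lemma pinsker_W_powr:
 assumes "\<beta> > 0" "L > 0" "n > 0"
 shows "pinsker_W \<beta> L n powr (2 * \<beta> + 1) = pi * real n * L * (\<beta> + 1) * (2 * \<beta> + 1) / \<beta>" "pinsker_W \<beta> L n > 0"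
 using assms by (auto simp: pinsker_W_def powr_powr)

text \<open>A Riemann sum for the integral that defines \<open>pinsker_W\<close>. Stopping at (1 -
  t) W saves the factor (1 - t)^2, and the discretization costs W^(2 \<beta>) / (A n).\<close>

lemma pinsker_budget:
 assumes \<beta>: "\<beta> > 1 / 2" and L: "L > 0" and n: "n > 0" and A: "A > 0" and t: "0 < t" "t < 1"
  and J: "pi * real J / A \<le> (1 - t) * pinsker_W \<beta> L n"
 shows "1 / (A * real n) * (\<Sum>j=1..J. ((real J / real j) powr \<beta> - 1) * (pi * real j / A) powr (2 * \<beta>))
  \<le> (1 - t)^2 * L + pinsker_W \<beta> L n powr (2 * \<beta>) / (A * real n)"
proof -
 define W where "W = pinsker_W \<beta> L n"
 have W: "W > 0" "W powr (2 * \<beta> + 1) = pi * real n * L * (\<beta> + 1) * (2 * \<beta> + 1) / \<beta>"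
  using pinsker_W_powr[of \<beta> L n] \<beta> L n by (auto simp: W_def)
 define x where "x = pi * real J / A"
 have x: "0 \<le> x" "x \<le> (1 - t) * W" using J A by (auto simp: x_def W_def)
 have "(\<Sum>j=1..J. ((real J / real j) powr \<beta> - 1) * (pi * real j / A) powr (2 * \<beta>))
  = (pi / A) powr (2 * \<beta>) * (real J powr \<beta> * (\<Sum>j=1..J. real j powr \<beta>) - (\<Sum>j=1..J. real j powr (2 * \<beta>)))"
  unfolding sum_distrib_left sum_subtractf[symmetric]
 proof (intro sum.cong refl)
  fix j assume "j \<in> {1..J}"
  then have j: "real j > 0" by simp
  have "(pi * real j / A) powr (2 * \<beta>) = (pi / A) powr (2 * \<beta>) * (real j powr \<beta> * real j powr \<beta>)"
   using powr_mult[of "pi / A" "real j" "2 * \<beta>"] by (simp add: powr_add[symmetric])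
  moreover have "(real J / real j) powr \<beta> = real J powr \<beta> / real j powr \<beta>" using j by (simp add: powr_divide)
  ultimately show "((real J / real j) powr \<beta> - 1) * (pi * real j / A) powr (2 * \<beta>) = (pi / A) powr (2 * \<beta>) * (real J powr \<beta> * real j powr \<beta> - real j powr (2 * \<beta>))"
   using j powr_add[of "real j" \<beta> \<beta>] by (simp add: field_simps)
 qed
 also have "... \<le> (pi / A) powr (2 * \<beta>) * (real J powr \<beta> * (real J powr (\<beta> + 1) / (\<beta> + 1) + real J powr \<beta>) - real J powr (2 * \<beta> + 1) / (2 * \<beta> + 1))"
  using power_sum_bounds(2)[of \<beta> J] power_sum_bounds(1)[of "2 * \<beta>" J] \<beta> by (intro mult_left_mono diff_mono) auto
 also have "... = (pi / A) powr (2 * \<beta>) * (real J powr (2 * \<beta> + 1) * (\<beta> / ((\<beta> + 1) * (2 * \<beta> + 1))) + real J powr (2 * \<beta>))"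
 proof -
  have e: "real J powr \<beta> * real J powr (\<beta> + 1) = real J powr (2 * \<beta> + 1)" "real J powr \<beta> * real J powr \<beta> = real J powr (2 * \<beta>)"
   using powr_add[of "real J" \<beta> "\<beta> + 1"] powr_add[of "real J" \<beta> \<beta>] by (simp_all add: algebra_simps)
  have f: "1 / (\<beta> + 1) - 1 / (2 * \<beta> + 1) = \<beta> / ((\<beta> + 1) * (2 * \<beta> + 1))" using \<beta> by (simp add: divide_simps)
  have "real J powr \<beta> * (real J powr (\<beta> + 1) / (\<beta> + 1) + real J powr \<beta>) - real J powr (2 * \<beta> + 1) / (2 * \<beta> + 1)
   = real J powr (2 * \<beta> + 1) * (1 / (\<beta> + 1) - 1 / (2 * \<beta> + 1)) + real J powr (2 * \<beta>)"
   unfolding distrib_left times_divide_eq_right e by (simp add: right_diff_distrib)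
  then show ?thesis unfolding f by simp
 qed
 also have "... = A / pi * (x powr (2 * \<beta> + 1) * (\<beta> / ((\<beta> + 1) * (2 * \<beta> + 1)))) + x powr (2 * \<beta>)"
 proof -
  have x': "x = pi / A * real J" by (simp add: x_def)
  have "(pi / A) powr (2 * \<beta> + 1) = (pi / A) powr (2 * \<beta>) * (pi / A)" using A by (simp add: powr_add)
  then have "(pi / A) powr (2 * \<beta>) = A / pi * (pi / A) powr (2 * \<beta> + 1)" using A by simp
  then have "(pi / A) powr (2 * \<beta>) * real J powr (2 * \<beta> + 1) = A / pi * x powr (2 * \<beta> + 1)"
   unfolding x' powr_mult by simp
  moreover have "(pi / A) powr (2 * \<beta>) * real J powr (2 * \<beta>) = x powr (2 * \<beta>)" unfolding x' powr_mult ..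
  ultimately show ?thesis by (simp only: distrib_left mult.assoc[symmetric])
 qed
 also have "... \<le> A / pi * (((1 - t)^2 * W powr (2 * \<beta> + 1)) * (\<beta> / ((\<beta> + 1) * (2 * \<beta> + 1)))) + W powr (2 * \<beta>)"
 proof (intro add_mono mult_left_mono mult_right_mono)
  have "x powr (2 * \<beta> + 1) \<le> ((1 - t) * W) powr (2 * \<beta> + 1)" using x \<beta> by (intro powr_mono2) auto
  also have "... = (1 - t) powr (2 * \<beta> + 1) * W powr (2 * \<beta> + 1)" by (simp add: powr_mult)
  \<comment> \<open>Since 2 \<beta> + 1 > 2 and 0 < 1 - t < 1.\<close>
  also have "... \<le> (1 - t) powr 2 * W powr (2 * \<beta> + 1)" using t \<beta> by (intro mult_right_mono powr_mono') auto
  finally show "x powr (2 * \<beta> + 1) \<le> (1 - t)^2 * W powr (2 * \<beta> + 1)" using t by simp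
  have "(1 - t) * W \<le> W" using t W by simp
  then have "x \<le> W" using x by simp
  then show "x powr (2 * \<beta>) \<le> W powr (2 * \<beta>)" using x \<beta> by (intro powr_mono2) auto
 qed (use A \<beta> in auto)
 also have "... = A * real n * ((1 - t)^2 * L) + W powr (2 * \<beta>)"
  unfolding W(2) using \<beta> by (simp add: divide_simps)
 finally have "1 / (A * real n) * (\<Sum>j=1..J. ((real J / real j) powr \<beta> - 1) * (pi * real j / A) powr (2 * \<beta>))
   \<le> 1 / (A * real n) * (A * real n * ((1 - t)^2 * L) + W powr (2 * \<beta>))" using A by (intro mult_left_mono) auto
 also have "... = (1 - t)^2 * L + W powr (2 * \<beta>) / (A * real n)" using A n by (simp add: field_simps)
 finally show ?thesis unfolding W_def .
qed

lemma clip_moment2: "(LINT s|beta_prior a. (clip s)^2) = 1 / real (2 * a + 3)"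
proof -
 have "(LINT s|beta_prior a. (clip s)^2) = (LINT s|beta_prior a. s\<^sup>2)"
  unfolding beta_prior_def using beta_density_nonneg[of _ a]
  by (subst (1 2) integral_density) (auto intro!: LINT_cong simp: indicator_def clip_def)
 then show ?thesis by (simp add: beta_prior_moment2)
qed

text \<open>The squares of the clipped coordinates are independent with mean 1 / (2a + 3), and
  centred they are at most 1 in modulus; so the variance of the weighted sum is at most the sum of
  the squared weights.\<close>

lemma beta_chebyshev:
 assumes P: "finite P" and b: "\<And>p. p \<in> P \<Longrightarrow> 0 \<le> b p" and x: "x > 0"
 shows "emeasure (Pi\<^sub>M P (\<lambda>_. beta_prior a)) {s \<in> space (Pi\<^sub>M P (\<lambda>_. beta_prior a)). (\<Sum>p\<in>P. b p) / real (2 * a + 3) + x < (\<Sum>p\<in>P. b p * (clip (s p))^2)}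
  \<le> ennreal ((\<Sum>p\<in>P. (b p)^2) / x\<^sup>2)"
proof -
 let ?\<Pi> = "Pi\<^sub>M P (\<lambda>_. beta_prior a)"
 interpret B: prob_space "beta_prior a" by (rule prob_space_beta_prior)
 interpret \<Pi>: prob_space ?\<Pi> by (rule prob_space_PiM) (rule prob_space_beta_prior)
 define m where "m = 1 / real (2 * a + 3)"
 define c where "c p s = (if p \<in> P then b p * ((clip s)^2 - m) else 0)" for p s
 have cl: "(clip s)^2 \<le> 1" for s using power_mono[OF abs_clip, of s 2] by simp
 have m: "0 \<le> m" "m \<le> 1" by (auto simp: m_def divide_le_eq)
 have c1: "\<bar>(clip s)\<^sup>2 - m\<bar> \<le> 1" for s using cl[of s] m zero_le_power2[of "clip s"] by (simp only: abs_le_iff) linarith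
 have cb: "\<bar>c p s\<bar> \<le> sum b P" for p s
 proof (cases "p \<in> P")
  case True
  then have "\<bar>c p s\<bar> \<le> b p * 1" using c1[of s] b by (simp add: c_def abs_mult mult_left_le)
  also have "b p \<le> sum b P" by (rule member_le_sum) (use P True b in auto)
  finally show ?thesis by simp
 qed (auto simp: c_def intro!: sum_nonneg b)
 have cm[measurable]: "c p \<in> borel_measurable (beta_prior a)" for p unfolding c_def[abs_def] by measurable
 have mean: "(LINT s|beta_prior a. c p s) = 0" for p
 proof -
  have i: "integrable (beta_prior a) (\<lambda>s. (clip s)^2)" by (rule B.integrable_bounded[where B = 1]) (use cl in auto)
  then have "(LINT s|beta_prior a. (clip s)^2 - m) = 0" using B.prob_space by (simp add: clip_moment2 m_def)
  then show ?thesis by (cases "p \<in> P") (simp_all add: c_def)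
 qed
 note M = iid_sum_moments[OF P prob_space_beta_prior cm cb mean]
 define S where "S s = (\<Sum>p\<in>P. c p (s p))" for s
 have S: "S s = (\<Sum>p\<in>P. b p * (clip (s p))^2) - (\<Sum>p\<in>P. b p) / real (2 * a + 3)" for s
  unfolding S_def c_def by (simp add: right_diff_distrib sum_subtractf m_def sum_divide_distrib)
 have Sm[measurable]: "S \<in> borel_measurable ?\<Pi>" unfolding S_def[abs_def] by measurable
 have Sb: "\<bar>S s\<bar> \<le> real (card P) * sum b P" for s
  unfolding S_def by (rule order_trans[OF sum_abs]) (use sum_bounded_above[of P "\<lambda>p. \<bar>c p (s p)\<bar>" "sum b P"] cb in simp)
 have i2: "integrable ?\<Pi> (\<lambda>s. (S s)^2 / x\<^sup>2)"
  by (intro integrable_divide \<Pi>.integrable_bounded[where B = "(real (card P) * sum b P)^2"]) (use power_mono[OF Sb, of _ 2] in auto)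
 let ?Bad = "{s \<in> space ?\<Pi>. (\<Sum>p\<in>P. b p) / real (2 * a + 3) + x < (\<Sum>p\<in>P. b p * (clip (s p))^2)}"
 have bad: "?Bad = {s \<in> space ?\<Pi>. x < S s}" unfolding S by auto
 have "emeasure ?\<Pi> ?Bad = (\<integral>\<^sup>+ s. indicator ?Bad s \<partial>?\<Pi>)" unfolding bad by (intro nn_integral_indicator[symmetric]) measurable
 also have "... \<le> (\<integral>\<^sup>+ s. ennreal ((S s)^2 / x\<^sup>2) \<partial>?\<Pi>)"
 proof (rule nn_integral_mono)
  fix s
  have "1 \<le> (S s)^2 / x\<^sup>2" if "x < S s" using power_mono[of x "S s" 2] that x by simp
  then show "indicator ?Bad s \<le> ennreal ((S s)^2 / x\<^sup>2)" unfolding bad by (auto simp: indicator_def)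
 qed
 also have "... = ennreal ((LINT s|?\<Pi>. (S s)^2) / x\<^sup>2)" using nn_integral_eq_integral[OF i2] by simp
 also have "... \<le> ennreal ((\<Sum>p\<in>P. (b p)^2) / x\<^sup>2)"
 proof (intro ennreal_leI divide_right_mono)
  have "(LINT s|?\<Pi>. (S s)^2) = (\<Sum>p\<in>P. LINT s|beta_prior a. (c p s)^2)" unfolding S_def by (rule M(2))
  also have "... \<le> (\<Sum>p\<in>P. (b p)^2)"
  proof (rule sum_mono)
   fix p assume p: "p \<in> P"
   have le: "(c p s)^2 \<le> (b p)^2" for s
    using power_mono[OF c1[of s], of 2] p by (simp add: c_def power_mult_distrib mult_left_le)
   have "(LINT s|beta_prior a. (c p s)^2) \<le> (LINT s|beta_prior a. (b p)^2)"
    by (intro integral_mono B.integrable_bounded[where B = "(b p)^2"]) (use le in auto)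
   then show "(LINT s|beta_prior a. (c p s)^2) \<le> (b p)^2" using B.prob_space by simp
  qed
  finally show "(LINT s|?\<Pi>. (S s)^2) \<le> (\<Sum>p\<in>P. (b p)^2)" .
 qed simp
 finally show ?thesis .
qed

text \<open>One parameter t measures all relative losses. A1, H2 and a1 are met by fixing A and a
  large; the others hold for large n and control the Riemann sum (H1), the frequency exchange (H3),
  positivity (H4), parameters outside the class (H5) and the rounding of J (H6).\<close>

lemma pinsker_lower_bound_fixed:
 assumes \<beta>: "\<beta> > 1 / 2" and L: "L > 0" and n: "n > 0" and A: "A > 0" and t: "0 < t" "t < 1" and a: "a \<ge> 2"
  and T: "T \<in> estimators n"
 defines "W \<equiv> pinsker_W \<beta> L n" and "N \<equiv> real (2 * a + 3)"
 defines "C \<equiv> N * t powr (- \<beta>) / real n"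
 assumes A1: "(1 - t) / (2 * A) \<le> (LBINT x. (sunif A x)^2)"
  and a1: "beta_info a \<le> N / (1 - t)"
  and H1: "W powr (2 * \<beta>) / (A * real n) \<le> t * L / 16"
  and H2: "(1 + 1 / t) / pi * ((LBINT u. (1 + \<bar>u\<bar>) powr (2 * \<beta> - 1) * exp (- u\<^sup>2)) / A) \<le> t * L / 8"
  and H3: "(1 + 1 / t) / pi * ((W * A)^2 * C * ((\<beta> + 1) * (1 + W) powr (max (\<beta> - 1) 0))^2 * (4 * (LBINT u. (kk A \<beta> u)^2))) \<le> t * L / 8"
  and H4: "2 * (W * A) * sqrt C \<le> t"
  and H5: "10 * (1 / (2 * A) * (W * A * C)) * (W * A * (1 / (2 * A) * (C * W powr (2 * \<beta>)))^2 / (t * L / 4)^2) \<le> t * pinsker \<beta> L n"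
  and H6: "2 / (A * real n) \<le> t * pinsker \<beta> L n"
 shows "ennreal ((1 - 9 * t) * pinsker \<beta> L n) \<le> max_risk n \<beta> L T"
proof -
 have W: "W > 0" using pinsker_W_powr[of \<beta> L n] \<beta> L n by (simp add: W_def)
 have N: "N > 0" by (simp add: N_def)
 have C: "C > 0" using N n t by (simp add: C_def)
 \<comment> \<open>The number of lattice frequencies up to (1 - t) W; the shrinking leaves room in
   the Sobolev budget.\<close>
 define J where "J = nat \<lfloor>(1 - t) * W * A / pi\<rfloor>"
 have J0: "0 \<le> (1 - t) * W * A / pi" using t W A by simp
 have J1: "real J \<le> (1 - t) * W * A / pi" "(1 - t) * W * A / pi - 1 \<le> real J" unfolding J_def using J0 by linarith+
 have J2: "pi * real J / A \<le> (1 - t) * W" using J1(1) A by (simp add: field_simps)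
 \<comment> \<open>Low frequencies are left out because the optimal variances blow up there; the cut
   at t J gives the uniform bound \<open>C\<close> on all (w p)^2.\<close>
 define R where "R = {j. t * real J < real j \<and> j \<le> J}"
 have R: "R \<subseteq> {1..J}" "finite R"
 proof -
  have "1 \<le> j" if "t * real J < real j" for j using that t by (cases "j = 0") (auto simp: mult_less_0_iff)
  then show "R \<subseteq> {1..J}" by (auto simp: R_def)
  then show "finite R" by (rule finite_subset) simp
 qed
 define P where "P = (UNIV :: bool set) \<times> R"
 have PR: "snd p \<in> R" if "p \<in> P" for p using that by (auto simp: P_def)
 have finP: "finite P" using R by (simp add: P_def)
 have sumP: "(\<Sum>p\<in>P. g p) = (\<Sum>j\<in>R. g (True, j) + g (False, j))" for g :: "bool \<times> nat \<Rightarrow> real"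
  unfolding P_def by (subst sum.cartesian_product[symmetric, of "\<lambda>b j. g (b, j)", simplified], subst sum.swap) (simp add: UNIV_bool add.commute)
 have cardP: "real (card P) \<le> W * A"
 proof -
  have "real (card P) \<le> 2 * real J" using card_mono[OF _ R(1)] by (simp add: P_def card_cartesian_product card_UNIV_bool)
  also have "... \<le> 2 * ((1 - t) * W * A / pi)" using J1(1) by (intro mult_left_mono) auto
  also have "... = (1 - t) * (W * A) * (2 / pi)" by simp
  also have "... \<le> 1 * (W * A) * 1" using t W A pi_gt3 by (intro mult_mono) auto
  finally show ?thesis by simp
 qed
 define rr where "rr j = (real j / real J) powr \<beta>" for j
 \<comment> \<open>The variance profile of the extremal ellipsoid, up to the factor 1 / n.\<close>
 define y where "y j = (real J / real j) powr \<beta> - 1" for j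
 have jR: "0 < real j" "real j \<le> real J" "0 < real J" "t * real J < real j" if "j \<in> R" for j using that R by (auto simp: R_def)
 have y0: "0 \<le> y j" "y j \<le> t powr (- \<beta>)" "y j = (1 - rr j) / rr j" "0 < rr j" "rr j \<le> 1" if j: "j \<in> R" for j
 proof -
  note q = jR[OF j]
  show "0 \<le> y j" unfolding y_def using q \<beta> by (simp add: ge_one_powr_ge_zero)
  have "real J / real j \<le> 1 / t" using q t by (simp add: field_simps)
  then have "(real J / real j) powr \<beta> \<le> (1 / t) powr \<beta>" using \<beta> by (intro powr_mono2) auto
  then show "y j \<le> t powr (- \<beta>)" unfolding y_def using t by (simp add: powr_divide powr_minus_divide)
  show r: "0 < rr j" "rr j \<le> 1" unfolding rr_def using q \<beta> by (auto intro!: powr_le1)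
  have "(real J / real j) powr \<beta> = 1 / rr j" unfolding rr_def using q by (simp add: powr_divide)
  then show "y j = (1 - rr j) / rr j" unfolding y_def using r by (simp add: diff_divide_distrib)
 qed
 \<comment> \<open>N is the reciprocal of the prior variance, so the coefficient w p * clip (s p)
   has variance y / n.\<close>
 define w where "w p = (if p \<in> P then sqrt (N * y (snd p) / real n) else 0)" for p :: "bool \<times> nat"
 have w2: "(w p)^2 = N * y (snd p) / real n" "(w p)^2 \<le> C" if p: "p \<in> P" for p
 proof -
  show e: "(w p)^2 = N * y (snd p) / real n" using p PR[OF p] y0(1)[of "snd p"] N n by (simp add: w_def)
  show "(w p)^2 \<le> C" unfolding e C_def using y0(2)[OF PR[OF p]] N by (intro divide_right_mono mult_left_mono) auto
 qed
 have w0: "0 \<le> w p" for p using PR[of p] y0(1)[of "snd p"] N by (simp add: w_def)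
 have wsum: "(\<Sum>p\<in>P. 2 * w p) \<le> t"
 proof -
  have "(\<Sum>p\<in>P. 2 * w p) \<le> (\<Sum>p\<in>P. 2 * sqrt C)"
   using w2(2) w0 by (intro sum_mono mult_left_mono real_le_rsqrt) auto
  also have "... = real (card P) * (2 * sqrt C)" by simp
  also have "... \<le> (W * A) * (2 * sqrt C)" using cardP C by (intro mult_right_mono) auto
  finally show ?thesis using H4 by (simp add: mult_ac)
 qed
 interpret trig_perturbation A P w t n a
 proof
  show "a \<ge> 2" by (rule a)
  show "finite P" by (rule finP)
  show "sunif A \<in> borel_measurable borel" "trig A p \<in> borel_measurable borel" for p by measurable
  show "0 < sunif A x" "sunif A x \<le> 1 / (2 * A)" "has_bochner_integral lborel (sunif A) 1" for x
   by (rule sunif_props[OF A])+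
  show "\<bar>trig A p x\<bar> \<le> 2" for p x by (rule trig_le)
  show "(LBINT x. sunif A x * trig A p x) = 0" if "p \<in> P" for p
   by (rule trig_mean[OF A]) (use jR(1)[OF PR[OF that]] in simp)
  show "(LBINT x. sunif A x * (trig A p x * trig A q x)) = (if p = q then 1 else 0)" if "p \<in> P" "q \<in> P" for p q
   by (rule trig_orth[OF A]) (use jR(1)[OF PR[OF that(1)]] jR(1)[OF PR[OF that(2)]] in simp_all)
  show "0 \<le> w p" for p by (rule w0)
  show "(\<Sum>p\<in>P. 2 * w p) \<le> t" by (rule wsum)
 qed (use t A in auto)
 note est_measurable[measurable del] T_measurable[measurable del]
 define fr where "fr p = freq A (snd p)" for p :: "bool \<times> nat"
 have fr: "0 \<le> fr p" "fr p \<le> W" if p: "p \<in> P" for p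
 proof -
  show "0 \<le> fr p" using A by (simp add: fr_def freq_def)
  have "fr p \<le> pi * real J / A" unfolding fr_def freq_def using jR(2)[OF PR[OF p]] A by (intro divide_right_mono mult_left_mono) auto
  also have "... \<le> 1 * W" by (rule order_trans[OF J2 mult_right_mono]) (use t W in auto)
  finally show "fr p \<le> W" by simp
 qed
 define b where "b p = 1 / (2 * A) * (w p * fr p powr \<beta>)^2" for p
 have b0: "0 \<le> b p" for p using A by (simp add: b_def)
 define V where "V s = (\<Sum>p\<in>P. b p * (clip (s p))^2)" for s
 let ?\<Pi> = "Pi\<^sub>M P (\<lambda>_. beta_prior a)"
 define mu where "mu = (\<Sum>p\<in>P. b p) / N"
 \<comment> \<open>\<open>V s\<close> is the main part of the Sobolev energy of the perturbation and
   \<open>mu\<close> its prior mean. Outside \<open>Gd\<close> the energy exceeds its mean by more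
   than t L / 4, which Chebyshev's inequality makes rare.\<close>
 define Gd where "Gd = {s \<in> space ?\<Pi>. V s \<le> mu + t * L / 4}"
 have Gd: "Gd \<in> sets ?\<Pi>" unfolding Gd_def V_def by measurable
 have mu: "mu \<le> (1 - t)^2 * L + t * L / 16"
 proof -
  have "mu = 1 / (A * real n) * (\<Sum>j\<in>R. y j * freq A j powr (2 * \<beta>))"
  proof -
   have "b p / N = 1 / (2 * A * real n) * (y (snd p) * freq A (snd p) powr (2 * \<beta>))" if "p \<in> P" for p
    unfolding b_def power_mult_distrib w2(1)[OF that] using N
    by (simp add: fr_def power2_eq_square[of "_ powr _"] powr_add[symmetric])
   then have "mu = (\<Sum>p\<in>P. 1 / (2 * A * real n) * (y (snd p) * freq A (snd p) powr (2 * \<beta>)))"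
    unfolding mu_def sum_divide_distrib by (intro sum.cong) auto
   also have "... = (\<Sum>j\<in>R. 1 / (A * real n) * (y j * freq A j powr (2 * \<beta>)))" unfolding sumP by (simp add: field_simps)
   finally show ?thesis unfolding sum_distrib_left .
  qed
  also have "... \<le> 1 / (A * real n) * (\<Sum>j=1..J. y j * freq A j powr (2 * \<beta>))"
  proof (intro mult_left_mono sum_mono2 R)
   fix j assume "j \<in> {1..J} - R"
   then have "0 \<le> y j" unfolding y_def using \<beta> by (auto intro!: ge_one_powr_ge_zero)
   then show "0 \<le> y j * freq A j powr (2 * \<beta>)" by simp
  qed (use A in auto)
  also have "... \<le> (1 - t)^2 * L + W powr (2 * \<beta>) / (A * real n)"
   unfolding y_def freq_def W_def by (rule pinsker_budget[OF \<beta> L n A t]) (use J2 in "simp add: W_def")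
  finally show ?thesis using H1 by linarith
 qed
 have dens_sob: "dens s \<in> sobolev_densities \<beta> L" if s: "s \<in> Gd" for s
 proof -
  have "(\<integral>\<^sup>+ x. ennreal (dens s x) \<partial>lborel) = 1"
   using dens_int[of s] dens_pos[of s] by (subst nn_integral_eq_integral) (auto simp: hbi_iff less_imp_le)
  moreover have "integrable lborel (\<lambda>x. (dens s x)^2)"
   unfolding dens_def
  proof (rule f0_sq_mult_int(1)[where K = 2])
   show "\<bar>1 + (\<Sum>p\<in>P. w p * clip (s p) * trig A p x)\<bar> \<le> 2" for x using clip_sum_le[of s x] t by linarith
  qed measurable
  moreover have "ennreal (1 / (2 * pi)) * (\<integral>\<^sup>+ \<omega>. ennreal ((\<bar>\<omega>\<bar> powr \<beta> * cmod (fourier (dens s) \<omega>))^2) \<partial>lborel) \<le> ennreal L"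
  proof -
   define M where "M = (LBINT u. (1 + \<bar>u\<bar>) powr (2 * \<beta> - 1) * exp (- u\<^sup>2))"
   define \<kappa> where "\<kappa> = (LBINT u. (kk A \<beta> u)^2)"
   define S2 where "S2 = (\<Sum>p\<in>P. (w p * clip (s p) * ((\<beta> + 1) * (1 + freq A (snd p)) powr (max (\<beta> - 1) 0)))^2)"
   define B where "B = ((\<beta> + 1) * (1 + W) powr (max (\<beta> - 1) 0))^2"
   have \<kappa>: "0 \<le> \<kappa>" unfolding \<kappa>_def by (intro integral_nonneg_AE AE_I2) simp
   have cl: "(clip u)^2 \<le> 1" for u using power_mono[OF abs_clip, of u 2] by simp
   have V: "1 / (2 * A) * (\<Sum>p\<in>P. (w p * clip (s p) * freq A (snd p) powr \<beta>)^2) = V s"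
    unfolding V_def b_def fr_def sum_distrib_left by (simp add: power_mult_distrib mult_ac)
   have "S2 \<le> (\<Sum>p\<in>P. C * 1 * B)" unfolding S2_def power_mult_distrib[of "w _ * clip _"] power_mult_distrib[of "w _"] B_def
    using w2(2) cl fr \<beta> C unfolding fr_def by (intro sum_mono mult_mono power_mono powr_mono2) auto
   then have S2: "S2 \<le> real (card P) * (C * B)" by simp
   have "real (card P) * S2 \<le> (W * A) * ((W * A) * (C * B))"
   proof (rule mult_mono[OF cardP])
    have "0 \<le> C * B" using C by (simp add: B_def)
    then show "S2 \<le> W * A * (C * B)" using mult_right_mono[OF cardP] S2 by fastforce
    show "0 \<le> S2" unfolding S2_def by (intro sum_nonneg) simp
   qed (use W A in simp)
   then have "(1 + 1 / t) / pi * (real (card P) * S2 * (4 * \<kappa>)) \<le> (1 + 1 / t) / pi * (((W * A) * ((W * A) * (C * B))) * (4 * \<kappa>))"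
    using t \<kappa> by (intro mult_left_mono mult_right_mono) auto
   also have "... \<le> t * L / 8" using H3 unfolding B_def \<kappa>_def by (simp add: power2_eq_square mult_ac)
   finally have X3: "(1 + 1 / t) / pi * (real (card P) * S2 * (4 * \<kappa>)) \<le> t * L / 8" .
   have "(1 + t) * V s \<le> (1 + t) * ((1 - t)^2 * L + t * L / 16 + t * L / 4)"
   proof (intro mult_left_mono)
    have "V s \<le> mu + t * L / 4" using s by (simp add: Gd_def)
    then show "V s \<le> (1 - t)^2 * L + t * L / 16 + t * L / 4" using mu by linarith
   qed (use t in simp)
   also have "... \<le> L - t * L / 4"
   proof -
    \<comment> \<open>The 5/16 is 1/16 for the Riemann sum plus 1/4 for the deviation from the mean.
      The t L / 4 left over is shared by the base density and the frequency exchange, t L / 8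
      each.\<close>
    have "(1 + t) * ((1 - t)^2 + t * (5 / 16)) \<le> 1 - t / 4"
    proof -
     have "t * t \<le> 1 * t" using t by (intro mult_right_mono) auto
     then have "0 \<le> (7 / 16) + (11 / 16) * t - t * t" using t by linarith
     then have "0 \<le> t * ((7 / 16) + (11 / 16) * t - t * t)" using t by simp
     then show ?thesis by (simp add: power2_eq_square algebra_simps)
    qed
    then have "(1 + t) * ((1 - t)^2 + t * (5 / 16)) * L \<le> (1 - t / 4) * L" using L by (intro mult_right_mono) auto
    then show ?thesis by (simp add: algebra_simps)
   qed
   finally have X1: "(1 + t) * V s \<le> L - t * L / 4" .
   have "ennreal (1 / (2 * pi)) * (\<integral>\<^sup>+ \<omega>. ennreal ((\<bar>\<omega>\<bar> powr \<beta> * cmod (fourier (dens s) \<omega>))^2) \<partial>lborel)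
    \<le> ennreal (1 / (2 * pi)) * ennreal (2 * pi * ((1 + t) * V s) + 2 * (1 + 1 / t) * (M / A + real (card P) * S2 * (4 * \<kappa>)))"
    using energy_bound[OF \<beta> t(1), of s] unfolding V M_def S2_def \<kappa>_def by (intro mult_left_mono) auto
   also have "... = ennreal (1 / (2 * pi) * (2 * pi * ((1 + t) * V s) + 2 * (1 + 1 / t) * (M / A + real (card P) * S2 * (4 * \<kappa>))))"
    by (rule ennreal_mult'[symmetric]) simp
   also have "1 / (2 * pi) * (2 * pi * ((1 + t) * V s) + 2 * (1 + 1 / t) * (M / A + real (card P) * S2 * (4 * \<kappa>)))
    = (1 + t) * V s + (1 + 1 / t) / pi * (M / A) + (1 + 1 / t) / pi * (real (card P) * S2 * (4 * \<kappa>))"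
   proof -
    have "1 / (2 * pi) * (2 * pi * v + 2 * x * (m + r)) = v + x / pi * m + x / pi * r" for v x m r
     by (simp add: field_simps)
    then show ?thesis .
   qed
   also have "... \<le> L" using X1 X3 H2 unfolding M_def by linarith
   finally show ?thesis by (simp add: ennreal_leI)
  qed
  ultimately show ?thesis using dens_pos[of s] by (simp add: sobolev_densities_def L2_real_def less_imp_le)
 qed
 have bad: "ennreal (10 * \<rho>) * emeasure ?\<Pi> (space ?\<Pi> - Gd) \<le> ennreal (t * pinsker \<beta> L n)"
 proof -
  have "space ?\<Pi> - Gd = {s \<in> space ?\<Pi>. (\<Sum>p\<in>P. b p) / real (2 * a + 3) + t * L / 4 < (\<Sum>p\<in>P. b p * (clip (s p))^2)}"
   unfolding Gd_def V_def mu_def N_def by auto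
  then have "emeasure ?\<Pi> (space ?\<Pi> - Gd) \<le> ennreal ((\<Sum>p\<in>P. (b p)^2) / (t * L / 4)^2)"
   using beta_chebyshev[OF finP b0, of "t * L / 4" a] t L by simp
  also have "... \<le> ennreal (W * A * (1 / (2 * A) * (C * W powr (2 * \<beta>)))^2 / (t * L / 4)^2)"
  proof (intro ennreal_leI divide_right_mono)
   have "(\<Sum>p\<in>P. (b p)^2) \<le> (\<Sum>p\<in>P. (1 / (2 * A) * (C * W powr (2 * \<beta>)))^2)"
   proof (intro sum_mono power_mono b0)
    fix p assume p: "p \<in> P"
    have "(w p)^2 * (fr p powr \<beta>)^2 \<le> C * (W powr \<beta>)^2"
     using w2(2)[OF p] fr[OF p] \<beta> C by (intro mult_mono power_mono powr_mono2) auto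
    also have "(W powr \<beta>)^2 = W powr (2 * \<beta>)" by (simp add: power2_eq_square powr_add[symmetric])
    finally show "b p \<le> 1 / (2 * A) * (C * W powr (2 * \<beta>))" unfolding b_def power_mult_distrib using A by (intro mult_left_mono) auto
   qed
   also have "... \<le> W * A * (1 / (2 * A) * (C * W powr (2 * \<beta>)))^2" using cardP by (simp add: mult_right_mono)
   finally show "(\<Sum>p\<in>P. (b p)^2) \<le> W * A * (1 / (2 * A) * (C * W powr (2 * \<beta>)))^2" .
  qed simp
  finally have e: "emeasure ?\<Pi> (space ?\<Pi> - Gd) \<le> ennreal (W * A * (1 / (2 * A) * (C * W powr (2 * \<beta>)))^2 / (t * L / 4)^2)" .
  have "\<rho> \<le> 1 / (2 * A) * (W * A * C)"
  proof -
   have "(\<Sum>p\<in>P. (w p)^2) \<le> (\<Sum>p\<in>P. C)" by (intro sum_mono w2(2))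
   also have "... \<le> W * A * C" using cardP C by (simp add: mult_right_mono)
   finally show ?thesis unfolding \<rho>_def using A by (intro mult_left_mono) auto
  qed
  then have "ennreal (10 * \<rho>) * emeasure ?\<Pi> (space ?\<Pi> - Gd) \<le>
   ennreal (10 * (1 / (2 * A) * (W * A * C))) * ennreal (W * A * (1 / (2 * A) * (C * W powr (2 * \<beta>)))^2 / (t * L / 4)^2)"
   by (intro mult_mono e ennreal_leI mult_left_mono) auto
  also have "... = ennreal (10 * (1 / (2 * A) * (W * A * C)) * (W * A * (1 / (2 * A) * (C * W powr (2 * \<beta>)))^2 / (t * L / 4)^2))"
   by (rule ennreal_mult'[symmetric]) (use W A C in auto)
  also have "... \<le> ennreal (t * pinsker \<beta> L n)" by (rule ennreal_leI[OF H5])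
  finally show ?thesis .
 qed
 have main: "(1 - 8 * t) * pinsker \<beta> L n \<le> (\<Sum>p\<in>P. 1 / (1 / (2 * A)) * ((w p * gram p p)^2 / (real n * ((w p)^2 / (1 - t)) + beta_info a)))"
 proof -
  define q where "q = (LBINT x. (sunif A x)^2)"
  \<comment> \<open>Up to the factor 1 - t this is 1 / n times the Pinsker filter at the j-th
    frequency: the value of the van Trees ratio for the optimal variance.\<close>
  define z where "z j = (1 - t) * (1 - rr j) / real n" for j
  have z0: "0 \<le> z j" if "j \<in> R" for j unfolding z_def using y0(5)[OF that] t by simp
  have trm: "2 * A * (z (snd p) * (gram p p)^2) \<le> 1 / (1 / (2 * A)) * ((w p * gram p p)^2 / (real n * ((w p)^2 / (1 - t)) + beta_info a))"
   if p: "p \<in> P" for p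
  proof -
   note Y = y0[OF PR[OF p]]
   let ?r = "rr (snd p)"
   have "real n * ((w p)^2 / (1 - t)) + beta_info a \<le> N / ((1 - t) * ?r)"
   proof -
    have "real n * ((w p)^2 / (1 - t)) + beta_info a \<le> N * y (snd p) / (1 - t) + N / (1 - t)"
     unfolding w2(1)[OF p] using n a1 by simp
    also have "... = N / ((1 - t) * ?r)" 
    proof -
     have "N * ((1 - r) / r) / u + N / u = N / (u * r)" if "u > 0" "r > 0" for u r
      using that by (simp add: field_simps)
     from this[of "1 - t" ?r] show ?thesis unfolding Y(3) using Y(4) t by simp
    qed
    finally show ?thesis .
   qed
   moreover have "0 < real n * ((w p)^2 / (1 - t)) + beta_info a"
    using t a by (intro add_nonneg_pos mult_nonneg_nonneg divide_nonneg_nonneg) (auto simp: beta_info_def)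
   ultimately have "(w p)^2 / (N / ((1 - t) * ?r)) \<le> (w p)^2 / (real n * ((w p)^2 / (1 - t)) + beta_info a)"
    using N t Y(4) by (intro divide_left_mono mult_pos_pos divide_pos_pos) auto
   moreover have "(w p)^2 / (N / ((1 - t) * ?r)) = z (snd p)"
    unfolding w2(1)[OF p] Y(3) z_def using N t Y(4) n by (simp add: field_simps)
   ultimately have "2 * A * (z (snd p) * (gram p p)^2) \<le> 2 * A * ((w p)^2 / (real n * ((w p)^2 / (1 - t)) + beta_info a) * (gram p p)^2)"
    using A by (intro mult_left_mono mult_right_mono) auto
   then show ?thesis by (simp add: power_mult_distrib)
  qed
  \<comment> \<open>Only the sum of the two diagonal entries is known, so their squares are bounded
    below through (g + h)^2 <= 2 (g^2 + h^2).\<close>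
  have pair: "2 * A * (z j * (gram (True, j) (True, j))^2) + 2 * A * (z j * (gram (False, j) (False, j))^2) \<ge> (1 - t)\<^sup>2 / A * z j" if j: "j \<in> R" for j
  proof -
   have "2 * q = gram (True, j) (True, j) + gram (False, j) (False, j)" unfolding q_def gram_def by (rule trig_gram[OF A, symmetric])
   moreover have "(g + h)^2 \<le> 2 * (g\<^sup>2 + h\<^sup>2)" for g h :: real
    using zero_le_power2[of "g - h"] by (simp add: power2_diff power2_sum)
   ultimately have "(2 * q)^2 \<le> 2 * ((gram (True, j) (True, j))^2 + (gram (False, j) (False, j))^2)" by metis
   moreover have "((1 - t) / A)^2 \<le> (2 * q)^2" using A1 t A unfolding q_def by (intro power_mono) (auto simp: field_simps)
   ultimately have "((1 - t) / A)^2 \<le> 2 * ((gram (True, j) (True, j))^2 + (gram (False, j) (False, j))^2)" by linarith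
   then have "A * z j * ((1 - t) / A)^2 \<le> A * z j * (2 * ((gram (True, j) (True, j))^2 + (gram (False, j) (False, j))^2))"
    using A z0[OF j] by (intro mult_left_mono) auto
   moreover have "A * z j * ((1 - t) / A)^2 = (1 - t)^2 / A * z j" using A by (simp add: power2_eq_square)
   ultimately show ?thesis by (simp add: algebra_simps)
  qed
  \<comment> \<open>The sum over 1..J approximates J times the integral of 1 - x^\<beta> over
    [0, 1], which is \<beta> / (\<beta> + 1). Leaving out the low frequencies costs at most t J,
    rounding at most 1.\<close>
  have sumr: "real J * (\<beta> / (\<beta> + 1) - t) - 1 \<le> (\<Sum>j\<in>R. 1 - rr j)"
  proof -
   have "(\<Sum>j=1..J. rr j) \<le> real J / (\<beta> + 1) + 1"
   proof (cases "J = 0")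
    case False
    then have Jp: "real J > 0" by simp
    have "(\<Sum>j=1..J. rr j) = (\<Sum>j=1..J. real j powr \<beta>) / real J powr \<beta>"
     unfolding rr_def sum_divide_distrib by (intro sum.cong refl) (simp add: powr_divide)
    also have "... \<le> (real J powr (\<beta> + 1) / (\<beta> + 1) + real J powr \<beta>) / real J powr \<beta>"
     using power_sum_bounds(2)[of \<beta> J] \<beta> by (intro divide_right_mono) auto
    also have "... = real J / (\<beta> + 1) + 1" using Jp by (simp add: powr_add add_divide_distrib)
    finally show ?thesis .
   qed (use \<beta> in simp)
   moreover have "(\<Sum>j\<in>{1..J} - R. 1 - rr j) \<le> t * real J"
   proof -
    have "(\<Sum>j\<in>{1..J} - R. 1 - rr j) \<le> (\<Sum>j\<in>{1..J} - R. 1)" by (intro sum_mono) (simp add: rr_def)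
    also have "... = real (card ({1..J} - R))" by simp
    also have "... \<le> real (card {1..nat \<lfloor>t * real J\<rfloor>})"
    proof (intro of_nat_mono card_mono)
     show "{1..J} - R \<subseteq> {1..nat \<lfloor>t * real J\<rfloor>}" 
     proof
      fix j assume "j \<in> {1..J} - R"
      then have "real j \<le> t * real J" "1 \<le> j" by (auto simp: R_def)
      then show "j \<in> {1..nat \<lfloor>t * real J\<rfloor>}" by (simp add: le_nat_floor)
     qed
    qed simp
    also have "... \<le> t * real J" using t by simp
    finally show ?thesis .
   qed
   moreover have "(\<Sum>j=1..J. 1 - rr j) = (\<Sum>j\<in>{1..J} - R. 1 - rr j) + (\<Sum>j\<in>R. 1 - rr j)" by (rule sum.subset_diff[OF R(1)]) simp
   moreover have "(\<Sum>j=1..J. 1 - rr j) = real J - (\<Sum>j=1..J. rr j)" by (simp add: sum_subtractf)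
   moreover have "real J * (\<beta> / (\<beta> + 1) - t) = real J - real J / (\<beta> + 1) - t * real J" using \<beta> by (simp add: field_simps)
   ultimately show ?thesis by linarith
  qed
  define D where "D = \<beta> / (\<beta> + 1)"
  have D: "1 / 3 < D" "D < 1" using \<beta> by (auto simp: D_def field_simps)
  have pin: "pinsker \<beta> L n = W / (pi * real n) * D" by (simp add: pinsker_def W_def D_def)
  have pin0: "0 \<le> pinsker \<beta> L n" unfolding pin using W D by simp
  show ?thesis
  proof (cases "1 - 8 * t \<le> 0")
   case True
   then have "(1 - 8 * t) * pinsker \<beta> L n \<le> 0" using pin0 by (simp add: mult_nonpos_nonneg)
   also have "... \<le> (\<Sum>p\<in>P. 2 * A * (z (snd p) * (gram p p)^2))" using A z0 PR by (intro sum_nonneg mult_nonneg_nonneg) auto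
   also have "... \<le> (\<Sum>p\<in>P. 1 / (1 / (2 * A)) * ((w p * gram p p)^2 / (real n * ((w p)^2 / (1 - t)) + beta_info a)))" by (intro sum_mono trm)
   finally show ?thesis .
  next
   case False
   then have t8: "t < 1 / 8" by simp
   have c3: "(1 - t) ^ 3 \<le> 1" "0 \<le> (1 - t) ^ 3" using t by (auto intro: power_le_one)
   \<comment> \<open>The cube collects one factor from the information and two from the Gram
     entries; 1 - t comes from the cut-off, 1 - 3 t from the low frequencies since D > 1/3, and the
     final t pays for rounding.\<close>
   have "(1 - 8 * t) * pinsker \<beta> L n \<le> (1 - t) ^ 3 * ((1 - t) * (1 - 3 * t)) * pinsker \<beta> L n - t * pinsker \<beta> L n"
   proof -
    have "1 - 3 * t \<le> (1 - t) ^ 3"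
    proof -
     have "(1 - t) ^ 3 = 1 - 3 * t + t * t * (3 - t)" by (simp add: power3_eq_cube algebra_simps)
     moreover have "0 \<le> t * t * (3 - t)" using t by (intro mult_nonneg_nonneg) auto
     ultimately show ?thesis by linarith
    qed
    moreover have "1 - 4 * t \<le> (1 - t) * (1 - 3 * t)" using t by (simp add: algebra_simps)
    ultimately have "(1 - 3 * t) * (1 - 4 * t) \<le> (1 - t) ^ 3 * ((1 - t) * (1 - 3 * t))" using t8 c3 by (intro mult_mono) auto
    moreover have "1 - 7 * t \<le> (1 - 3 * t) * (1 - 4 * t)" using t by (simp add: algebra_simps)
    ultimately have "1 - 8 * t \<le> (1 - t) ^ 3 * ((1 - t) * (1 - 3 * t)) - t" by linarith
    from mult_right_mono[OF this pin0] show ?thesis by (simp add: left_diff_distrib)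
   qed
   also have "... \<le> (1 - t) ^ 3 * ((1 - t) * (1 - 3 * t)) * pinsker \<beta> L n - (1 - t) ^ 3 * (2 / (A * real n))"
   proof -
    have "(1 - t) ^ 3 * (2 / (A * real n)) \<le> 1 * (2 / (A * real n))" using c3 A by (intro mult_right_mono) auto
    then show ?thesis using H6 by linarith
   qed
   also have "... = (1 - t) ^ 3 / (A * real n) * (((1 - t) * W * A / pi) * (D * (1 - 3 * t)) - 2)"
    unfolding pin using A n by (simp add: field_simps)
   also have "... \<le> (1 - t) ^ 3 / (A * real n) * (real J * (D - t) - 1)"
   proof (intro mult_left_mono)
    have "D * (1 - 3 * t) \<le> D - t" using D t by (simp add: algebra_simps)
    then have "((1 - t) * W * A / pi) * (D * (1 - 3 * t)) \<le> ((1 - t) * W * A / pi) * (D - t)" using J0 by (rule mult_left_mono)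
    also have "... \<le> (real J + 1) * (D - t)" using J1(2) D t8 by (intro mult_right_mono) auto
    also have "... \<le> real J * (D - t) + 1" using D t by (simp add: algebra_simps)
    finally show "((1 - t) * W * A / pi) * (D * (1 - 3 * t)) - 2 \<le> real J * (D - t) - 1" by linarith
   qed (use c3 A in auto)
   also have "... \<le> (1 - t) ^ 3 / (A * real n) * (\<Sum>j\<in>R. 1 - rr j)"
    using sumr c3 A unfolding D_def by (intro mult_left_mono) auto
   also have "... = (\<Sum>j\<in>R. (1 - t)^2 / A * z j)"
    unfolding sum_distrib_left z_def by (intro sum.cong refl) (simp add: power3_eq_cube power2_eq_square)
   also have "... \<le> (\<Sum>p\<in>P. 2 * A * (z (snd p) * (gram p p)^2))" unfolding sumP using pair by (intro sum_mono) auto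
   also have "... \<le> (\<Sum>p\<in>P. 1 / (1 / (2 * A)) * ((w p * gram p p)^2 / (real n * ((w p)^2 / (1 - t)) + beta_info a)))" by (intro sum_mono trm)
   finally show ?thesis .
  qed
 qed
 have pin0: "0 \<le> pinsker \<beta> L n" using W \<beta> unfolding pinsker_def W_def[symmetric] by simp
 have "ennreal ((1 - 8 * t) * pinsker \<beta> L n) \<le> max_risk n \<beta> L T + ennreal (10 * \<rho>) * emeasure ?\<Pi> (space ?\<Pi> - Gd)"
  using order_trans[OF ennreal_leI[OF main] bayes_lower_bound[OF T Gd dens_sob]] unfolding max_risk_def by simp
 also have "... \<le> max_risk n \<beta> L T + ennreal (t * pinsker \<beta> L n)" by (intro add_left_mono bad)
 finally have fin: "ennreal ((1 - 8 * t) * pinsker \<beta> L n) \<le> max_risk n \<beta> L T + ennreal (t * pinsker \<beta> L n)" .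
 show ?thesis
 proof (cases "1 - 9 * t \<le> 0")
  case True
  then have "(1 - 9 * t) * pinsker \<beta> L n \<le> 0" using pin0 by (simp add: mult_nonpos_nonneg)
  then show ?thesis by (simp add: ennreal_neg)
 next
  case False
  have "0 \<le> (1 - 9 * t) * pinsker \<beta> L n" "0 \<le> t * pinsker \<beta> L n" using False pin0 t by auto
  moreover have "t * pinsker \<beta> L n + (1 - 9 * t) * pinsker \<beta> L n = (1 - 8 * t) * pinsker \<beta> L n" by (simp add: algebra_simps)
  ultimately have "ennreal (t * pinsker \<beta> L n) + ennreal ((1 - 9 * t) * pinsker \<beta> L n) \<le> ennreal (t * pinsker \<beta> L n) + max_risk n \<beta> L T"
   using fin by (simp add: add.commute flip: ennreal_plus)
  then show ?thesis unfolding ennreal_add_left_cancel_le by simp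
 qed
qed

lemma eventually_powr_le:
 assumes "q < 0" "e > 0"
 shows "\<forall>\<^sub>F n in sequentially. K * real n powr q \<le> e"
proof -
 have "(\<lambda>n. K * real n powr q) \<longlonglongrightarrow> K * 0"
  by (intro tendsto_intros tendsto_neg_powr filterlim_real_sequentially assms)
 then have "\<forall>\<^sub>F n in sequentially. K * real n powr q < e" using assms by (intro order_tendstoD) auto
 then show ?thesis by eventually_elim simp
qed

text \<open>The order of choices is t from \<epsilon>, then a and A from t, and only then n. Each
  remaining condition is a constant times a negative power of n; positivity of the densities needs
  \<gamma> < 1/2, which is \<beta> > 1/2.\<close>

theorem pinsker_lower_bound:
 assumes \<beta>: "\<beta> > 1 / 2" and L: "L > 0" and \<epsilon>: "\<epsilon> > 0"
 shows "\<forall>\<^sub>F n in sequentially. \<forall>T\<in>estimators n. ennreal ((1 - \<epsilon>) * pinsker \<beta> L n) \<le> max_risk n \<beta> L T"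
proof -
 define t where "t = min \<epsilon> 1 / 10"
 have t: "0 < t" "t < 1" "9 * t \<le> \<epsilon>" using \<epsilon> by (auto simp: t_def min_def)
 \<comment> \<open>From a >= 3 / t it follows that the product of prior information and prior
   variance is at most 1 / (1 - t).\<close>
 define a where "a = nat \<lceil>3 / t\<rceil> + 2"
 have a: "a \<ge> 2" by (simp add: a_def)
 define N where "N = real (2 * a + 3)"
 have N: "N > 0" by (simp add: N_def)
 have a1: "beta_info a \<le> N / (1 - t)"
 proof -
  have "3 / t \<le> real a" unfolding a_def by linarith
  then have "3 \<le> t * real a" using t by (simp add: field_simps)
  moreover have "t * real a * 1 \<le> t * real a * (2 * real a + 1)" using t by (intro mult_left_mono) auto
  ultimately have "(real a * (2 * real a + 1)) * (1 - t) \<le> (2 * real a + 3) * (real a - 1)" by (simp add: algebra_simps)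
  then have "real a * (2 * real a + 1) / (real a - 1) \<le> (2 * real a + 3) / (1 - t)"
   using t a by (simp add: divide_le_eq le_divide_eq)
  then show ?thesis using a by (simp add: beta_info_def N_def of_nat_diff add.commute)
 qed
 define M where "M = (LBINT u. (1 + \<bar>u\<bar>) powr (2 * \<beta> - 1) * exp (- u\<^sup>2))"
 define R where "R = 2 / sqrt t"
 \<comment> \<open>The first entry gives R / A <= t / 2, which joins 2 / R^2 = t / 2 in A1; the
   second keeps the energy of the base density small.\<close>
 define A where "A = max (max (2 * R / t) ((1 + 1 / t) / pi * M * (8 / (t * L)))) 1"
 have R: "R > 0" "2 / R\<^sup>2 = t / 2" using t by (auto simp: R_def power_divide)
 have A: "A > 0" "2 * R / t \<le> A" "(1 + 1 / t) / pi * M * (8 / (t * L)) \<le> A" by (auto simp: A_def)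
 have A1: "(1 - t) / (2 * A) \<le> (LBINT x. (sunif A x)^2)"
 proof -
  have "R / A \<le> t / 2" using A t by (simp add: field_simps)
  then have "(1 - t) / (2 * A) \<le> (1 - 2 / R\<^sup>2 - R / A) / (2 * A)" unfolding R(2) using A by (intro divide_right_mono) auto
  then show ?thesis using sunif_sq(2)[OF A(1) R(1)] by linarith
 qed
 have H2: "(1 + 1 / t) / pi * (M / A) \<le> t * L / 8"
  using A t L by (simp add: field_simps)
 define \<kappa> where "\<kappa> = (LBINT u. (kk A \<beta> u)^2)"
 have \<kappa>: "0 \<le> \<kappa>" unfolding \<kappa>_def by (intro integral_nonneg_AE AE_I2) simp
 define \<gamma> where "\<gamma> = 1 / (2 * \<beta> + 1)"
 define m where "m = max (\<beta> - 1) 0"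
 define c where "c = (pi * L * (\<beta> + 1) * (2 * \<beta> + 1) / \<beta>) powr \<gamma>"
 define p where "p = c / pi * (\<beta> / (\<beta> + 1))"
 define c1 where "c1 = N * t powr (- \<beta>)"
 \<comment> \<open>For \<beta> <= 1 this is \<beta> > 1/2 again; for larger \<beta> the left side is
   2 \<beta>.\<close>
 have "2 * (1 + m) < 2 * \<beta> + 1" using \<beta> by (simp add: m_def max_def)
 then have "2 * (1 + m) * \<gamma> < 1" using \<beta> unfolding \<gamma>_def by (simp add: divide_less_eq)
 then have \<gamma>: "0 < \<gamma>" "\<gamma> < 1 / 2" "2 * \<beta> * \<gamma> < 1" "2 * \<gamma> + 2 * \<gamma> * m < 1" "\<gamma> + 4 * \<beta> * \<gamma> < 2"
  using \<beta> by (auto simp: algebra_simps) (auto simp: \<gamma>_def field_simps)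
 have c: "c > 0" "p > 0" "c1 > 0" "m \<ge> 0" unfolding p_def c_def c1_def m_def using \<beta> L N t by auto
 have pin: "pinsker \<beta> L n = p * (real n powr \<gamma> / real n)" for n
  by (simp add: pinsker_def pinsker_W_eq p_def c_def \<gamma>_def mult_ac)
 have W: "pinsker_W \<beta> L n = c * real n powr \<gamma>" for n unfolding c_def \<gamma>_def by (rule pinsker_W_eq)
 define K3 where "K3 = (1 + 1 / t) / pi * ((c * A)^2 * c1 * ((\<beta> + 1)^2 * (1 + c) powr (2 * m)) * (4 * \<kappa>))"
 define K5 where "K5 = 10 * (1 / (2 * A) * (c * A * c1)) * (c * A * (1 / (2 * A) * (c1 * c powr (2 * \<beta>)))^2 / (t * L / 4)^2)"
 have E1: "\<forall>\<^sub>F n in sequentially. c powr (2 * \<beta>) / A * real n powr (2 * \<beta> * \<gamma> - 1) \<le> t * L / 16"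
  by (rule eventually_powr_le) (use \<gamma> t L in auto)
 have E3: "\<forall>\<^sub>F n in sequentially. K3 * real n powr (2 * \<gamma> + 2 * \<gamma> * m - 1) \<le> t * L / 8"
  by (rule eventually_powr_le) (use \<gamma> t L in auto)
 have E4: "\<forall>\<^sub>F n in sequentially. 2 * (c * A) * sqrt c1 * real n powr (\<gamma> - 1 / 2) \<le> t"
  by (rule eventually_powr_le) (use \<gamma> t L in auto)
 have E5: "\<forall>\<^sub>F n in sequentially. K5 * real n powr (\<gamma> + 4 * \<beta> * \<gamma> - 2) \<le> t * p"
  by (rule eventually_powr_le) (use \<gamma> t c in auto)
 have E6: "\<forall>\<^sub>F n in sequentially. 2 / A * real n powr (- \<gamma>) \<le> t * p"
  by (rule eventually_powr_le) (use \<gamma> t c in auto)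
 show ?thesis
  using E1 E3 E4 E5 E6 eventually_gt_at_top[of 0]
 proof eventually_elim
  case (elim n)
  define x where "x = real n"
  have x: "x > 0" "x \<ge> 1" using elim(6) by (auto simp: x_def)
  have W2: "(c * x powr \<gamma>) powr (2 * \<beta>) = c powr (2 * \<beta>) * x powr (2 * \<beta> * \<gamma>)"
   by (simp add: powr_mult powr_powr mult_ac)
  show ?case
  proof
   fix T assume T: "T \<in> estimators n"
   have "ennreal ((1 - 9 * t) * pinsker \<beta> L n) \<le> max_risk n \<beta> L T"
   proof (rule pinsker_lower_bound_fixed[OF \<beta> L _ A(1) t(1,2) a T A1 a1[unfolded N_def] _ H2[unfolded M_def]])
    show "n > 0" by (rule elim(6))
    show "pinsker_W \<beta> L n powr (2 * \<beta>) / (A * real n) \<le> t * L / 16"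
    proof -
     have "pinsker_W \<beta> L n powr (2 * \<beta>) / (A * real n) = c powr (2 * \<beta>) / A * x powr (2 * \<beta> * \<gamma> - 1)"
      unfolding W x_def[symmetric] W2 using x by (simp add: powr_diff)
     then show ?thesis using elim(1) by (simp add: x_def)
    qed
    show "(1 + 1 / t) / pi * ((pinsker_W \<beta> L n * A)^2 * (real (2 * a + 3) * t powr - \<beta> / real n) *
     ((\<beta> + 1) * (1 + pinsker_W \<beta> L n) powr max (\<beta> - 1) 0)\<^sup>2 * (4 * (LBINT u. (kk A \<beta> u)^2))) \<le> t * L / 8"
    proof -
     have "1 + c * x powr \<gamma> \<le> (1 + c) * x powr \<gamma>" using x c \<gamma> by (simp add: distrib_right ge_one_powr_ge_zero)
     then have "(1 + c * x powr \<gamma>) powr (2 * m) \<le> ((1 + c) * x powr \<gamma>) powr (2 * m)" using c by (intro powr_mono2) auto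
     also have "... = (1 + c) powr (2 * m) * x powr (2 * \<gamma> * m)" by (simp add: powr_mult powr_powr mult_ac)
     finally have p2: "(1 + c * x powr \<gamma>) powr (2 * m) \<le> (1 + c) powr (2 * m) * x powr (2 * \<gamma> * m)" .
     have "(1 + 1 / t) / pi * ((c * x powr \<gamma> * A)^2 * (c1 / x) * ((\<beta> + 1) * (1 + c * x powr \<gamma>) powr m)^2 * (4 * \<kappa>))
      = (1 + 1 / t) / pi * ((c * A)^2 * c1 * ((\<beta> + 1)^2 * (1 + c * x powr \<gamma>) powr (2 * m)) * (4 * \<kappa>)) * (x powr (2 * \<gamma>) / x)"
     proof -
      have "((1 + c * x powr \<gamma>) powr m)^2 = (1 + c * x powr \<gamma>) powr (2 * m)" "(x powr \<gamma>)^2 = x powr (2 * \<gamma>)"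
       by (simp_all add: power2_eq_square powr_add[symmetric])
      then show ?thesis by (simp add: power_mult_distrib)
     qed
     also have "... \<le> (1 + 1 / t) / pi * ((c * A)^2 * c1 * ((\<beta> + 1)^2 * ((1 + c) powr (2 * m) * x powr (2 * \<gamma> * m))) * (4 * \<kappa>)) * (x powr (2 * \<gamma>) / x)"
      using p2 c t \<kappa> x by (intro mult_right_mono mult_left_mono) auto
     also have "... = K3 * x powr (2 * \<gamma> + 2 * \<gamma> * m - 1)"
      unfolding K3_def using x by (simp add: powr_add powr_diff)
     also have "... \<le> t * L / 8" using elim(2) by (simp add: x_def)
     finally show ?thesis unfolding W by (simp only: x_def c1_def N_def m_def \<kappa>_def)
    qed
    show "2 * (pinsker_W \<beta> L n * A) * sqrt (real (2 * a + 3) * t powr - \<beta> / real n) \<le> t"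
    proof -
     have "sqrt (c1 / x) = sqrt c1 * x powr (- 1 / 2)" using x by (simp add: real_sqrt_divide powr_minus_divide powr_half_sqrt)
     then have "2 * (c * x powr \<gamma> * A) * sqrt (c1 / x) = 2 * (c * A) * sqrt c1 * x powr (\<gamma> - 1 / 2)"
      by (simp add: powr_add[symmetric])
     also have "... \<le> t" unfolding x_def by (rule elim(3))
     finally show ?thesis unfolding W by (simp only: x_def c1_def N_def)
    qed
    show "10 * (1 / (2 * A) * (pinsker_W \<beta> L n * A * (real (2 * a + 3) * t powr - \<beta> / real n))) *
     (pinsker_W \<beta> L n * A * (1 / (2 * A) * (real (2 * a + 3) * t powr - \<beta> / real n * pinsker_W \<beta> L n powr (2 * \<beta>)))^2 / (t * L / 4)^2)
     \<le> t * pinsker \<beta> L n"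
    proof -
     have "10 * (1 / (2 * A) * (c * x powr \<gamma> * A * (c1 / x))) * (c * x powr \<gamma> * A * (1 / (2 * A) * (c1 / x * (c * x powr \<gamma>) powr (2 * \<beta>)))^2 / (t * L / 4)^2)
      = K5 * (x powr \<gamma> * (x powr (2 * \<beta> * \<gamma>))^2 / x\<^sup>2) * (x powr \<gamma> / x)"
     proof -
      have "10 * (u * (c * X * A * (c1 * y))) * (c * X * A * (u * (c1 * y * (B * Y)))^2 * v)
       = 10 * (u * (c * A * c1)) * (c * A * (u * (c1 * B))^2 * v) * (X * Y\<^sup>2 * y\<^sup>2) * (X * y)" for u v y X Y B
       by (simp add: power2_eq_square)
      from this[of "1 / (2 * A)" "x powr \<gamma>" "inverse x" "c powr (2 * \<beta>)" "x powr (2 * \<beta> * \<gamma>)" "inverse ((t * L / 4)^2)"]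
      show ?thesis unfolding W2 K5_def divide_inverse[of _ x] divide_inverse[of _ "x\<^sup>2"] divide_inverse[of _ "(t * L / 4)^2"] power_inverse .
     qed
     also have "x powr \<gamma> * (x powr (2 * \<beta> * \<gamma>))^2 / x\<^sup>2 = x powr (\<gamma> + 4 * \<beta> * \<gamma> - 2)"
     proof -
      have e: "\<gamma> + 4 * \<beta> * \<gamma> - 2 = \<gamma> + (2 * \<beta> * \<gamma> + 2 * \<beta> * \<gamma>) - 2" by simp
      have "x powr 2 = x\<^sup>2" using x by simp
      then show ?thesis unfolding e powr_add powr_diff power2_eq_square[of "x powr _"] by simp
     qed
     also have "K5 * x powr (\<gamma> + 4 * \<beta> * \<gamma> - 2) * (x powr \<gamma> / x) \<le> t * p * (x powr \<gamma> / x)"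
      using elim(4) x by (intro mult_right_mono) (auto simp: x_def)
     finally show ?thesis unfolding W pin by (simp only: x_def c1_def N_def mult.assoc)
    qed
    show "2 / (A * real n) \<le> t * pinsker \<beta> L n"
    proof -
     have "2 / (A * x) = 2 / A * x powr (- \<gamma>) * (x powr \<gamma> / x)" using x by (simp add: powr_minus_divide)
     also have "... \<le> t * p * (x powr \<gamma> / x)" using elim(5) x by (intro mult_right_mono) (auto simp: x_def)
     finally show ?thesis unfolding pin by (simp add: x_def)
    qed
   qed
   moreover have "ennreal ((1 - \<epsilon>) * pinsker \<beta> L n) \<le> ennreal ((1 - 9 * t) * pinsker \<beta> L n)"
    unfolding pin using t c by (intro ennreal_leI mult_right_mono) auto
   ultimately show "ennreal ((1 - \<epsilon>) * pinsker \<beta> L n) \<le> max_risk n \<beta> L T" by (rule order_trans[rotated])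
  qed
 qed
qed

text \<open>Both bounds are multiples of the same sequence \<open>pinsker \<beta> L n\<close> with
  factors arbitrarily close to 1. The quotient lives in \<open>ennreal\<close>, so the infimum is
  shown to be positive and finite before dividing; that the quotient is at least 1 rests on the
  measurability of the cross-validated estimator.\<close>

theorem mainTheorem2:
  fixes K0 :: "nat \<Rightarrow> (nat \<Rightarrow> real) \<Rightarrow> real \<Rightarrow> real"
  assumes K0_minimizes:
    "\<And>n X. n \<ge> 2 \<Longrightarrow> X \<in> {..<n} \<rightarrow>\<^sub>E UNIV \<Longrightarrow>
       is_arg_min (cv n X) (\<lambda>K. K \<in> bandlimited_kernels n) (K0 n X)"
  shows "\<forall>\<beta> L::real. \<beta> > 1 / 2 \<longrightarrow> L > 0 \<longrightarrow>
    (\<lambda>n. max_risk n \<beta> L (\<lambda>X. kde n (K0 n X) X) / (INF T\<in>estimators n. max_risk n \<beta> L T))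
      \<longlonglongrightarrow> 1"
proof (intro allI impI)
 fix \<beta> L :: real assume \<beta>: "\<beta> > 1 / 2" and L: "L > 0"
 let ?R = "\<lambda>n. max_risk n \<beta> L (\<lambda>X. kde n (K0 n X) X)" and ?I = "\<lambda>n. INF T\<in>estimators n. max_risk n \<beta> L T"
 have key: "\<forall>\<^sub>F n in sequentially. 1 \<le> ?R n / ?I n \<and> ?R n / ?I n \<le> ennreal ((1 + \<delta>) / (1 - \<delta>))" if \<delta>: "0 < \<delta>" "\<delta> < 1" for \<delta>
 proof -
  have "\<forall>\<^sub>F n in sequentially. ?R n \<le> ennreal ((1 + \<delta>) * pinsker \<beta> L n)"
   by (rule max_risk_cv_upper[OF _ \<beta> L \<delta>(1)]) (rule K0_minimizes)
  then show ?thesis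
  using pinsker_lower_bound[OF \<beta> L \<delta>(1)] eventually_ge_at_top[of 2]
 proof eventually_elim
  case (elim n)
  have "pinsker_W \<beta> L n > 0" using pinsker_W_powr[of \<beta> L n] \<beta> L elim by simp
  then have p: "pinsker \<beta> L n > 0" unfolding pinsker_def using \<beta> elim by simp
  have lo: "ennreal ((1 - \<delta>) * pinsker \<beta> L n) \<le> ?I n" using elim(2) by (intro INF_greatest) auto
  have le: "?I n \<le> ?R n" by (rule INF_lower, rule cross_validated_estimator_measurable) (use elim K0_minimizes in auto)
  have lo0: "0 < ennreal ((1 - \<delta>) * pinsker \<beta> L n)" using p \<delta> by simp
  have I: "?I n \<noteq> 0" "?I n < \<top>"
   using less_le_trans[OF lo0 lo] le_less_trans[OF order_trans[OF le elim(1)] ennreal_less_top] by (simp_all only: less_not_refl not_gr_zero[symmetric] simp_thms)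
  obtain i where i: "?I n = ennreal i" "0 \<le> i" using I(2) by (cases "?I n") auto
  have li: "(1 - \<delta>) * pinsker \<beta> L n \<le> i" using lo i by (simp add: ennreal_le_iff)
  have l0: "0 < (1 - \<delta>) * pinsker \<beta> L n" using p \<delta> by simp
  then have i0: "0 < i" using li by linarith
  have "?R n / ?I n \<le> ennreal ((1 + \<delta>) * pinsker \<beta> L n) / ?I n" by (rule divide_right_mono_ennreal[OF elim(1)])
  also have "... = ennreal ((1 + \<delta>) * pinsker \<beta> L n / i)"
   unfolding i(1) using p \<delta> i0 by (intro divide_ennreal) auto
  also have "... \<le> ennreal ((1 + \<delta>) * pinsker \<beta> L n / ((1 - \<delta>) * pinsker \<beta> L n))"
   using p \<delta> li l0 i0 by (intro ennreal_leI divide_left_mono mult_pos_pos[OF i0 l0]) auto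
  also have "... = ennreal ((1 + \<delta>) / (1 - \<delta>))" using p by simp
  finally show ?case using divide_right_mono_ennreal[OF le, of "?I n"] ennreal_divide_self[OF I] by simp
  qed
 qed
 show "(\<lambda>n. ?R n / ?I n) \<longlonglongrightarrow> 1"
 proof (rule order_tendstoI)
  fix b :: ennreal assume b: "b < 1"
  \<comment> \<open>The lower bound 1 in \<open>key\<close> does not involve \<delta>, so any value
    in (0, 1) serves.\<close>
  show "\<forall>\<^sub>F n in sequentially. b < ?R n / ?I n" using key[of "1 / 2", simplified]
   by eventually_elim (use b in auto)
 next
  fix b :: ennreal assume b: "1 < b"
  obtain r where r: "1 < r" "ennreal r \<le> b"
   by (cases b) (use b in "auto simp: ennreal_less_iff simp flip: ennreal_1 intro: that[of 2]")
  \<comment> \<open>Chosen such that \<delta> (r + 1) = (r - 1) / 2 < r - 1, which is equivalent to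
    (1 + \<delta>) / (1 - \<delta>) < r.\<close>
  define \<delta> where "\<delta> = (r - 1) / (2 * (r + 1))"
  have \<delta>: "0 < \<delta>" "\<delta> < 1" using r by (auto simp: \<delta>_def field_simps)
  have "(r - 1) / (2 * k) * k = (r - 1) / 2" if "k \<noteq> 0" for k using that by simp
  from this[of "r + 1"] have "\<delta> * (r + 1) = (r - 1) / 2" unfolding \<delta>_def using r by linarith
  also have "... < r - 1" using r(1) by simp
  finally have "\<delta> * (r + 1) < r - 1" .
  with \<delta> have "(1 + \<delta>) / (1 - \<delta>) < r" by (simp add: divide_less_eq algebra_simps)
  then have "ennreal ((1 + \<delta>) / (1 - \<delta>)) < ennreal r" using r by (intro ennreal_lessI) auto
  then have lt: "ennreal ((1 + \<delta>) / (1 - \<delta>)) < b" using r(2) by (rule less_le_trans)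
  show "\<forall>\<^sub>F n in sequentially. ?R n / ?I n < b"
   using key[OF \<delta>(1,2)] by eventually_elim (use lt in auto)
 qed
qed

end
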